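(* Let $\frac34<H<1$, let $W$ and $B^H$ be independent, and let $\rho_1=\rho_2=\rho$. Then the solution $v=(v_1,v_2)^\top$ of the system (V) of the context, as well as the solution $z=(z_1,z_2)^\top$ of the system (Z) of the context, quenches in finite time $\tau_q<\infty$ almost surely.
   Context: $D\subset\mathbb{R}^d$, $d\ge1$, is a bounded domain with smooth boundary $\partial D$ and outward unit normal $\nu$. The constants $\beta$, $\lambda_{i1},\lambda_{i2}$, $k_{i1},k_{i2}$ ($i=1,2$) are positive. On a filtered probability space $(\Omega,\mathcal F,(\mathcal F_t)_{t\ge0},\mathbb P)$, $W$ is a standard one-dimensional Brownian motion and $B^H$ is a one-dimensional fractional Brownian motion with Hurst index $H$; $N_i(t):=k_{i1}W(t)+k_{i2}B^H(t)$. $g_i=1-f_i$ with $f_i\in C^2(D)$, $0\le f_i<1$, $f_i\not\equiv0$, so $0<g_i\le1$. Throughout $i=1,2$ and $j\in\{1,2\}\setminus\{i\}$. Parameter condition: $k_{21}+2k_{11}=3k_{11}=:\rho_{11}$, $k_{22}+2k_{12}=3k_{12}=:\rho_{12}$, $k_{11}+2k_{21}=3k_{21}=:\rho_{21}$, $k_{12}+2k_{22}=3k_{22}=:\rho_{22}$, with $\rho_{11}=\rho_{21}=:\rho_1$ and $\rho_{12}=\rho_{22}=:\rho_2$. System (Z): $dz_i=[\Delta z_i-\lambda_{i1}z_i^{-2}-\lambda_{i2}z_j^{-2}]dt-z_i\,dN_i(t)$ for $t>0,\ x\in D$ (Itô integral for $W$, pathwise Young integral for $B^H$); $\frac{\partial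 z_i}{\partial\nu}+\beta z_i=0$ on $\partial D$, $t>0$; $z_i(0,x)=g_i(x)$, $x\in D$. System (V), obtained from (Z) by $v_i=e^{N_i(t)}z_i$: $\frac{\partial v_i}{\partial t}=(\Delta-\frac{k_{i1}^2}{2})v_i-\lambda_{i1}v_i^{-2}e^{3N_i(t)}-\lambda_{i2}v_j^{-2}e^{N_i(t)+2N_j(t)}$ for $t>0,\ x\in D$; $\frac{\partial v_i}{\partial\nu}+\beta v_i=0$ on $\partial D$, $t>0$; $v_i(0,x)=g_i(x)$, $x\in D$. The solution $v$ is understood in the weak sense: for every $\varphi_i\in C^2(D)$ with $\frac{\partial\varphi_i}{\partial\nu}+\beta\varphi_i=0$ on $\partial D$ and $t<\tau_q$, $\int_Dv_i(t)\varphi_i=\int_Dg_i\varphi_i+\int_0^t\int_Dv_i(s)(\Delta-\frac{k_{i1}^2}{2})\varphi_i\,ds-\lambda_{i1}\int_0^te^{3N_i(s)}\int_Dv_i^{-2}(s)\varphi_i\,ds-\lambda_{i2}\int_0^te^{N_i(s)+2N_j(s)}\int_Dv_j^{-2}(s)\varphi_i\,ds$. The quenching time $\tau_q$ (common to $v$ and $z$) is the stopping time such that $\lim_{t\to\tau_q}\min\{\min_{\bar D}|z_1(t,\cdot)|,\min_{\bar D}|z_2(t,\cdot)|\}=0$ a.s. on $\{\tau_q<\infty\}$; the solution is global if $\tau_q=\infty$. *)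

theory Defs
  imports "HOL-Probability.Probability"
begin

section \<open>Domains with smooth boundary and functions of class \<open>C\<^sup>k\<close>\<close>

text \<open>Partial derivatives are taken within \<open>S\<close>. For \<open>S\<close> open this is the usual partial derivative.
  For \<open>S = closure D\<close> with \<open>D\<close> a smooth domain the derivative within \<open>S\<close> is unique also at
  boundary points, and \<open>Ck_on k (closure D)\<close> is the class of functions that are \<open>C\<^sup>k\<close> up to the
  boundary.\<close>

definition partial_on :: "'a::euclidean_space set \<Rightarrow> 'a \<Rightarrow> ('a \<Rightarrow> real) \<Rightarrow> 'a \<Rightarrow> real" where
  "partial_on S b \<phi> x = frechet_derivative \<phi> (at x within S) b"

fun Ck_on :: "nat \<Rightarrow> 'a::euclidean_space set \<Rightarrow> ('a \<Rightarrow> real) \<Rightarrow> bool" where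
  "Ck_on 0 S \<phi> \<longleftrightarrow> continuous_on S \<phi>"
| "Ck_on (Suc k) S \<phi> \<longleftrightarrow> \<phi> differentiable_on S \<and> (\<forall>b\<in>Basis. Ck_on k S (partial_on S b \<phi>))"

definition gradient_on :: "'a::euclidean_space set \<Rightarrow> ('a \<Rightarrow> real) \<Rightarrow> 'a \<Rightarrow> 'a" where
  "gradient_on S \<phi> x = (\<Sum>b\<in>Basis. partial_on S b \<phi> x *\<^sub>R b)"

definition laplacian_on :: "'a::euclidean_space set \<Rightarrow> ('a \<Rightarrow> real) \<Rightarrow> 'a \<Rightarrow> real" where
  "laplacian_on S \<phi> x = (\<Sum>b\<in>Basis. partial_on S b (partial_on S b \<phi>) x)"

definition local_defining_function ::
    "'a::euclidean_space set \<Rightarrow> 'a set \<Rightarrow> ('a \<Rightarrow> real) \<Rightarrow> bool" where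
  "local_defining_function D U r \<longleftrightarrow>
     open U \<and> (\<forall>k. Ck_on k U r) \<and> (\<forall>x\<in>U. gradient_on U r x \<noteq> 0) \<and> D \<inter> U = {x\<in>U. r x < 0}"

definition smooth_bounded_domain :: "'a::euclidean_space set \<Rightarrow> bool" where
  "smooth_bounded_domain D \<longleftrightarrow>
     open D \<and> connected D \<and> D \<noteq> {} \<and> bounded D \<and>
     (\<forall>p\<in>frontier D. \<exists>U r. p \<in> U \<and> local_defining_function D U r)"

definition outward_unit_normal :: "'a::euclidean_space set \<Rightarrow> ('a \<Rightarrow> 'a) \<Rightarrow> bool" where
  "outward_unit_normal D \<nu> \<longleftrightarrow>
     (\<forall>p\<in>frontier D. \<exists>U r. p \<in> U \<and> local_defining_function D U r \<and>
        \<nu> p = (1 / norm (gradient_on U r p)) *\<^sub>R gradient_on U r p)"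

definition robin_test_function ::
    "'a::euclidean_space set \<Rightarrow> ('a \<Rightarrow> 'a) \<Rightarrow> real \<Rightarrow> ('a \<Rightarrow> real) \<Rightarrow> bool" where
  "robin_test_function D \<nu> \<beta> \<phi> \<longleftrightarrow>
     Ck_on 2 (closure D) \<phi> \<and>
     (\<forall>p\<in>frontier D. frechet_derivative \<phi> (at p within closure D) (\<nu> p) + \<beta> * \<phi> p = 0)"


section \<open>Filtered probability spaces, Brownian and fractional Brownian motion\<close>

text \<open>Processes and filtrations are indexed by \<open>real\<close>; only indices \<open>t \<ge> 0\<close> are ever used.\<close>

definition filtered_prob_space :: "'w measure \<Rightarrow> (real \<Rightarrow> 'w measure) \<Rightarrow> bool" where
  "filtered_prob_space M F \<longleftrightarrow>
     prob_space M \<and> (\<forall>t\<ge>0. subalgebra M (F t)) \<and>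
     (\<forall>s t. 0 \<le> s \<longrightarrow> s \<le> t \<longrightarrow> sets (F s) \<subseteq> sets (F t))"

text \<open>The library's \<open>stopping_time\<close> forces the values to lie in the index type of the filtration;
  here the value \<open>\<infinity>\<close> is needed.\<close>

definition ext_stopping_time :: "(real \<Rightarrow> 'w measure) \<Rightarrow> ('w \<Rightarrow> ennreal) \<Rightarrow> bool" where
  "ext_stopping_time F \<tau> \<longleftrightarrow> (\<forall>t\<ge>0. Measurable.pred (F t) (\<lambda>\<omega>. \<tau> \<omega> \<le> ennreal t))"

definition adapted :: "(real \<Rightarrow> 'w measure) \<Rightarrow> (real \<Rightarrow> 'w \<Rightarrow> real) \<Rightarrow> bool" where
  "adapted F X \<longleftrightarrow> (\<forall>t\<ge>0. X t \<in> borel_measurable (F t))"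

definition brownian_motion ::
    "'w measure \<Rightarrow> (real \<Rightarrow> 'w measure) \<Rightarrow> (real \<Rightarrow> 'w \<Rightarrow> real) \<Rightarrow> bool" where
  "brownian_motion M F W \<longleftrightarrow>
     adapted F W \<and>
     (AE \<omega> in M. W 0 \<omega> = 0) \<and>
     (AE \<omega> in M. continuous_on {0..} (\<lambda>t. W t \<omega>)) \<and>
     (\<forall>s t. 0 \<le> s \<longrightarrow> s < t \<longrightarrow>
        prob_space.indep_set M (sets (F s))
          {(\<lambda>\<omega>. W t \<omega> - W s \<omega>) -` A \<inter> space M | A. A \<in> sets borel} \<and>
        distributed M lborel (\<lambda>\<omega>. W t \<omega> - W s \<omega>)
          (\<lambda>x. ennreal (normal_density 0 (sqrt (t - s)) x)))"

text \<open>Degenerate (almost surely constant) variables count as Gaussian.\<close>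

definition gaussian_rv :: "'w measure \<Rightarrow> ('w \<Rightarrow> real) \<Rightarrow> bool" where
  "gaussian_rv M X \<longleftrightarrow>
     X \<in> borel_measurable M \<and>
     (\<exists>\<mu>. (AE \<omega> in M. X \<omega> = \<mu>) \<or>
          (\<exists>\<sigma>>0. distributed M lborel X (\<lambda>x. ennreal (normal_density \<mu> \<sigma> x))))"

definition gaussian_process :: "'w measure \<Rightarrow> (real \<Rightarrow> 'w \<Rightarrow> real) \<Rightarrow> bool" where
  "gaussian_process M X \<longleftrightarrow>
     (\<forall>J a. finite J \<longrightarrow> J \<subseteq> {0..} \<longrightarrow> gaussian_rv M (\<lambda>\<omega>. \<Sum>t\<in>J. a t * X t \<omega>))"

definition fractional_brownian_motion ::
    "'w measure \<Rightarrow> real \<Rightarrow> (real \<Rightarrow> 'w \<Rightarrow> real) \<Rightarrow> bool" where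
  "fractional_brownian_motion M H B \<longleftrightarrow>
     gaussian_process M B \<and>
     (\<forall>t\<ge>0. (LINT \<omega>|M. B t \<omega>) = 0) \<and>
     (\<forall>s\<ge>0. \<forall>t\<ge>0. (LINT \<omega>|M. B s \<omega> * B t \<omega>) =
        (s powr (2 * H) + t powr (2 * H) - \<bar>t - s\<bar> powr (2 * H)) / 2) \<and>
     (AE \<omega> in M. continuous_on {0..} (\<lambda>t. B t \<omega>))"

definition independent_processes ::
    "'w measure \<Rightarrow> (real \<Rightarrow> 'w \<Rightarrow> real) \<Rightarrow> (real \<Rightarrow> 'w \<Rightarrow> real) \<Rightarrow> bool" where
  "independent_processes M X Y \<longleftrightarrow>
     prob_space.indep_var M
       (Pi\<^sub>M {0..} (\<lambda>_. borel)) (\<lambda>\<omega>. \<lambda>t\<in>{0..}. X t \<omega>)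
       (Pi\<^sub>M {0..} (\<lambda>_. borel)) (\<lambda>\<omega>. \<lambda>t\<in>{0..}. Y t \<omega>)"


section \<open>Young and Ito integrals\<close>

definition partition_of :: "real \<Rightarrow> real \<Rightarrow> nat \<Rightarrow> (nat \<Rightarrow> real) \<Rightarrow> bool" where
  "partition_of a b n t \<longleftrightarrow> t 0 = a \<and> t n = b \<and> (\<forall>k<n. t k \<le> t (Suc k))"

definition finite_variation_of_order :: "real \<Rightarrow> (real \<Rightarrow> real) \<Rightarrow> real \<Rightarrow> real \<Rightarrow> bool" where
  "finite_variation_of_order p f a b \<longleftrightarrow>
     (\<exists>C. \<forall>n t. partition_of a b n t \<longrightarrow> (\<Sum>k<n. \<bar>f (t (Suc k)) - f (t k)\<bar> powr p) \<le> C)"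

text \<open>Young's integral: the limit of Riemann-Stieltjes sums as the mesh tends to 0, for an integrand
  of finite \<open>p\<close>-variation and an integrator of finite \<open>q\<close>-variation with \<open>1/p + 1/q > 1\<close>.\<close>

definition has_young_integral ::
    "(real \<Rightarrow> real) \<Rightarrow> (real \<Rightarrow> real) \<Rightarrow> real \<Rightarrow> real \<Rightarrow> real \<Rightarrow> bool" where
  "has_young_integral f g a b I \<longleftrightarrow>
     (\<exists>p\<ge>1. \<exists>q\<ge>1. 1 / p + 1 / q > 1 \<and>
        finite_variation_of_order p f a b \<and> finite_variation_of_order q g a b) \<and>
     (\<forall>e>0. \<exists>d>0. \<forall>n t \<xi>.
        partition_of a b n t \<longrightarrow>
        (\<forall>k<n. t (Suc k) - t k < d \<and> \<xi> k \<in> {t k..t (Suc k)}) \<longrightarrow>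
        \<bar>(\<Sum>k<n. f (\<xi> k) * (g (t (Suc k)) - g (t k))) - I\<bar> < e)"

text \<open>Convergence in probability, stated with outer probability so that no measurability of
  \<open>X n\<close> and \<open>Y\<close> has to be presupposed (\<open>measure\<close> is 0 on sets that are not measurable).\<close>

definition converges_in_prob :: "'w measure \<Rightarrow> (nat \<Rightarrow> 'w \<Rightarrow> real) \<Rightarrow> ('w \<Rightarrow> real) \<Rightarrow> bool" where
  "converges_in_prob M X Y \<longleftrightarrow>
     (\<forall>e>0. \<exists>A. (\<forall>n. A n \<in> sets M \<and> {\<omega>\<in>space M. e < \<bar>X n \<omega> - Y \<omega>\<bar>} \<subseteq> A n) \<and>
        (\<lambda>n. measure M (A n)) \<longlonglongrightarrow> 0)"

text \<open>The triple \<open>(n, t, \<xi>)\<close> stands for the simple process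
  \<open>\<Sum>k<n. \<xi>\<^sub>k 1\<^bsub>(t\<^sub>k, t\<^sub>k\<^sub>+\<^sub>1]\<^esub>\<close> with \<open>\<xi>\<^sub>k\<close> bounded and \<open>F (t\<^sub>k)\<close>-measurable.\<close>

type_synonym 'w simple = "nat \<times> (nat \<Rightarrow> real) \<times> (nat \<Rightarrow> 'w \<Rightarrow> real)"

fun is_simple_process :: "(real \<Rightarrow> 'w measure) \<Rightarrow> 'w simple \<Rightarrow> bool" where
  "is_simple_process F (n, t, \<xi>) \<longleftrightarrow>
     0 \<le> t 0 \<and> (\<forall>k<n. t k \<le> t (Suc k)) \<and>
     (\<forall>k<n. \<xi> k \<in> borel_measurable (F (t k)) \<and> (\<exists>C. \<forall>\<omega>\<in>space (F (t k)). \<bar>\<xi> k \<omega>\<bar> \<le> C))"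

fun simple_process :: "'w simple \<Rightarrow> real \<Rightarrow> 'w \<Rightarrow> real" where
  "simple_process (n, t, \<xi>) s \<omega> = (\<Sum>k<n. \<xi> k \<omega> * indicator {t k<..t (Suc k)} s)"

fun simple_integral :: "(real \<Rightarrow> 'w \<Rightarrow> real) \<Rightarrow> 'w simple \<Rightarrow> real \<Rightarrow> 'w \<Rightarrow> real" where
  "simple_integral W (n, t, \<xi>) T \<omega> =
     (\<Sum>k<n. \<xi> k \<omega> * (W (min (t (Suc k)) T) \<omega> - W (min (t k) T) \<omega>))"

text \<open>\<open>has_ito_integral M F W X T I\<close>: the random variable \<open>I\<close> is \<open>\<integral>\<^sub>0\<^sup>T X dW\<close>, i.e. \<open>X\<close> is almost surely
  square integrable on \<open>[0,T]\<close> and \<open>I\<close> is the limit in probability of the integrals of simple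
  processes approximating \<open>X\<close> in \<open>L\<^sup>2([0,T])\<close> in probability. By the standard estimate for integrals
  of simple processes \<open>I\<close> is independent of the approximating sequence up to null sets.\<close>

definition has_ito_integral ::
    "'w measure \<Rightarrow> (real \<Rightarrow> 'w measure) \<Rightarrow> (real \<Rightarrow> 'w \<Rightarrow> real) \<Rightarrow> (real \<Rightarrow> 'w \<Rightarrow> real) \<Rightarrow> real \<Rightarrow>
     ('w \<Rightarrow> real) \<Rightarrow> bool" where
  "has_ito_integral M F W X T I \<longleftrightarrow>
     I \<in> borel_measurable M \<and>
     (AE \<omega> in M. set_borel_measurable lborel {0..T} (\<lambda>s. X s \<omega>) \<and>
                 set_integrable lborel {0..T} (\<lambda>s. (X s \<omega>)\<^sup>2)) \<and>
     (\<exists>S. (\<forall>m. is_simple_process F (S m)) \<and>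
        converges_in_prob M
          (\<lambda>m \<omega>. LINT s:{0..T}|lborel. (simple_process (S m) s \<omega> - X s \<omega>)\<^sup>2) (\<lambda>_. 0) \<and>
        converges_in_prob M (\<lambda>m. simple_integral W (S m) T) I)"


section \<open>The systems\<close>

text \<open>All families are indexed by \<open>i \<in> {1, 2}\<close>, so that the other index is \<open>j = 3 - i\<close>.
  A random field is written \<open>u i t x \<omega>\<close>.\<close>

definition parameter_condition :: "(nat \<Rightarrow> nat \<Rightarrow> real) \<Rightarrow> real \<Rightarrow> real \<Rightarrow> bool" where
  "parameter_condition k \<rho>1 \<rho>2 \<longleftrightarrow>
     (\<exists>\<rho> :: nat \<Rightarrow> nat \<Rightarrow> real.
        k 2 1 + 2 * k 1 1 = 3 * k 1 1 \<and> 3 * k 1 1 = \<rho> 1 1 \<and>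
        k 2 2 + 2 * k 1 2 = 3 * k 1 2 \<and> 3 * k 1 2 = \<rho> 1 2 \<and>
        k 1 1 + 2 * k 2 1 = 3 * k 2 1 \<and> 3 * k 2 1 = \<rho> 2 1 \<and>
        k 1 2 + 2 * k 2 2 = 3 * k 2 2 \<and> 3 * k 2 2 = \<rho> 2 2 \<and>
        \<rho> 1 1 = \<rho>1 \<and> \<rho> 2 1 = \<rho>1 \<and> \<rho> 1 2 = \<rho>2 \<and> \<rho> 2 2 = \<rho>2)"

definition noise ::
    "(nat \<Rightarrow> nat \<Rightarrow> real) \<Rightarrow> (real \<Rightarrow> 'w \<Rightarrow> real) \<Rightarrow> (real \<Rightarrow> 'w \<Rightarrow> real) \<Rightarrow> nat \<Rightarrow> real \<Rightarrow> 'w \<Rightarrow> real"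
  where "noise k W B i t \<omega> = k i 1 * W t \<omega> + k i 2 * B t \<omega>"

definition lifetime :: "('w \<Rightarrow> ennreal) \<Rightarrow> 'w \<Rightarrow> real set" where
  "lifetime \<tau> \<omega> = {t. 0 \<le> t \<and> ennreal t < \<tau> \<omega>}"

text \<open>Regularity common to solutions of both systems: adapted, continuous on \<open>[0,\<tau>) \<times> closure D\<close>,
  and non-vanishing there, so that the singular terms are well defined up to \<open>\<tau>\<close>.\<close>

definition local_random_field ::
    "'w measure \<Rightarrow> (real \<Rightarrow> 'w measure) \<Rightarrow> 'a::euclidean_space set \<Rightarrow> (nat \<Rightarrow> 'a \<Rightarrow> real) \<Rightarrow>
     (nat \<Rightarrow> real \<Rightarrow> 'a \<Rightarrow> 'w \<Rightarrow> real) \<Rightarrow> ('w \<Rightarrow> ennreal) \<Rightarrow> bool" where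
  "local_random_field M F D g u \<tau> \<longleftrightarrow>
     ext_stopping_time F \<tau> \<and> (AE \<omega> in M. 0 < \<tau> \<omega>) \<and>
     (\<forall>i\<in>{1, 2}.
        (\<forall>x\<in>closure D. adapted F (\<lambda>t \<omega>. if t \<in> lifetime \<tau> \<omega> then u i t x \<omega> else 0)) \<and>
        (AE \<omega> in M. continuous_on (lifetime \<tau> \<omega> \<times> closure D) (\<lambda>(t, x). u i t x \<omega>)) \<and>
        (AE \<omega> in M. \<forall>t\<in>lifetime \<tau> \<omega>. \<forall>x\<in>closure D. u i t x \<omega> \<noteq> 0) \<and>
        (AE \<omega> in M. \<forall>x\<in>D. u i 0 x \<omega> = g i x))"

definition weak_solution_V where
  "weak_solution_V M F W B (D :: 'a::euclidean_space set) \<nu> \<beta> lam k g v \<tau> \<longleftrightarrow>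
     local_random_field M F D g v \<tau> \<and>
     (\<forall>i\<in>{1, 2}. \<forall>\<phi>. robin_test_function D \<nu> \<beta> \<phi> \<longrightarrow>
        (AE \<omega> in M. \<forall>t\<in>lifetime \<tau> \<omega>.
           (LINT x:D|lborel. v i t x \<omega> * \<phi> x) =
             (LINT x:D|lborel. g i x * \<phi> x)
             + (LINT s:{0..t}|lborel. LINT x:D|lborel.
                  v i s x \<omega> * (laplacian_on (closure D) \<phi> x - (k i 1)\<^sup>2 / 2 * \<phi> x))
             - lam i 1 * (LINT s:{0..t}|lborel. exp (3 * noise k W B i s \<omega>) *
                  (LINT x:D|lborel. v i s x \<omega> powi (-2) * \<phi> x))
             - lam i (2::nat) * (LINT s:{0..t}|lborel.
                  exp (noise k W B i s \<omega> + 2 * noise k W B (3 - i) s \<omega>) *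
                  (LINT x:D|lborel. v (3 - i) s x \<omega> powi (-2) * \<phi> x))))"

text \<open>Weak form of system (Z), tested against the same functions. As a solution only lives on
  \<open>[0,\<tau>)\<close>, the Ito integral is localised by stopping times \<open>\<sigma> n\<close> increasing to \<open>\<tau>\<close>: on
  \<open>{t \<le> \<sigma> n}\<close> it is the integral over \<open>[0,t]\<close> of the integrand cut off at \<open>\<sigma> n\<close>.\<close>

definition weak_solution_Z where
  "weak_solution_Z M F W B (D :: 'a::euclidean_space set) \<nu> \<beta> lam k g z \<tau> \<longleftrightarrow>
     local_random_field M F D g z \<tau> \<and>
     (\<exists>\<sigma> :: nat \<Rightarrow> _ \<Rightarrow> ennreal.
        (\<forall>n. ext_stopping_time F (\<sigma> n)) \<and>
        (AE \<omega> in M. incseq (\<lambda>n. \<sigma> n \<omega>) \<and> (\<forall>n. \<sigma> n \<omega> < \<tau> \<omega>) \<and> (\<lambda>n. \<sigma> n \<omega>) \<longlonglongrightarrow> \<tau> \<omega>) \<and>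
        (\<forall>i\<in>{1, 2}. \<forall>\<phi>. robin_test_function D \<nu> \<beta> \<phi> \<longrightarrow>
          (\<forall>n. \<forall>t\<ge>0. \<exists>I.
             has_ito_integral M F W
               (\<lambda>s \<omega>. if ennreal s \<le> \<sigma> n \<omega> then LINT x:D|lborel. z i s x \<omega> * \<phi> x else 0) t I \<and>
             (AE \<omega> in M. ennreal t \<le> \<sigma> n \<omega> \<longrightarrow>
                (\<exists>Y. has_young_integral
                       (\<lambda>s. LINT x:D|lborel. z i s x \<omega> * \<phi> x) (\<lambda>s. B s \<omega>) 0 t Y \<and>
                   (LINT x:D|lborel. z i t x \<omega> * \<phi> x) =
                     (LINT x:D|lborel. g i x * \<phi> x)
                     + (LINT s:{0..t}|lborel. LINT x:D|lborel.
                          z i s x \<omega> * laplacian_on (closure D) \<phi> x)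
                     - lam i 1 * (LINT s:{0..t}|lborel. LINT x:D|lborel.
                          z i s x \<omega> powi (-2) * \<phi> x)
                     - lam i (2::nat) * (LINT s:{0..t}|lborel. LINT x:D|lborel.
                          z (3 - i) s x \<omega> powi (-2) * \<phi> x)
                     - (k i 1 * I \<omega> + k i (2::nat) * Y))))))"

text \<open>\<open>\<tau> = \<infinity>\<close> is allowed and means that the solution is global. Together with the non-vanishing in
  \<open>local_random_field\<close>, the condition says that \<open>\<tau>\<close> is the first time at which the minimum
  reaches 0.\<close>

definition quenching_time ::
    "'w measure \<Rightarrow> (real \<Rightarrow> 'w measure) \<Rightarrow> 'a::euclidean_space set \<Rightarrow>
     (nat \<Rightarrow> real \<Rightarrow> 'a \<Rightarrow> 'w \<Rightarrow> real) \<Rightarrow> ('w \<Rightarrow> ennreal) \<Rightarrow> bool" where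
  "quenching_time M F D u \<tau> \<longleftrightarrow>
     ext_stopping_time F \<tau> \<and>
     (AE \<omega> in M. \<tau> \<omega> < \<infinity> \<longrightarrow>
        ((\<lambda>t. min (INF x\<in>closure D. \<bar>u 1 t x \<omega>\<bar>) (INF x\<in>closure D. \<bar>u 2 t x \<omega>\<bar>)) \<longlongrightarrow> 0)
          (at_left (enn2real (\<tau> \<omega>))))"

end

theory Submission
  imports Defs "HOL-Real_Asymp.Real_Asymp"
begin

text \<open>The parameter condition with \<open>\<rho>\<^sub>1 = \<rho>\<^sub>2\<close> makes all \<open>k\<^sub>i\<^sub>l\<close> equal to one \<open>\<kappa>\<close>, so that
  \<open>N\<^sub>1 = N\<^sub>2 = \<kappa> (W + B)\<close>. Instead of the first Robin eigenfunction, the first equation is tested with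
  a superharmonic \<open>\<phi> \<ge> 1\<close>, which is an explicit concave function of a boundary defining function. With
  \<open>E = exp (\<kappa> (W + B) + \<kappa>\<^sup>2 s / 2)\<close>, Ito's formula shows that \<open>u = E \<integral> z\<^sub>1 \<phi>\<close> is nonincreasing and, by
  convexity of \<open>x \<mapsto> x\<^sup>-\<^sup>2\<close>, that \<open>u(T) \<le> u(0) - c \<integral>\<^sub>0\<^sup>T E\<^sup>3 ds\<close> as long as the solution lives. As
  \<open>W + B\<close> is sublinear in mean, the integral diverges almost surely, while \<open>u > 0\<close>.

  For (V) this only uses the product rule. For (Z) Ito's formula is proved on uniform grids: the
  left-endpoint errors of the Ito integral are controlled by Lenglart's inequality, those of the Young
  integral by Henstock's argument, and \<open>B\<close> has no quadratic variation since \<open>H > 1/2\<close>.\<close>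

section \<open>A superharmonic test function with the Robin boundary condition\<close>

text \<open>The term \<open>\<kappa>\<^sup>2 s / 2\<close> in \<open>E\<close> makes the
  second-order terms cancel: dE contains \<kappa>^2 E ds, while the covariation of E with y
  contributes -\<kappa>^2 E y ds, which leaves d(E y) = E a ds. The cube of \<open>E\<close> arises
  because E y \<le> u(0) bounds y by u(0)/E, convexity turns this into a lower bound of order E^2
  for the integral of z_1^(-2) \<phi>, and E multiplies the drift once more. Superharmonicity
  suffices for \<phi> because its Laplacian meets the positive z_1 with the favourable sign; such a
  \<phi> can be written down, while an eigenfunction smooth up to the boundary would call for
  elliptic theory. The argument for (Z) is shaped by the stochastic integral, which is given at each
  fixed time as a limit in probability, without a continuous version and without moments. Hence
  formulas are proved at fixed T on the event that a localising stopping time lies beyond T, errors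
  are measured by means truncated at 1, null sets are collected over countably many grid points and
  rational T, and continuity in time fills the gaps. The sign of z_1 is not assumed: nonvanishing,
  positive initial data and connectedness supply it.\<close>

lemma partial_on_open:
  assumes "open S" "x \<in> S" "(f has_derivative f') (at x)"
  shows "partial_on S b f x = f' b"
  using frechet_derivative_at[OF assms(3)] at_within_open[OF assms(2,1)]
  by (simp add: partial_on_def)

lemma partial_on_open_eq:
  assumes "open S" "x \<in> S"
  shows "partial_on S b f x = frechet_derivative f (at x) b"
  using assms at_within_open[of x S] by (auto simp: partial_on_def)

lemma frechet_derivative_cong_within:
  assumes "x \<in> S" "\<And>y. y \<in> S \<Longrightarrow> f y = g y"
  shows "frechet_derivative f (at x within S) = frechet_derivative g (at x within S)"
proof -
  have "(f has_derivative f') (at x within S) \<longleftrightarrow> (g has_derivative f') (at x within S)" for f'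
    using has_derivative_transform[OF assms(1), of f g] has_derivative_transform[OF assms(1), of g f]
      assms(2) by auto
  then show ?thesis by (simp add: frechet_derivative_def)
qed

lemma Ck_on_cong:
  assumes "\<And>x. x \<in> S \<Longrightarrow> f x = g x"
  shows "Ck_on k S f \<longleftrightarrow> Ck_on k S g"
  using assms
proof (induction k arbitrary: f g)
  case 0
  then show ?case using continuous_on_cong by force
next
  case (Suc k)
  have "f differentiable_on S \<longleftrightarrow> g differentiable_on S"
    using Suc.prems unfolding differentiable_on_def differentiable_def
    by (metis has_derivative_transform)
  moreover have "Ck_on k S (partial_on S b f) \<longleftrightarrow> Ck_on k S (partial_on S b g)" for b
    by (rule Suc.IH) (simp add: partial_on_def frechet_derivative_cong_within[OF _ Suc.prems])
  ultimately show ?case by simp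
qed

lemma Ck_on_imp_continuous_on: "Ck_on k S f \<Longrightarrow> continuous_on S f"
  by (cases k) (auto simp: differentiable_imp_continuous_on)

lemma Ck_on_SucD: "Ck_on (Suc k) S f \<Longrightarrow> Ck_on k S f"
  by (induction k arbitrary: f) (auto simp: differentiable_imp_continuous_on)

lemma Ck_on_open_subset:
  assumes "open S" "open U" "U \<subseteq> S" "Ck_on k S f"
  shows "Ck_on k U f"
  using assms(4)
proof (induction k arbitrary: f)
  case 0
  then show ?case using assms continuous_on_subset by auto
next
  case (Suc k)
  have "partial_on U b f x = partial_on S b f x" if "x \<in> U" for b x
    using that assms at_within_open[of x U] at_within_open[of x S] by (auto simp: partial_on_def)
  then have "Ck_on k U (partial_on U b f) \<longleftrightarrow> Ck_on k U (partial_on S b f)" for b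
    by (rule Ck_on_cong)
  then show ?case
    using Suc assms(3) by (auto intro: differentiable_on_subset)
qed

text \<open>Used for products that are smooth for different reasons on different open sets. The
  induction works because partial derivatives within \<open>U \<inter> S\<close> and within
  \<open>S\<close> are both the ordinary ones.\<close>

lemma Ck_on_local:
  assumes "open S" "\<And>x. x \<in> S \<Longrightarrow> \<exists>U. open U \<and> x \<in> U \<and> Ck_on k U f"
  shows "Ck_on k S f"
  using assms(2)
proof (induction k arbitrary: f)
  case 0
  show ?case
    unfolding Ck_on.simps continuous_on_eq_continuous_at[OF assms(1)]
  proof
    fix x assume "x \<in> S"
    then obtain U where "open U" "x \<in> U" "continuous_on U f" using 0 by auto
    then show "isCont f x" using continuous_on_eq_continuous_at by blast
  qed
next
  case (Suc k)
  have "f differentiable (at x)" if "x \<in> S" for x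
  proof -
    obtain U where U: "open U" "x \<in> U" "Ck_on (Suc k) U f" using Suc.prems[OF \<open>x \<in> S\<close>] by auto
    then have "f differentiable (at x within U)" by (simp add: differentiable_on_def)
    then show ?thesis using at_within_open U by metis
  qed
  then have "f differentiable_on S"
    by (simp add: differentiable_on_def differentiable_at_withinI)
  moreover have "Ck_on k S (partial_on S b f)" if "b \<in> Basis" for b
  proof (rule Suc.IH)
    fix x assume "x \<in> S"
    then obtain U where U: "open U" "x \<in> U" "Ck_on (Suc k) U f" using Suc.prems by auto
    have "Ck_on (Suc k) (U \<inter> S) f"
      using Ck_on_open_subset[OF U(1) _ _ U(3)] U assms by auto
    moreover have "partial_on (U \<inter> S) b f y = partial_on S b f y" if "y \<in> U \<inter> S" for y
      using that partial_on_open_eq[of "U \<inter> S" y] partial_on_open_eq[of S y] U assms by (simp add: open_Int)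
    then have "Ck_on k (U \<inter> S) (partial_on (U \<inter> S) b f) \<longleftrightarrow> Ck_on k (U \<inter> S) (partial_on S b f)"
      by (rule Ck_on_cong)
    ultimately have "Ck_on k (U \<inter> S) (partial_on S b f)" using that by auto
    then show "\<exists>U. open U \<and> x \<in> U \<and> Ck_on k U (partial_on S b f)"
      using U assms \<open>x \<in> S\<close> by (intro exI[of _ "U \<inter> S"]) auto
  qed
  ultimately show ?case by simp
qed

lemma differentiable_at_Ck_on:
  assumes "open S" "x \<in> S" "Ck_on (Suc k) S f"
  shows "(f has_derivative frechet_derivative f (at x)) (at x)"
  using assms at_within_open[of x S]
  by (auto simp: differentiable_on_def frechet_derivative_works[symmetric])

text \<open>Reduces each closure property below to an explicit derivative formula whose coefficients
  are handled by induction on the order.\<close>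

lemma Ck_on_SucI:
  assumes "open S" "\<And>x. x \<in> S \<Longrightarrow> (f has_derivative f' x) (at x)"
    and "\<And>b. b \<in> Basis \<Longrightarrow> Ck_on k S (\<lambda>x. f' x b)"
  shows "Ck_on (Suc k) S f"
proof -
  have "f differentiable_on S"
    using assms(2) by (auto simp: differentiable_on_def differentiable_def intro: has_derivative_at_withinI)
  moreover have "Ck_on k S (partial_on S b f)" if "b \<in> Basis" for b
    using assms(3)[OF that] Ck_on_cong[of S "partial_on S b f" "\<lambda>x. f' x b" k]
      partial_on_open[OF assms(1) _ assms(2)] by auto
  ultimately show ?thesis by simp
qed

lemma Ck_on_SucD_partial:
  assumes "open S" "Ck_on (Suc k) S f" "b \<in> Basis"
  shows "Ck_on k S (\<lambda>x. frechet_derivative f (at x) b)"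
  using assms Ck_on_cong[of S "partial_on S b f" "\<lambda>x. frechet_derivative f (at x) b" k]
    partial_on_open_eq[OF assms(1)] by auto

lemma Ck_on_const: "open S \<Longrightarrow> Ck_on k S (\<lambda>x. c)"
proof (induction k arbitrary: c)
  case (Suc k)
  show ?case
    by (rule Ck_on_SucI[where f'="\<lambda>_ _. 0"]) (use Suc in \<open>auto simp del: Ck_on.simps\<close>)
qed simp

lemma Ck_on_add:
  assumes "open S" "Ck_on k S f" "Ck_on k S g"
  shows "Ck_on k S (\<lambda>x. f x + g x)"
  using assms(2,3)
proof (induction k arbitrary: f g)
  case 0 then show ?case by (auto intro: continuous_intros)
next
  case (Suc k)
  show ?case
    by (rule Ck_on_SucI[OF assms(1) has_derivative_add[OF differentiable_at_Ck_on differentiable_at_Ck_on]])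
      (use Suc assms in \<open>auto intro!: Suc.IH Ck_on_SucD_partial simp del: Ck_on.simps\<close>)
qed

lemma Ck_on_mult:
  assumes "open S" "Ck_on k S f" "Ck_on k S g"
  shows "Ck_on k S (\<lambda>x. f x * g x)"
  using assms(2,3)
proof (induction k arbitrary: f g)
  case 0 then show ?case by (auto intro: continuous_intros)
next
  case (Suc k)
  have D: "Ck_on k S (\<lambda>x. f x * frechet_derivative g (at x) b + frechet_derivative f (at x) b * g x)"
    if "b \<in> Basis" for b
    by (intro Ck_on_add Suc.IH assms(1) Ck_on_SucD_partial[OF assms(1) _ that] Suc.prems
        Ck_on_SucD[OF Suc.prems(1)] Ck_on_SucD[OF Suc.prems(2)])
  show ?case
    by (rule Ck_on_SucI[OF assms(1) has_derivative_mult[OF differentiable_at_Ck_on differentiable_at_Ck_on]])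
      (use Suc.prems assms(1) D in \<open>simp_all del: Ck_on.simps\<close>)
qed

lemma Ck_on_sum:
  assumes "open S" "\<And>i. i \<in> I \<Longrightarrow> Ck_on k S (f i)"
  shows "Ck_on k S (\<lambda>x. \<Sum>i\<in>I. f i x)"
  using assms(2)
  by (induction I rule: infinite_finite_induct) (auto intro: Ck_on_const Ck_on_add assms(1))

text \<open>The derivative of the inverse is a product of factors of order \<open>k\<close>, two of
  which are the inverse itself; the induction hypothesis covers exactly these.\<close>

lemma Ck_on_inverse:
  assumes "open S" "Ck_on k S f" "\<And>x. x \<in> S \<Longrightarrow> f x \<noteq> 0"
  shows "Ck_on k S (\<lambda>x. inverse (f x))"
  using assms(2)
proof (induction k)
  case 0 then show ?case using assms(3) by (auto intro!: continuous_intros)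
next
  case (Suc k)
  then have IH: "Ck_on k S (\<lambda>x. inverse (f x))" using Ck_on_SucD by blast
  have D: "Ck_on k S (\<lambda>x. - 1 * (inverse (f x) * frechet_derivative f (at x) b * inverse (f x)))"
    if "b \<in> Basis" for b
    by (intro Ck_on_mult assms(1) IH Ck_on_const Ck_on_SucD_partial Suc.prems that)
  show ?case
    by (rule Ck_on_SucI[OF assms(1) Deriv.has_derivative_inverse[OF assms(3) differentiable_at_Ck_on[OF assms(1) _ Suc.prems]]])
      (use D Suc.prems assms(1) in \<open>simp_all del: Ck_on.simps\<close>)
qed

lemma Ck_on_sqrt:
  assumes "open S" "Ck_on k S f" "\<And>x. x \<in> S \<Longrightarrow> f x > (0::real)"
  shows "Ck_on k S (\<lambda>x. sqrt (f x))"
  using assms(2)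
proof (induction k)
  case 0 then show ?case using assms(3) by (auto intro!: continuous_intros)
next
  case (Suc k)
  then have IH: "Ck_on k S (\<lambda>x. sqrt (f x))" using Ck_on_SucD by blast
  have "Ck_on k S (\<lambda>x. inverse (sqrt (f x)))"
    by (rule Ck_on_inverse[OF assms(1) IH]) (use assms(3) in force)
  then have D: "Ck_on k S (\<lambda>x. frechet_derivative f (at x) b * (inverse (sqrt (f x)) * inverse 2))"
    if "b \<in> Basis" for b
    by (intro Ck_on_mult assms(1) Ck_on_const Ck_on_SucD_partial Suc.prems that) 
  show ?case
    by (rule Ck_on_SucI[OF assms(1) has_derivative_real_sqrt[OF assms(3) differentiable_at_Ck_on[OF assms(1) _ Suc.prems]]])
      (use D Suc.prems assms(1) in \<open>simp_all del: Ck_on.simps add: divide_simps mult_ac\<close>)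
qed

lemma Ck_on_inner: "open S \<Longrightarrow> Ck_on k S (\<lambda>x. x \<bullet> c)"
proof (induction k)
  case 0 then show ?case by (auto intro: continuous_intros)
next
  case (Suc k)
  show ?case
    by (rule Ck_on_SucI[OF Suc.prems, where f'="\<lambda>x v. v \<bullet> c"])
      (auto intro!: derivative_eq_intros Ck_on_const Suc.prems)
qed

lemma Ck_on_norm_sq: "open S \<Longrightarrow> Ck_on k S (\<lambda>x. (norm (x - p))\<^sup>2)"
proof -
  assume S: "open S"
  have eq: "(norm (x - p))\<^sup>2 = (\<Sum>b\<in>Basis. (x \<bullet> b + - (p \<bullet> b)) * (x \<bullet> b + - (p \<bullet> b)))" for x
    unfolding power2_norm_eq_inner by (subst euclidean_inner) (simp add: inner_diff_left)
  show ?thesis unfolding eq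
    by (intro Ck_on_sum Ck_on_mult Ck_on_add Ck_on_const Ck_on_inner S)
qed

section \<open>Truncated powers as C^2 cutoffs\<close>

lemma has_field_derivative_max0_sq:
  "((\<lambda>s::real. (max 0 s)\<^sup>2) has_real_derivative 2 * max 0 s) (at s)"
proof -
  consider "s > 0" | "s < 0" | "s = 0" by linarith
  then show ?thesis
  proof cases
    case 1
    show ?thesis
      by (rule has_field_derivative_transform_within_open[where S="{0<..}" and f="\<lambda>s. s\<^sup>2"])
        (use 1 in \<open>auto intro!: derivative_eq_intros\<close>)
  next
    case 2
    show ?thesis
      by (rule has_field_derivative_transform_within_open[where S="{..<0}" and f="\<lambda>s. 0"])
        (use 2 in \<open>auto intro!: derivative_eq_intros\<close>)
  next
    case 3
    have "((\<lambda>h::real. (max 0 h)\<^sup>2 / h) \<longlongrightarrow> 0) (at 0)"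
      by (rule Lim_null_comparison[of _ "\<lambda>h. \<bar>h\<bar>"])
        (auto intro!: tendsto_eq_intros eventuallyI simp: max_def power2_eq_square)
    then show ?thesis using 3 by (simp add: DERIV_def)
  qed
qed

lemma max0_cube: "(max 0 s :: real) ^ 3 = (max 0 s)\<^sup>2 * s"
  by (auto simp: max_def power3_eq_cube power2_eq_square)

text \<open>The truncated cube is twice continuously differentiable, which is the regularity of test
  functions. It serves both as bump in the gluing of boundary charts and, with a negative factor, as
  concave profile of the test function.\<close>

lemma has_field_derivative_max0_cube:
  "((\<lambda>s::real. (max 0 s) ^ 3) has_real_derivative 3 * (max 0 s)\<^sup>2) (at s)"
  unfolding max0_cube
  by (rule derivative_eq_intros has_field_derivative_max0_sq | simp)+
    (auto simp: max_def power2_eq_square)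

lemma has_derivative_max0_sq:
  assumes "(q has_derivative q') (at x)"
  shows "((\<lambda>x. (max 0 (q x :: real))\<^sup>2) has_derivative (\<lambda>v. 2 * max 0 (q x) * q' v)) (at x)"
  using has_derivative_compose[OF assms has_field_derivative_max0_sq[unfolded has_field_derivative_def]]
  by simp

lemma has_derivative_max0_cube:
  assumes "(q has_derivative q') (at x)"
  shows "((\<lambda>x. (max 0 (q x :: real)) ^ 3) has_derivative (\<lambda>v. 3 * (max 0 (q x))\<^sup>2 * q' v)) (at x)"
  using has_derivative_compose[OF assms has_field_derivative_max0_cube[unfolded has_field_derivative_def]]
  by simp

lemma Ck_on_1_max0_sq:
  assumes "open S" "Ck_on (Suc 0) S q"
  shows "Ck_on (Suc 0) S (\<lambda>x. (max 0 (q x))\<^sup>2)"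
proof -
  have c: "Ck_on 0 S (\<lambda>x. 2 * max 0 (q x))"
    using Ck_on_imp_continuous_on[OF assms(2)] by (auto intro!: continuous_intros)
  show ?thesis
    by (rule Ck_on_SucI[OF assms(1) has_derivative_max0_sq[OF differentiable_at_Ck_on[OF assms(1) _ assms(2)]]])
      (auto intro!: Ck_on_mult[OF assms(1) c] Ck_on_SucD_partial assms simp del: Ck_on.simps)
qed

lemma Ck_on_2_max0_cube:
  assumes "open S" "Ck_on 2 S q"
  shows "Ck_on 2 S (\<lambda>x. (max 0 (q x)) ^ 3)"
proof -
  have q: "Ck_on (Suc (Suc 0)) S q" using assms(2) by (simp add: numeral_2_eq_2)
  have c: "Ck_on (Suc 0) S (\<lambda>x. 3 * (max 0 (q x))\<^sup>2)"
    by (intro Ck_on_mult Ck_on_const Ck_on_1_max0_sq assms(1) Ck_on_SucD[OF q])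
  have "Ck_on (Suc (Suc 0)) S (\<lambda>x. (max 0 (q x)) ^ 3)"
    by (rule Ck_on_SucI[OF assms(1) has_derivative_max0_cube[OF differentiable_at_Ck_on[OF assms(1) _ q]]])
      (auto intro!: Ck_on_mult[OF assms(1) c] Ck_on_SucD_partial assms q simp del: Ck_on.simps)
  then show ?thesis by (simp only: numeral_2_eq_2)
qed

section \<open>Derivatives within the closed domain and uniqueness of the outward normal\<close>

lemma has_derivative_within_ray_unique:
  fixes f :: "'a::euclidean_space \<Rightarrow> real"
  assumes "(f has_derivative f') (at x within S)" "(f has_derivative f'') (at x within S)"
    and "x \<in> S" "d > 0" "\<And>t. 0 < t \<Longrightarrow> t < d \<Longrightarrow> x + t *\<^sub>R w \<in> S"
  shows "f' w = f'' w"
proof -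
  have S: "(\<lambda>t. x + t *\<^sub>R w) ` {0..<d} \<subseteq> S"
  proof clarify
    fix t assume "t \<in> {0..<d}"
    then show "x + t *\<^sub>R w \<in> S" using assms(3,5) by (cases "t = 0") auto
  qed
  have ray: "((\<lambda>t. x + t *\<^sub>R w) has_derivative (\<lambda>t. t *\<^sub>R w)) (at 0 within {0..<d})"
    by (auto intro!: derivative_eq_intros)
  \<comment> \<open>Restricting to the ray turns both candidates into derivatives of one function of
    a single variable at the endpoint of an interval, where the derivative is unique.\<close>
  have "((\<lambda>t. f (x + t *\<^sub>R w)) has_derivative (\<lambda>t. g (t *\<^sub>R w))) (at 0 within {0..<d})"
    if "(f has_derivative g) (at x within S)" for g
    by (rule has_derivative_in_compose[OF ray]) (use has_derivative_subset[OF that S] in simp)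
  note D = this[OF assms(1)] this[OF assms(2)]
  have "(\<lambda>t. f' (t *\<^sub>R w)) = (\<lambda>t. f'' (t *\<^sub>R w))"
  proof (rule frechet_derivative_unique_within[OF D])
    fix i e :: real assume "i \<in> Basis" "e > 0"
    then show "\<exists>c. 0 < \<bar>c\<bar> \<and> \<bar>c\<bar> < e \<and> 0 + c *\<^sub>R i \<in> {0..<d}"
      using assms(4) by (intro exI[of _ "min e d / 2"]) auto
  qed
  then show ?thesis by (metis scaleR_one)
qed

lemma norm_gradient_on_sq: "(norm (gradient_on U r x))\<^sup>2 = (\<Sum>b\<in>Basis. (partial_on U b r x)\<^sup>2)"
proof -
  have "gradient_on U r x \<bullet> b = partial_on U b r x" if "b \<in> Basis" for b
    using that by (simp add: gradient_on_def inner_sum_left inner_Basis if_distrib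
        cong: if_cong)
  then show ?thesis
    unfolding power2_norm_eq_inner by (subst euclidean_inner) (simp add: power2_eq_square)
qed

lemma has_derivative_gradient_on:
  assumes "open U" "x \<in> U" "Ck_on (Suc k) U r"
  shows "(r has_derivative (\<lambda>v. gradient_on U r x \<bullet> v)) (at x)"
proof -
  let ?f = "frechet_derivative r (at x)"
  have d: "(r has_derivative ?f) (at x)" by (rule differentiable_at_Ck_on[OF assms])
  then have lin: "linear ?f" by (rule has_derivative_linear)
  have "?f v = gradient_on U r x \<bullet> v" for v
  proof -
    have "?f v = ?f (\<Sum>b\<in>Basis. (v \<bullet> b) *\<^sub>R b)" by (simp add: euclidean_representation)
    also have "\<dots> = (\<Sum>b\<in>Basis. (v \<bullet> b) * ?f b)"
      by (simp add: linear_sum[OF lin] linear_cmul[OF lin])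
    also have "\<dots> = gradient_on U r x \<bullet> v"
      by (simp add: gradient_on_def inner_sum_right inner_commute[of _ v] partial_on_open_eq[OF assms(1,2)] mult.commute)
    finally show ?thesis .
  qed
  then have "?f = (\<lambda>v. gradient_on U r x \<bullet> v)" by auto
  with d show ?thesis by metis
qed

lemma local_defining_function_deriv:
  assumes "local_defining_function D U r" "x \<in> U"
  shows "(r has_derivative (\<lambda>v. gradient_on U r x \<bullet> v)) (at x)"
  using assms has_derivative_gradient_on[of U x 0 r] unfolding local_defining_function_def by blast

text \<open>The point lies outside the open set \<open>D\<close>, so \<open>r p \<ge> 0\<close>; if
  \<open>r p\<close> were positive, \<open>r\<close> would be positive on a neighbourhood of
  \<open>p\<close>, which then misses \<open>D\<close>.\<close>

lemma local_defining_function_frontier: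
  assumes "open D" "local_defining_function D U r" "p \<in> U" "p \<in> frontier D"
  shows "r p = 0"
proof -
  have U: "open U" "D \<inter> U = {x \<in> U. r x < 0}" "continuous_on U r"
    using assms(2) Ck_on_imp_continuous_on unfolding local_defining_function_def by blast+
  have "p \<notin> D" using assms(1,4) by (simp add: frontier_def interior_open)
  then have "r p \<ge> 0" using U(2) assms(3) by force
  moreover have "\<not> r p > 0"
  proof
    assume "r p > 0"
    then have "open (U \<inter> r -` {0<..})" "p \<in> U \<inter> r -` {0<..}"
      using continuous_open_preimage[OF U(3,1) open_greaterThan[of 0]] assms(3) by auto
    moreover have "p \<in> closure D" using assms(4) by (simp add: frontier_def)
    ultimately obtain y where "y \<in> D" "y \<in> U" "r y > 0"
      using open_Int_closure_eq_empty[of "U \<inter> r -` {0<..}" D] by auto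
    then have "y \<in> {x \<in> U. r x < 0}" using U(2) by blast
    then show False using \<open>r y > 0\<close> by simp
  qed
  ultimately show ?thesis by simp
qed

lemma ray_DERIV:
  assumes "(r has_derivative r') (at x)"
  shows "((\<lambda>t. r (x + t *\<^sub>R w) :: real) has_real_derivative r' w) (at 0)"
proof -
  have "((\<lambda>t. x + t *\<^sub>R w) has_derivative (\<lambda>t. t *\<^sub>R w)) (at 0)"
    by (auto intro!: derivative_eq_intros)
  then have "((\<lambda>t. r (x + t *\<^sub>R w)) has_derivative (\<lambda>t. r' (t *\<^sub>R w))) (at 0)"
    by (rule has_derivative_compose) (use assms in simp)
  moreover have "r' (t *\<^sub>R w) = r' w * t" for t
    using linear_cmul[OF has_derivative_linear[OF assms]] by simp
  ultimately show ?thesis by (simp add: has_field_derivative_def)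
qed

text \<open>Starting from \<open>r p = 0\<close>, the function \<open>r\<close> decreases to first
  order along \<open>w\<close>, so short steps land where \<open>r < 0\<close>, which inside
  \<open>U\<close> means in \<open>D\<close>.\<close>

lemma local_defining_function_inward:
  assumes "open D" "local_defining_function D U r" "p \<in> U" "p \<in> frontier D"
    and "gradient_on U r p \<bullet> w < 0"
  shows "\<exists>d>0. \<forall>t. 0 < t \<longrightarrow> t < d \<longrightarrow> p + t *\<^sub>R w \<in> D"
proof -
  have U: "open U" "D \<inter> U = {x \<in> U. r x < 0}"
    using assms(2) unfolding local_defining_function_def by blast+
  obtain d1 where d1: "d1 > 0" "\<And>h. h > 0 \<Longrightarrow> h < d1 \<Longrightarrow> r (p + h *\<^sub>R w) < r p"
    using DERIV_neg_dec_right[OF ray_DERIV[OF local_defining_function_deriv[OF assms(2,3)]] assms(5)]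
    by auto
  have "((\<lambda>t. p + t *\<^sub>R w) \<longlongrightarrow> p) (at_right 0)" by (auto intro!: tendsto_eq_intros)
  then have "eventually (\<lambda>t. p + t *\<^sub>R w \<in> U) (at_right 0)"
    using U(1) assms(3) topological_tendstoD by blast
  then obtain d2 where d2: "d2 > 0" "\<And>t. 0 < t \<Longrightarrow> t < d2 \<Longrightarrow> p + t *\<^sub>R w \<in> U"
    by (auto simp: eventually_at_right_field)
  show ?thesis
    by (rule exI[of _ "min d1 d2"])
      (use d1 d2 U local_defining_function_frontier[OF assms(1-4)] in auto)
qed

text \<open>Different charts define the same normal. If the unit gradients \<open>a\<close> and
  \<open>b\<close> differed, \<open>b - a\<close> would point inward for the first chart and outward
  for the second, because \<open>a \<bullet> b < 1\<close>.\<close>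

lemma local_defining_function_normal_unique:
  assumes "open D" "local_defining_function D U r" "p \<in> U" "p \<in> frontier D"
    and "local_defining_function D U' r'" "p \<in> U'"
  shows "(1 / norm (gradient_on U r p)) *\<^sub>R gradient_on U r p =
         (1 / norm (gradient_on U' r' p)) *\<^sub>R gradient_on U' r' p"
proof -
  let ?a = "gradient_on U r p" and ?b = "gradient_on U' r' p"
  have nz: "?a \<noteq> 0" "?b \<noteq> 0" using assms unfolding local_defining_function_def by auto
  define a b where ab: "a = (1 / norm ?a) *\<^sub>R ?a" "b = (1 / norm ?b) *\<^sub>R ?b"
  have n1: "a \<bullet> a = 1" "b \<bullet> b = 1"
    using nz by (auto simp: ab dot_square_norm power2_eq_square)
  have "a = b"
  proof (rule ccontr)
    assume "a \<noteq> b"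
    then have "(a - b) \<bullet> (a - b) > 0" by simp
    then have lt: "a \<bullet> b < 1" using n1 by (simp add: inner_diff inner_commute)
    let ?w = "b - a"
    have "?a \<bullet> ?w = norm ?a * (a \<bullet> ?w)" using nz by (simp add: ab)
    also have "\<dots> < 0" using lt n1 nz by (simp add: inner_diff mult_pos_neg)
    finally obtain d where d: "d > 0" "\<And>t. 0 < t \<Longrightarrow> t < d \<Longrightarrow> p + t *\<^sub>R ?w \<in> D"
      using local_defining_function_inward[OF assms(1-4)] by blast
    have "?b \<bullet> ?w = norm ?b * (b \<bullet> ?w)" using nz by (simp add: ab)
    also have "\<dots> > 0" using lt n1 nz by (simp add: inner_diff inner_commute)
    finally obtain d1 where d1: "d1 > 0" "\<And>h. h > 0 \<Longrightarrow> h < d1 \<Longrightarrow> r' p < r' (p + h *\<^sub>R ?w)"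
      using DERIV_pos_inc_right[OF ray_DERIV[OF local_defining_function_deriv[OF assms(5,6)]]] by auto
    have U: "open U'" "D \<inter> U' = {x \<in> U'. r' x < 0}"
      using assms(5) unfolding local_defining_function_def by blast+
    have "((\<lambda>t. p + t *\<^sub>R ?w) \<longlongrightarrow> p) (at_right 0)" by (auto intro!: tendsto_eq_intros)
    then have "eventually (\<lambda>t. p + t *\<^sub>R ?w \<in> U') (at_right 0)"
      using U(1) assms(6) topological_tendstoD by blast
    then obtain d2 where d2: "d2 > 0" "\<And>t. 0 < t \<Longrightarrow> t < d2 \<Longrightarrow> p + t *\<^sub>R ?w \<in> U'"
      by (auto simp: eventually_at_right_field)
    define t where "t = min d (min d1 d2) / 2"
    have t: "0 < t" "t < d" "t < d1" "t < d2" using d d1 d2 by (auto simp: t_def)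
    have "r' (p + t *\<^sub>R ?w) < 0" using d(2)[of t] d2(2)[of t] t U(2) by auto
    moreover have "r' p < r' (p + t *\<^sub>R ?w)" using d1(2)[of t] t by simp
    ultimately show False
      using local_defining_function_frontier[OF assms(1,5,6,4)] by simp
  qed
  then show ?thesis by (simp add: ab)
qed

text \<open>Makes \<open>frechet_derivative\<close> within the closure a determined object. At a
  frontier point every direction with negative inner product with the gradient leads into
  \<open>D\<close>; along these the two derivatives agree, and the open half-space they form spans
  the whole space.\<close>

lemma has_derivative_unique_within_closure:
  fixes f :: "'a::euclidean_space \<Rightarrow> real"
  assumes "smooth_bounded_domain D" "x \<in> closure D"
    and "(f has_derivative f') (at x within closure D)" "(f has_derivative f'') (at x within closure D)"
  shows "f' = f''"
proof -
  have D: "open D" using assms(1) unfolding smooth_bounded_domain_def by blast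
  note ray = has_derivative_within_ray_unique[OF assms(3,4,2)]
  show ?thesis
  proof (cases "x \<in> D")
    case True
    then have "x \<in> interior (closure D)" using D interior_maximal closure_subset by blast
    then have "at x within closure D = at x" by (rule at_within_interior)
    then show ?thesis using assms(3,4) has_derivative_unique by metis
  next
    case False
    then have fr: "x \<in> frontier D" using D assms(2) by (simp add: frontier_def interior_open)
    then obtain U r where r: "x \<in> U" "local_defining_function D U r"
      using assms(1) unfolding smooth_bounded_domain_def by blast
    let ?a = "gradient_on U r x"
    have a: "?a \<noteq> 0" using r unfolding local_defining_function_def by auto
    have eq: "f' w = f'' w" if w: "?a \<bullet> w < 0" for w
    proof -
      obtain d where d: "d > 0" "\<And>t. 0 < t \<Longrightarrow> t < d \<Longrightarrow> x + t *\<^sub>R w \<in> D"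
        using local_defining_function_inward[OF D r(2,1) fr w] by blast
      then show ?thesis using ray[OF d(1)] closure_subset by blast
    qed
    have lin: "linear f'" "linear f''" using assms(3,4) has_derivative_linear by auto
    have "f' v = f'' v" for v
    proof -
      \<comment> \<open>So large that \<open>v\<close> minus \<open>s\<close> times the gradient
        points inward; the negative gradient does too, and \<open>v\<close> is a linear combination
        of these two directions.\<close>
      define s where "s = (\<bar>?a \<bullet> v\<bar> + 1) / (?a \<bullet> ?a)"
      have "?a \<bullet> (v + (- s) *\<^sub>R ?a) = ?a \<bullet> v - (\<bar>?a \<bullet> v\<bar> + 1)"
        using a by (simp add: s_def inner_diff_right)
      then have "f' (v + (- s) *\<^sub>R ?a) = f'' (v + (- s) *\<^sub>R ?a)" by (intro eq) simp
      moreover have "f' (- ?a) = f'' (- ?a)" by (rule eq) (use a in simp)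
      ultimately show ?thesis
        using lin by (simp add: linear_add linear_neg linear_cmul linear_diff)
    qed
    then show ?thesis by auto
  qed
qed

lemma frechet_derivative_closure:
  fixes f :: "'a::euclidean_space \<Rightarrow> real"
  assumes "smooth_bounded_domain D" "x \<in> closure D" "(f has_derivative f') (at x)"
  shows "frechet_derivative f (at x within closure D) = f'"
proof -
  have d: "(f has_derivative f') (at x within closure D)"
    using assms(3) by (rule has_derivative_at_withinI)
  then have "(f has_derivative frechet_derivative f (at x within closure D)) (at x within closure D)"
    by (metis differentiable_def frechet_derivative_works)
  then show ?thesis using has_derivative_unique_within_closure[OF assms(1,2)] d by blast
qed

text \<open>Transfers derivatives within the closure to an open neighbourhood, where the calculus of
  C^k functions is available.\<close>

lemma partial_on_closure:
  assumes "smooth_bounded_domain D" "open O'" "closure D \<subseteq> O'" "Ck_on (Suc k) O' f" "x \<in> closure D"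
  shows "partial_on (closure D) b f x = partial_on O' b f x"
  using frechet_derivative_closure[OF assms(1,5) differentiable_at_Ck_on[OF assms(2) _ assms(4)]]
    assms(3,5) partial_on_open_eq[OF assms(2)] by (auto simp: partial_on_def)

lemma Ck_on_closure:
  assumes "smooth_bounded_domain D" "open O'" "closure D \<subseteq> O'" "Ck_on k O' f"
  shows "Ck_on k (closure D) f"
  using assms(4)
proof (induction k arbitrary: f)
  case 0
  then show ?case using assms(3) continuous_on_subset by auto
next
  case (Suc k)
  have "Ck_on k (closure D) (partial_on (closure D) b f) \<longleftrightarrow> Ck_on k (closure D) (partial_on O' b f)" for b
    by (rule Ck_on_cong) (rule partial_on_closure[OF assms(1-3) Suc.prems])
  moreover have "f differentiable_on closure D"
    using Suc.prems assms(3) differentiable_on_subset by auto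
  ultimately show ?case using Suc by auto
qed

text \<open>Normalises a local defining function to first order: \<open>- r\<close> divided by the
  norm of its gradient vanishes on the frontier and has gradient \<open>- \<nu>\<close> there,
  because the derivative of the denominator is multiplied by \<open>r = 0\<close>.\<close>

lemma boundary_chart:
  assumes D: "smooth_bounded_domain D" and \<nu>: "outward_unit_normal D \<nu>" and p: "p \<in> closure D"
  shows "\<exists>e>0. \<exists>s. Ck_on 2 (ball p e) s \<and> (\<forall>x\<in>ball p e \<inter> D. 0 < s x) \<and>
    (\<forall>x\<in>ball p e \<inter> frontier D. s x = 0 \<and> (s has_derivative (\<lambda>v. - (\<nu> x \<bullet> v))) (at x))"
proof (cases "p \<in> D")
  case True
  have oD: "open D" using D unfolding smooth_bounded_domain_def by blast
  then obtain e where e: "e > 0" "ball p e \<subseteq> D" using True open_contains_ball by blast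
  moreover have "ball p e \<inter> frontier D = {}"
    using e oD by (auto simp: frontier_def interior_open)
  \<comment> \<open>Well inside \<open>D\<close> the frontier conditions are vacuous and the
    constant 1 is a chart.\<close>
  ultimately show ?thesis
    by (intro exI[of _ e] conjI exI[of _ "\<lambda>_. 1"]) (auto intro: Ck_on_const simp del: Ck_on.simps)
next
  case False
  have oD: "open D" using D unfolding smooth_bounded_domain_def by blast
  have fr: "p \<in> frontier D" using False oD p by (simp add: frontier_def interior_open)
  then obtain U r where r: "p \<in> U" "local_defining_function D U r"
    using D unfolding smooth_bounded_domain_def by blast
  have U: "open U" "\<And>k. Ck_on k U r" "\<And>x. x \<in> U \<Longrightarrow> gradient_on U r x \<noteq> 0"
      "D \<inter> U = {x\<in>U. r x < 0}"
    using r(2) unfolding local_defining_function_def by blast+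
  define G where "G = (\<lambda>x. \<Sum>b\<in>Basis. partial_on U b r x * partial_on U b r x)"
  define h where "h = (\<lambda>x. inverse (sqrt (G x)))"
  have Gn: "G x = (norm (gradient_on U r x))\<^sup>2" for x
    unfolding norm_gradient_on_sq G_def by (simp add: power2_eq_square)
  have hn: "h x = 1 / norm (gradient_on U r x)" for x
    by (simp add: h_def Gn divide_inverse)
  have Gpos: "G x > 0" if "x \<in> U" for x using U(3)[OF that] by (simp add: Gn)
  have partial: "Ck_on k U (partial_on U b r)" if "b \<in> Basis" for b k
    using U(2)[of "Suc k"] that by simp
  have h: "Ck_on 2 U h" unfolding h_def G_def
    by (intro Ck_on_inverse Ck_on_sqrt Ck_on_sum Ck_on_mult partial U(1))
      (use Gpos in \<open>auto simp: G_def less_imp_neq[symmetric]\<close>)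
  define s where "s = (\<lambda>x. (- 1 * r x) * h x)"
  have s: "Ck_on 2 U s" unfolding s_def by (intro Ck_on_mult Ck_on_const h U)
  obtain e where e: "e > 0" "ball p e \<subseteq> U" using r(1) U(1) open_contains_ball by blast
  have "0 < s x" if "x \<in> ball p e \<inter> D" for x
  proof -
    have "x \<in> U" using that e by auto
    moreover have "x \<in> {x\<in>U. r x < 0}" using that e U(4) by blast
    ultimately show ?thesis using U(3) by (simp add: s_def hn divide_neg_pos)
  qed
  moreover have "s x = 0 \<and> (s has_derivative (\<lambda>v. - (\<nu> x \<bullet> v))) (at x)"
    if "x \<in> ball p e \<inter> frontier D" for x
  proof -
    have x: "x \<in> U" "x \<in> frontier D" using that e by auto
    have r0: "r x = 0" by (rule local_defining_function_frontier[OF oD r(2) x])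
    obtain U' r' where r': "x \<in> U'" "local_defining_function D U' r'"
      "\<nu> x = (1 / norm (gradient_on U' r' x)) *\<^sub>R gradient_on U' r' x"
      using \<nu> x(2) unfolding outward_unit_normal_def by blast
    \<comment> \<open>The chart supplied by \<open>outward_unit_normal\<close> may differ from the
      one covering \<open>p\<close>; uniqueness of the unit gradient allows \<open>\<nu>\<close> to
      be expressed by the latter.\<close>
    have \<nu>x: "\<nu> x = (1 / norm (gradient_on U r x)) *\<^sub>R gradient_on U r x"
      unfolding r'(3) by (rule local_defining_function_normal_unique[OF oD r'(2,1) x(2) r(2) x(1)])
    have h2: "Ck_on (Suc 1) U h" using h by (simp only: numeral_2_eq_2 One_nat_def)
    have "(s has_derivative (\<lambda>v. (- 1 * r x) * frechet_derivative h (at x) v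
        + (- 1 * (gradient_on U r x \<bullet> v)) * h x)) (at x)"
      unfolding s_def
      by (intro has_derivative_mult has_derivative_mult_right local_defining_function_deriv[OF r(2) x(1)]
          differentiable_at_Ck_on[OF U(1) x(1) h2])
    then show ?thesis using r0 by (simp add: s_def \<nu>x hn)
  qed
  ultimately show ?thesis
    using e Ck_on_open_subset[OF U(1) open_ball e(2) s] by (intro exI[of _ e] conjI exI[of _ s]) auto
qed

text \<open>Glues the charts by the C^2 partition of unity \<open>\<eta> p / X\<close>. Each
  \<open>s p\<close> has value 0 and gradient \<open>- \<nu>\<close> on the frontier, so derivatives
  of the weights drop out there and the weighted average keeps that value and gradient.\<close>

lemma boundary_defining_function:
  fixes D :: "'a::euclidean_space set"
  assumes D: "smooth_bounded_domain D" and \<nu>: "outward_unit_normal D \<nu>"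
  obtains O' \<psi> where "open O'" "closure D \<subseteq> O'" "Ck_on 2 O' \<psi>" "\<And>x. x \<in> D \<Longrightarrow> 0 < \<psi> x"
    "\<And>x. x \<in> frontier D \<Longrightarrow> \<psi> x = 0"
    "\<And>x. x \<in> frontier D \<Longrightarrow> (\<psi> has_derivative (\<lambda>v. - (\<nu> x \<bullet> v))) (at x)"
proof -
  have bD: "bounded D" and oD: "open D" using D unfolding smooth_bounded_domain_def by blast+
  then have comp: "compact (closure D)" by (simp add: compact_closure)
  define chart where "chart p e s \<longleftrightarrow> Ck_on 2 (ball p e) s \<and> (\<forall>x\<in>ball p e \<inter> D. 0 < s x) \<and>
    (\<forall>x\<in>ball p e \<inter> frontier D. s x = 0 \<and> (s has_derivative (\<lambda>v. - (\<nu> x \<bullet> v))) (at x))" for p e s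
  have "\<forall>p\<in>closure D. \<exists>e s. 0 < e \<and> chart p e s"
    using boundary_chart[OF D \<nu>] unfolding chart_def by metis
  then obtain e s where es: "\<And>p. p \<in> closure D \<Longrightarrow> 0 < e p \<and> chart p (e p) (s p)"
    by metis
  have "closure D \<subseteq> (\<Union>p\<in>closure D. ball p (e p / 2))" using es by force
  then obtain P where P: "P \<subseteq> closure D" "finite P" "closure D \<subseteq> (\<Union>p\<in>P. ball p (e p / 2))"
    by (rule compactE_image[OF comp, rotated]) auto
  \<comment> \<open>The bump lives on the ball of half the chart radius, so
    \<open>\<eta> p * s p\<close> vanishes before the domain of \<open>s p\<close> ends and extends
    by zero as a C^2 function.\<close>
  define \<eta> where "\<eta> p x = (max 0 ((e p / 2)\<^sup>2 + - 1 * (norm (x - p))\<^sup>2)) ^ 3" for p x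
  define X where "X x = (\<Sum>p\<in>P. \<eta> p x)" for x
  define Y where "Y x = (\<Sum>p\<in>P. \<eta> p x * s p x)" for x
  define \<psi> where "\<psi> x = Y x * inverse (X x)" for x
  have \<eta>C: "Ck_on 2 UNIV (\<eta> p)" for p unfolding \<eta>_def
    by (intro Ck_on_2_max0_cube Ck_on_add Ck_on_mult Ck_on_const Ck_on_norm_sq open_UNIV)
  have \<eta>nn: "\<eta> p x \<ge> 0" for p x by (simp add: \<eta>_def)
  have \<eta>0: "\<eta> p x = 0" if "x \<notin> ball p (e p / 2)" "0 < e p" for p x
  proof -
    have "e p / 2 \<le> norm (x - p)" using that by (simp add: dist_norm norm_minus_commute)
    then have "(e p / 2)\<^sup>2 \<le> (norm (x - p))\<^sup>2" by (rule power_mono) (use that in simp)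
    then show ?thesis by (simp add: \<eta>_def)
  qed
  have \<eta>pos: "\<eta> p x > 0" if "x \<in> ball p (e p / 2)" for p x
  proof -
    have "norm (x - p) < e p / 2" using that by (simp add: dist_norm norm_minus_commute)
    then have "(norm (x - p))\<^sup>2 < (e p / 2)\<^sup>2" by (rule power_strict_mono) auto
    then show ?thesis by (simp add: \<eta>_def)
  qed
  have Xpos: "X x > 0" if x: "x \<in> closure D" for x
  proof -
    obtain p where p: "p \<in> P" "x \<in> ball p (e p / 2)" using x P(3) by blast
    then show ?thesis unfolding X_def
      by (intro sum_pos2[OF P(2) p(1)]) (auto intro: \<eta>pos \<eta>nn)
  qed
  have term2: "Ck_on 2 UNIV (\<lambda>x. \<eta> p x * s p x)" if p: "p \<in> P" for p
  proof (rule Ck_on_local[OF open_UNIV])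
    have pe: "0 < e p" "Ck_on 2 (ball p (e p)) (s p)"
      using es P(1) p unfolding chart_def by blast+
    fix x :: 'a
    show "\<exists>U. open U \<and> x \<in> U \<and> Ck_on 2 U (\<lambda>x. \<eta> p x * s p x)"
    proof (cases "x \<in> ball p (e p)")
      case True
      then show ?thesis using pe(2) Ck_on_open_subset[OF open_UNIV open_ball _ \<eta>C]
        by (intro exI[of _ "ball p (e p)"] conjI Ck_on_mult) auto
    next
      case False
      have "Ck_on 2 (- cball p (e p / 2)) (\<lambda>x. \<eta> p x * s p x) \<longleftrightarrow> Ck_on 2 (- cball p (e p / 2)) (\<lambda>x. 0)"
        by (rule Ck_on_cong) (use \<eta>0 pe(1) in auto)
      then show ?thesis using False pe(1) Ck_on_const[of "- cball p (e p / 2)" 2 0]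
        by (intro exI[of _ "- cball p (e p / 2)"] conjI) (auto simp: open_Compl)
    qed
  qed
  have XC: "Ck_on 2 UNIV X" unfolding X_def by (intro Ck_on_sum \<eta>C open_UNIV)
  have YC: "Ck_on 2 UNIV Y" unfolding Y_def by (intro Ck_on_sum term2 open_UNIV)
  \<comment> \<open>The quotient makes sense where some bump is positive; this open set contains the
    closure by the choice of the finite cover \<open>P\<close>.\<close>
  define O' where "O' = {x. X x > 0}"
  have oO: "open O'" unfolding O'_def
    using Ck_on_imp_continuous_on[OF XC] by (intro open_Collect_less continuous_on_const)
  have DO: "closure D \<subseteq> O'" using Xpos by (auto simp: O'_def)
  have \<psi>C: "Ck_on 2 O' \<psi>" unfolding \<psi>_def
    by (intro Ck_on_mult Ck_on_inverse oO Ck_on_open_subset[OF open_UNIV oO _ XC]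
        Ck_on_open_subset[OF open_UNIV oO _ YC]) (auto simp: O'_def)
  have tnn: "\<eta> p x * s p x \<ge> 0" if "p \<in> P" "x \<in> D" for p x
  proof (cases "x \<in> ball p (e p)")
    case True
    then have "s p x > 0" using es[of p] P(1) that unfolding chart_def by blast
    then show ?thesis using \<eta>nn[of p x] by simp
  next
    case False
    moreover have "0 < e p" using es[of p] P(1) that by blast
    ultimately show ?thesis using \<eta>0[of x p] by auto
  qed
  have pos: "0 < \<psi> x" if x: "x \<in> D" for x
  proof -
    have xc: "x \<in> closure D" using x closure_subset by auto
    obtain p where p: "p \<in> P" "x \<in> ball p (e p / 2)" using xc P(3) by blast
    have "0 < e p" using es[of p] P(1) p by blast
    then have "x \<in> ball p (e p)" using p(2) by auto
    then have "0 < s p x" using es[of p] P(1) p(1) x unfolding chart_def by blast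
    then have "0 < \<eta> p x * s p x" using \<eta>pos[OF p(2)] by simp
    then have "0 < Y x" unfolding Y_def using tnn[OF _ x] by (intro sum_pos2[OF P(2) p(1)]) auto
    then show ?thesis using Xpos[OF xc] by (simp add: \<psi>_def)
  qed
  have term0: "\<eta> p x * s p x = 0 \<and> ((\<lambda>x. \<eta> p x * s p x) has_derivative (\<lambda>v. \<eta> p x * - (\<nu> x \<bullet> v))) (at x)"
    if p: "p \<in> P" and x: "x \<in> frontier D" for p x
  proof (cases "x \<in> ball p (e p)")
    case True
    then have s0: "s p x = 0" "(s p has_derivative (\<lambda>v. - (\<nu> x \<bullet> v))) (at x)"
      using es[of p] P(1) p x unfolding chart_def by blast+
    have "Ck_on (Suc 1) UNIV (\<eta> p)" using \<eta>C[of p] by (simp only: numeral_2_eq_2 One_nat_def)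
    from has_derivative_mult[OF differentiable_at_Ck_on[OF open_UNIV UNIV_I this] s0(2)]
    show ?thesis using s0(1) by simp
  next
    case False
    have e: "0 < e p" using es[of p] P(1) p by blast
    have "((\<lambda>x. \<eta> p x * s p x) has_derivative (\<lambda>v. 0)) (at x)"
      by (rule has_derivative_transform_within_open[where f="\<lambda>_. 0" and s="- cball p (e p / 2)"])
        (use False e \<eta>0 in auto)
    then show ?thesis using \<eta>0[of x p] e False by auto
  qed
  have Y0: "Y x = 0" if "x \<in> frontier D" for x
    unfolding Y_def using term0[OF _ that] by (intro sum.neutral) blast
  have deriv: "(\<psi> has_derivative (\<lambda>v. - (\<nu> x \<bullet> v))) (at x)" if x: "x \<in> frontier D" for x
  proof -
    have xc: "x \<in> closure D" using x by (simp add: frontier_def)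
    have Yd: "(Y has_derivative (\<lambda>v. \<Sum>p\<in>P. \<eta> p x * - (\<nu> x \<bullet> v))) (at x)"
      unfolding Y_def by (intro has_derivative_sum) (use term0[OF _ x] in blast)
    have "Ck_on 2 O' (\<lambda>x. inverse (X x))"
      by (intro Ck_on_inverse oO Ck_on_open_subset[OF open_UNIV oO _ XC]) (auto simp: O'_def)
    then have "Ck_on (Suc 1) O' (\<lambda>x. inverse (X x))" by (simp only: numeral_2_eq_2 One_nat_def)
    from has_derivative_mult[OF Yd differentiable_at_Ck_on[OF oO _ this]]
    have "(\<psi> has_derivative (\<lambda>v. (\<Sum>p\<in>P. \<eta> p x * - (\<nu> x \<bullet> v)) * inverse (X x))) (at x)"
      using DO xc Y0[OF x] by (auto simp: \<psi>_def[abs_def])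
    moreover have "(\<Sum>p\<in>P. \<eta> p x * - (\<nu> x \<bullet> v)) * inverse (X x) = - (\<nu> x \<bullet> v)" for v
      using Xpos[OF xc] by (simp add: X_def sum_distrib_right[symmetric] sum_negf)
    ultimately show ?thesis by simp
  qed
  show ?thesis
    by (rule that[OF oO DO \<psi>C pos _ deriv]) (auto simp: \<psi>_def Y0)
qed

text \<open>With \<psi> the boundary defining function, \<phi> = 1 + (\<beta>\<epsilon>/3)(1 - (1 -
  \<psi>/\<epsilon>)_+^3). On the frontier \<phi> = 1 and its gradient is \<beta> times that of
  \<psi>, that is -\<beta>\<nu>, which is the Robin condition. In the layer \<psi> < \<epsilon> the
  second derivative of the concave profile, weighted by the squared gradient of \<psi>, dominates
  the Laplacian of \<psi>; beyond the layer \<phi> is constant.\<close>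

lemma superharmonic_robin_test_function:
  fixes D :: "'a::euclidean_space set"
  assumes D: "smooth_bounded_domain D" and \<nu>: "outward_unit_normal D \<nu>" and "\<beta> > 0"
  obtains \<phi> where "robin_test_function D \<nu> \<beta> \<phi>" "\<And>x. x \<in> closure D \<Longrightarrow> 1 \<le> \<phi> x"
    "\<And>x. x \<in> closure D \<Longrightarrow> laplacian_on (closure D) \<phi> x \<le> 0"
proof -
  obtain O' \<psi> where O': "open O'" "closure D \<subseteq> O'" "Ck_on 2 O' \<psi>"
    and \<psi>pos: "\<And>x. x \<in> D \<Longrightarrow> 0 < \<psi> x"
    and \<psi>0: "\<And>x. x \<in> frontier D \<Longrightarrow> \<psi> x = 0"
    and d\<psi>: "\<And>x. x \<in> frontier D \<Longrightarrow> (\<psi> has_derivative (\<lambda>v. - (\<nu> x \<bullet> v))) (at x)"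
    using boundary_defining_function[OF D \<nu>] by metis
  have bD: "bounded D" and oD: "open D" using D unfolding smooth_bounded_domain_def by blast+
  have comp: "compact (closure D)" using bD by (simp add: compact_closure)
  have clD: "closure D = D \<union> frontier D" using oD by (auto simp: frontier_def interior_open closure_def)
  have \<psi>nn: "0 \<le> \<psi> x" if "x \<in> closure D" for x using that \<psi>pos \<psi>0 clD by force
  let ?d = "\<lambda>b x. frechet_derivative \<psi> (at x) b"
  have C2: "Ck_on (Suc (Suc 0)) O' \<psi>" using O'(3) by (simp only: numeral_2_eq_2)
  have dC: "Ck_on (Suc 0) O' (?d b)" if "b \<in> Basis" for b
    by (rule Ck_on_SucD_partial[OF O'(1) C2 that])
  have ddC: "Ck_on 0 O' (\<lambda>x. frechet_derivative (?d b) (at x) b)" if "b \<in> Basis" for b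
    by (rule Ck_on_SucD_partial[OF O'(1) dC[OF that] that])
  define G where "G x = (\<Sum>b\<in>Basis. (?d b x)\<^sup>2)" for x
  define L where "L x = (\<Sum>b\<in>Basis. frechet_derivative (?d b) (at x) b)" for x
  have cont: "continuous_on (closure D) G" "continuous_on (closure D) L" "continuous_on (closure D) \<psi>"
    unfolding G_def L_def using ddC Ck_on_imp_continuous_on[OF dC] Ck_on_imp_continuous_on[OF C2]
    by (auto intro!: continuous_intros intro: continuous_on_subset[OF _ O'(2)])
  have G1: "G x = 1" if x: "x \<in> frontier D" for x
  proof -
    obtain U r where r: "x \<in> U" "local_defining_function D U r"
      "\<nu> x = (1 / norm (gradient_on U r x)) *\<^sub>R gradient_on U r x"
      using \<nu> x unfolding outward_unit_normal_def by blast
    have "gradient_on U r x \<noteq> 0" using r unfolding local_defining_function_def by blast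
    then have "norm (\<nu> x) = 1" using r(3) by simp
    then have "1 = (\<Sum>b\<in>Basis. (\<nu> x \<bullet> b) * (\<nu> x \<bullet> b))"
      using euclidean_inner[of "\<nu> x" "\<nu> x"] by (simp add: dot_square_norm)
    moreover have "?d b x = - (\<nu> x \<bullet> b)" for b
      using frechet_derivative_at[OF d\<psi>[OF x]] by metis
    ultimately show ?thesis by (simp add: G_def power2_eq_square)
  qed
  \<comment> \<open>The compact set where \<open>G \<le> 1/2\<close> misses the frontier, on which
    \<open>G = 1\<close>. If it is nonempty, \<open>\<psi>\<close> has a positive minimum on it, and
    this is \<open>\<delta>\<close>.\<close>
  obtain \<delta> where \<delta>: "\<delta> > 0" "\<And>x. x \<in> closure D \<Longrightarrow> \<psi> x < \<delta> \<Longrightarrow> G x > 1 / 2"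
  proof -
    define K where "K = closure D \<inter> G -` {..1/2}"
    have "closed K" unfolding K_def by (rule continuous_closed_preimage[OF cont(1)]) auto
    then have cK: "compact K" using comp compact_Int_closed[of "closure D" K]
      by (metis K_def Int_absorb2 Int_commute Int_lower1)
    show ?thesis
    proof (cases "K = {}")
      case True
      show ?thesis by (rule that[of 1]) (use True in \<open>auto simp: K_def not_le[symmetric]\<close>)
    next
      case False
      have "continuous_on K \<psi>" using cont(3) by (rule continuous_on_subset) (auto simp: K_def)
      then obtain x where x: "x \<in> K" "\<And>y. y \<in> K \<Longrightarrow> \<psi> x \<le> \<psi> y"
        using continuous_attains_inf[OF cK False] by blast
      have "x \<in> D" using x(1) clD G1 by (force simp: K_def)
      show ?thesis
      proof (rule that[of "\<psi> x"])
        show "G y > 1 / 2" if "y \<in> closure D" "\<psi> y < \<psi> x" for y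
          using that x(2)[of y] by (force simp: K_def)
      qed (rule \<psi>pos[OF \<open>x \<in> D\<close>])
    qed
  qed
  obtain M where M: "\<And>x. x \<in> closure D \<Longrightarrow> norm (L x) \<le> M"
    using compact_imp_bounded[OF compact_continuous_image[OF cont(2) comp]]
    by (auto simp: bounded_iff)
  \<comment> \<open>The resulting bound \<open>\<epsilon> * (\<bar>M\<bar> + 1) \<le> 1\<close>
    keeps \<open>L\<close> below \<open>1 / \<epsilon>\<close>, while \<open>G > 1/2\<close> makes
    the competing term \<open>2 * G / \<epsilon>\<close> exceed \<open>1 / \<epsilon>\<close> in the
    layer.\<close>
  define \<epsilon> where "\<epsilon> = min \<delta> (1 / (\<bar>M\<bar> + 1))"
  have \<epsilon>: "\<epsilon> > 0" "\<epsilon> \<le> \<delta>" using \<delta> by (auto simp: \<epsilon>_def)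
  have "\<epsilon> * (\<bar>M\<bar> + 1) \<le> 1 / (\<bar>M\<bar> + 1) * (\<bar>M\<bar> + 1)"
    by (rule mult_right_mono) (auto simp: \<epsilon>_def)
  then have \<epsilon>M: "\<epsilon> * (\<bar>M\<bar> + 1) \<le> 1" by (simp split: if_splits)
  define q where "q x = 1 + - (1 / \<epsilon>) * \<psi> x" for x
  define \<phi> where "\<phi> x = (1 + \<beta> * \<epsilon> / 3) + - (\<beta> * \<epsilon> / 3) * (max 0 (q x)) ^ 3" for x
  have qC: "Ck_on 2 O' q" unfolding q_def by (intro Ck_on_add Ck_on_mult Ck_on_const O')
  have \<phi>C: "Ck_on 2 O' \<phi>" unfolding \<phi>_def
    by (intro Ck_on_add Ck_on_mult Ck_on_const O' Ck_on_2_max0_cube qC)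
  then have \<phi>C': "Ck_on (Suc (Suc 0)) O' \<phi>" by (simp only: numeral_2_eq_2)
  have q_deriv: "(q has_derivative (\<lambda>v. - (1 / \<epsilon>) * ?d v x)) (at x)" if "x \<in> O'" for x
    unfolding q_def
    by (rule derivative_eq_intros differentiable_at_Ck_on[OF O'(1) that C2] | simp)+
  have \<phi>_deriv: "(\<phi> has_derivative (\<lambda>v. \<beta> * ((max 0 (q x))\<^sup>2 * ?d v x))) (at x)" if "x \<in> O'" for x
    unfolding \<phi>_def
    by (rule derivative_eq_intros has_derivative_max0_cube[OF q_deriv[OF that]] | simp)+
      (use \<epsilon> in \<open>auto simp: fun_eq_iff\<close>)
  have p1: "partial_on O' b \<phi> x = \<beta> * ((max 0 (q x))\<^sup>2 * ?d b x)" if "x \<in> O'" for b x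
    by (rule partial_on_open[OF O'(1) that \<phi>_deriv[OF that]])
  have p2: "partial_on O' b (partial_on O' b \<phi>) x =
      \<beta> * ((max 0 (q x))\<^sup>2 * frechet_derivative (?d b) (at x) b
        + 2 * max 0 (q x) * (- (1 / \<epsilon>) * ?d b x) * ?d b x)"
    if x: "x \<in> O'" and b: "b \<in> Basis" for b x
  proof -
    have "((\<lambda>x. \<beta> * ((max 0 (q x))\<^sup>2 * ?d b x)) has_derivative
       (\<lambda>v. \<beta> * ((max 0 (q x))\<^sup>2 * frechet_derivative (?d b) (at x) v
        + 2 * max 0 (q x) * (- (1 / \<epsilon>) * ?d v x) * ?d b x))) (at x)"
      by (intro has_derivative_mult_right has_derivative_mult has_derivative_max0_sq q_deriv x
          differentiable_at_Ck_on[OF O'(1) x dC[OF b]])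
    then have "(partial_on O' b \<phi> has_derivative
       (\<lambda>v. \<beta> * ((max 0 (q x))\<^sup>2 * frechet_derivative (?d b) (at x) v
        + 2 * max 0 (q x) * (- (1 / \<epsilon>) * ?d v x) * ?d b x))) (at x)"
      by (rule has_derivative_transform_within_open[OF _ O'(1) x]) (simp add: p1)
    then show ?thesis by (rule partial_on_open[OF O'(1) x])
  qed
  have lap: "laplacian_on (closure D) \<phi> x = \<beta> * max 0 (q x) * (max 0 (q x) * L x - 2 * G x / \<epsilon>)"
    if x: "x \<in> closure D" for x
  proof -
    have xO: "x \<in> O'" using x O'(2) by auto
    have "partial_on (closure D) b (partial_on (closure D) b \<phi>) x = partial_on O' b (partial_on O' b \<phi>) x"
      if b: "b \<in> Basis" for b
    proof -
      \<comment> \<open>The inner derivative is known to agree with the one on \<open>O'\<close> on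
        the closure only; this is enough because the outer derivative is taken within the closure as
        well.\<close>
      have "partial_on (closure D) b (partial_on (closure D) b \<phi>) x
        = partial_on (closure D) b (partial_on O' b \<phi>) x"
        unfolding partial_on_def[of "closure D" b "partial_on _ _ _"]
        by (subst frechet_derivative_cong_within[OF x partial_on_closure[OF D O'(1,2) \<phi>C']]) auto
      also have "\<dots> = partial_on O' b (partial_on O' b \<phi>) x"
        by (rule partial_on_closure[OF D O'(1,2) _ x, of 0]) (use \<phi>C' b in simp)
      finally show ?thesis .
    qed
    then have "laplacian_on (closure D) \<phi> x = (\<Sum>b\<in>Basis. \<beta> * ((max 0 (q x))\<^sup>2 * frechet_derivative (?d b) (at x) b
        + 2 * max 0 (q x) * (- (1 / \<epsilon>) * ?d b x) * ?d b x))"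
      unfolding laplacian_on_def using p2[OF xO] by simp
    also have "\<dots> = (\<Sum>b\<in>Basis. \<beta> * (max 0 (q x))\<^sup>2 * frechet_derivative (?d b) (at x) b
        + \<beta> * max 0 (q x) * (- 2 / \<epsilon>) * (?d b x)\<^sup>2)"
      by (rule sum.cong) (auto simp: algebra_simps power2_eq_square)
    also have "\<dots> = \<beta> * (max 0 (q x))\<^sup>2 * L x + \<beta> * max 0 (q x) * (- 2 / \<epsilon>) * G x"
      by (simp only: sum.distrib sum_distrib_left[symmetric] L_def G_def)
    finally show ?thesis by (simp add: algebra_simps power2_eq_square)
  qed
  have q1: "max 0 (q x) \<le> 1" if "x \<in> closure D" for x
    using \<psi>nn[OF that] \<epsilon> by (simp add: q_def)
  show ?thesis
  proof (rule that[of \<phi>])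
    show "1 \<le> \<phi> x" if x: "x \<in> closure D" for x
    proof -
      have "(max 0 (q x)) ^ 3 \<le> 1" using q1[OF x] by (intro power_le_one) auto
      then have "(\<beta> * \<epsilon> / 3) * (max 0 (q x)) ^ 3 \<le> (\<beta> * \<epsilon> / 3) * 1"
        by (rule mult_left_mono) (use \<epsilon> assms(3) in simp)
      then show ?thesis by (simp add: \<phi>_def)
    qed
    show "laplacian_on (closure D) \<phi> x \<le> 0" if x: "x \<in> closure D" for x
    proof (cases "q x > 0")
      case True
      then have "\<psi> x < \<epsilon>" using \<epsilon> by (simp add: q_def field_simps)
      then have G: "G x > 1 / 2" using \<delta>(2)[OF x] \<epsilon> by simp
      have "max 0 (q x) * L x \<le> max 0 (q x) * (\<bar>M\<bar> + 1)"
        using M[OF x] by (intro mult_left_mono) auto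
      also have "\<dots> \<le> 1 * (\<bar>M\<bar> + 1)" using q1[OF x] by (intro mult_right_mono) auto
      also have "\<dots> \<le> 1 / \<epsilon>" using \<epsilon>M \<epsilon> by (simp add: field_simps)
      also have "\<dots> \<le> 2 * G x / \<epsilon>" using G \<epsilon> by (intro divide_right_mono) auto
      finally show ?thesis unfolding lap[OF x] using assms(3) by (intro mult_nonneg_nonpos) auto
    next
      case False
      then show ?thesis by (simp add: lap[OF x])
    qed
    show "robin_test_function D \<nu> \<beta> \<phi>"
      unfolding robin_test_function_def
    proof (intro conjI ballI)
      show "Ck_on 2 (closure D) \<phi>" by (rule Ck_on_closure[OF D O'(1,2) \<phi>C])
      fix x assume x: "x \<in> frontier D"
      have xc: "x \<in> closure D" using x by (simp add: frontier_def)
      have q: "q x = 1" by (simp add: q_def \<psi>0[OF x])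
      obtain U r where r: "x \<in> U" "local_defining_function D U r"
        "\<nu> x = (1 / norm (gradient_on U r x)) *\<^sub>R gradient_on U r x"
        using \<nu> x unfolding outward_unit_normal_def by blast
      have "gradient_on U r x \<noteq> 0" using r unfolding local_defining_function_def by blast
      then have "\<nu> x \<bullet> \<nu> x = 1" using r(3) by (simp add: dot_square_norm)
      then have "?d (\<nu> x) x = - 1"
        using frechet_derivative_at[OF d\<psi>[OF x]] by metis
      moreover have "frechet_derivative \<phi> (at x within closure D) = (\<lambda>v. \<beta> * ((max 0 (q x))\<^sup>2 * ?d v x))"
        using frechet_derivative_closure[OF D xc \<phi>_deriv] O'(2) xc by blast
      ultimately show "frechet_derivative \<phi> (at x within closure D) (\<nu> x) + \<beta> * \<phi> x = 0"
        by (simp add: q \<phi>_def)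
    qed
  qed
qed

section \<open>Left-endpoint sums along a path\<close>

definition grid :: "real \<Rightarrow> nat \<Rightarrow> nat \<Rightarrow> real" where
  "grid T N j = T * real j / real N"

lemma grid_0 [simp]: "grid T N 0 = 0" by (simp add: grid_def)
lemma grid_N [simp]: "N > 0 \<Longrightarrow> grid T N N = T" by (simp add: grid_def)

lemma grid_mono: "0 \<le> T \<Longrightarrow> i \<le> j \<Longrightarrow> grid T N i \<le> grid T N j"
  by (auto simp: grid_def intro!: divide_right_mono mult_left_mono)

lemma grid_strict_mono: "0 < T \<Longrightarrow> N > 0 \<Longrightarrow> i < j \<Longrightarrow> grid T N i < grid T N j"
  by (auto simp: grid_def intro!: divide_strict_right_mono)

lemma grid_nonneg: "0 \<le> T \<Longrightarrow> 0 \<le> grid T N j"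
  by (simp add: grid_def)

lemma grid_le: "0 \<le> T \<Longrightarrow> j \<le> N \<Longrightarrow> grid T N j \<le> T"
  by (cases "N = 0") (auto simp: grid_def field_simps mult_left_mono)

lemma grid_Suc_diff: "grid T N (Suc j) - grid T N j = T / real N"
  by (simp add: grid_def diff_divide_distrib[symmetric] algebra_simps)

lemma grid_refine: "q > 0 \<Longrightarrow> grid T (N * q) (j * q) = grid T N j"
  by (simp add: grid_def)

lemma grid_subset:
  "0 \<le> T \<Longrightarrow> j < N \<Longrightarrow> {grid T N j..grid T N (Suc j)} \<subseteq> {0..T}"
  using grid_nonneg[of T N j] grid_le[of T "Suc j" N] by auto

lemma grid_uniform_continuity:
  fixes f :: "real \<Rightarrow> real"
  assumes "continuous_on {0..T} f" "0 \<le> T" "e > 0"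
  shows "eventually (\<lambda>N. \<forall>j<N. \<forall>s\<in>{grid T N j..grid T N (Suc j)}. \<forall>s'\<in>{grid T N j..grid T N (Suc j)}.
     \<bar>f s - f s'\<bar> < e) sequentially"
proof -
  have "uniformly_continuous_on {0..T} f" using assms(1) by (simp add: compact_uniformly_continuous)
  then obtain d where d: "d > 0" "\<And>s s'. s \<in> {0..T} \<Longrightarrow> s' \<in> {0..T} \<Longrightarrow> \<bar>s' - s\<bar> < d \<Longrightarrow> \<bar>f s' - f s\<bar> < e"
    using assms(3) unfolding uniformly_continuous_on_def dist_real_def by metis
  have "(\<lambda>N. T / real N) \<longlonglongrightarrow> 0" by real_asymp
  then have "eventually (\<lambda>N. T / real N < d) sequentially" using d(1) by (rule order_tendstoD)
  then show ?thesis
  proof (rule eventually_mono, intro allI impI ballI)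
    fix N j s s' assume N: "T / real N < d" "j < N" "s \<in> {grid T N j..grid T N (Suc j)}"
      "s' \<in> {grid T N j..grid T N (Suc j)}"
    then have "\<bar>s - s'\<bar> \<le> T / real N" using grid_Suc_diff[of T N j] by auto
    then show "\<bar>f s - f s'\<bar> < e" using d(2)[of s' s] N grid_subset[OF assms(2) N(2)] by auto
  qed
qed

lemma integral_grid_split:
  fixes a :: "real \<Rightarrow> real"
  assumes "continuous_on {0..T} a" "0 \<le> T" "k \<le> N"
  shows "integral {0..grid T N k} a = (\<Sum>j<k. integral {grid T N j..grid T N (Suc j)} a)"
  using assms(3)
proof (induction k)
  case (Suc k)
  have "a integrable_on {0..grid T N (Suc k)}"
    by (rule integrable_continuous_real, rule continuous_on_subset[OF assms(1)])
      (use Suc.prems grid_le assms in auto)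
  then have "integral {0..grid T N k} a + integral {grid T N k..grid T N (Suc k)} a
    = integral {0..grid T N (Suc k)} a"
    by (intro Henstock_Kurzweil_Integration.integral_combine) (auto intro: grid_nonneg grid_mono assms)
  then show ?case using Suc by simp
qed simp

lemma LINT_eq_integral:
  fixes f :: "real \<Rightarrow> real"
  assumes "continuous_on {a..b} f"
  shows "(LINT s:{a..b}|lborel. f s) = integral {a..b} f"
  using set_borel_integral_eq_integral(2)[OF borel_integrable_atLeastAtMost'[OF assms]] .

lemma integral_mean_bound:
  fixes f :: "real \<Rightarrow> real"
  assumes "continuous_on {a..b} f" "a \<le> b" "\<And>s. s \<in> {a..b} \<Longrightarrow> \<bar>f s\<bar> \<le> C"
  shows "\<bar>integral {a..b} f\<bar> \<le> C * (b - a)"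
  using integral_bound[of a b f C] assms by auto

lemma continuous_on_Icc_bounded:
  fixes f :: "real \<Rightarrow> real"
  assumes "continuous_on {a..b} f"
  obtains C where "C \<ge> 0" "\<And>s. s \<in> {a..b} \<Longrightarrow> \<bar>f s\<bar> \<le> C"
proof -
  obtain C where "\<forall>y\<in>f ` {a..b}. norm y \<le> C"
    using compact_imp_bounded[OF compact_continuous_image[OF assms]] unfolding bounded_iff by auto
  then show ?thesis by (intro that[of "\<bar>C\<bar>"]) force+
qed

text \<open>The integral of \<open>a\<close> over each cell is kept exact, so that only the
  oscillation of \<open>E\<close> over a cell enters the error. Tags are arbitrary because Ito's
  formula leads to right endpoints and the time averages of the noise to left endpoints.\<close>

lemma riemann_sum_tendsto:
  fixes E a :: "real \<Rightarrow> real"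
  assumes "continuous_on {0..T} E" "continuous_on {0..T} a" "0 \<le> T"
    and \<xi>: "\<And>N j. j < N \<Longrightarrow> \<xi> N j \<in> {grid T N j..grid T N (Suc j)}"
  shows "(\<lambda>N. \<Sum>j<N. E (\<xi> N j) * integral {grid T N j..grid T N (Suc j)} a) \<longlonglongrightarrow>
    integral {0..T} (\<lambda>s. E s * a s)"
proof -
  obtain A where A0: "A \<ge> 0" and A: "\<And>s. s \<in> {0..T} \<Longrightarrow> \<bar>a s\<bar> \<le> A"
    using continuous_on_Icc_bounded[OF assms(2)] by metis
  show ?thesis
  proof (rule LIMSEQ_I)
    fix r :: real assume r: "r > 0"
    define C where "C = A * T + 1"
    have C: "C > 0" using A0 assms(3) by (simp add: C_def add_nonneg_pos)
    define e where "e = r / (2 * C)"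
    have e: "e > 0" using r C by (simp add: e_def)
    have eA: "e * A * T < r"
    proof -
      have "e * (A * T) \<le> e * C" using e by (simp add: C_def)
      also have "\<dots> = r / 2" using C by (simp add: e_def)
      finally show ?thesis using r by (simp add: mult.assoc)
    qed
    have "eventually (\<lambda>N. N > 0 \<and> (\<forall>j<N. \<forall>s\<in>{grid T N j..grid T N (Suc j)}. \<forall>s'\<in>{grid T N j..grid T N (Suc j)}.
       \<bar>E s - E s'\<bar> < e)) sequentially"
      using grid_uniform_continuity[OF assms(1,3) e] eventually_gt_at_top[of 0] by eventually_elim auto
    then obtain N0 where N0: "\<And>N. N \<ge> N0 \<Longrightarrow> N > 0 \<and> (\<forall>j<N. \<forall>s\<in>{grid T N j..grid T N (Suc j)}. \<forall>s'\<in>{grid T N j..grid T N (Suc j)}.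
       \<bar>E s - E s'\<bar> < e)" by (auto simp: eventually_sequentially)
    have "norm ((\<Sum>j<N. E (\<xi> N j) * integral {grid T N j..grid T N (Suc j)} a) - integral {0..T} (\<lambda>s. E s * a s)) < r"
      if N: "N \<ge> N0" for N
    proof -
      have Npos: "N > 0" using N0[OF N] by simp
      have "integral {0..grid T N N} (\<lambda>s. E s * a s) = (\<Sum>j<N. integral {grid T N j..grid T N (Suc j)} (\<lambda>s. E s * a s))"
        by (rule integral_grid_split) (auto intro!: continuous_intros assms)
      then have split: "integral {0..T} (\<lambda>s. E s * a s) = (\<Sum>j<N. integral {grid T N j..grid T N (Suc j)} (\<lambda>s. E s * a s))"
        using Npos by simp
      have each: "\<bar>E (\<xi> N j) * integral {grid T N j..grid T N (Suc j)} a - integral {grid T N j..grid T N (Suc j)} (\<lambda>s. E s * a s)\<bar>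
        \<le> e * A * (T / real N)" if j: "j < N" for j
      proof -
        let ?I = "{grid T N j..grid T N (Suc j)}"
        have sub: "?I \<subseteq> {0..T}" by (rule grid_subset[OF assms(3) j])
        have c: "continuous_on ?I a" "continuous_on ?I E" using assms(1,2) sub continuous_on_subset by blast+
        have "E (\<xi> N j) * integral ?I a - integral ?I (\<lambda>s. E s * a s) = integral ?I (\<lambda>s. (E (\<xi> N j) - E s) * a s)"
          using c by (subst integral_mult_right[symmetric], subst integral_diff[symmetric])
            (auto intro!: integrable_continuous_real continuous_intros simp: algebra_simps)
        moreover have "\<bar>integral ?I (\<lambda>s. (E (\<xi> N j) - E s) * a s)\<bar> \<le> e * A * (grid T N (Suc j) - grid T N j)"
        proof (rule integral_mean_bound)
          show "continuous_on ?I (\<lambda>s. (E (\<xi> N j) - E s) * a s)" using c by (auto intro!: continuous_intros)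
          show "grid T N j \<le> grid T N (Suc j)" by (rule grid_mono[OF assms(3)]) simp
          fix s assume s: "s \<in> ?I"
          have "\<bar>E (\<xi> N j) - E s\<bar> < e" using N0[OF N] j s \<xi>[OF j] by blast
          then show "\<bar>(E (\<xi> N j) - E s) * a s\<bar> \<le> e * A"
            unfolding abs_mult using A[of s] s sub by (intro mult_mono) auto
        qed
        ultimately show ?thesis by (simp add: grid_Suc_diff)
      qed
      have "norm ((\<Sum>j<N. E (\<xi> N j) * integral {grid T N j..grid T N (Suc j)} a) - integral {0..T} (\<lambda>s. E s * a s))
        \<le> (\<Sum>j<N. e * A * (T / real N))"
        unfolding split sum_subtractf[symmetric] by (rule sum_norm_le) (use each in auto)
      also have "\<dots> = e * A * T" using Npos by simp
      finally show ?thesis using eA by simp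
    qed
    then show "\<exists>no. \<forall>N\<ge>no. norm ((\<Sum>j<N. E (\<xi> N j) * integral {grid T N j..grid T N (Suc j)} a) - integral {0..T} (\<lambda>s. E s * a s)) < r"
      by blast
  qed
qed

section \<open>Remainders of Young integrals over the cells of a grid\<close>

lemma has_young_integralD:
  assumes "has_young_integral f g a b I" "e > 0"
  shows "\<exists>d>0. \<forall>n t \<xi>. partition_of a b n t \<longrightarrow>
        (\<forall>k<n. t (Suc k) - t k < d \<and> \<xi> k \<in> {t k..t (Suc k)}) \<longrightarrow>
        \<bar>(\<Sum>k<n. f (\<xi> k) * (g (t (Suc k)) - g (t k))) - I\<bar> < e"
  using assms unfolding has_young_integral_def by blast

text \<open>Henstock's argument: as all fine tagged sums are close to the integral, the error of a coarse
  sum is small on every union \<open>J\<close> of grid cells separately. The partition that is coarse on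
  \<open>J\<close> and fine elsewhere repeats the left endpoints of the coarse cells.\<close>

lemma young_remainder_subset:
  fixes f g Y :: "real \<Rightarrow> real"
  assumes "0 \<le> T" and young: "\<And>j. j \<le> N \<Longrightarrow> has_young_integral f g 0 (grid T N j) (Y (grid T N j))"
    and N: "N > 0" and d: "T / real N < d" and J: "J \<subseteq> {..<N}"
    and bound: "\<forall>n t \<xi>. partition_of 0 T n t \<longrightarrow>
     (\<forall>k<n. t (Suc k) - t k < d \<and> \<xi> k \<in> {t k..t (Suc k)}) \<longrightarrow>
     \<bar>(\<Sum>k<n. f (\<xi> k) * (g (t (Suc k)) - g (t k))) - I\<bar> < e"
  shows "\<bar>\<Sum>j\<in>J. Y (grid T N (Suc j)) - Y (grid T N j)
      - f (grid T N j) * (g (grid T N (Suc j)) - g (grid T N j))\<bar> \<le> 2 * e"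
proof -
  define G where "G q p = f (grid T (N * q) p) * (g (grid T (N * q) (Suc p)) - g (grid T (N * q) p))" for q p
  define fsum where "fsum q j = sum (G q) {j * q..<j * q + q}" for q j
  define coarse where "coarse j = f (grid T N j) * (g (grid T N (Suc j)) - g (grid T N j))" for j
  have main: "\<bar>\<Sum>j\<in>J. fsum q j - coarse j\<bar> \<le> 2 * e" if q: "q > 0" for q
  proof -
    \<comment> \<open>Every \<open>u K\<close> uses the same \<open>N * q\<close> indices. Inside a
      cell of \<open>K\<close> all points sit at its left endpoint and the last interval is the
      whole cell, so the sum over that cell collapses to one coarse term.\<close>
    define u where "u K p = (if p div q \<in> K then grid T N (p div q) else grid T (N * q) p)" for K p
    have Nq: "N * q > 0" using N q by simp
    have end1: "u K (j * q) = grid T N j" for K j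
      using q by (simp add: u_def grid_refine)
    have last: "Suc p = Suc (p div q) * q" if "Suc p div q \<noteq> p div q" for p
      using that by (metis Suc_eq_plus1 div_Suc div_mult_mod_eq mult.commute add.commute plus_nat.add_0 mod_Suc mult_Suc_right Suc_inject add_Suc)
    have sandwich: "u K p \<le> u K (Suc p) \<and> u K (Suc p) - u K p \<le> T / real N" for K p
    proof -
      have lo: "grid T N (p div q) \<le> grid T (N * q) p"
        using grid_mono[OF assms(1), of "(p div q) * q" p "N * q"] grid_refine[OF q] by simp
      have "Suc p \<le> Suc (p div q) * q"
        using q dividend_less_div_times[of q p] by (simp add: mult.commute Suc_le_eq)
      then have hi: "grid T (N * q) (Suc p) \<le> grid T N (Suc (p div q))"
        using grid_mono[OF assms(1), of "Suc p" "Suc (p div q) * q" "N * q"] by (simp only: grid_refine[OF q])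
      have m: "grid T (N * q) p \<le> grid T (N * q) (Suc p)" by (rule grid_mono[OF assms(1)]) simp
      have s: "grid T N (Suc (p div q)) - grid T N (p div q) = T / real N" by (rule grid_Suc_diff)
      have u1: "u K p = (if p div q \<in> K then grid T N (p div q) else grid T (N * q) p)" by (simp add: u_def)
      show ?thesis
      proof (cases "Suc p div q = p div q")
        case True
        then have "u K (Suc p) = (if p div q \<in> K then grid T N (p div q) else grid T (N * q) (Suc p))"
          by (simp add: u_def)
        then show ?thesis using u1 lo hi m s assms(1) by auto
      next
        case False
        then have "u K (Suc p) = grid T N (Suc (p div q))" using end1 last by metis
        then show ?thesis using u1 lo hi m s by auto
      qed
    qed
    have part: "partition_of 0 T (N * q) (u K)" for K
      unfolding partition_of_def using sandwich end1[of K 0] end1[of K N] N by simp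
    define S where "S K = (\<Sum>p<N * q. f (u K p) * (g (u K (Suc p)) - g (u K p)))" for K
    have close: "\<bar>S K - I\<bar> < e" for K
      unfolding S_def
    proof (rule bound[rule_format, OF part])
      show "u K (Suc p) - u K p < d \<and> u K p \<in> {u K p..u K (Suc p)}" for p
        using sandwich[of K p] d by auto
    qed
    have block: "sum (\<lambda>p. f (u K p) * (g (u K (Suc p)) - g (u K p))) {j * q..<j * q + q}
      = (if j \<in> K then coarse j else fsum q j)" for K j
    proof (cases "j \<in> K")
      case True
      have "f (u K p) = f (grid T N j)" if "p \<in> {j * q..<j * q + q}" for p
      proof -
        have "p div q = j" using that by (intro div_nat_eqI) (auto simp: mult.commute)
        then show ?thesis using True by (simp add: u_def)
      qed
      then have "sum (\<lambda>p. f (u K p) * (g (u K (Suc p)) - g (u K p))) {j * q..<j * q + q}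
        = f (grid T N j) * (\<Sum>p = j * q..<j * q + q. g (u K (Suc p)) - g (u K p))"
        by (simp add: sum_distrib_left)
      also have "(\<Sum>p = j * q..<j * q + q. g (u K (Suc p)) - g (u K p)) = g (u K (Suc j * q)) - g (u K (j * q))"
        by (subst sum_Suc_diff') (simp_all add: add.commute)
      finally show ?thesis using True unfolding end1 by (simp add: coarse_def)
    next
      case False
      have "u K p = grid T (N * q) p \<and> u K (Suc p) = grid T (N * q) (Suc p)"
        if "p \<in> {j * q..<j * q + q}" for p
      proof -
        have pj: "p div q = j" using that by (intro div_nat_eqI) (auto simp: mult.commute)
        show ?thesis
        proof (cases "Suc p div q = p div q")
          case True
          then show ?thesis using pj False by (simp add: u_def)
        next
          case c: False
          then have "Suc p = Suc j * q" using last pj by metis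
          then show ?thesis using pj False end1[of K "Suc j"] grid_refine[OF q, of T N "Suc j"] by (simp add: u_def)
        qed
      qed
      then show ?thesis using False by (simp add: fsum_def G_def)
    qed
    have S: "S K = (\<Sum>j<N. if j \<in> K then coarse j else fsum q j)" for K
      unfolding S_def sum.nat_group[symmetric] block ..
    \<comment> \<open>The fine sum \<open>S {}\<close> and the mixed sum \<open>S J\<close> share
      all cells outside \<open>J\<close>, and both lie within \<open>e\<close> of
      \<open>I\<close>.\<close>
    have "S {} - S J = (\<Sum>j<N. if j \<in> J then fsum q j - coarse j else 0)"
      unfolding S sum_subtractf[symmetric] by (rule sum.cong) auto
    also have "\<dots> = (\<Sum>j\<in>J. fsum q j - coarse j)"
      using J by (simp add: sum.inter_restrict[symmetric] Int_absorb1)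
    finally show ?thesis using close[of "{}"] close[of J] by linarith
  qed
  \<comment> \<open>Refining the partition of \<open>[0, grid T N j]\<close> recovers the Young
    integral over that interval, so the fine sum over one cell tends to the increment of
    \<open>Y\<close>.\<close>
  have lim: "(\<lambda>q. \<Sum>p<j * q. G q p) \<longlonglongrightarrow> Y (grid T N j)" if j: "j \<le> N" for j
  proof (rule LIMSEQ_I)
    fix r :: real assume "r > 0"
    then obtain d' where d': "d' > 0" "\<forall>n t \<xi>. partition_of 0 (grid T N j) n t \<longrightarrow>
     (\<forall>k<n. t (Suc k) - t k < d' \<and> \<xi> k \<in> {t k..t (Suc k)}) \<longrightarrow>
     \<bar>(\<Sum>k<n. f (\<xi> k) * (g (t (Suc k)) - g (t k))) - Y (grid T N j)\<bar> < r"
      using has_young_integralD[OF young[OF j]] by blast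
    have "(\<lambda>q. T / real (N * q)) \<longlonglongrightarrow> 0" using N by real_asymp
    then have "eventually (\<lambda>q. T / real (N * q) < d') sequentially" using d'(1) by (rule order_tendstoD)
    then have "eventually (\<lambda>q. T / real (N * q) < d' \<and> q > 0) sequentially"
      using eventually_gt_at_top[of 0] by eventually_elim simp
    then obtain q0 where q0: "\<And>q. q \<ge> q0 \<Longrightarrow> T / real (N * q) < d' \<and> q > 0"
      by (auto simp: eventually_sequentially)
    show "\<exists>no. \<forall>q\<ge>no. norm ((\<Sum>p<j * q. G q p) - Y (grid T N j)) < r"
    proof (intro exI[of _ q0] allI impI)
      fix q assume "q \<ge> q0"
      then have q: "T / real (N * q) < d'" "q > 0" using q0 by auto
      have "\<bar>(\<Sum>k<j * q. f (grid T (N * q) k) * (g (grid T (N * q) (Suc k)) - g (grid T (N * q) k)))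
         - Y (grid T N j)\<bar> < r"
      proof (rule d'(2)[rule_format])
        show "partition_of 0 (grid T N j) (j * q) (grid T (N * q))"
          unfolding partition_of_def using grid_refine[OF q(2)] by (auto intro: grid_mono assms)
        fix k
        show "grid T (N * q) (Suc k) - grid T (N * q) k < d' \<and>
          grid T (N * q) k \<in> {grid T (N * q) k..grid T (N * q) (Suc k)}"
          using q(1) by (auto simp: grid_Suc_diff intro: grid_mono assms)
      qed
      then show "norm ((\<Sum>p<j * q. G q p) - Y (grid T N j)) < r" by (simp add: G_def)
    qed
  qed
  have "(\<lambda>q. fsum q j) \<longlonglongrightarrow> Y (grid T N (Suc j)) - Y (grid T N j)" if "j < N" for j
  proof -
    have "fsum q j = (\<Sum>p<Suc j * q. G q p) - (\<Sum>p<j * q. G q p)" for q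
      unfolding fsum_def lessThan_atLeast0
      using sum.atLeastLessThan_concat[of 0 "j * q" "j * q + q" "G q"] by (simp add: add.commute)
    then show ?thesis using tendsto_diff[OF lim[of "Suc j"] lim[of j]] that by (simp only: Suc_leI less_imp_le)
  qed
  then have "(\<lambda>q. \<bar>\<Sum>j\<in>J. fsum q j - coarse j\<bar>) \<longlonglongrightarrow>
      \<bar>\<Sum>j\<in>J. (Y (grid T N (Suc j)) - Y (grid T N j)) - coarse j\<bar>"
    using J by (intro tendsto_rabs tendsto_sum tendsto_diff tendsto_const) auto
  then have "\<bar>\<Sum>j\<in>J. (Y (grid T N (Suc j)) - Y (grid T N j)) - coarse j\<bar> \<le> 2 * e"
    by (rule LIMSEQ_le_const2) (use main in \<open>auto intro!: exI[of _ 1]\<close>)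
  then show ?thesis by (simp add: coarse_def)
qed

text \<open>The absolute values cost a factor of two: the cells with nonnegative and those with
  negative remainder are two unions of cells, each subject to the preceding bound. Four times
  \<open>r / 8\<close> stays below \<open>r\<close>.\<close>

lemma young_remainder:
  fixes f g Y :: "real \<Rightarrow> real"
  assumes "0 \<le> T"
    and young: "\<And>N j. N > 0 \<Longrightarrow> j \<le> N \<Longrightarrow> has_young_integral f g 0 (grid T N j) (Y (grid T N j))"
  shows "(\<lambda>N. \<Sum>j<N. \<bar>Y (grid T N (Suc j)) - Y (grid T N j)
      - f (grid T N j) * (g (grid T N (Suc j)) - g (grid T N j))\<bar>) \<longlonglongrightarrow> 0"
proof (rule LIMSEQ_I)
  fix r :: real assume r: "r > 0"
  have "has_young_integral f g 0 T (Y T)" using young[of 1 1] by simp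
  moreover have "r / 8 > 0" using r by simp
  ultimately obtain d where d: "d > 0" "\<forall>n t \<xi>. partition_of 0 T n t \<longrightarrow>
     (\<forall>k<n. t (Suc k) - t k < d \<and> \<xi> k \<in> {t k..t (Suc k)}) \<longrightarrow>
     \<bar>(\<Sum>k<n. f (\<xi> k) * (g (t (Suc k)) - g (t k))) - Y T\<bar> < r / 8"
    using has_young_integralD[of f g 0 T "Y T" "r / 8"] by blast
  have "(\<lambda>N. T / real N) \<longlonglongrightarrow> 0" by real_asymp
  then have "eventually (\<lambda>N. T / real N < d) sequentially" using d(1) by (rule order_tendstoD)
  then have "eventually (\<lambda>N. T / real N < d \<and> N > 0) sequentially"
    using eventually_gt_at_top[of 0] by eventually_elim simp
  then obtain N0 where N0: "\<And>N. N \<ge> N0 \<Longrightarrow> T / real N < d \<and> N > 0"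
    by (auto simp: eventually_sequentially)
  show "\<exists>no. \<forall>N\<ge>no. norm ((\<Sum>j<N. \<bar>Y (grid T N (Suc j)) - Y (grid T N j)
      - f (grid T N j) * (g (grid T N (Suc j)) - g (grid T N j))\<bar>) - 0) < r"
  proof (intro exI[of _ N0] allI impI)
    fix N assume "N \<ge> N0"
    then have N: "T / real N < d" "N > 0" using N0 by auto
    define R where "R j = Y (grid T N (Suc j)) - Y (grid T N j)
      - f (grid T N j) * (g (grid T N (Suc j)) - g (grid T N j))" for j
    have sub: "\<bar>\<Sum>j\<in>J. R j\<bar> \<le> 2 * (r / 8)" if "J \<subseteq> {..<N}" for J
      unfolding R_def by (rule young_remainder_subset[OF assms(1) young[OF N(2)] N(2,1) that d(2)])
    have "(\<Sum>j<N. \<bar>R j\<bar>) = (\<Sum>j\<in>{j\<in>{..<N}. R j \<ge> 0}. \<bar>R j\<bar>) + (\<Sum>j\<in>{j\<in>{..<N}. \<not> R j \<ge> 0}. \<bar>R j\<bar>)"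
      by (subst sum.union_disjoint[symmetric]) (auto intro!: sum.cong)
    also have "\<dots> = (\<Sum>j\<in>{j\<in>{..<N}. R j \<ge> 0}. R j) - (\<Sum>j\<in>{j\<in>{..<N}. \<not> R j \<ge> 0}. R j)"
      by (simp add: sum_negf[symmetric])
    also have "\<dots> \<le> r / 2"
      using sub[of "{j\<in>{..<N}. R j \<ge> 0}", OF Collect_restrict]
        sub[of "{j\<in>{..<N}. \<not> R j \<ge> 0}", OF Collect_restrict] unfolding abs_le_iff by linarith
    finally show "norm ((\<Sum>j<N. \<bar>Y (grid T N (Suc j)) - Y (grid T N j)
      - f (grid T N j) * (g (grid T N (Suc j)) - g (grid T N j))\<bar>) - 0) < r"
      using r by (simp add: R_def sum_nonneg)
  qed
qed

text \<open>Second-order expansion of the factor by which \<open>E * y\<close> changes in one step: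
  \<open>1 - x\<close> comes from \<open>y\<close> and \<open>exp (x + c)\<close> from
  \<open>E\<close>. The terms linear in \<open>x\<close> cancel, since
  \<open>(1 - x) * exp x\<close> equals \<open>1 - x\<^sup>2 / 2\<close> up to third order.\<close>

lemma exp_product_remainder:
  fixes x c :: real
  assumes "\<bar>x\<bar> \<le> 1" "0 \<le> c" "c \<le> 1"
  shows "\<bar>(1 - x) * exp (x + c) - 1 - (c - x\<^sup>2 / 2)\<bar> \<le> 6 * (\<bar>x\<bar> * x\<^sup>2) + c\<^sup>2 + c * x\<^sup>2"
proof -
  obtain t where t: "\<bar>t\<bar> \<le> \<bar>x\<bar>" "exp x = (\<Sum>m<3. x ^ m / fact m) + exp t / fact 3 * x ^ 3"
    using Maclaurin_exp_le[of x 3] by auto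
  define \<rho> where "\<rho> = exp t / 6 * x ^ 3"
  have ex: "exp x = 1 + x + x\<^sup>2 / 2 + \<rho>"
    using t(2) by (simp add: \<rho>_def numeral_3_eq_3 power2_eq_square fact_numeral)
  have "exp t \<le> exp 1" using t(1) assms(1) by simp
  then have et: "exp t \<le> 3" using exp_le by linarith
  have x3: "\<bar>x ^ 3\<bar> = \<bar>x\<bar> * x\<^sup>2" by (simp add: power_abs[symmetric] power3_eq_cube power2_eq_square abs_mult)
  have \<rho>: "\<bar>\<rho>\<bar> \<le> (\<bar>x\<bar> * x\<^sup>2) / 2"
    unfolding \<rho>_def abs_mult x3 using mult_right_mono[OF et, of "\<bar>x\<bar> * x\<^sup>2"] by (simp add: mult_ac)
  define r1 where "r1 = (1 - x) * \<rho> - x ^ 3 / 2"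
  have e1: "(1 - x) * exp x = 1 - x\<^sup>2 / 2 + r1"
    unfolding ex r1_def by (simp add: field_simps power2_eq_square power3_eq_cube)
  have "\<bar>(1 - x) * \<rho>\<bar> \<le> 2 * ((\<bar>x\<bar> * x\<^sup>2) / 2)"
    unfolding abs_mult by (intro mult_mono \<rho>) (use assms(1) in auto)
  then have r1: "\<bar>r1\<bar> \<le> 2 * (\<bar>x\<bar> * x\<^sup>2)"
    using x3 unfolding r1_def by linarith
  define r2 where "r2 = exp c - 1 - c"
  have r2: "0 \<le> r2" "r2 \<le> c\<^sup>2"
    using exp_ge_add_one_self[of c, simplified add.commute] exp_bound[OF assms(2,3)] by (auto simp: r2_def algebra_simps)
  have ec: "exp c = 1 + c + r2" by (simp add: r2_def)
  have x21: "x\<^sup>2 \<le> 1" using assms(1) by (simp add: abs_square_le_1)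
  have "exp c \<le> 3" using assms(3) exp_le exp_le_cancel_iff[of c 1] by linarith
  have "(1 - x) * exp (x + c) - 1 - (c - x\<^sup>2 / 2) = (1 - x\<^sup>2 / 2 + r1) * exp c - 1 - (c - x\<^sup>2 / 2)"
    by (simp add: exp_add e1[symmetric])
  also have "\<dots> = r1 * exp c + r2 * (1 - x\<^sup>2 / 2) - c * x\<^sup>2 / 2"
    unfolding ec by (simp add: algebra_simps)
  finally have eq: "(1 - x) * exp (x + c) - 1 - (c - x\<^sup>2 / 2) = r1 * exp c + r2 * (1 - x\<^sup>2 / 2) - c * x\<^sup>2 / 2" .
  have "\<bar>r1 * exp c\<bar> \<le> (2 * (\<bar>x\<bar> * x\<^sup>2)) * 3"
    unfolding abs_mult using r1 \<open>exp c \<le> 3\<close> by (intro mult_mono) auto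
  moreover have "0 \<le> r2 * (1 - x\<^sup>2 / 2)" "r2 * (1 - x\<^sup>2 / 2) \<le> c\<^sup>2"
    using r2 x21 mult_left_le[of "1 - x\<^sup>2 / 2" r2] by auto
  moreover have "0 \<le> c * x\<^sup>2" using assms by simp
  ultimately show ?thesis unfolding eq by linarith
qed

text \<open>The pathwise content of Ito's formula for \<open>E * y\<close>, where \<open>dy = a ds - \<kappa> y d(W + B)\<close> in the
  sense of left-endpoint sums with errors \<open>RW\<close> and \<open>RB\<close>, \<open>W\<close> has quadratic variation \<open>t\<close> and
  \<open>B\<close> has none along the grids.\<close>

lemma exp_product_formula:
  fixes y W B a E :: "real \<Rightarrow> real" and RW RB :: "nat \<Rightarrow> nat \<Rightarrow> real" and n :: "nat \<Rightarrow> nat"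
  assumes T: "T > 0" and \<kappa>: "\<kappa> > 0"
    and cont: "continuous_on {0..T} y" "continuous_on {0..T} W" "continuous_on {0..T} B" "continuous_on {0..T} a"
    and n: "filterlim n at_top sequentially" "\<And>l. n l > 0"
    and E: "\<And>s. E s = exp (\<kappa> * (W s + B s) + \<kappa>\<^sup>2 / 2 * s)"
    and step: "\<And>l j. j < n l \<Longrightarrow> y (grid T (n l) (Suc j)) - y (grid T (n l) j) =
      integral {grid T (n l) j..grid T (n l) (Suc j)} a
      - \<kappa> * (y (grid T (n l) j) * (W (grid T (n l) (Suc j)) - W (grid T (n l) j))
            + y (grid T (n l) j) * (B (grid T (n l) (Suc j)) - B (grid T (n l) j)) + RW l j + RB l j)"
    and h1: "(\<lambda>l. \<Sum>j<n l. E (grid T (n l) j) * RW l j) \<longlonglongrightarrow> 0"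
    and h2: "(\<lambda>l. \<Sum>j<n l. (RW l j)\<^sup>2) \<longlonglongrightarrow> 0"
    and h3: "(\<lambda>l. \<Sum>j<n l. \<bar>RB l j\<bar>) \<longlonglongrightarrow> 0"
    and h4: "(\<lambda>l. \<Sum>j<n l. y (grid T (n l) j) * E (grid T (n l) j) *
               ((W (grid T (n l) (Suc j)) - W (grid T (n l) j))\<^sup>2 - T / real (n l))) \<longlonglongrightarrow> 0"
    and h5: "(\<lambda>l. \<Sum>j<n l. (W (grid T (n l) (Suc j)) - W (grid T (n l) j))\<^sup>2 - T / real (n l)) \<longlonglongrightarrow> 0"
    and h6: "(\<lambda>l. \<Sum>j<n l. (B (grid T (n l) (Suc j)) - B (grid T (n l) j))\<^sup>2) \<longlonglongrightarrow> 0"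
  shows "y T * E T = y 0 * E 0 + integral {0..T} (\<lambda>s. E s * a s)"
proof -
  define g where "g l j = grid T (n l) j" for l j
  define dW where "dW l j = W (g l (Suc j)) - W (g l j)" for l j
  define dB where "dB l j = B (g l (Suc j)) - B (g l j)" for l j
  define x where "x l j = \<kappa> * (dW l j + dB l j)" for l j
  define c where "c l = \<kappa>\<^sup>2 / 2 * (T / real (n l))" for l
  define A where "A l j = integral {g l j..g l (Suc j)} a" for l j
  have T0: "0 \<le> T" using T by simp
  have gT: "g l j \<in> {0..T}" if "j \<le> n l" for l j
    using that by (auto simp: g_def grid_nonneg grid_le T0)
  have contE: "continuous_on {0..T} E" unfolding E by (intro continuous_intros cont)
  obtain ME where ME: "ME \<ge> 0" "\<And>s. s \<in> {0..T} \<Longrightarrow> \<bar>E s\<bar> \<le> ME"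
    using continuous_on_Icc_bounded[OF contE] by metis
  obtain My where My: "My \<ge> 0" "\<And>s. s \<in> {0..T} \<Longrightarrow> \<bar>y s\<bar> \<le> My"
    using continuous_on_Icc_bounded[OF cont(1)] by metis
  have Tn: "(\<lambda>l. T / real (n l)) \<longlonglongrightarrow> 0"
    using filterlim_compose[OF _ n(1), of "\<lambda>N. T / real N" "nhds 0"] by (simp add: lim_const_over_n)
  have c0: "c \<longlonglongrightarrow> 0" unfolding c_def by (rule tendsto_mult_right_zero[OF Tn])
  have cpos: "c l \<ge> 0" for l using T by (simp add: c_def)
  have nc: "(\<Sum>j<n l. c l) = \<kappa>\<^sup>2 / 2 * T" for l using n(2)[of l] by (simp add: c_def)
  have Estep: "E (g l (Suc j)) = E (g l j) * exp (x l j + c l)" for l j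
    unfolding E x_def c_def dW_def dB_def exp_add[symmetric]
    using grid_Suc_diff[of T "n l" j, folded g_def] by (simp add: algebra_simps)
  have maxx: "eventually (\<lambda>l. \<forall>j<n l. \<bar>x l j\<bar> < e) sequentially" if e: "e > 0" for e
  proof -
    have "continuous_on {0..T} (\<lambda>s. \<kappa> * (W s + B s))" by (intro continuous_intros cont)
    from filterlim_iff[THEN iffD1, OF n(1), rule_format, OF grid_uniform_continuity[OF this T0 e]]
    show ?thesis
    proof (rule eventually_mono, intro allI impI)
      fix l j assume H: "\<forall>j<n l. \<forall>s\<in>{grid T (n l) j..grid T (n l) (Suc j)}. \<forall>s'\<in>{grid T (n l) j..grid T (n l) (Suc j)}.
        \<bar>\<kappa> * (W s + B s) - \<kappa> * (W s' + B s')\<bar> < e" "j < n l"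
      have "g l j \<le> g l (Suc j)" unfolding g_def by (rule grid_mono[OF T0]) simp
      then have "\<bar>\<kappa> * (W (g l (Suc j)) + B (g l (Suc j))) - \<kappa> * (W (g l j) + B (g l j))\<bar> < e"
        using H unfolding g_def by simp
      then show "\<bar>x l j\<bar> < e" unfolding x_def dW_def dB_def by (simp add: algebra_simps)
    qed
  qed
  have W2: "(\<lambda>l. \<Sum>j<n l. (dW l j)\<^sup>2) \<longlonglongrightarrow> T"
  proof -
    have "(\<Sum>j<n l. (dW l j)\<^sup>2) = (\<Sum>j<n l. (dW l j)\<^sup>2 - T / real (n l)) + T" for l
      using n(2)[of l] by (simp add: sum_subtractf)
    then show ?thesis using tendsto_add[OF h5[folded g_def, folded dW_def] tendsto_const[of T]] by simp
  qed
  have B2: "(\<lambda>l. \<Sum>j<n l. (dB l j)\<^sup>2) \<longlonglongrightarrow> 0" using h6 by (simp add: dB_def g_def)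
  have X2le: "(\<Sum>j<n l. (x l j)\<^sup>2) \<le> 2 * \<kappa>\<^sup>2 * ((\<Sum>j<n l. (dW l j)\<^sup>2) + (\<Sum>j<n l. (dB l j)\<^sup>2))" for l
  proof -
    have "(x l j)\<^sup>2 \<le> 2 * \<kappa>\<^sup>2 * ((dW l j)\<^sup>2 + (dB l j)\<^sup>2)" for j
    proof -
      have "(dW l j + dB l j)\<^sup>2 \<le> 2 * ((dW l j)\<^sup>2 + (dB l j)\<^sup>2)"
        using zero_le_power2[of "dW l j - dB l j"] by (simp add: power2_sum power2_diff)
      from mult_left_mono[OF this, of "\<kappa>\<^sup>2"] show ?thesis
        unfolding x_def power_mult_distrib by (simp add: algebra_simps)
    qed
    then show ?thesis by (simp only: sum.distrib[symmetric] sum_distrib_left) (rule sum_mono)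
  qed
  define K where "K = 2 * \<kappa>\<^sup>2 * (T + 2)"
  have K: "eventually (\<lambda>l. (\<Sum>j<n l. (x l j)\<^sup>2) \<le> K) sequentially"
  proof -
    have "eventually (\<lambda>l. (\<Sum>j<n l. (dW l j)\<^sup>2) < T + 1) sequentially" "eventually (\<lambda>l. (\<Sum>j<n l. (dB l j)\<^sup>2) < 1) sequentially"
      using order_tendstoD(2)[OF W2, of "T + 1"] order_tendstoD(2)[OF B2, of 1] by simp_all
    then show ?thesis
    proof eventually_elim
      case (elim l)
      then have "2 * \<kappa>\<^sup>2 * ((\<Sum>j<n l. (dW l j)\<^sup>2) + (\<Sum>j<n l. (dB l j)\<^sup>2)) \<le> K"
        unfolding K_def by (intro mult_left_mono) auto
      then show ?case using X2le[of l] by linarith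
    qed
  qed
  have K0: "K \<ge> 0" using T by (simp add: K_def)
  have t1: "(\<lambda>l. \<Sum>j<n l. E (g l (Suc j)) * A l j) \<longlonglongrightarrow> integral {0..T} (\<lambda>s. E s * a s)"
  proof -
    have "(\<lambda>N. \<Sum>j<N. E (grid T N (Suc j)) * integral {grid T N j..grid T N (Suc j)} a) \<longlonglongrightarrow>
      integral {0..T} (\<lambda>s. E s * a s)"
      by (rule riemann_sum_tendsto[OF contE cont(4) T0]) (auto intro: grid_mono T0)
    from filterlim_compose[OF this n(1)] show ?thesis by (simp add: g_def A_def)
  qed
  \<comment> \<open>Moving \<open>E\<close> from the right to the left endpoint costs increments of
    \<open>E\<close>, whose squares have bounded sums; Cauchy-Schwarz against the sum of
    \<open>(RW l j)\<^sup>2\<close> makes the cost vanish.\<close>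
  have t2: "(\<lambda>l. \<Sum>j<n l. E (g l (Suc j)) * RW l j) \<longlonglongrightarrow> 0"
  proof -
    have "(\<lambda>l. \<Sum>j<n l. (E (g l (Suc j)) - E (g l j)) * RW l j) \<longlonglongrightarrow> 0"
    proof (rule Lim_null_comparison)
      have "eventually (\<lambda>l. c l < 1 / 2) sequentially" using order_tendstoD(2)[OF c0, of "1/2"] by simp
      then show "eventually (\<lambda>l. norm (\<Sum>j<n l. (E (g l (Suc j)) - E (g l j)) * RW l j)
        \<le> sqrt ((8 * ME\<^sup>2 * (K + \<kappa>\<^sup>2 / 2 * T)) * (\<Sum>j<n l. (RW l j)\<^sup>2))) sequentially"
        using maxx[of "1/2", simplified] K
      proof eventually_elim
        case (elim l)
        have "(E (g l (Suc j)) - E (g l j))\<^sup>2 \<le> 8 * ME\<^sup>2 * ((x l j)\<^sup>2 + c l)" if j: "j < n l" for j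
        proof -
          let ?z = "x l j + c l"
          have z: "\<bar>?z\<bar> \<le> 1" using elim j cpos[of l] by (auto simp: abs_less_iff abs_le_iff dest!: spec[of _ j])
          have "\<bar>exp ?z - 1\<bar> \<le> 2 * \<bar>?z\<bar>"
          proof (cases "?z \<ge> 0")
            case True
            have "?z\<^sup>2 \<le> ?z" using True z power_le_one_iff[of ?z 2] by (simp add: power2_eq_square mult_left_le)
            then show ?thesis using exp_bound[of ?z] True z exp_ge_add_one_self[of ?z] by auto
          next
            case False
            then have "exp ?z \<le> 1" by simp
            moreover have "\<bar>a - 1\<bar> \<le> 2 * \<bar>z\<bar>" if "a \<le> 1" "1 + z \<le> a" "\<not> 0 \<le> z" for a z :: real
              using that by linarith
            ultimately show ?thesis using exp_ge_add_one_self[of ?z] False by blast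
          qed
          then have "(exp ?z - 1)\<^sup>2 \<le> (2 * \<bar>?z\<bar>)\<^sup>2" using abs_le_square_iff by fastforce
          also have "\<dots> \<le> 8 * ((x l j)\<^sup>2 + (c l)\<^sup>2)"
            using zero_le_power2[of "x l j - c l"] by (simp add: power_mult_distrib power2_sum power2_diff)
          also have "(c l)\<^sup>2 \<le> c l" using elim cpos[of l] by (simp add: power2_eq_square mult_left_le)
          finally have 1: "(exp ?z - 1)\<^sup>2 \<le> 8 * ((x l j)\<^sup>2 + c l)" by simp
          have "(E (g l j))\<^sup>2 \<le> ME\<^sup>2" using ME(2)[OF gT[of j l]] j ME(1) by (simp add: abs_le_square_iff[symmetric])
          then have "(E (g l j))\<^sup>2 * (exp ?z - 1)\<^sup>2 \<le> ME\<^sup>2 * (8 * ((x l j)\<^sup>2 + c l))"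
            using 1 by (intro mult_mono) auto
          then show ?thesis unfolding Estep by (simp add: power2_eq_square algebra_simps)
        qed
        then have "(\<Sum>j<n l. (E (g l (Suc j)) - E (g l j))\<^sup>2) \<le> (\<Sum>j<n l. 8 * ME\<^sup>2 * ((x l j)\<^sup>2 + c l))"
          by (intro sum_mono) auto
        also have "\<dots> = 8 * ME\<^sup>2 * ((\<Sum>j<n l. (x l j)\<^sup>2) + \<kappa>\<^sup>2 / 2 * T)"
          unfolding sum_distrib_left[symmetric] sum.distrib nc ..
        also have "\<dots> \<le> 8 * ME\<^sup>2 * (K + \<kappa>\<^sup>2 / 2 * T)" using elim by (intro mult_left_mono) auto
        finally have 2: "(\<Sum>j<n l. (E (g l (Suc j)) - E (g l j))\<^sup>2) \<le> 8 * ME\<^sup>2 * (K + \<kappa>\<^sup>2 / 2 * T)" .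
        have "(\<Sum>j<n l. (E (g l (Suc j)) - E (g l j)) * RW l j)\<^sup>2
          \<le> (\<Sum>j<n l. (E (g l (Suc j)) - E (g l j))\<^sup>2) * (\<Sum>j<n l. (RW l j)\<^sup>2)"
          by (rule Cauchy_Schwarz_ineq_sum)
        also have "\<dots> \<le> (8 * ME\<^sup>2 * (K + \<kappa>\<^sup>2 / 2 * T)) * (\<Sum>j<n l. (RW l j)\<^sup>2)"
          by (intro mult_right_mono 2 sum_nonneg) auto
        finally show ?case using real_le_rsqrt[of "\<bar>\<Sum>j<n l. (E (g l (Suc j)) - E (g l j)) * RW l j\<bar>"] by simp
      qed
      show "(\<lambda>l. sqrt ((8 * ME\<^sup>2 * (K + \<kappa>\<^sup>2 / 2 * T)) * (\<Sum>j<n l. (RW l j)\<^sup>2))) \<longlonglongrightarrow> 0"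
        using tendsto_real_sqrt[OF tendsto_mult_right_zero[OF h2]] by simp
    qed
    from tendsto_add[OF this h1[folded g_def]] show ?thesis
      by (simp add: sum.distrib[symmetric] algebra_simps)
  qed
  have t3: "(\<lambda>l. \<Sum>j<n l. E (g l (Suc j)) * RB l j) \<longlonglongrightarrow> 0"
  proof (rule Lim_null_comparison[OF always_eventually, rule_format])
    show "norm (\<Sum>j<n l. E (g l (Suc j)) * RB l j) \<le> ME * (\<Sum>j<n l. \<bar>RB l j\<bar>)" for l
      unfolding sum_distrib_left
      by (rule sum_norm_le) (use ME(2)[OF gT] in \<open>auto simp: abs_mult intro!: mult_right_mono\<close>)
    show "(\<lambda>l. ME * (\<Sum>j<n l. \<bar>RB l j\<bar>)) \<longlonglongrightarrow> 0" by (rule tendsto_mult_right_zero[OF h3])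
  qed
  define \<theta> where "\<theta> l j = y (g l j) * E (g l j)" for l j
  have \<theta>: "\<bar>\<theta> l j\<bar> \<le> My * ME" if "j < n l" for l j
    unfolding \<theta>_def abs_mult using that by (intro mult_mono My ME gT) auto
  \<comment> \<open>Here the Ito correction cancels: \<open>c l - (x l j)\<^sup>2 / 2\<close> is
    \<open>- \<kappa>\<^sup>2 / 2\<close> times the centred square of \<open>dW\<close> plus a mixed
    term and a square of \<open>dB\<close>. The centred squares vanish in the weighted sum, the
    other two because \<open>B\<close> has no quadratic variation.\<close>
  have t4: "(\<lambda>l. \<Sum>j<n l. \<theta> l j * (c l - (x l j)\<^sup>2 / 2)) \<longlonglongrightarrow> 0"
  proof -
    have a1: "(\<lambda>l. \<Sum>j<n l. \<theta> l j * (dB l j)\<^sup>2) \<longlonglongrightarrow> 0"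
    proof (rule Lim_null_comparison[OF always_eventually, rule_format])
      show "norm (\<Sum>j<n l. \<theta> l j * (dB l j)\<^sup>2) \<le> (My * ME) * (\<Sum>j<n l. (dB l j)\<^sup>2)" for l
        unfolding sum_distrib_left
        by (rule sum_norm_le) (use \<theta> in \<open>auto simp: abs_mult intro!: mult_right_mono\<close>)
      show "(\<lambda>l. (My * ME) * (\<Sum>j<n l. (dB l j)\<^sup>2)) \<longlonglongrightarrow> 0" by (rule tendsto_mult_right_zero[OF B2])
    qed
    have a2: "(\<lambda>l. \<Sum>j<n l. \<theta> l j * (dW l j * dB l j)) \<longlonglongrightarrow> 0"
    proof (rule Lim_null_comparison[OF always_eventually, rule_format])
      fix l
      have "(\<Sum>j<n l. \<bar>dW l j\<bar> * \<bar>dB l j\<bar>)\<^sup>2 \<le> (\<Sum>j<n l. (dW l j)\<^sup>2) * (\<Sum>j<n l. (dB l j)\<^sup>2)"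
        using Cauchy_Schwarz_ineq_sum[of "\<lambda>j. \<bar>dW l j\<bar>" "\<lambda>j. \<bar>dB l j\<bar>" "{..<n l}"] by simp
      then have "(\<Sum>j<n l. \<bar>dW l j\<bar> * \<bar>dB l j\<bar>) \<le> sqrt ((\<Sum>j<n l. (dW l j)\<^sup>2) * (\<Sum>j<n l. (dB l j)\<^sup>2))"
        by (rule real_le_rsqrt)
      moreover have "norm (\<Sum>j<n l. \<theta> l j * (dW l j * dB l j)) \<le> (My * ME) * (\<Sum>j<n l. \<bar>dW l j\<bar> * \<bar>dB l j\<bar>)"
        unfolding sum_distrib_left
        by (rule sum_norm_le) (use \<theta> in \<open>auto simp: abs_mult intro!: mult_right_mono\<close>)
      ultimately show "norm (\<Sum>j<n l. \<theta> l j * (dW l j * dB l j))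
          \<le> (My * ME) * sqrt ((\<Sum>j<n l. (dW l j)\<^sup>2) * (\<Sum>j<n l. (dB l j)\<^sup>2))"
        using mult_left_mono[of "\<Sum>j<n l. \<bar>dW l j\<bar> * \<bar>dB l j\<bar>" _ "My * ME"] My(1) ME(1) by fastforce
    next
      show "(\<lambda>l. (My * ME) * sqrt ((\<Sum>j<n l. (dW l j)\<^sup>2) * (\<Sum>j<n l. (dB l j)\<^sup>2))) \<longlonglongrightarrow> 0"
        using tendsto_mult_right_zero[OF tendsto_real_sqrt[OF tendsto_mult[OF W2 B2], simplified]] by simp
    qed
    have a0: "(\<lambda>l. \<Sum>j<n l. \<theta> l j * ((dW l j)\<^sup>2 - T / real (n l))) \<longlonglongrightarrow> 0"
      using h4 by (simp add: \<theta>_def dW_def g_def)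
    have "(\<Sum>j<n l. \<theta> l j * (c l - (x l j)\<^sup>2 / 2)) = - (\<kappa>\<^sup>2 / 2) *
       ((\<Sum>j<n l. \<theta> l j * ((dW l j)\<^sup>2 - T / real (n l))) + 2 * (\<Sum>j<n l. \<theta> l j * (dW l j * dB l j))
        + (\<Sum>j<n l. \<theta> l j * (dB l j)\<^sup>2))" for l
      unfolding sum_distrib_left sum.distrib[symmetric]
      by (rule sum.cong) (auto simp: x_def c_def power2_eq_square field_simps)
    then show ?thesis
      using tendsto_mult_right_zero[OF tendsto_add_zero[OF tendsto_add_zero[OF a0 tendsto_mult_right_zero[OF a2]] a1]] by (simp only:)
  qed
  \<comment> \<open>Once all \<open>\<bar>x l j\<bar>\<close> and \<open>c l\<close> are below
    \<open>e\<close>, the errors of the expansion are at most \<open>e\<close> times quadratic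
    terms, whose sums are bounded through \<open>K\<close>.\<close>
  have t5: "(\<lambda>l. \<Sum>j<n l. \<theta> l j * ((1 - x l j) * exp (x l j + c l) - 1 - (c l - (x l j)\<^sup>2 / 2))) \<longlonglongrightarrow> 0"
  proof (rule LIMSEQ_I)
    fix r :: real assume r: "r > 0"
    define C where "C = (My * ME + 1) * (7 * K + \<kappa>\<^sup>2 / 2 * T + 1)"
    have C: "C > 0" using My(1) ME(1) K0 T by (auto simp: C_def intro!: mult_pos_pos add_nonneg_pos)
    define e where "e = min 1 (r / (2 * C))"
    have e: "e > 0" "e \<le> 1" using r C by (auto simp: e_def)
    have eC: "C * e < r"
    proof -
      have "C * e \<le> C * (r / (2 * C))" using C by (intro mult_left_mono) (auto simp: e_def)
      also have "\<dots> = r / 2" using C by simp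
      finally show ?thesis using r by simp
    qed
    have "eventually (\<lambda>l. c l < e) sequentially" by (rule order_tendstoD(2)[OF c0 e(1)])
    then have "eventually (\<lambda>l. norm ((\<Sum>j<n l. \<theta> l j * ((1 - x l j) * exp (x l j + c l) - 1 - (c l - (x l j)\<^sup>2 / 2))) - 0) < r) sequentially"
      using maxx[OF e(1)] K
    proof eventually_elim
      case (elim l)
      have each: "norm (\<theta> l j * ((1 - x l j) * exp (x l j + c l) - 1 - (c l - (x l j)\<^sup>2 / 2)))
         \<le> (My * ME) * (e * (7 * (x l j)\<^sup>2 + c l))" if j: "j < n l" for j
      proof -
        have xe: "\<bar>x l j\<bar> < e" using elim j by blast
        have "\<bar>(1 - x l j) * exp (x l j + c l) - 1 - (c l - (x l j)\<^sup>2 / 2)\<bar>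
          \<le> 6 * (\<bar>x l j\<bar> * (x l j)\<^sup>2) + (c l)\<^sup>2 + c l * (x l j)\<^sup>2"
          by (rule exp_product_remainder) (use xe e elim cpos[of l] in auto)
        also have "\<dots> \<le> 6 * (e * (x l j)\<^sup>2) + e * c l + e * (x l j)\<^sup>2"
          using xe elim cpos[of l] by (intro add_mono mult_left_mono mult_right_mono) (auto simp: power2_eq_square mult_right_mono)
        also have "\<dots> = e * (7 * (x l j)\<^sup>2 + c l)" by (simp add: algebra_simps)
        finally show ?thesis unfolding real_norm_def abs_mult using \<theta>[OF j] My(1) ME(1) by (intro mult_mono) auto
      qed
      have "norm (\<Sum>j<n l. \<theta> l j * ((1 - x l j) * exp (x l j + c l) - 1 - (c l - (x l j)\<^sup>2 / 2)))
        \<le> (\<Sum>j<n l. (My * ME) * (e * (7 * (x l j)\<^sup>2 + c l)))"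
        by (rule sum_norm_le) (use each in auto)
      also have "\<dots> = (My * ME) * (e * (7 * (\<Sum>j<n l. (x l j)\<^sup>2) + \<kappa>\<^sup>2 / 2 * T))"
        unfolding sum_distrib_left[symmetric] sum.distrib nc ..
      also have "\<dots> \<le> (My * ME + 1) * (e * (7 * K + \<kappa>\<^sup>2 / 2 * T + 1))"
        using elim My(1) ME(1) e T by (intro mult_mono) (auto intro!: add_nonneg_nonneg mult_nonneg_nonneg sum_nonneg)
      also have "\<dots> = C * e" by (simp add: C_def)
      finally show ?case using eC by simp
    qed
    then show "\<exists>no. \<forall>l\<ge>no. norm ((\<Sum>j<n l. \<theta> l j * ((1 - x l j) * exp (x l j + c l) - 1 - (c l - (x l j)\<^sup>2 / 2))) - 0) < r"
      by (simp add: eventually_sequentially)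
  qed
  \<comment> \<open>Exact telescoping for each \<open>l\<close>: error terms carry \<open>E\<close>
    at the right endpoint, and what remains of a step is \<open>\<theta>\<close> times the one-step
    factor minus 1. The left side is independent of \<open>l\<close>, so the limits of the five sums
    give the formula.\<close>
  have id: "y T * E T - y 0 * E 0 = (\<Sum>j<n l. E (g l (Suc j)) * A l j)
    - \<kappa> * (\<Sum>j<n l. E (g l (Suc j)) * RW l j) - \<kappa> * (\<Sum>j<n l. E (g l (Suc j)) * RB l j)
    + (\<Sum>j<n l. \<theta> l j * ((1 - x l j) * exp (x l j + c l) - 1 - (c l - (x l j)\<^sup>2 / 2)))
    + (\<Sum>j<n l. \<theta> l j * (c l - (x l j)\<^sup>2 / 2))" for l
  proof -
    have "y T * E T - y 0 * E 0 = y (g l (n l)) * E (g l (n l)) - y (g l 0) * E (g l 0)"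
      using n(2)[of l] by (simp add: g_def)
    also have "\<dots> = (\<Sum>j<n l. y (g l (Suc j)) * E (g l (Suc j)) - y (g l j) * E (g l j))"
      using sum_lessThan_telescope[of "\<lambda>j. y (g l j) * E (g l j)" "n l"] by simp
    also have "\<dots> = (\<Sum>j<n l. E (g l (Suc j)) * A l j - \<kappa> * (E (g l (Suc j)) * RW l j) - \<kappa> * (E (g l (Suc j)) * RB l j)
      + \<theta> l j * ((1 - x l j) * exp (x l j + c l) - 1 - (c l - (x l j)\<^sup>2 / 2)) + \<theta> l j * (c l - (x l j)\<^sup>2 / 2))"
    proof (rule sum.cong)
      fix j assume "j \<in> {..<n l}"
      then have ys: "y (g l (Suc j)) = y (g l j) + A l j - x l j * y (g l j) - \<kappa> * RW l j - \<kappa> * RB l j"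
        using step[of j l] unfolding g_def[symmetric] A_def[symmetric] dW_def[symmetric] dB_def[symmetric] x_def
        by (simp add: algebra_simps)
      then show "y (g l (Suc j)) * E (g l (Suc j)) - y (g l j) * E (g l j) =
        E (g l (Suc j)) * A l j - \<kappa> * (E (g l (Suc j)) * RW l j) - \<kappa> * (E (g l (Suc j)) * RB l j)
      + \<theta> l j * ((1 - x l j) * exp (x l j + c l) - 1 - (c l - (x l j)\<^sup>2 / 2)) + \<theta> l j * (c l - (x l j)\<^sup>2 / 2)"
        unfolding \<theta>_def Estep ys by (simp add: algebra_simps)
    qed simp
    finally show ?thesis by (simp add: sum.distrib sum_subtractf sum_distrib_left)
  qed
  have "(\<lambda>l. (\<Sum>j<n l. E (g l (Suc j)) * A l j)
    - \<kappa> * (\<Sum>j<n l. E (g l (Suc j)) * RW l j) - \<kappa> * (\<Sum>j<n l. E (g l (Suc j)) * RB l j)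
    + (\<Sum>j<n l. \<theta> l j * ((1 - x l j) * exp (x l j + c l) - 1 - (c l - (x l j)\<^sup>2 / 2)))
    + (\<Sum>j<n l. \<theta> l j * (c l - (x l j)\<^sup>2 / 2)))
    \<longlonglongrightarrow> integral {0..T} (\<lambda>s. E s * a s) - \<kappa> * 0 - \<kappa> * 0 + 0 + 0"
    by (intro tendsto_add tendsto_diff tendsto_mult tendsto_const t1 t2 t3 t4 t5)
  then have "(\<lambda>l::nat. y T * E T - y 0 * E 0) \<longlonglongrightarrow> integral {0..T} (\<lambda>s. E s * a s)"
    unfolding id[symmetric] by simp
  then show ?thesis by (simp add: LIMSEQ_const_iff)
qed

section \<open>Lenglart's inequality\<close>

text \<open>The preimages of Borel sets under one function already form a \<sigma>-algebra, so
  independence of the generated \<sigma>-algebras is the product rule for these sets, with no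
  generator argument in between.\<close>

lemma (in prob_space) indep_var_subalgebra:
  fixes X D :: "'a \<Rightarrow> real"
  assumes "subalgebra M G" "X \<in> borel_measurable G" "D \<in> borel_measurable M"
    and "\<And>a B. a \<in> sets G \<Longrightarrow> B \<in> sets borel \<Longrightarrow>
      prob (a \<inter> (D -` B \<inter> space M)) = prob a * prob (D -` B \<inter> space M)"
  shows "indep_var borel X borel D"
proof -
  have sp: "space G = space M" "sets G \<subseteq> sets M" using assms(1) by (auto simp: subalgebra_def)
  have XM: "X \<in> borel_measurable M" by (rule measurable_from_subalg[OF assms(1,2)])
  have v: "sigma_sets (space M) {Z -` A \<inter> space M |A. A \<in> sets borel} = {Z -` A \<inter> space M |A. A \<in> sets borel}"
    for Z :: "'a \<Rightarrow> real"
    using sets_vimage_algebra[of "space M" Z borel] sets_vimage_algebra2[of Z "space M" borel] by auto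
  have XG: "X -` A \<inter> space M \<in> sets G" if "A \<in> sets borel" for A
    using measurable_sets[OF assms(2) that] sp by simp
  have "indep_set {X -` A \<inter> space M |A. A \<in> sets borel} {D -` A \<inter> space M |A. A \<in> sets borel}"
    unfolding indep_sets2_eq
  proof (intro conjI ballI)
    show "{X -` A \<inter> space M |A. A \<in> sets borel} \<subseteq> events" using XG sp by blast
    show "{D -` A \<inter> space M |A. A \<in> sets borel} \<subseteq> events" using measurable_sets[OF assms(3)] by blast
    fix a b assume "a \<in> {X -` A \<inter> space M |A. A \<in> sets borel}" "b \<in> {D -` A \<inter> space M |A. A \<in> sets borel}"
    then show "prob (a \<inter> b) = prob a * prob b" using XG assms(4) by blast
  qed
  then show ?thesis unfolding indep_var_eq v using XM assms(3) by blast
qed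

text \<open>A finite martingale difference array with deterministic conditional variances:
  \<open>G p\<close> is the information before \<open>D p\<close>, and \<open>D p\<close> is
  independent of it. Brownian increments and their centred squares are the two instances. All
  requirements concern indices below \<open>P\<close>.\<close>

locale difference_array = prob_space M for M :: "'w measure" +
  fixes G :: "nat \<Rightarrow> 'w measure" and D :: "nat \<Rightarrow> 'w \<Rightarrow> real" and v :: "nat \<Rightarrow> real" and P :: nat
  assumes sub: "p < P \<Longrightarrow> subalgebra M (G p)"
    and mono: "p \<le> q \<Longrightarrow> q < P \<Longrightarrow> sets (G p) \<subseteq> sets (G q)"
    and D_past: "p < q \<Longrightarrow> q < P \<Longrightarrow> D p \<in> borel_measurable (G q)"
    and D_meas: "p < P \<Longrightarrow> D p \<in> borel_measurable M"
    and D_indep: "p < P \<Longrightarrow> a \<in> sets (G p) \<Longrightarrow> B \<in> sets borel \<Longrightarrow>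
      prob (a \<inter> (D p -` B \<inter> space M)) = prob a * prob (D p -` B \<inter> space M)"
    and D_sq_int: "p < P \<Longrightarrow> integrable M (\<lambda>\<omega>. (D p \<omega>)\<^sup>2)"
    and D_mean: "p < P \<Longrightarrow> expectation (D p) = 0"
    and D_var: "p < P \<Longrightarrow> expectation (\<lambda>\<omega>. (D p \<omega>)\<^sup>2) = v p"
    and v_pos: "p < P \<Longrightarrow> 0 < v p"
begin

lemma D_int: "p < P \<Longrightarrow> integrable M (D p)"
  using square_integrable_imp_integrable[OF D_meas D_sq_int] .

lemma measurable_G_mono:
  assumes "p \<le> q" "q < P" "X \<in> borel_measurable (G p)"
  shows "X \<in> borel_measurable (G q)"
proof -
  have "space (G p) = space (G q)" using sub assms by (auto simp: subalgebra_def)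
  then show ?thesis using assms mono[OF assms(1,2)] unfolding measurable_def by auto
qed

lemma measurable_G: "p < P \<Longrightarrow> X \<in> borel_measurable (G p) \<Longrightarrow> X \<in> borel_measurable M"
  using sub measurable_from_subalg by blast

lemma expectation_times_D:
  assumes p: "p < P" and X: "X \<in> borel_measurable (G p)" "integrable M X"
  shows "integrable M (\<lambda>\<omega>. X \<omega> * D p \<omega>)" "expectation (\<lambda>\<omega>. X \<omega> * D p \<omega>) = 0"
    and "integrable M (\<lambda>\<omega>. X \<omega> * (D p \<omega>)\<^sup>2)" "expectation (\<lambda>\<omega>. X \<omega> * (D p \<omega>)\<^sup>2) = expectation X * v p"
proof -
  have ind: "indep_var borel X borel (D p)"
    by (rule indep_var_subalgebra[OF sub[OF p] X(1) D_meas[OF p] D_indep[OF p]])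
  show "integrable M (\<lambda>\<omega>. X \<omega> * D p \<omega>)" by (rule indep_var_integrable[OF ind X(2) D_int[OF p]])
  show "expectation (\<lambda>\<omega>. X \<omega> * D p \<omega>) = 0"
    using indep_var_lebesgue_integral[OF ind X(2) D_int[OF p]] D_mean[OF p] by simp
  have ind2: "indep_var borel X borel (\<lambda>\<omega>. (D p \<omega>)\<^sup>2)"
    using indep_var_compose[OF ind, of "\<lambda>x. x" borel "\<lambda>x. x\<^sup>2" borel] by (simp add: comp_def)
  show "integrable M (\<lambda>\<omega>. X \<omega> * (D p \<omega>)\<^sup>2)" by (rule indep_var_integrable[OF ind2 X(2) D_sq_int[OF p]])
  show "expectation (\<lambda>\<omega>. X \<omega> * (D p \<omega>)\<^sup>2) = expectation X * v p"
    using indep_var_lebesgue_integral[OF ind2 X(2) D_sq_int[OF p]] D_var[OF p] by simp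
qed

lemma expectation_sum_sq:
  assumes \<eta>: "\<And>p. p < P \<Longrightarrow> \<eta> p \<in> borel_measurable (G p)" "\<And>p \<omega>. p < P \<Longrightarrow> \<bar>\<eta> p \<omega>\<bar> \<le> K p"
    and B: "B \<subseteq> {..<P}"
  shows "integrable M (\<lambda>\<omega>. (\<Sum>p\<in>B. \<eta> p \<omega> * D p \<omega>)\<^sup>2)"
    and "expectation (\<lambda>\<omega>. (\<Sum>p\<in>B. \<eta> p \<omega> * D p \<omega>)\<^sup>2) = (\<Sum>p\<in>B. expectation (\<lambda>\<omega>. (\<eta> p \<omega>)\<^sup>2) * v p)"
proof -
  have finB: "finite B" using B finite_subset by blast
  have bnd: "integrable M f" if "f \<in> borel_measurable M" "\<And>\<omega>. \<bar>f \<omega>\<bar> \<le> C" for f :: "'w \<Rightarrow> real" and C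
    by (rule integrable_const_bound[of _ C]) (use that in auto)
  have diag: "integrable M (\<lambda>\<omega>. (\<eta> p \<omega> * D p \<omega>) * (\<eta> p \<omega> * D p \<omega>)) \<and>
      expectation (\<lambda>\<omega>. (\<eta> p \<omega> * D p \<omega>) * (\<eta> p \<omega> * D p \<omega>)) = expectation (\<lambda>\<omega>. (\<eta> p \<omega>)\<^sup>2) * v p"
    if p: "p < P" for p
  proof -
    have m: "(\<lambda>\<omega>. (\<eta> p \<omega>)\<^sup>2) \<in> borel_measurable (G p)" using \<eta>(1)[OF p] by measurable
    have "(\<eta> p \<omega>)\<^sup>2 \<le> (K p)\<^sup>2" for \<omega> using \<eta>(2)[OF p, of \<omega>] by (rule abs_le_square_iff[THEN iffD1, OF order_trans]) simp
    then have i: "integrable M (\<lambda>\<omega>. (\<eta> p \<omega>)\<^sup>2)" by (intro bnd[of _ "(K p)\<^sup>2"] measurable_G[OF p m]) auto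
    have "(\<eta> p \<omega> * D p \<omega>) * (\<eta> p \<omega> * D p \<omega>) = (\<eta> p \<omega>)\<^sup>2 * (D p \<omega>)\<^sup>2" for \<omega> by (simp add: power2_eq_square)
    then show ?thesis using expectation_times_D(3,4)[OF p m i] by simp
  qed
  have off: "integrable M (\<lambda>\<omega>. (\<eta> p \<omega> * D p \<omega>) * (\<eta> q \<omega> * D q \<omega>)) \<and>
      expectation (\<lambda>\<omega>. (\<eta> p \<omega> * D p \<omega>) * (\<eta> q \<omega> * D q \<omega>)) = 0" if pq: "p < q" "q < P" for p q
  proof -
    define X where "X \<omega> = \<eta> p \<omega> * D p \<omega> * \<eta> q \<omega>" for \<omega>
    have m: "X \<in> borel_measurable (G q)"
      unfolding X_def[abs_def]
      by (intro borel_measurable_times measurable_G_mono[of p q "\<eta> p"] \<eta>(1) D_past pq) (use pq in auto)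
    have i: "integrable M X"
    proof (rule Bochner_Integration.integrable_bound)
      show "integrable M (\<lambda>\<omega>. K p * K q * D p \<omega>)" using D_int[of p] pq by simp
      show "X \<in> borel_measurable M" using measurable_G m pq by blast
      have "\<bar>X \<omega>\<bar> \<le> \<bar>K p * K q * D p \<omega>\<bar>" for \<omega>
      proof -
        have k: "\<bar>\<eta> p \<omega>\<bar> \<le> \<bar>K p\<bar>" "\<bar>\<eta> q \<omega>\<bar> \<le> \<bar>K q\<bar>"
          using \<eta>(2)[of p \<omega>] \<eta>(2)[of q \<omega>] pq by auto
        have "\<bar>X \<omega>\<bar> = \<bar>\<eta> p \<omega>\<bar> * \<bar>\<eta> q \<omega>\<bar> * \<bar>D p \<omega>\<bar>" by (simp add: X_def abs_mult)
        also have "\<dots> \<le> \<bar>K p\<bar> * \<bar>K q\<bar> * \<bar>D p \<omega>\<bar>" using k by (intro mult_right_mono mult_mono) auto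
        finally show ?thesis by (simp add: abs_mult)
      qed
      then show "AE \<omega> in M. norm (X \<omega>) \<le> norm (K p * K q * D p \<omega>)" by simp
    qed
    have "(\<lambda>\<omega>. (\<eta> p \<omega> * D p \<omega>) * (\<eta> q \<omega> * D q \<omega>)) = (\<lambda>\<omega>. X \<omega> * D q \<omega>)" by (simp add: X_def mult.assoc)
    then show ?thesis using expectation_times_D(1,2)[OF pq(2) m i] by (simp only:)
  qed
  have pair: "integrable M (\<lambda>\<omega>. (\<eta> p \<omega> * D p \<omega>) * (\<eta> q \<omega> * D q \<omega>)) \<and>
      expectation (\<lambda>\<omega>. (\<eta> p \<omega> * D p \<omega>) * (\<eta> q \<omega> * D q \<omega>)) = (if p = q then expectation (\<lambda>\<omega>. (\<eta> p \<omega>)\<^sup>2) * v p else 0)"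
    if "p < P" "q < P" for p q
    using diag[of p] off[of p q] off[of q p] that by (cases p q rule: linorder_cases) (auto simp: mult.commute)
  have eq: "(\<Sum>p\<in>B. \<eta> p \<omega> * D p \<omega>)\<^sup>2 = (\<Sum>p\<in>B. \<Sum>q\<in>B. (\<eta> p \<omega> * D p \<omega>) * (\<eta> q \<omega> * D q \<omega>))" for \<omega>
    by (simp add: power2_eq_square sum_product)
  have pi: "integrable M (\<lambda>\<omega>. (\<eta> p \<omega> * D p \<omega>) * (\<eta> q \<omega> * D q \<omega>))" if "p \<in> B" "q \<in> B" for p q
    using pair[of p q] B that by blast
  have ri: "integrable M (\<lambda>\<omega>. \<Sum>q\<in>B. (\<eta> p \<omega> * D p \<omega>) * (\<eta> q \<omega> * D q \<omega>))" if "p \<in> B" for p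
    by (rule Bochner_Integration.integrable_sum) (rule pi[OF that])
  show "integrable M (\<lambda>\<omega>. (\<Sum>p\<in>B. \<eta> p \<omega> * D p \<omega>)\<^sup>2)"
    unfolding eq by (rule Bochner_Integration.integrable_sum) (rule ri)
  have "expectation (\<lambda>\<omega>. (\<Sum>p\<in>B. \<eta> p \<omega> * D p \<omega>)\<^sup>2)
    = (\<Sum>p\<in>B. expectation (\<lambda>\<omega>. \<Sum>q\<in>B. (\<eta> p \<omega> * D p \<omega>) * (\<eta> q \<omega> * D q \<omega>)))"
    unfolding eq by (rule Bochner_Integration.integral_sum) (rule ri)
  also have "\<dots> = (\<Sum>p\<in>B. \<Sum>q\<in>B. expectation (\<lambda>\<omega>. (\<eta> p \<omega> * D p \<omega>) * (\<eta> q \<omega> * D q \<omega>)))"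
    by (intro sum.cong refl Bochner_Integration.integral_sum pi)
  also have "\<dots> = (\<Sum>p\<in>B. \<Sum>q\<in>B. if p = q then expectation (\<lambda>\<omega>. (\<eta> p \<omega>)\<^sup>2) * v p else 0)"
    by (intro sum.cong refl) (use pair B in blast)
  also have "\<dots> = (\<Sum>p\<in>B. expectation (\<lambda>\<omega>. (\<eta> p \<omega>)\<^sup>2) * v p)" using finB by simp
  finally show "expectation (\<lambda>\<omega>. (\<Sum>p\<in>B. \<eta> p \<omega> * D p \<omega>)\<^sup>2) = (\<Sum>p\<in>B. expectation (\<lambda>\<omega>. (\<eta> p \<omega>)\<^sup>2) * v p)" .
qed

text \<open>Lenglart's inequality: no integrability of \<open>\<xi>\<close> is needed because the array is stopped as soon
  as its bracket exceeds \<open>b\<close>.\<close>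

lemma lenglart:
  assumes \<xi>: "\<And>p. p < P \<Longrightarrow> \<xi> p \<in> borel_measurable (G p)"
    and b: "b > 0" and \<Omega>: "\<Omega> \<in> events" and C: "finite C" "c ` {..<P} \<subseteq> C"
  shows "expectation (\<lambda>\<omega>. min 1 (\<Sum>k\<in>C. (\<Sum>p | p < P \<and> c p = k. \<xi> p \<omega> * D p \<omega>)\<^sup>2) * indicator \<Omega> \<omega>)
    \<le> expectation (\<lambda>\<omega>. min 1 ((\<Sum>p<P. (\<xi> p \<omega>)\<^sup>2 * v p) / b) * indicator \<Omega> \<omega>) + b"
proof -
  \<comment> \<open>The bracket includes the current term. Since the \<open>v q\<close> are
    deterministic, \<open>A p\<close> is still \<open>G p\<close>-measurable, so the truncated
    \<open>\<eta> p\<close> is an admissible weight, and it is bounded by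
    \<open>sqrt (b / v p)\<close>.\<close>
  define A where "A p \<omega> = (\<Sum>q\<le>p. (\<xi> q \<omega>)\<^sup>2 * v q)" for p \<omega>
  define \<eta> where "\<eta> p \<omega> = (if A p \<omega> \<le> b then \<xi> p \<omega> else 0)" for p \<omega>
  define Q where "Q \<omega> = (\<Sum>k\<in>C. (\<Sum>p | p < P \<and> c p = k. \<xi> p \<omega> * D p \<omega>)\<^sup>2)" for \<omega>
  define Q' where "Q' \<omega> = (\<Sum>k\<in>C. (\<Sum>p | p < P \<and> c p = k. \<eta> p \<omega> * D p \<omega>)\<^sup>2)" for \<omega>
  define V where "V \<omega> = (\<Sum>p<P. (\<xi> p \<omega>)\<^sup>2 * v p)" for \<omega>
  have nn: "0 \<le> (\<xi> q \<omega>)\<^sup>2 * v q" if "q < P" for q \<omega> using v_pos[OF that] by simp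
  have A_meas: "A p \<in> borel_measurable (G p)" if p: "p < P" for p
    unfolding A_def
  proof (intro borel_measurable_sum borel_measurable_times borel_measurable_power borel_measurable_const)
    fix q assume "q \<in> {..p}"
    then show "\<xi> q \<in> borel_measurable (G p)" using measurable_G_mono[of q p "\<xi> q"] \<xi>[of q] p by simp
  qed
  have \<eta>_meas: "\<eta> p \<in> borel_measurable (G p)" if p: "p < P" for p
    using A_meas[OF p] \<xi>[OF p] unfolding \<eta>_def by measurable
  have \<eta>_bound: "\<bar>\<eta> p \<omega>\<bar> \<le> sqrt (b / v p)" if p: "p < P" for p \<omega>
  proof (cases "A p \<omega> \<le> b")
    case True
    have "(\<xi> p \<omega>)\<^sup>2 * v p \<le> A p \<omega>" unfolding A_def
      by (rule member_le_sum) (use nn p in auto)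
    then have "(\<xi> p \<omega>)\<^sup>2 \<le> b / v p" using True v_pos[OF p] by (simp add: pos_le_divide_eq)
    then show ?thesis using True real_le_rsqrt[of "\<bar>\<xi> p \<omega>\<bar>"] by (simp add: \<eta>_def)
  next
    case False
    then show ?thesis using b v_pos[OF p] by (simp add: \<eta>_def)
  qed
  have m: "\<xi> p \<in> borel_measurable M" "\<eta> p \<in> borel_measurable M" "D p \<in> borel_measurable M" if "p < P" for p
    using measurable_G[OF that] \<xi> \<eta>_meas D_meas that by auto
  have Q_meas: "Q \<in> borel_measurable M" unfolding Q_def using m by measurable
  have V_meas: "V \<in> borel_measurable M" unfolding V_def using m by measurable
  have \<Omega>_meas[measurable]: "\<Omega> \<in> sets M" by (rule \<Omega>)
  have Q_nn: "0 \<le> Q \<omega>" "0 \<le> Q' \<omega>" for \<omega> by (auto simp: Q_def Q'_def intro!: sum_nonneg)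
  have V_nn: "0 \<le> V \<omega>" for \<omega> unfolding V_def using nn by (auto intro!: sum_nonneg)
  have \<eta>V: "(\<Sum>p<P. (\<eta> p \<omega>)\<^sup>2 * v p) \<le> b" for \<omega>
  proof (cases "\<exists>p<P. A p \<omega> \<le> b")
    case False
    then show ?thesis using b by (simp add: \<eta>_def)
  next
    case True
    \<comment> \<open>Where \<open>\<eta> p\<close> is not truncated to 0,
      \<open>A p \<le> b\<close> and hence \<open>p \<le> L\<close>; all terms up to
      \<open>L\<close> together sum to \<open>A L\<close>, which is at most
      \<open>b\<close>.\<close>
    define L where "L = Max {p. p < P \<and> A p \<omega> \<le> b}"
    have fin: "finite {p. p < P \<and> A p \<omega> \<le> b}" by simp
    have L: "L < P" "A L \<omega> \<le> b" using Max_in[OF fin] True unfolding L_def by blast+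
    have "(\<Sum>p<P. (\<eta> p \<omega>)\<^sup>2 * v p) \<le> (\<Sum>p<P. if p \<le> L then (\<xi> p \<omega>)\<^sup>2 * v p else 0)"
    proof (rule sum_mono)
      fix p assume "p \<in> {..<P}"
      then show "(\<eta> p \<omega>)\<^sup>2 * v p \<le> (if p \<le> L then (\<xi> p \<omega>)\<^sup>2 * v p else 0)"
        using Max_ge[OF fin, of p] nn[of p \<omega>] unfolding \<eta>_def L_def by auto
    qed
    also have "\<dots> = A L \<omega>" unfolding A_def
      using L(1) by (intro sum.mono_neutral_cong_right) auto
    finally show ?thesis using L(2) by simp
  qed
  have Q'_int: "integrable M Q'" unfolding Q'_def
    by (intro Bochner_Integration.integrable_sum expectation_sum_sq(1)[of \<eta> "\<lambda>p. sqrt (b / v p)"] \<eta>_meas \<eta>_bound) auto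
  have \<eta>2_int: "integrable M (\<lambda>\<omega>. (\<eta> p \<omega>)\<^sup>2)" if p: "p < P" for p
  proof (rule integrable_const_bound[of _ "b / v p"])
    have "(\<eta> p \<omega>)\<^sup>2 \<le> (sqrt (b / v p))\<^sup>2" for \<omega> using \<eta>_bound[OF p, of \<omega>] power_mono[of "\<bar>\<eta> p \<omega>\<bar>" _ 2] by fastforce
    then show "AE \<omega> in M. norm ((\<eta> p \<omega>)\<^sup>2) \<le> b / v p" using b v_pos[OF p] by simp
  qed (use m[OF p] in measurable)
  have "expectation Q' = (\<Sum>k\<in>C. \<Sum>p | p < P \<and> c p = k. expectation (\<lambda>\<omega>. (\<eta> p \<omega>)\<^sup>2) * v p)"
    unfolding Q'_def
    by (subst Bochner_Integration.integral_sum)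
      (auto intro!: sum.cong expectation_sum_sq[of \<eta> "\<lambda>p. sqrt (b / v p)"] \<eta>_meas \<eta>_bound)
  also have "\<dots> = (\<Sum>p<P. expectation (\<lambda>\<omega>. (\<eta> p \<omega>)\<^sup>2) * v p)"
    using sum.group[OF finite_lessThan C] by (simp add: lessThan_def)
  also have "\<dots> = expectation (\<lambda>\<omega>. \<Sum>p<P. (\<eta> p \<omega>)\<^sup>2 * v p)"
    using \<eta>2_int by (subst Bochner_Integration.integral_sum) auto
  also have "\<dots> \<le> b"
  proof -
    have "expectation (\<lambda>\<omega>. \<Sum>p<P. (\<eta> p \<omega>)\<^sup>2 * v p) \<le> expectation (\<lambda>\<omega>. b)"
      by (rule integral_mono) (use \<eta>2_int \<eta>V in auto)
    then show ?thesis by (simp add: prob_space)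
  qed
  finally have EQ': "expectation Q' \<le> b" .
  \<comment> \<open>Either the total bracket stays within \<open>b\<close>, nothing was truncated
    and \<open>Q = Q'\<close>, or the truncated bracket term on the right equals 1 on
    \<open>\<Omega>\<close>.\<close>
  have pw: "min 1 (Q \<omega>) * indicator \<Omega> \<omega> \<le> min 1 (V \<omega> / b) * indicator \<Omega> \<omega> + Q' \<omega>" for \<omega>
  proof (cases "V \<omega> \<le> b")
    case True
    have "A p \<omega> \<le> b" if p: "p < P" for p
    proof -
      have "A p \<omega> \<le> V \<omega>" unfolding A_def V_def by (rule sum_mono2) (use p nn in auto)
      then show ?thesis using True by simp
    qed
    then have "Q \<omega> = Q' \<omega>" unfolding Q_def Q'_def by (intro sum.cong refl arg_cong[of _ _ "\<lambda>x. x\<^sup>2"]) (auto simp: \<eta>_def)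
    moreover have "0 \<le> min 1 (V \<omega> / b)" using V_nn[of \<omega>] b by simp
    ultimately show ?thesis using Q_nn[of \<omega>] by (auto simp: indicator_def)
  next
    case False
    then have "min 1 (V \<omega> / b) = 1" using b by (simp add: min_def field_simps)
    then show ?thesis using Q_nn[of \<omega>] by (auto simp: indicator_def)
  qed
  have int: "integrable M (\<lambda>\<omega>. min 1 (f \<omega>) * indicator \<Omega> \<omega>)"
    if "f \<in> borel_measurable M" "\<And>\<omega>. 0 \<le> f \<omega>" for f :: "'w \<Rightarrow> real"
    using that by (intro integrable_const_bound[of _ 1]) (auto simp: indicator_def)
  have "expectation (\<lambda>\<omega>. min 1 (Q \<omega>) * indicator \<Omega> \<omega>) \<le> expectation (\<lambda>\<omega>. min 1 (V \<omega> / b) * indicator \<Omega> \<omega> + Q' \<omega>)"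
    using Q_nn V_nn b Q_meas V_meas by (intro integral_mono pw int Bochner_Integration.integrable_add Q'_int) auto
  also have "\<dots> = expectation (\<lambda>\<omega>. min 1 (V \<omega> / b) * indicator \<Omega> \<omega>) + expectation Q'"
    using V_nn b V_meas by (intro Bochner_Integration.integral_add int Q'_int) auto
  finally show ?thesis using EQ' by (simp add: Q_def V_def)
qed

lemma lenglart_single:
  assumes "\<And>p. p < P \<Longrightarrow> \<xi> p \<in> borel_measurable (G p)" "b > 0" "\<Omega> \<in> events"
  shows "expectation (\<lambda>\<omega>. min 1 ((\<Sum>p<P. \<xi> p \<omega> * D p \<omega>)\<^sup>2) * indicator \<Omega> \<omega>)
    \<le> expectation (\<lambda>\<omega>. min 1 ((\<Sum>p<P. (\<xi> p \<omega>)\<^sup>2 * v p) / b) * indicator \<Omega> \<omega>) + b"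
  using lenglart[OF assms, where C="{0}" and c="\<lambda>_. 0"] by (simp add: lessThan_def image_subset_iff)

end

section \<open>Brownian increments and their centred squares as difference arrays\<close>

lemma normal_moments:
  assumes X: "distributed M lborel X (\<lambda>x. ennreal (normal_density 0 (sqrt \<tau>) x))" and \<tau>: "\<tau> > 0"
  shows "X \<in> borel_measurable M" "integrable M X" "(LINT \<omega>|M. X \<omega>) = 0"
    "integrable M (\<lambda>\<omega>. (X \<omega>)\<^sup>2)" "(LINT \<omega>|M. (X \<omega>)\<^sup>2) = \<tau>"
    "integrable M (\<lambda>\<omega>. (X \<omega>) ^ 4)" "(LINT \<omega>|M. (X \<omega>) ^ 4) = 3 * \<tau>\<^sup>2"
proof -
  have \<sigma>: "0 < sqrt \<tau>" using \<tau> by simp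
  show "X \<in> borel_measurable M" using distributed_measurable[OF X] by simp
  have int: "integrable M (\<lambda>\<omega>. (X \<omega>) ^ k)" for k
    using distributed_integrable[OF X, of "\<lambda>x. x ^ k"] integrable_normal_moment[OF \<sigma>, of 0 k] by simp
  have eq: "(LINT \<omega>|M. (X \<omega>) ^ k) = (LINT x|lborel. normal_density 0 (sqrt \<tau>) x * (x - 0) ^ k)" for k
    using distributed_integral[OF X, of "\<lambda>x. x ^ k"] by simp
  show "integrable M X" "integrable M (\<lambda>\<omega>. (X \<omega>)\<^sup>2)" "integrable M (\<lambda>\<omega>. (X \<omega>) ^ 4)"
    using int[of 1] int[of 2] int[of 4] by simp_all
  show "(LINT \<omega>|M. X \<omega>) = 0"
    using eq[of 1] integral_normal_moment_odd[OF \<sigma>, of 0 0] by simp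
  show "(LINT \<omega>|M. (X \<omega>)\<^sup>2) = \<tau>"
    using eq[of 2] integral_normal_moment_even[OF \<sigma>, of 0 1] \<tau> by simp
  have "(LINT \<omega>|M. (X \<omega>) ^ 4) = fact 4 / ((2 / \<tau>)\<^sup>2 * fact 2)"
    using eq[of 4] integral_normal_moment_even[OF \<sigma>, of 0 2] \<tau> by simp
  also have "\<dots> = 3 * \<tau>\<^sup>2" using \<tau> by (simp add: fact_numeral power_divide field_simps)
  finally show "(LINT \<omega>|M. (X \<omega>) ^ 4) = 3 * \<tau>\<^sup>2" .
qed

lemma filtered_prob_spaceD:
  assumes "filtered_prob_space M F"
  shows "prob_space M" "0 \<le> t \<Longrightarrow> subalgebra M (F t)"
    and "0 \<le> s \<Longrightarrow> s \<le> t \<Longrightarrow> X \<in> borel_measurable (F s) \<Longrightarrow> X \<in> borel_measurable (F t)"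
    and "0 \<le> t \<Longrightarrow> X \<in> borel_measurable (F t) \<Longrightarrow> X \<in> borel_measurable M"
proof -
  show "prob_space M" "0 \<le> t \<Longrightarrow> subalgebra M (F t)"
    using assms unfolding filtered_prob_space_def by auto
  show "0 \<le> t \<Longrightarrow> X \<in> borel_measurable (F t) \<Longrightarrow> X \<in> borel_measurable M"
    using assms measurable_from_subalg unfolding filtered_prob_space_def by blast
  assume st: "0 \<le> s" "s \<le> t" and X: "X \<in> borel_measurable (F s)"
  have "space (F s) = space (F t)" "sets (F s) \<subseteq> sets (F t)"
    using assms st unfolding filtered_prob_space_def subalgebra_def by auto
  then show "X \<in> borel_measurable (F t)" using X unfolding measurable_def by auto
qed

lemma brownian_motionD:
  assumes "brownian_motion M F W"
  shows "0 \<le> t \<Longrightarrow> W t \<in> borel_measurable (F t)" "AE \<omega> in M. continuous_on {0..} (\<lambda>t. W t \<omega>)"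
    "AE \<omega> in M. W 0 \<omega> = 0"
    "0 \<le> s \<Longrightarrow> s < t \<Longrightarrow> distributed M lborel (\<lambda>\<omega>. W t \<omega> - W s \<omega>) (\<lambda>x. ennreal (normal_density 0 (sqrt (t - s)) x))"
  using assms unfolding brownian_motion_def adapted_def by auto

text \<open>A Borel function \<open>h p\<close> of the increment is still independent of
  \<open>F (\<tau> p)\<close>, since its preimages are preimages of Borel sets under the increment.
  The identity and the centred square, as choices of \<open>h p\<close>, give the two arrays
  used.\<close>

lemma brownian_difference_array:
  assumes fps: "filtered_prob_space M F" and bm: "brownian_motion M F W"
    and \<tau>: "0 \<le> \<tau> 0" "\<And>p. p < P \<Longrightarrow> \<tau> p < \<tau> (Suc p)"
    and h: "\<And>p. p < P \<Longrightarrow> h p \<in> borel_measurable borel"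
      "\<And>p. p < P \<Longrightarrow> integrable M (\<lambda>\<omega>. (h p (W (\<tau> (Suc p)) \<omega> - W (\<tau> p) \<omega>))\<^sup>2)"
      "\<And>p. p < P \<Longrightarrow> (LINT \<omega>|M. h p (W (\<tau> (Suc p)) \<omega> - W (\<tau> p) \<omega>)) = 0"
      "\<And>p. p < P \<Longrightarrow> (LINT \<omega>|M. (h p (W (\<tau> (Suc p)) \<omega> - W (\<tau> p) \<omega>))\<^sup>2) = v p"
      "\<And>p. p < P \<Longrightarrow> 0 < v p"
  shows "difference_array M (\<lambda>p. F (\<tau> p)) (\<lambda>p \<omega>. h p (W (\<tau> (Suc p)) \<omega> - W (\<tau> p) \<omega>)) v P"
proof -
  interpret prob_space M using filtered_prob_spaceD(1)[OF fps] .
  have le: "\<tau> p \<le> \<tau> q" if "p \<le> q" "q \<le> P" for p q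
    using that
  proof (induction q)
    case (Suc q)
    then show ?case using \<tau>(2)[of q] by (cases "p = Suc q") auto
  qed simp
  have nn: "0 \<le> \<tau> p" if "p \<le> P" for p using le[of 0 p] \<tau>(1) that by simp
  have W: "W (\<tau> p) \<in> borel_measurable (F (\<tau> q))" if "p \<le> q" "q \<le> P" for p q
    by (rule filtered_prob_spaceD(3)[OF fps nn le brownian_motionD(1)[OF bm nn]]) (use that in auto)
  show ?thesis
  proof
    fix p assume p: "p < P"
    show "subalgebra M (F (\<tau> p))" using filtered_prob_spaceD(2)[OF fps nn] p by simp
    have "W (\<tau> p) \<in> borel_measurable M" "W (\<tau> (Suc p)) \<in> borel_measurable M"
      using filtered_prob_spaceD(4)[OF fps nn W[OF order_refl]] p by auto
    then show "(\<lambda>\<omega>. h p (W (\<tau> (Suc p)) \<omega> - W (\<tau> p) \<omega>)) \<in> borel_measurable M"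
      using h(1)[OF p] by measurable
    show "integrable M (\<lambda>\<omega>. (h p (W (\<tau> (Suc p)) \<omega> - W (\<tau> p) \<omega>))\<^sup>2)"
      "(LINT \<omega>|M. h p (W (\<tau> (Suc p)) \<omega> - W (\<tau> p) \<omega>)) = 0"
      "(LINT \<omega>|M. (h p (W (\<tau> (Suc p)) \<omega> - W (\<tau> p) \<omega>))\<^sup>2) = v p" "0 < v p"
      using h p by auto
    fix a B assume a: "a \<in> sets (F (\<tau> p))" and B: "B \<in> sets (borel :: real measure)"
    have eq: "(\<lambda>\<omega>. h p (W (\<tau> (Suc p)) \<omega> - W (\<tau> p) \<omega>)) -` B \<inter> space M
      = (\<lambda>\<omega>. W (\<tau> (Suc p)) \<omega> - W (\<tau> p) \<omega>) -` (h p -` B) \<inter> space M" by auto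
    have hB: "h p -` B \<in> sets borel" using measurable_sets[OF h(1)[OF p] B] by simp
    have "indep_set (sets (F (\<tau> p))) {(\<lambda>\<omega>. W (\<tau> (Suc p)) \<omega> - W (\<tau> p) \<omega>) -` A \<inter> space M | A. A \<in> sets borel}"
      using bm nn[of p] \<tau>(2)[OF p] p unfolding brownian_motion_def by auto
    from indep_setD[OF this a] hB
    show "prob (a \<inter> ((\<lambda>\<omega>. h p (W (\<tau> (Suc p)) \<omega> - W (\<tau> p) \<omega>)) -` B \<inter> space M)) =
      prob a * prob ((\<lambda>\<omega>. h p (W (\<tau> (Suc p)) \<omega> - W (\<tau> p) \<omega>)) -` B \<inter> space M)"
      unfolding eq by blast
  next
    fix p q assume "p \<le> q" "q < P"
    then show "sets (F (\<tau> p)) \<subseteq> sets (F (\<tau> q))"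
      using fps nn[of p] le[of p q] unfolding filtered_prob_space_def by auto
  next
    fix p q assume pq: "p < q" "q < P"
    have "W (\<tau> p) \<in> borel_measurable (F (\<tau> q))" "W (\<tau> (Suc p)) \<in> borel_measurable (F (\<tau> q))"
      using W pq by auto
    then show "(\<lambda>\<omega>. h p (W (\<tau> (Suc p)) \<omega> - W (\<tau> p) \<omega>)) \<in> borel_measurable (F (\<tau> q))"
      by (intro measurable_compose[OF borel_measurable_diff h(1)]) (use pq in auto)
  qed
qed

lemma brownian_increment_array:
  assumes fps: "filtered_prob_space M F" and bm: "brownian_motion M F W"
    and \<tau>: "0 \<le> \<tau> 0" "\<And>p. p < P \<Longrightarrow> \<tau> p < \<tau> (Suc p)"
  shows "difference_array M (\<lambda>p. F (\<tau> p)) (\<lambda>p \<omega>. W (\<tau> (Suc p)) \<omega> - W (\<tau> p) \<omega>) (\<lambda>p. \<tau> (Suc p) - \<tau> p) P"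
proof -
  have le: "\<tau> 0 \<le> \<tau> p" if "p \<le> P" for p
    using that
  proof (induction p)
    case (Suc p)
    then show ?case using \<tau>(2)[of p] by simp
  qed simp
  have nn: "0 \<le> \<tau> p" if "p < P" for p using le[of p] \<tau>(1) that by simp
  note N = normal_moments[OF brownian_motionD(4)[OF bm]]
  show ?thesis
    by (rule brownian_difference_array[OF fps bm \<tau>, where h="\<lambda>_ x. x", simplified])
      (use N nn \<tau>(2) in auto)
qed

text \<open>With \<open>d\<close> the length of the step, the variance is the Gaussian fourth moment
  \<open>3 * d\<^sup>2\<close> minus \<open>2 * d\<^sup>2\<close> plus
  \<open>d\<^sup>2\<close>.\<close>

lemma brownian_square_array:
  assumes fps: "filtered_prob_space M F" and bm: "brownian_motion M F W"
    and \<tau>: "0 \<le> \<tau> 0" "\<And>p. p < P \<Longrightarrow> \<tau> p < \<tau> (Suc p)"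
  shows "difference_array M (\<lambda>p. F (\<tau> p))
    (\<lambda>p \<omega>. (W (\<tau> (Suc p)) \<omega> - W (\<tau> p) \<omega>)\<^sup>2 - (\<tau> (Suc p) - \<tau> p)) (\<lambda>p. 2 * (\<tau> (Suc p) - \<tau> p)\<^sup>2) P"
proof -
  interpret prob_space M using filtered_prob_spaceD(1)[OF fps] .
  have le: "\<tau> 0 \<le> \<tau> p" if "p \<le> P" for p
    using that
  proof (induction p)
    case (Suc p)
    then show ?case using \<tau>(2)[of p] by simp
  qed simp
  have nn: "0 \<le> \<tau> p" if "p < P" for p using le[of p] \<tau>(1) that by simp
  have key: "integrable M (\<lambda>\<omega>. ((W t \<omega> - W s \<omega>)\<^sup>2 - (t - s))\<^sup>2) \<and>
    expectation (\<lambda>\<omega>. (W t \<omega> - W s \<omega>)\<^sup>2 - (t - s)) = 0 \<and>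
    expectation (\<lambda>\<omega>. ((W t \<omega> - W s \<omega>)\<^sup>2 - (t - s))\<^sup>2) = 2 * (t - s)\<^sup>2" if st: "0 \<le> s" "s < t" for s t
  proof -
    have ts: "t - s > 0" using st by simp
    note N = normal_moments[OF brownian_motionD(4)[OF bm st] ts]
    have eq: "((W t \<omega> - W s \<omega>)\<^sup>2 - (t - s))\<^sup>2 =
      (W t \<omega> - W s \<omega>) ^ 4 - 2 * (t - s) * (W t \<omega> - W s \<omega>)\<^sup>2 + (t - s)\<^sup>2" for \<omega>
    proof -
      have "(x\<^sup>2 - d)\<^sup>2 = x ^ 4 - 2 * d * x\<^sup>2 + d\<^sup>2" for x d :: real
        by (simp add: power2_diff power_mult[symmetric])
      then show ?thesis by blast
    qed
    show ?thesis unfolding eq using N by (simp add: prob_space power2_eq_square)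
  qed
  show ?thesis
    by (rule brownian_difference_array[OF fps bm \<tau>, where h="\<lambda>p x. x\<^sup>2 - (\<tau> (Suc p) - \<tau> p)"])
      (use key nn \<tau>(2) less_imp_neq[OF \<tau>(2), symmetric] in auto)
qed

text \<open>Truncation at 1 supplies the dominating constant, so pathwise convergence on
  \<open>\<Omega>\<close> yields convergence of means for functions without moments.\<close>

lemma (in prob_space) expectation_min1_tendsto_0:
  fixes f :: "nat \<Rightarrow> 'a \<Rightarrow> real"
  assumes f: "\<And>N. f N \<in> borel_measurable M" "\<And>N \<omega>. 0 \<le> f N \<omega>" and \<Omega>: "\<Omega> \<in> events"
    and lim: "AE \<omega> in M. \<omega> \<in> \<Omega> \<longrightarrow> (\<lambda>N. f N \<omega>) \<longlonglongrightarrow> 0"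
  shows "(\<lambda>N. expectation (\<lambda>\<omega>. min 1 (f N \<omega>) * indicator \<Omega> \<omega>)) \<longlonglongrightarrow> 0"
proof -
  have "(\<lambda>N. expectation (\<lambda>\<omega>. min 1 (f N \<omega>) * indicator \<Omega> \<omega>)) \<longlonglongrightarrow> expectation (\<lambda>\<omega>. 0)"
  proof (rule integral_dominated_convergence[where w="\<lambda>_. 1"])
    show "AE \<omega> in M. (\<lambda>N. min 1 (f N \<omega>) * indicator \<Omega> \<omega>) \<longlonglongrightarrow> 0"
      using lim
    proof eventually_elim
      case (elim \<omega>)
      show ?case
      proof (cases "\<omega> \<in> \<Omega>")
        case True
        then have "(\<lambda>N. min 1 (f N \<omega>)) \<longlonglongrightarrow> min 1 0" using elim by (intro tendsto_min tendsto_const) auto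
        then show ?thesis using True by simp
      qed simp
    qed
    show "AE \<omega> in M. norm (min 1 (f N \<omega>) * indicator \<Omega> \<omega>) \<le> 1" for N
      using f(2) by (auto simp: indicator_def)
  qed (use f(1) \<Omega> in auto)
  then show ?thesis by simp
qed

text \<open>The form in which Lenglart's inequality is exploited: for each fixed \<open>b\<close>
  the bracket term tends to 0, and \<open>b\<close> is arbitrary. The case \<open>N = 0\<close> is
  left out because the grid degenerates there.\<close>

lemma tendsto_0_by_slack:
  fixes a :: "nat \<Rightarrow> real"
  assumes "\<And>N. 0 \<le> a N" "\<And>b. b > 0 \<Longrightarrow> c b \<longlonglongrightarrow> 0" "\<And>b N. b > 0 \<Longrightarrow> N > 0 \<Longrightarrow> a N \<le> c b N + b"
  shows "a \<longlonglongrightarrow> 0"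
proof (rule LIMSEQ_I)
  fix r :: real assume r: "r > 0"
  then have "eventually (\<lambda>N. c (r / 2) N < r / 2) sequentially"
    using order_tendstoD(2)[OF assms(2)[of "r / 2"], of "r / 2"] by simp
  then have "eventually (\<lambda>N. norm (a N - 0) < r) sequentially"
    using eventually_gt_at_top[of 0]
  proof eventually_elim
    case (elim N)
    then show ?case using assms(3)[of "r / 2" N] assms(1)[of N] r by auto
  qed
  then show "\<exists>no. \<forall>N\<ge>no. norm (a N - 0) < r" by (simp add: eventually_sequentially)
qed

text \<open>The centred squares have variance \<open>2 * (T / N)\<^sup>2\<close>, so weights bounded
  by \<open>C\<close> along a path give a bracket of at most
  \<open>2 * C\<^sup>2 * T\<^sup>2 / N\<close>. As \<open>C\<close> depends on the path, Lenglart's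
  inequality takes the place of the isometry.\<close>

lemma brownian_quadratic_variation:
  assumes fps: "filtered_prob_space M F" and bm: "brownian_motion M F W" and T: "T > 0"
    and \<theta>: "\<And>t. t \<in> {0..T} \<Longrightarrow> \<theta> t \<in> borel_measurable (F t)" and \<Omega>: "\<Omega> \<in> sets M"
    and bdd: "AE \<omega> in M. \<omega> \<in> \<Omega> \<longrightarrow> (\<exists>C. \<forall>N j. j \<le> N \<longrightarrow> \<bar>\<theta> (grid T N j) \<omega>\<bar> \<le> C)"
  shows "(\<lambda>N. LINT \<omega>|M. min 1 ((\<Sum>j<N. \<theta> (grid T N j) \<omega> *
      ((W (grid T N (Suc j)) \<omega> - W (grid T N j) \<omega>)\<^sup>2 - T / real N))\<^sup>2) * indicator \<Omega> \<omega>) \<longlonglongrightarrow> 0"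
proof (rule tendsto_0_by_slack)
  interpret prob_space M using filtered_prob_spaceD(1)[OF fps] .
  have gT: "grid T N j \<in> {0..T}" if "j \<le> N" for N j
    using that T by (auto simp: grid_nonneg grid_le)
  have \<theta>M: "\<theta> (grid T N j) \<in> borel_measurable M" if "j < N" for N j
    using filtered_prob_spaceD(4)[OF fps _ \<theta>] gT[of j N] that by auto
  define V where "V b N \<omega> = (\<Sum>j<N. (\<theta> (grid T N j) \<omega>)\<^sup>2 * (2 * (T / real N)\<^sup>2)) / b" for b N \<omega>
  show "(\<lambda>N. expectation (\<lambda>\<omega>. min 1 (V b N \<omega>) * indicator \<Omega> \<omega>)) \<longlonglongrightarrow> 0" if b: "b > 0" for b
  proof (rule expectation_min1_tendsto_0[OF _ _ \<Omega>])
    show "V b N \<in> borel_measurable M" for N unfolding V_def using \<theta>M by measurable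
    show "0 \<le> V b N \<omega>" for N \<omega> unfolding V_def using b by (intro divide_nonneg_pos sum_nonneg) auto
    show "AE \<omega> in M. \<omega> \<in> \<Omega> \<longrightarrow> (\<lambda>N. V b N \<omega>) \<longlonglongrightarrow> 0"
      using bdd
    proof (eventually_elim, intro impI)
      fix \<omega> assume "\<omega> \<in> \<Omega> \<longrightarrow> (\<exists>C. \<forall>N j. j \<le> N \<longrightarrow> \<bar>\<theta> (grid T N j) \<omega>\<bar> \<le> C)" "\<omega> \<in> \<Omega>"
      then obtain C where C: "\<And>N j. j \<le> N \<Longrightarrow> \<bar>\<theta> (grid T N j) \<omega>\<bar> \<le> C" by blast
      show "(\<lambda>N. V b N \<omega>) \<longlonglongrightarrow> 0"
      proof (rule Lim_null_comparison[OF always_eventually, rule_format])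
        fix N
        have "(\<Sum>j<N. (\<theta> (grid T N j) \<omega>)\<^sup>2 * (2 * (T / real N)\<^sup>2)) \<le> (\<Sum>j<N. C\<^sup>2 * (2 * (T / real N)\<^sup>2))"
        proof (intro sum_mono mult_right_mono)
          fix j assume "j \<in> {..<N}"
          then have "\<bar>\<theta> (grid T N j) \<omega>\<bar> \<le> \<bar>C\<bar>" using C[of j N] by force
          then show "(\<theta> (grid T N j) \<omega>)\<^sup>2 \<le> C\<^sup>2" by (simp add: abs_le_square_iff)
        qed simp
        also have "\<dots> \<le> 2 * C\<^sup>2 * T\<^sup>2 / real N" by (simp add: power2_eq_square field_simps)
        finally have "V b N \<omega> \<le> 2 * C\<^sup>2 * T\<^sup>2 / real N / b"
          unfolding V_def using b by (intro divide_right_mono) auto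
        moreover have "0 \<le> V b N \<omega>" unfolding V_def using b by (intro divide_nonneg_pos sum_nonneg) auto
        ultimately show "norm (V b N \<omega>) \<le> 2 * C\<^sup>2 * T\<^sup>2 / b / real N" by (simp add: mult.commute)
      next
        show "(\<lambda>N. 2 * C\<^sup>2 * T\<^sup>2 / b / real N) \<longlonglongrightarrow> 0" by (rule lim_const_over_n)
      qed
    qed
  qed
  show "expectation (\<lambda>\<omega>. min 1 ((\<Sum>j<N. \<theta> (grid T N j) \<omega> *
      ((W (grid T N (Suc j)) \<omega> - W (grid T N j) \<omega>)\<^sup>2 - T / real N))\<^sup>2) * indicator \<Omega> \<omega>)
      \<le> expectation (\<lambda>\<omega>. min 1 (V b N \<omega>) * indicator \<Omega> \<omega>) + b" if b: "b > 0" and N: "N > 0" for b N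
  proof -
    interpret difference_array M "\<lambda>p. F (grid T N p)"
      "\<lambda>p \<omega>. (W (grid T N (Suc p)) \<omega> - W (grid T N p) \<omega>)\<^sup>2 - (grid T N (Suc p) - grid T N p)"
      "\<lambda>p. 2 * (grid T N (Suc p) - grid T N p)\<^sup>2" N
      by (rule brownian_square_array[OF fps bm]) (use T N in \<open>auto intro: grid_strict_mono\<close>)
    show ?thesis
      using lenglart_single[OF _ b \<Omega>, of "\<lambda>j. \<theta> (grid T N j)"] \<theta> gT
      by (simp add: grid_Suc_diff V_def)
  qed
  show "0 \<le> expectation (\<lambda>\<omega>. min 1 ((\<Sum>j<N. \<theta> (grid T N j) \<omega> *
      ((W (grid T N (Suc j)) \<omega> - W (grid T N j) \<omega>)\<^sup>2 - T / real N))\<^sup>2) * indicator \<Omega> \<omega>)" for N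
    by (intro integral_nonneg_AE always_eventually) auto
qed

section \<open>Almost sure subsequences of limits in probability\<close>

lemma converges_in_prob_subseq:
  assumes "converges_in_prob M X Y" "strict_mono r"
  shows "converges_in_prob M (\<lambda>n. X (r n)) Y"
  unfolding converges_in_prob_def
proof (intro allI impI)
  fix e :: real assume "e > 0"
  then obtain A where A: "\<forall>n. A n \<in> sets M \<and> {\<omega>\<in>space M. e < \<bar>X n \<omega> - Y \<omega>\<bar>} \<subseteq> A n" "(\<lambda>n. measure M (A n)) \<longlonglongrightarrow> 0"
    using assms(1) unfolding converges_in_prob_def by blast
  show "\<exists>A. (\<forall>n. A n \<in> sets M \<and> {\<omega>\<in>space M. e < \<bar>X (r n) \<omega> - Y \<omega>\<bar>} \<subseteq> A n) \<and> (\<lambda>n. measure M (A n)) \<longlonglongrightarrow> 0"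
    using A(1) LIMSEQ_subseq_LIMSEQ[OF A(2) assms(2)]
    by (intro exI[of _ "\<lambda>n. A (r n)"]) (auto simp: comp_def)
qed

text \<open>Borel-Cantelli is applied to the measurable covers \<open>A k n\<close> that the
  definition supplies, with thresholds and probabilities both controlled by
  \<open>(1 / 2) ^ k\<close>.\<close>

lemma (in prob_space) converges_in_prob_AE_subseq:
  assumes "converges_in_prob M X Y"
  shows "\<exists>r. strict_mono r \<and> (AE \<omega> in M. (\<lambda>n. X (r n) \<omega>) \<longlonglongrightarrow> Y \<omega>)"
proof -
  define e where "e k = (1 / 2 :: real) ^ k" for k :: nat
  have e: "e k > 0" for k by (simp add: e_def)
  have "\<forall>k. \<exists>A. (\<forall>n. A n \<in> sets M \<and> {\<omega>\<in>space M. e k < \<bar>X n \<omega> - Y \<omega>\<bar>} \<subseteq> A n) \<and> (\<lambda>n. measure M (A n)) \<longlonglongrightarrow> 0"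
    using assms e unfolding converges_in_prob_def by blast
  from choice[OF this] obtain A where A: "\<And>k n. A k n \<in> sets M" "\<And>k n. {\<omega>\<in>space M. e k < \<bar>X n \<omega> - Y \<omega>\<bar>} \<subseteq> A k n"
      "\<And>k. (\<lambda>n. measure M (A k n)) \<longlonglongrightarrow> 0"
    by blast
  have "\<forall>k. \<exists>n0. \<forall>n\<ge>n0. measure M (A k n) < e k"
    using order_tendstoD(2)[OF A(3) e] by (simp add: eventually_sequentially)
  then obtain n0 where n0: "\<And>k n. n \<ge> n0 k \<Longrightarrow> measure M (A k n) < e k" by metis
  \<comment> \<open>The partial sum dominates \<open>n0 k\<close>, and the summand \<open>k\<close>
    makes the sequence strictly increasing.\<close>
  define r where "r k = (\<Sum>i\<le>k. n0 i) + k" for k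
  have r: "strict_mono r" by (rule strict_monoI_Suc) (simp add: r_def)
  have "n0 k \<le> r k" for k unfolding r_def by (rule trans_le_add1, rule member_le_sum) auto
  then have small: "measure M (A k (r k)) < e k" for k by (rule n0)
  have "AE \<omega> in M. eventually (\<lambda>k. \<omega> \<in> space M - A k (r k)) sequentially"
  proof (rule borel_cantelli_AE1)
    show "summable (\<lambda>k. measure M (A k (r k)))"
    proof (rule summable_comparison_test'[of e])
      show "summable e" unfolding e_def by (rule summable_geometric) simp
      show "norm (measure M (A k (r k))) \<le> e k" for k using less_imp_le[OF small[of k]] by simp
    qed
  qed (use A in \<open>auto simp: less_top[symmetric]\<close>)
  then have "AE \<omega> in M. (\<lambda>n. X (r n) \<omega>) \<longlonglongrightarrow> Y \<omega>"
  proof eventually_elim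
    case (elim \<omega>)
    have "e \<longlonglongrightarrow> 0" unfolding e_def by (rule LIMSEQ_power_zero) simp
    then have "(\<lambda>n. X (r n) \<omega> - Y \<omega>) \<longlonglongrightarrow> 0"
    proof (rule Lim_null_comparison[rotated])
      show "eventually (\<lambda>n. norm (X (r n) \<omega> - Y \<omega>) \<le> e n) sequentially"
        using elim by eventually_elim (use A(2) in \<open>force simp: not_less[symmetric]\<close>)
    qed
    then show ?case by (simp add: LIM_zero_iff)
  qed
  then show ?thesis using r by blast
qed

lemma has_ito_integral_AE:
  assumes "prob_space M" "has_ito_integral M F W X T I"
  shows "\<exists>S. (\<forall>m. is_simple_process F (S m)) \<and>
    (AE \<omega> in M. (\<lambda>m. LINT s:{0..T}|lborel. (simple_process (S m) s \<omega> - X s \<omega>)\<^sup>2) \<longlonglongrightarrow> 0) \<and>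
    (AE \<omega> in M. (\<lambda>m. simple_integral W (S m) T \<omega>) \<longlonglongrightarrow> I \<omega>)"
proof -
  interpret prob_space M by fact
  obtain S where S: "\<And>m. is_simple_process F (S m)"
    "converges_in_prob M (\<lambda>m \<omega>. LINT s:{0..T}|lborel. (simple_process (S m) s \<omega> - X s \<omega>)\<^sup>2) (\<lambda>_. 0)"
    "converges_in_prob M (\<lambda>m. simple_integral W (S m) T) I"
    using assms(2) unfolding has_ito_integral_def by blast
  obtain r where r: "strict_mono r"
    "AE \<omega> in M. (\<lambda>m. LINT s:{0..T}|lborel. (simple_process (S (r m)) s \<omega> - X s \<omega>)\<^sup>2) \<longlonglongrightarrow> 0"
    using converges_in_prob_AE_subseq[OF S(2)] by blast
  obtain q where q: "strict_mono q" "AE \<omega> in M. (\<lambda>m. simple_integral W (S (r (q m))) T \<omega>) \<longlonglongrightarrow> I \<omega>"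
    using converges_in_prob_AE_subseq[OF converges_in_prob_subseq[OF S(3) r(1)]] by blast
  have "AE \<omega> in M. (\<lambda>m. LINT s:{0..T}|lborel. (simple_process (S (r (q m))) s \<omega> - X s \<omega>)\<^sup>2) \<longlonglongrightarrow> 0"
    using r(2) by eventually_elim (use LIMSEQ_subseq_LIMSEQ[OF _ q(1)] in \<open>auto simp: comp_def\<close>)
  then show ?thesis using S(1) q(2) by (intro exI[of _ "\<lambda>m. S (r (q m))"]) auto
qed

section \<open>Ito integrals as limits of left-endpoint sums\<close>

lemma sorted_nth_less_iff:
  assumes "sorted_wrt (<) (xs :: real list)" "a < length xs" "b < length xs"
  shows "xs ! a < xs ! b \<longleftrightarrow> a < b"
  using assms sorted_wrt_nth_less[of "(<)" xs a b] sorted_wrt_nth_less[of "(<)" xs b a]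
  by (cases a b rule: linorder_cases) auto

lemma sorted_gap:
  assumes "sorted_wrt (<) (xs :: real list)" "p < length xs - 1" "u \<in> set xs" "u < xs ! Suc p"
  shows "u \<le> xs ! p"
proof -
  obtain a where a: "a < length xs" "u = xs ! a" using assms(3) by (auto simp: in_set_conv_nth)
  then have "a < Suc p" using assms sorted_nth_less_iff[OF assms(1), of a "Suc p"] by auto
  then have "\<not> xs ! p < xs ! a" using assms a sorted_nth_less_iff[OF assms(1), of p a] by auto
  then show ?thesis using a by simp
qed

text \<open>Intervals between consecutive list points are selected by their right endpoint; those
  with right endpoint in \<open>(u, v]\<close> tile \<open>(u, v]\<close>, because \<open>u\<close>
  and \<open>v\<close> are list points themselves.\<close>

lemma sorted_telescope:
  fixes f :: "real \<Rightarrow> real"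
  assumes xs: "sorted_wrt (<) xs" and u: "u \<in> set xs" "v \<in> set xs" "u \<le> v"
  shows "(\<Sum>p<length xs - 1. if u < xs ! Suc p \<and> xs ! Suc p \<le> v then f (xs ! Suc p) - f (xs ! p) else 0) = f v - f u"
proof -
  obtain i j where ij: "i < length xs" "u = xs ! i" "j < length xs" "v = xs ! j"
    using u by (auto simp: in_set_conv_nth)
  have le: "i \<le> j" using u(3) ij sorted_nth_less_iff[OF xs, of j i] by auto
  have "(\<Sum>p<length xs - 1. if u < xs ! Suc p \<and> xs ! Suc p \<le> v then f (xs ! Suc p) - f (xs ! p) else 0)
    = (\<Sum>p\<in>{i..<j}. f (xs ! Suc p) - f (xs ! p))"
  proof (rule sum.mono_neutral_cong_right)
    show "{i..<j} \<subseteq> {..<length xs - 1}" using ij by auto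
    show "\<forall>p\<in>{..<length xs - 1} - {i..<j}. (if u < xs ! Suc p \<and> xs ! Suc p \<le> v then f (xs ! Suc p) - f (xs ! p) else 0) = 0"
      using ij sorted_nth_less_iff[OF xs, of i] sorted_nth_less_iff[OF xs, of j] by (auto simp: not_less[symmetric])
    show "\<And>p. p \<in> {i..<j} \<Longrightarrow> (if u < xs ! Suc p \<and> xs ! Suc p \<le> v then f (xs ! Suc p) - f (xs ! p) else 0) = f (xs ! Suc p) - f (xs ! p)"
      using ij sorted_nth_less_iff[OF xs, of i] sorted_nth_less_iff[OF xs, of j] by (auto simp: not_less[symmetric])
  qed simp
  also have "\<dots> = f v - f u" using sum_Suc_diff'[of i j "\<lambda>p. f (xs ! p)"] le ij by simp
  finally show ?thesis .
qed

section \<open>Simple processes on a common refinement\<close>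

lemma simple_times_mono:
  fixes t :: "nat \<Rightarrow> real"
  assumes "\<forall>k<n. t k \<le> t (Suc k)" "i \<le> j" "j \<le> n"
  shows "t i \<le> t j"
  using assms(2,3)
proof (induction j)
  case (Suc j)
  then show ?case using assms(1) by (cases "i = Suc j") (auto intro: order_trans[of _ "t j"])
qed simp

fun simple_times :: "'w simple \<Rightarrow> real set" where
  "simple_times (n, t, \<xi>) = t ` {..n}"

lemma finite_simple_times [simp]: "finite (simple_times S)"
  by (cases S) simp

lemma simple_times_nonneg:
  assumes "is_simple_process F S" "s \<in> simple_times S"
  shows "0 \<le> s"
proof -
  obtain n t \<xi> where S: "S = (n, t, \<xi>)" by (cases S)
  then obtain k where "k \<le> n" "s = t k" using assms(2) by auto
  then show ?thesis using simple_times_mono[of n t 0 k] assms(1) S by auto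
qed

text \<open>Two simple processes, or a simple process and a grid, become comparable on one list of
  points. The steps are left-open and right-closed, so the value on an interval is read off at its
  right endpoint; \<open>T\<close> is a list point so that stopping at \<open>T\<close> cuts no
  interval.\<close>

lemma simple_integral_eq_sum:
  assumes xs: "sorted_wrt (<) xs" and S: "is_simple_process F S"
    and sub: "simple_times S \<subseteq> set xs" and T: "T \<in> set xs"
  shows "simple_integral W S T \<omega> = (\<Sum>p<length xs - 1. if xs ! Suc p \<le> T
     then simple_process S (xs ! Suc p) \<omega> * (W (xs ! Suc p) \<omega> - W (xs ! p) \<omega>) else 0)"
proof -
  obtain n t \<xi> where Seq: "S = (n, t, \<xi>)" by (cases S)
  have t: "t k \<in> set xs" if "k \<le> n" for k using sub that Seq by auto
  have m: "t k \<le> t (Suc k)" if "k < n" for k using S that Seq by auto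
  have "simple_integral W S T \<omega> = (\<Sum>k<n. \<xi> k \<omega> * (\<Sum>p<length xs - 1.
      if min (t k) T < xs ! Suc p \<and> xs ! Suc p \<le> min (t (Suc k)) T then W (xs ! Suc p) \<omega> - W (xs ! p) \<omega> else 0))"
    unfolding Seq simple_integral.simps
  proof (intro sum.cong refl)
    fix k assume k: "k \<in> {..<n}"
    have "(\<Sum>p<length xs - 1. if min (t k) T < xs ! Suc p \<and> xs ! Suc p \<le> min (t (Suc k)) T
        then W (xs ! Suc p) \<omega> - W (xs ! p) \<omega> else 0) = W (min (t (Suc k)) T) \<omega> - W (min (t k) T) \<omega>"
      by (rule sorted_telescope[OF xs, where f="\<lambda>s. W s \<omega>"])
        (use t[of k] t[of "Suc k"] T k m[of k] in \<open>auto simp: min_def\<close>)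
    then show "\<xi> k \<omega> * (W (min (t (Suc k)) T) \<omega> - W (min (t k) T) \<omega>) = \<xi> k \<omega> * (\<Sum>p<length xs - 1.
      if min (t k) T < xs ! Suc p \<and> xs ! Suc p \<le> min (t (Suc k)) T then W (xs ! Suc p) \<omega> - W (xs ! p) \<omega> else 0)"
      by simp
  qed
  also have "\<dots> = (\<Sum>p<length xs - 1. \<Sum>k<n. \<xi> k \<omega> *
      (if min (t k) T < xs ! Suc p \<and> xs ! Suc p \<le> min (t (Suc k)) T then W (xs ! Suc p) \<omega> - W (xs ! p) \<omega> else 0))"
    unfolding sum_distrib_left by (rule sum.swap)
  also have "\<dots> = (\<Sum>p<length xs - 1. if xs ! Suc p \<le> T
     then simple_process S (xs ! Suc p) \<omega> * (W (xs ! Suc p) \<omega> - W (xs ! p) \<omega>) else 0)"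
  proof (rule sum.cong[OF refl])
    fix p
    have e: "(if min (t k) T < xs ! Suc p \<and> xs ! Suc p \<le> min (t (Suc k)) T then W (xs ! Suc p) \<omega> - W (xs ! p) \<omega> else 0)
      = (if xs ! Suc p \<le> T then indicator {t k<..t (Suc k)} (xs ! Suc p) * (W (xs ! Suc p) \<omega> - W (xs ! p) \<omega>) else 0)" for k
      by (auto simp: indicator_def min_def)
    show "(\<Sum>k<n. \<xi> k \<omega> * (if min (t k) T < xs ! Suc p \<and> xs ! Suc p \<le> min (t (Suc k)) T
        then W (xs ! Suc p) \<omega> - W (xs ! p) \<omega> else 0))
      = (if xs ! Suc p \<le> T then simple_process S (xs ! Suc p) \<omega> * (W (xs ! Suc p) \<omega> - W (xs ! p) \<omega>) else 0)"
      unfolding Seq e simple_process.simps sum_distrib_right by (simp add: mult.assoc del: Int_iff sum_mult_indicator)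
  qed
  finally show ?thesis .
qed

lemma simple_process_const:
  assumes "simple_times S \<inter> {s<..<e} = {}" "s < u" "u \<le> e"
  shows "simple_process S u \<omega> = simple_process S e \<omega>"
proof -
  obtain n t \<xi> where S: "S = (n, t, \<xi>)" by (cases S)
  have t: "t k \<le> s \<or> e \<le> t k" if "k \<le> n" for k using assms(1) that S by force
  have "indicator {t k<..t (Suc k)} u = (indicator {t k<..t (Suc k)} e :: real)" if k: "k < n" for k
    using t[of k] t[of "Suc k"] assms(2,3) k by (auto simp: indicator_def)
  then show ?thesis unfolding S by simp
qed

text \<open>Predictability: the value at the right endpoint \<open>e\<close> was fixed no later than
  \<open>s\<close>, as no jump time lies in between. This makes it an admissible weight for the
  increment from \<open>s\<close> to \<open>e\<close>.\<close>

lemma simple_process_measurable: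
  assumes fps: "filtered_prob_space M F" and S: "is_simple_process F S"
    and gap: "simple_times S \<inter> {s<..<e} = {}" and s: "0 \<le> s" "s < e"
  shows "simple_process S e \<in> borel_measurable (F s)"
proof -
  obtain n t \<xi> where Seq: "S = (n, t, \<xi>)" by (cases S)
  have "(\<lambda>\<omega>. \<xi> k \<omega> * indicator {t k<..t (Suc k)} e) \<in> borel_measurable (F s)" if k: "k < n" for k
  proof (cases "e \<in> {t k<..t (Suc k)}")
    case True
    have "t k \<in> simple_times S" using k Seq by simp
    then have "t k \<notin> {s<..<e}" using gap by blast
    then have "t k \<le> s" using True by auto
    moreover have "0 \<le> t k" using simple_times_nonneg[OF S, of "t k"] k Seq by simp
    ultimately have "\<xi> k \<in> borel_measurable (F s)"
      using filtered_prob_spaceD(3)[OF fps, of "t k" s "\<xi> k"] S k Seq by auto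
    then show ?thesis by measurable
  qed simp
  then show ?thesis unfolding Seq simple_process.simps[abs_def] by (intro borel_measurable_sum) auto
qed

lemma simple_integral_measurable:
  assumes fps: "filtered_prob_space M F" and bm: "brownian_motion M F W" and S: "is_simple_process F S" and T: "0 \<le> T"
  shows "simple_integral W S T \<in> borel_measurable M"
proof -
  obtain n t \<xi> where Seq: "S = (n, t, \<xi>)" by (cases S)
  have t: "0 \<le> t k" if "k \<le> n" for k using simple_times_nonneg[OF S, of "t k"] that Seq by auto
  have W: "W s \<in> borel_measurable M" if "0 \<le> s" for s
    using filtered_prob_spaceD(4)[OF fps that brownian_motionD(1)[OF bm that]] .
  have \<xi>: "\<xi> k \<in> borel_measurable M" if "k < n" for k
    using filtered_prob_spaceD(4)[OF fps t[of k]] S that Seq by auto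
  show ?thesis unfolding Seq simple_integral.simps[abs_def]
    by (intro borel_measurable_sum borel_measurable_times borel_measurable_diff W \<xi>) (use t T in auto)
qed

lemma step_function_integral:
  fixes h :: "real \<Rightarrow> real"
  assumes xs: "sorted_wrt (<) xs"
    and h: "\<And>p u. p < length xs - 1 \<Longrightarrow> xs ! p < u \<Longrightarrow> u \<le> xs ! Suc p \<Longrightarrow> h u = h (xs ! Suc p)"
    and k: "k < length xs"
  shows "set_integrable lborel {xs ! 0<..xs ! k} h \<and>
    (LINT u:{xs ! 0<..xs ! k}|lborel. h u) = (\<Sum>p<k. h (xs ! Suc p) * (xs ! Suc p - xs ! p))"
  using k
proof (induction k)
  case 0
  then show ?case by (simp add: set_integrable_def set_lebesgue_integral_def)
next
  case (Suc k)
  let ?A = "{xs ! 0<..xs ! k}" and ?B = "{xs ! k<..xs ! Suc k}"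
  have lt: "xs ! k < xs ! Suc k" using sorted_nth_less_iff[OF xs, of k "Suc k"] Suc.prems by simp
  have le: "xs ! 0 \<le> xs ! k" using sorted_nth_less_iff[OF xs, of k 0] Suc.prems by force
  have B: "indicator ?B u * h u = h (xs ! Suc k) * indicator ?B u" for u
    using h[of k u] Suc.prems by (auto simp: indicator_def)
  have iB: "set_integrable lborel ?B h"
    unfolding set_integrable_def real_scaleR_def B using lt by simp
  have vB: "(LINT u:?B|lborel. h u) = h (xs ! Suc k) * (xs ! Suc k - xs ! k)"
    unfolding set_lebesgue_integral_def real_scaleR_def B using lt by simp
  have IH: "set_integrable lborel ?A h" "(LINT u:?A|lborel. h u) = (\<Sum>p<k. h (xs ! Suc p) * (xs ! Suc p - xs ! p))"
    using Suc by auto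
  have U: "{xs ! 0<..xs ! Suc k} = ?A \<union> ?B" using le lt by auto
  have "set_integrable lborel (?A \<union> ?B) h" by (rule set_integrable_Un[OF IH(1) iB]) auto
  moreover have "(LINT u:?A \<union> ?B|lborel. h u) = (LINT u:?A|lborel. h u) + (LINT u:?B|lborel. h u)"
    by (rule set_integral_Un[OF _ IH(1) iB]) auto
  ultimately show ?case unfolding U using IH(2) vB by simp
qed

text \<open>The discrete bracket of a step integrand is the time integral of its square, which is
  then compared with an integrable majorant on \<open>[0, T]\<close>.\<close>

lemma step_bracket_le:
  fixes h G :: "real \<Rightarrow> real"
  assumes xs: "sorted_wrt (<) xs" "xs \<noteq> []" "0 \<le> xs ! 0"
    and h: "\<And>p u. p < length xs - 1 \<Longrightarrow> xs ! p < u \<Longrightarrow> u \<le> xs ! Suc p \<Longrightarrow> h u = h (xs ! Suc p)"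
    and h0: "\<And>u. u > T \<Longrightarrow> h u = 0" and hG: "\<And>u. u \<in> {0<..T} \<Longrightarrow> (h u)\<^sup>2 \<le> G u"
    and G: "set_integrable lborel {0..T} G" "\<And>u. 0 \<le> G u"
  shows "(\<Sum>p<length xs - 1. (h (xs ! Suc p))\<^sup>2 * (xs ! Suc p - xs ! p)) \<le> (LINT u:{0..T}|lborel. G u)"
proof -
  let ?A = "{xs ! 0<..xs ! (length xs - 1)}"
  have len: "length xs - 1 < length xs" using xs(2) by simp
  have sq: "(h u)\<^sup>2 = (h (xs ! Suc p))\<^sup>2" if "p < length xs - 1" "xs ! p < u" "u \<le> xs ! Suc p" for p u
    using h[OF that] by simp
  note I = step_function_integral[where h="\<lambda>u. (h u)\<^sup>2", OF xs(1) sq len]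
  have "(\<Sum>p<length xs - 1. (h (xs ! Suc p))\<^sup>2 * (xs ! Suc p - xs ! p)) = (LINT u:?A|lborel. (h u)\<^sup>2)"
    using I by simp
  also have "\<dots> \<le> (LINT u:{0..T}|lborel. G u)"
    unfolding set_lebesgue_integral_def
  proof (rule integral_mono)
    show "integrable lborel (\<lambda>u. indicat_real ?A u *\<^sub>R (h u)\<^sup>2)" using I unfolding set_integrable_def by simp
    show "integrable lborel (\<lambda>u. indicat_real {0..T} u *\<^sub>R G u)" using G(1) unfolding set_integrable_def .
    fix u :: real
    show "indicat_real ?A u *\<^sub>R (h u)\<^sup>2 \<le> indicat_real {0..T} u *\<^sub>R G u"
      using hG[of u] h0[of u] G(2)[of u] xs(3) by (cases "u > T") (auto simp: indicator_def)
  qed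
  finally show ?thesis .
qed

lemma simple_process_borel: "(\<lambda>s. simple_process S s \<omega>) \<in> borel_measurable borel"
proof -
  obtain n t \<xi> where S: "S = (n, t, \<xi>)" by (cases S)
  show ?thesis unfolding S simple_process.simps by measurable
qed

lemma simple_process_bounded: "\<exists>C. \<forall>s. \<bar>simple_process S s \<omega>\<bar> \<le> C"
proof -
  obtain n t \<xi> where S: "S = (n, t, \<xi>)" by (cases S)
  have "\<bar>simple_process S s \<omega>\<bar> \<le> (\<Sum>k<n. \<bar>\<xi> k \<omega>\<bar>)" for s
    unfolding S simple_process.simps
    by (rule order_trans[OF sum_abs]) (auto intro!: sum_mono simp: indicator_def)
  then show ?thesis by blast
qed

text \<open>The Bochner integral of a non-integrable function is 0, so the approximation error
  carries information only together with integrability. It holds because a simple process is bounded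
  along each path.\<close>

lemma simple_process_diff_sq_integrable:
  fixes X :: "real \<Rightarrow> real"
  assumes "set_borel_measurable lborel {0..T} X" "set_integrable lborel {0..T} (\<lambda>s. (X s)\<^sup>2)"
  shows "set_integrable lborel {0..T} (\<lambda>s. (simple_process S s \<omega> - X s)\<^sup>2)"
proof -
  obtain C where C: "\<And>s. \<bar>simple_process S s \<omega>\<bar> \<le> C" using simple_process_bounded[of S \<omega>] by blast
  have S2: "(simple_process S s \<omega>)\<^sup>2 \<le> C\<^sup>2" for s using C[of s] power_mono[of "\<bar>simple_process S s \<omega>\<bar>" C 2] by simp
  have m: "(\<lambda>s. indicat_real {0..T} s * X s) \<in> borel_measurable lborel"
    using assms(1) by (simp add: set_borel_measurable_def)
  have "integrable lborel (\<lambda>s. 2 * C\<^sup>2 * indicat_real {0..T} s + 2 * (indicat_real {0..T} s * (X s)\<^sup>2))"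
    using assms(2) unfolding set_integrable_def real_scaleR_def
    by (intro Bochner_Integration.integrable_add integrable_mult_right integrable_real_indicator)
      (auto simp: emeasure_lborel_Icc_eq)
  then have "integrable lborel (\<lambda>s. indicat_real {0..T} s * (simple_process S s \<omega> - X s)\<^sup>2)"
  proof (rule Bochner_Integration.integrable_bound)
    have "(\<lambda>s. (indicat_real {0..T} s * simple_process S s \<omega> - indicat_real {0..T} s * X s)\<^sup>2) \<in> borel_measurable lborel"
      using m simple_process_borel[of S \<omega>] by measurable
    moreover have "(indicat_real {0..T} s * simple_process S s \<omega> - indicat_real {0..T} s * X s)\<^sup>2
      = indicat_real {0..T} s * (simple_process S s \<omega> - X s)\<^sup>2" for s by (simp add: indicator_def)
    ultimately show "(\<lambda>s. indicat_real {0..T} s * (simple_process S s \<omega> - X s)\<^sup>2) \<in> borel_measurable lborel" by simp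
    have "(simple_process S s \<omega> - X s)\<^sup>2 \<le> 2 * C\<^sup>2 + 2 * (X s)\<^sup>2" for s
    proof -
      have "(simple_process S s \<omega> - X s)\<^sup>2 \<le> 2 * (simple_process S s \<omega>)\<^sup>2 + 2 * (X s)\<^sup>2"
        using zero_le_power2[of "simple_process S s \<omega> + X s"] by (simp add: power2_sum power2_diff)
      then show ?thesis using S2[of s] by simp
    qed
    then show "AE s in lborel. norm (indicat_real {0..T} s * (simple_process S s \<omega> - X s)\<^sup>2)
       \<le> norm (2 * C\<^sup>2 * indicat_real {0..T} s + 2 * (indicat_real {0..T} s * (X s)\<^sup>2))"
      by (auto simp: indicator_def intro!: AE_I2)
  qed
  then show ?thesis by (simp add: set_integrable_def)
qed

lemma sorted_list_of_set_points:
  fixes A :: "real set"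
  assumes "finite A" "0 \<in> A" "\<And>a. a \<in> A \<Longrightarrow> 0 \<le> a"
  shows "sorted_wrt (<) (sorted_list_of_set A)" "set (sorted_list_of_set A) = A"
    "sorted_list_of_set A \<noteq> []" "sorted_list_of_set A ! 0 = 0"
    "\<And>p. p < length (sorted_list_of_set A) - 1 \<Longrightarrow> 0 \<le> sorted_list_of_set A ! p"
    "\<And>p. p < length (sorted_list_of_set A) - 1 \<Longrightarrow> sorted_list_of_set A ! p < sorted_list_of_set A ! Suc p"
proof -
  let ?xs = "sorted_list_of_set A"
  show s: "sorted_wrt (<) ?xs" by simp
  show st: "set ?xs = A" using assms(1) by simp
  then show ne: "?xs \<noteq> []" using assms(2) by auto
  have nn: "0 \<le> ?xs ! p" if "p < length ?xs" for p using nth_mem[OF that] assms(3) st by blast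
  then show "\<And>p. p < length ?xs - 1 \<Longrightarrow> 0 \<le> ?xs ! p" by simp
  show "\<And>p. p < length ?xs - 1 \<Longrightarrow> ?xs ! p < ?xs ! Suc p" using sorted_nth_less_iff[OF s] by simp
  obtain a where a: "a < length ?xs" "?xs ! a = 0" using assms(2) st by (metis in_set_conv_nth)
  have "\<not> ?xs ! 0 < ?xs ! a \<Longrightarrow> a = 0" using sorted_nth_less_iff[OF s, of 0 a] a by force
  then show "?xs ! 0 = 0" using a nn[of 0] ne by (metis length_greater_0_conv order_le_less not_less)
qed

text \<open>The definition of the Ito integral supplies a separate approximating sequence for every
  time. Two such sequences approximate the same \<open>X\<close> on \<open>[0, t]\<close>; the
  difference of their integrals has the integrand \<open>S m - S' m\<close>, whose bracket is at
  most twice the sum of the two squared errors, and Lenglart's inequality applies.\<close>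

lemma simple_integral_same_limit:
  assumes fps: "filtered_prob_space M F" and bm: "brownian_motion M F W" and t: "t \<in> {0..T}"
    and S: "\<And>m. is_simple_process F (S m)" "\<And>m. is_simple_process F (S' m)"
    and X: "AE \<omega> in M. set_borel_measurable lborel {0..T} (\<lambda>s. X s \<omega>) \<and> set_integrable lborel {0..T} (\<lambda>s. (X s \<omega>)\<^sup>2)"
    and lim: "AE \<omega> in M. (\<lambda>m. LINT s:{0..T}|lborel. (simple_process (S m) s \<omega> - X s \<omega>)\<^sup>2) \<longlonglongrightarrow> 0"
      "AE \<omega> in M. (\<lambda>m. LINT s:{0..t}|lborel. (simple_process (S' m) s \<omega> - X s \<omega>)\<^sup>2) \<longlonglongrightarrow> 0"
  shows "(\<lambda>m. LINT \<omega>|M. min 1 ((simple_integral W (S m) t \<omega> - simple_integral W (S' m) t \<omega>)\<^sup>2) * indicator (space M) \<omega>) \<longlonglongrightarrow> 0"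
proof (rule tendsto_0_by_slack)
  interpret prob_space M using filtered_prob_spaceD(1)[OF fps] .
  define A where "A m = simple_times (S m) \<union> simple_times (S' m) \<union> {0, t}" for m
  define xs where "xs m = sorted_list_of_set (A m)" for m
  \<comment> \<open>Cut off after \<open>t\<close>. Since \<open>t\<close> is one of the points of
    \<open>A m\<close>, \<open>H m\<close> remains constant between consecutive points.\<close>
  define H where "H m u \<omega> = (if u \<le> t then simple_process (S m) u \<omega> - simple_process (S' m) u \<omega> else 0)" for m u \<omega>
  have A: "finite (A m)" "0 \<in> A m" "a \<in> A m \<Longrightarrow> 0 \<le> a" for m a
    using simple_times_nonneg[OF S(1)] simple_times_nonneg[OF S(2)] t by (auto simp: A_def)
  have P: "sorted_wrt (<) (xs m)" "set (xs m) = A m" "xs m \<noteq> []" "xs m ! 0 = 0"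
    "p < length (xs m) - 1 \<Longrightarrow> 0 \<le> xs m ! p" "p < length (xs m) - 1 \<Longrightarrow> xs m ! p < xs m ! Suc p" for m p
    using sorted_list_of_set_points[of "A m"] A(1,2)[of m] A(3) unfolding xs_def by blast+
  have gap: "A m \<inter> {xs m ! p<..<xs m ! Suc p} = {}" if "p < length (xs m) - 1" for m p
    using sorted_gap[OF P(1) that] P(2)[of m] by force
  have gapS: "simple_times (S m) \<inter> {xs m ! p<..<xs m ! Suc p} = {}"
    "simple_times (S' m) \<inter> {xs m ! p<..<xs m ! Suc p} = {}" if "p < length (xs m) - 1" for m p
    using gap[OF that] by (auto simp: A_def)
  have Hm: "H m (xs m ! Suc p) \<in> borel_measurable (F (xs m ! p))" if p: "p < length (xs m) - 1" for m p
    unfolding H_def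
    using simple_process_measurable[OF fps S(1) gapS(1)[OF p] P(5,6)[OF p]]
      simple_process_measurable[OF fps S(2) gapS(2)[OF p] P(5,6)[OF p]]
    by measurable
  have Hc: "H m u \<omega> = H m (xs m ! Suc p) \<omega>" if p: "p < length (xs m) - 1" and u: "xs m ! p < u" "u \<le> xs m ! Suc p" for m p u \<omega>
  proof -
    have "t \<in> set (xs m)" using P(2)[of m] by (simp add: A_def)
    then have "u \<le> t \<longleftrightarrow> xs m ! Suc p \<le> t" using sorted_gap[OF P(1) p, of t] u by force
    then show ?thesis unfolding H_def
      using simple_process_const[OF gapS(1)[OF p] u] simple_process_const[OF gapS(2)[OF p] u] by simp
  qed
  define V where "V b m \<omega> = (\<Sum>p<length (xs m) - 1. (H m (xs m ! Suc p) \<omega>)\<^sup>2 * (xs m ! Suc p - xs m ! p)) / b" for b m \<omega>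
  have HM: "H m (xs m ! Suc p) \<in> borel_measurable M" if "p < length (xs m) - 1" for m p
    by (rule filtered_prob_spaceD(4)[OF fps P(5)[OF that] Hm[OF that]])
  have Vnn: "0 \<le> V b m \<omega>" if "b > 0" for b m \<omega>
    unfolding V_def using that P(6)[of _ m] by (intro divide_nonneg_pos sum_nonneg mult_nonneg_nonneg) (auto simp: less_imp_le)
  \<comment> \<open>The default 1 for \<open>b \<le> 0\<close> keeps the divisor positive, so that
    the claim holds for every \<open>b\<close>.\<close>
  show "(\<lambda>m. expectation (\<lambda>\<omega>. min 1 (V (if b > 0 then b else 1) m \<omega>) * indicator (space M) \<omega>)) \<longlonglongrightarrow> 0" for b
  proof (rule expectation_min1_tendsto_0[OF _ _ sets.top])
    let ?b = "if b > 0 then b else 1"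
    have b: "?b > 0" by simp
    show "V ?b m \<in> borel_measurable M" for m unfolding V_def using HM[of _ m] by (intro borel_measurable_divide borel_measurable_sum borel_measurable_times borel_measurable_power) auto
    show "0 \<le> V ?b m \<omega>" for m \<omega> by (rule Vnn[OF b])
    show "AE \<omega> in M. \<omega> \<in> space M \<longrightarrow> (\<lambda>m. V ?b m \<omega>) \<longlonglongrightarrow> 0"
      using X lim
    proof (eventually_elim, intro impI)
      fix \<omega>
      assume X: "set_borel_measurable lborel {0..T} (\<lambda>s. X s \<omega>) \<and> set_integrable lborel {0..T} (\<lambda>s. (X s \<omega>)\<^sup>2)"
        and l1: "(\<lambda>m. LINT s:{0..T}|lborel. (simple_process (S m) s \<omega> - X s \<omega>)\<^sup>2) \<longlonglongrightarrow> 0"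
        and l2: "(\<lambda>m. LINT s:{0..t}|lborel. (simple_process (S' m) s \<omega> - X s \<omega>)\<^sup>2) \<longlonglongrightarrow> 0"
      have sub: "{0..t} \<subseteq> {0..T}" using t by auto
      have i1: "set_integrable lborel {0..T} (\<lambda>s. (simple_process (S m) s \<omega> - X s \<omega>)\<^sup>2)"
        "set_integrable lborel {0..T} (\<lambda>s. (simple_process (S' m) s \<omega> - X s \<omega>)\<^sup>2)" for m
        by (rule simple_process_diff_sq_integrable[OF conjunct1[OF X] conjunct2[OF X]])+
      have i2: "set_integrable lborel {0..t} (\<lambda>s. (simple_process (S m) s \<omega> - X s \<omega>)\<^sup>2)"
        "set_integrable lborel {0..t} (\<lambda>s. (simple_process (S' m) s \<omega> - X s \<omega>)\<^sup>2)" for m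
        using set_integrable_subset[OF i1(1) _ sub] set_integrable_subset[OF i1(2) _ sub] by auto
      let ?a = "\<lambda>m. LINT s:{0..T}|lborel. (simple_process (S m) s \<omega> - X s \<omega>)\<^sup>2"
      let ?a' = "\<lambda>m. LINT s:{0..t}|lborel. (simple_process (S' m) s \<omega> - X s \<omega>)\<^sup>2"
      have le: "V ?b m \<omega> \<le> (2 * ?a m + 2 * ?a' m) / ?b" for m
        unfolding V_def
      proof (rule divide_right_mono)
        have "(\<Sum>p<length (xs m) - 1. (H m (xs m ! Suc p) \<omega>)\<^sup>2 * (xs m ! Suc p - xs m ! p)) \<le>
          (LINT u:{0..t}|lborel. 2 * (simple_process (S m) u \<omega> - X u \<omega>)\<^sup>2 + 2 * (simple_process (S' m) u \<omega> - X u \<omega>)\<^sup>2)"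
        proof (rule step_bracket_le[where h="\<lambda>u. H m u \<omega>" and xs="xs m", OF P(1) P(3) _ Hc])
          show "0 \<le> xs m ! 0" by (simp add: P(4))
          show "\<And>u. u > t \<Longrightarrow> H m u \<omega> = 0" by (simp add: H_def)
          fix u assume "u \<in> {0<..t}"
          then have "H m u \<omega> = (simple_process (S m) u \<omega> - X u \<omega>) - (simple_process (S' m) u \<omega> - X u \<omega>)" by (simp add: H_def)
          moreover have "(x - y)\<^sup>2 \<le> 2 * x\<^sup>2 + 2 * y\<^sup>2" for x y :: real
            using zero_le_power2[of "x + y"] by (simp add: power2_sum power2_diff)
          ultimately show "(H m u \<omega>)\<^sup>2 \<le> 2 * (simple_process (S m) u \<omega> - X u \<omega>)\<^sup>2 + 2 * (simple_process (S' m) u \<omega> - X u \<omega>)\<^sup>2"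
            by metis
        next
          show "set_integrable lborel {0..t} (\<lambda>u. 2 * (simple_process (S m) u \<omega> - X u \<omega>)\<^sup>2 + 2 * (simple_process (S' m) u \<omega> - X u \<omega>)\<^sup>2)"
            by (intro set_integral_add set_integrable_mult_right i2)
        qed auto
        also have "\<dots> = 2 * (LINT s:{0..t}|lborel. (simple_process (S m) s \<omega> - X s \<omega>)\<^sup>2) + 2 * ?a' m"
          by (subst set_integral_add) (auto intro!: set_integrable_mult_right i2)
        also have "(LINT s:{0..t}|lborel. (simple_process (S m) s \<omega> - X s \<omega>)\<^sup>2) \<le> ?a m"
          unfolding set_lebesgue_integral_def
          by (rule integral_mono) (use i1(1)[of m] i2(1)[of m] sub in \<open>auto simp: set_integrable_def indicator_def\<close>)
        finally show "(\<Sum>p<length (xs m) - 1. (H m (xs m ! Suc p) \<omega>)\<^sup>2 * (xs m ! Suc p - xs m ! p)) \<le> 2 * ?a m + 2 * ?a' m"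
          by simp
      qed (use b in simp)
      have "(\<lambda>m. (2 * ?a m + 2 * ?a' m) / ?b) \<longlonglongrightarrow> (2 * 0 + 2 * 0) / ?b"
        by (intro tendsto_divide tendsto_add tendsto_mult tendsto_const l1 l2) (use b in simp)
      then have z: "(\<lambda>m. (2 * ?a m + 2 * ?a' m) / ?b) \<longlonglongrightarrow> 0" by simp
      show "(\<lambda>m. V ?b m \<omega>) \<longlonglongrightarrow> 0"
        by (rule tendsto_sandwich[OF _ _ tendsto_const z]) (use Vnn[OF b] le in \<open>auto intro!: always_eventually\<close>)
    qed
  qed
  show "expectation (\<lambda>\<omega>. min 1 ((simple_integral W (S m) t \<omega> - simple_integral W (S' m) t \<omega>)\<^sup>2) * indicator (space M) \<omega>)
    \<le> expectation (\<lambda>\<omega>. min 1 (V (if b > 0 then b else 1) m \<omega>) * indicator (space M) \<omega>) + b" if b: "b > 0" for b m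
  proof -
    interpret difference_array M "\<lambda>p. F (xs m ! p)" "\<lambda>p \<omega>. W (xs m ! Suc p) \<omega> - W (xs m ! p) \<omega>"
      "\<lambda>p. xs m ! Suc p - xs m ! p" "length (xs m) - 1"
      by (rule brownian_increment_array[OF fps bm]) (use P(4,6) in auto)
    have "simple_integral W (S m) t \<omega> - simple_integral W (S' m) t \<omega> =
      (\<Sum>p<length (xs m) - 1. H m (xs m ! Suc p) \<omega> * (W (xs m ! Suc p) \<omega> - W (xs m ! p) \<omega>))" for \<omega>
    proof -
      have sub: "simple_times (S m) \<subseteq> set (xs m)" "simple_times (S' m) \<subseteq> set (xs m)" "t \<in> set (xs m)"
        using P(2)[of m] by (auto simp: A_def)
      show ?thesis
        unfolding simple_integral_eq_sum[OF P(1) S(1) sub(1,3)] simple_integral_eq_sum[OF P(1) S(2) sub(2,3)]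
          sum_subtractf[symmetric]
        by (rule sum.cong) (auto simp: H_def algebra_simps)
    qed
    then show ?thesis
      using lenglart_single[OF Hm b sets.top] b by (simp add: V_def)
  qed
  show "0 \<le> expectation (\<lambda>\<omega>. min 1 ((simple_integral W (S m) t \<omega> - simple_integral W (S' m) t \<omega>)\<^sup>2) * indicator (space M) \<omega>)" for m
    by (intro integral_nonneg_AE always_eventually) auto
qed

text \<open>Index of the cell \<open>(grid T N j, grid T N (Suc j)]\<close> containing
  \<open>u\<close>. The cells are closed on the right like the steps of simple processes, hence a
  ceiling minus one in place of a floor.\<close>

definition cell :: "real \<Rightarrow> nat \<Rightarrow> real \<Rightarrow> nat" where
  "cell T N u = nat (\<lceil>u * real N / T\<rceil> - 1)"

lemma grid_less_iff: "T > 0 \<Longrightarrow> N > 0 \<Longrightarrow> grid T N j < u \<longleftrightarrow> real j < u * real N / T"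
  "T > 0 \<Longrightarrow> N > 0 \<Longrightarrow> u \<le> grid T N j \<longleftrightarrow> u * real N / T \<le> real j"
  by (simp_all add: grid_def field_simps)

lemma cell:
  assumes "T > 0" "N > 0" "0 < u" "u \<le> T"
  shows "cell T N u < N" "grid T N (cell T N u) < u" "u \<le> grid T N (Suc (cell T N u))"
proof -
  let ?z = "u * real N / T"
  have z: "0 < ?z" "?z \<le> real N" using assms by (auto simp: field_simps)
  then have "1 \<le> \<lceil>?z\<rceil>" by (simp add: one_le_ceiling)
  then have c: "real (cell T N u) = real_of_int \<lceil>?z\<rceil> - 1" by (simp add: cell_def)
  have "real (cell T N u) < ?z" using c by linarith
  moreover have "?z \<le> real (Suc (cell T N u))" using c by linarith
  moreover have "real (cell T N u) < real N" using calculation z by linarith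
  ultimately show "cell T N u < N" "grid T N (cell T N u) < u" "u \<le> grid T N (Suc (cell T N u))"
    using grid_less_iff[OF assms(1,2)] by auto
qed

lemma cell_unique:
  assumes "T > 0" "N > 0" "grid T N j < u" "u \<le> grid T N (Suc j)"
  shows "cell T N u = j"
proof -
  have "real j < u * real N / T" "u * real N / T \<le> real (Suc j)"
    using grid_less_iff[OF assms(1,2)] assms by auto
  then have "\<lceil>u * real N / T\<rceil> = int j + 1" by (intro ceiling_unique) auto
  then show ?thesis by (simp add: cell_def)
qed

text \<open>The left-endpoint sums of a general Ito integral: with weights \<open>w\<close> and blocks \<open>c\<close>, this covers
  both \<open>\<Sum> w R \<longlonglongrightarrow> 0\<close> (a single block) and \<open>\<Sum> R\<^sup>2 \<longlonglongrightarrow> 0\<close> (singleton blocks, \<open>w = 1\<close>).\<close>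

lemma ito_remainder:
  assumes fps: "filtered_prob_space M F" and bm: "brownian_motion M F W" and T: "T > 0"
    and I: "\<And>t. t \<in> {0..T} \<Longrightarrow> has_ito_integral M F W X t (I t)"
    and \<xi>: "\<And>t. t \<in> {0..T} \<Longrightarrow> \<xi> t \<in> borel_measurable (F t)"
      "\<And>t. t \<in> {0..T} \<Longrightarrow> AE \<omega> in M. \<omega> \<in> \<Omega> \<longrightarrow> X t \<omega> = \<xi> t \<omega>"
    and w: "\<And>t. t \<in> {0..T} \<Longrightarrow> w t \<in> borel_measurable (F t)"
    and \<Omega>: "\<Omega> \<in> sets M"
    and cont: "AE \<omega> in M. \<omega> \<in> \<Omega> \<longrightarrow> continuous_on {0..T} (\<lambda>s. X s \<omega>)"
      "AE \<omega> in M. \<omega> \<in> \<Omega> \<longrightarrow> continuous_on {0..T} (\<lambda>s. w s \<omega>)"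
    and C: "\<And>N. finite (C N)" "\<And>N. c N ` {..<N} \<subseteq> C N"
  defines "R \<equiv> \<lambda>N j \<omega>. I (grid T N (Suc j)) \<omega> - I (grid T N j) \<omega>
      - \<xi> (grid T N j) \<omega> * (W (grid T N (Suc j)) \<omega> - W (grid T N j) \<omega>)"
  shows "(\<lambda>N. LINT \<omega>|M. min 1 (\<Sum>k\<in>C N. (\<Sum>j | j < N \<and> c N j = k. w (grid T N j) \<omega> * R N j \<omega>)\<^sup>2) * indicator \<Omega> \<omega>) \<longlonglongrightarrow> 0"
proof -
  interpret prob_space M using filtered_prob_spaceD(1)[OF fps] .
  have T0: "0 \<le> T" using T by simp
  have gT: "grid T N j \<in> {0..T}" if "j \<le> N" for N j using that by (auto simp: grid_nonneg grid_le T0)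
  have X: "AE \<omega> in M. set_borel_measurable lborel {0..T} (\<lambda>s. X s \<omega>) \<and> set_integrable lborel {0..T} (\<lambda>s. (X s \<omega>)\<^sup>2)"
    using I[of T] T0 unfolding has_ito_integral_def by simp
  have IM: "I t \<in> borel_measurable M" if "t \<in> {0..T}" for t using I[OF that] unfolding has_ito_integral_def by blast
  have WM: "W t \<in> borel_measurable M" if "t \<in> {0..T}" for t
    using filtered_prob_spaceD(4)[OF fps _ brownian_motionD(1)[OF bm]] that by auto
  have \<xi>M: "\<xi> t \<in> borel_measurable M" "w t \<in> borel_measurable M" if "t \<in> {0..T}" for t
    using filtered_prob_spaceD(4)[OF fps _ \<xi>(1)[OF that]] filtered_prob_spaceD(4)[OF fps _ w[OF that]] that by auto
  have "has_ito_integral M F W X T (I T)" using I[of T] T0 by simp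
  from has_ito_integral_AE[OF prob_space_axioms this]
  obtain S where S: "\<And>m. is_simple_process F (S m)"
    and Sa: "AE \<omega> in M. (\<lambda>m. LINT s:{0..T}|lborel. (simple_process (S m) s \<omega> - X s \<omega>)\<^sup>2) \<longlonglongrightarrow> 0"
    by blast
  define J where "J m t \<omega> = simple_integral W (S m) t \<omega>" for m t \<omega>
  have JM: "J m t \<in> borel_measurable M" if "t \<in> {0..T}" for m t
    using simple_integral_measurable[OF fps bm S] that by (simp add: J_def[abs_def])
  have int1: "integrable M (\<lambda>\<omega>. min 1 (f \<omega>) * indicator A \<omega>)"
    if "f \<in> borel_measurable M" "\<And>\<omega>. 0 \<le> f \<omega>" "A \<in> events" for f :: "'a \<Rightarrow> real" and A
    using that by (intro integrable_const_bound[of _ 1]) (auto simp: indicator_def)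
  \<comment> \<open>One sequence \<open>S\<close>, chosen for the final time \<open>T\<close>, now
    serves all earlier times: \<open>J m t\<close> tends to \<open>I t\<close> in truncated
    mean.\<close>
  have JI: "(\<lambda>m. expectation (\<lambda>\<omega>. min 1 ((J m t \<omega> - I t \<omega>)\<^sup>2) * indicator (space M) \<omega>)) \<longlonglongrightarrow> 0"
    if t: "t \<in> {0..T}" for t
  proof -
    from has_ito_integral_AE[OF prob_space_axioms I[OF t]]
    obtain S' where S': "\<And>m. is_simple_process F (S' m)"
      "AE \<omega> in M. (\<lambda>m. LINT s:{0..t}|lborel. (simple_process (S' m) s \<omega> - X s \<omega>)\<^sup>2) \<longlonglongrightarrow> 0"
      "AE \<omega> in M. (\<lambda>m. simple_integral W (S' m) t \<omega>) \<longlonglongrightarrow> I t \<omega>" by blast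
    have J'M: "simple_integral W (S' m) t \<in> borel_measurable M" for m
      using simple_integral_measurable[OF fps bm S'(1)] t by simp
    have l1: "(\<lambda>m. expectation (\<lambda>\<omega>. min 1 ((J m t \<omega> - simple_integral W (S' m) t \<omega>)\<^sup>2) * indicator (space M) \<omega>)) \<longlonglongrightarrow> 0"
      unfolding J_def by (rule simple_integral_same_limit[OF fps bm t S S'(1) X Sa S'(2)])
    have l2: "(\<lambda>m. expectation (\<lambda>\<omega>. min 1 ((simple_integral W (S' m) t \<omega> - I t \<omega>)\<^sup>2) * indicator (space M) \<omega>)) \<longlonglongrightarrow> 0"
    proof (rule expectation_min1_tendsto_0[OF _ _ sets.top])
      show "AE \<omega> in M. \<omega> \<in> space M \<longrightarrow> (\<lambda>m. (simple_integral W (S' m) t \<omega> - I t \<omega>)\<^sup>2) \<longlonglongrightarrow> 0"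
        using S'(3)
      proof (eventually_elim, intro impI)
        fix \<omega> assume "(\<lambda>m. simple_integral W (S' m) t \<omega>) \<longlonglongrightarrow> I t \<omega>"
        then have "(\<lambda>m. (simple_integral W (S' m) t \<omega> - I t \<omega>)\<^sup>2) \<longlonglongrightarrow> (I t \<omega> - I t \<omega>)\<^sup>2"
          by (intro tendsto_intros)
        then show "(\<lambda>m. (simple_integral W (S' m) t \<omega> - I t \<omega>)\<^sup>2) \<longlonglongrightarrow> 0" by simp
      qed
    qed (use J'M IM[OF t] in measurable)
    have "expectation (\<lambda>\<omega>. min 1 ((J m t \<omega> - I t \<omega>)\<^sup>2) * indicator (space M) \<omega>)
      \<le> 2 * expectation (\<lambda>\<omega>. min 1 ((J m t \<omega> - simple_integral W (S' m) t \<omega>)\<^sup>2) * indicator (space M) \<omega>)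
       + 2 * expectation (\<lambda>\<omega>. min 1 ((simple_integral W (S' m) t \<omega> - I t \<omega>)\<^sup>2) * indicator (space M) \<omega>)" for m
    proof -
      have i: "integrable M (\<lambda>\<omega>. min 1 ((J m t \<omega> - simple_integral W (S' m) t \<omega>)\<^sup>2) * indicator (space M) \<omega>)"
        "integrable M (\<lambda>\<omega>. min 1 ((simple_integral W (S' m) t \<omega> - I t \<omega>)\<^sup>2) * indicator (space M) \<omega>)"
        "integrable M (\<lambda>\<omega>. min 1 ((J m t \<omega> - I t \<omega>)\<^sup>2) * indicator (space M) \<omega>)"
        using J'M IM[OF t] JM[OF t] by (auto intro!: int1)
      have pw: "min 1 ((x - z)\<^sup>2) * r \<le> 2 * (min 1 ((x - y)\<^sup>2) * r) + 2 * (min 1 ((y - z)\<^sup>2) * r)"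
        if "0 \<le> r" for x y z r :: real
      proof -
        have "(x - z)\<^sup>2 \<le> 2 * (x - y)\<^sup>2 + 2 * (y - z)\<^sup>2"
          using zero_le_power2[of "x - 2 * y + z"] by (simp add: power2_eq_square algebra_simps)
        moreover have "min 1 a \<le> 2 * min 1 b + 2 * min 1 c" if "a \<le> 2 * b + 2 * c" "0 \<le> b" "0 \<le> c" for a b c :: real
          using that by (auto simp: min_def)
        ultimately have "min 1 ((x - z)\<^sup>2) \<le> 2 * min 1 ((x - y)\<^sup>2) + 2 * min 1 ((y - z)\<^sup>2)"
          by simp
        from mult_right_mono[OF this that] show ?thesis by (simp add: algebra_simps)
      qed
      have "expectation (\<lambda>\<omega>. min 1 ((J m t \<omega> - I t \<omega>)\<^sup>2) * indicator (space M) \<omega>) \<le>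
        expectation (\<lambda>\<omega>. 2 * (min 1 ((J m t \<omega> - simple_integral W (S' m) t \<omega>)\<^sup>2) * indicator (space M) \<omega>)
        + 2 * (min 1 ((simple_integral W (S' m) t \<omega> - I t \<omega>)\<^sup>2) * indicator (space M) \<omega>))"
        by (rule integral_mono[OF i(3) Bochner_Integration.integrable_add pw]; (intro integrable_mult_right i)?) simp
      also have "\<dots> = 2 * expectation (\<lambda>\<omega>. min 1 ((J m t \<omega> - simple_integral W (S' m) t \<omega>)\<^sup>2) * indicator (space M) \<omega>)
       + 2 * expectation (\<lambda>\<omega>. min 1 ((simple_integral W (S' m) t \<omega> - I t \<omega>)\<^sup>2) * indicator (space M) \<omega>)"
        by (subst Bochner_Integration.integral_add; (intro integrable_mult_right i)?) (simp only: integral_mult_right_zero)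
      finally show ?thesis .
    qed
    moreover have z: "(\<lambda>m. 2 * expectation (\<lambda>\<omega>. min 1 ((J m t \<omega> - simple_integral W (S' m) t \<omega>)\<^sup>2) * indicator (space M) \<omega>)
       + 2 * expectation (\<lambda>\<omega>. min 1 ((simple_integral W (S' m) t \<omega> - I t \<omega>)\<^sup>2) * indicator (space M) \<omega>)) \<longlonglongrightarrow> 0"
      by (intro tendsto_add_zero tendsto_mult_right_zero l1 l2)
    ultimately show ?thesis
      by (intro tendsto_sandwich[OF _ _ tendsto_const z] always_eventually allI integral_nonneg_AE AE_I2) auto
  qed
  define R' where "R' m N j \<omega> = J m (grid T N (Suc j)) \<omega> - J m (grid T N j) \<omega>
      - \<xi> (grid T N j) \<omega> * (W (grid T N (Suc j)) \<omega> - W (grid T N j) \<omega>)" for m N j \<omega>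
  define Q where "Q N \<omega> = (\<Sum>k\<in>C N. (\<Sum>j | j < N \<and> c N j = k. w (grid T N j) \<omega> * R N j \<omega>)\<^sup>2)" for N \<omega>
  define Q' where "Q' m N \<omega> = (\<Sum>k\<in>C N. (\<Sum>j | j < N \<and> c N j = k. w (grid T N j) \<omega> * R' m N j \<omega>)\<^sup>2)" for m N \<omega>
  have QM: "Q N \<in> borel_measurable M" "Q' m N \<in> borel_measurable M" for m N
    unfolding Q_def Q'_def R_def R'_def
    by (intro borel_measurable_sum borel_measurable_power borel_measurable_times borel_measurable_diff
        IM JM WM \<xi>M gT; simp)+
  have Qnn: "0 \<le> Q N \<omega>" "0 \<le> Q' m N \<omega>" for m N \<omega> by (auto simp: Q_def Q'_def intro!: sum_nonneg)
  \<comment> \<open>At the finitely many grid points belonging to \<open>N\<close>, \<open>I\<close>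
    can be replaced by simple integrals at a cost below \<open>1 / (N + 1)\<close> in truncated
    mean; \<open>m \<ge> N\<close> ensures that the approximation improves with
    \<open>N\<close>.\<close>
  have ex: "\<exists>m\<ge>N. expectation (\<lambda>\<omega>. \<bar>min 1 (Q' m N \<omega>) - min 1 (Q N \<omega>)\<bar>) < 1 / real (Suc N)" for N
  proof -
    define u where "u m \<omega> = (\<Sum>j\<le>N. min 1 ((J m (grid T N j) \<omega> - I (grid T N j) \<omega>)\<^sup>2) * indicator (space M) \<omega>)" for m \<omega>
    have ui: "integrable M (\<lambda>\<omega>. min 1 ((J m (grid T N j) \<omega> - I (grid T N j) \<omega>)\<^sup>2) * indicator (space M) \<omega>)" if "j \<le> N" for m j
      using JM[OF gT[OF that]] IM[OF gT[OF that]] by (auto intro!: int1)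
    have unn: "0 \<le> u m \<omega>" for m \<omega> by (auto simp: u_def intro!: sum_nonneg)
    have "expectation (u m) = (\<Sum>j\<le>N. expectation (\<lambda>\<omega>. min 1 ((J m (grid T N j) \<omega> - I (grid T N j) \<omega>)\<^sup>2) * indicator (space M) \<omega>))" for m
      unfolding u_def by (rule Bochner_Integration.integral_sum) (use ui in auto)
    moreover have "(\<lambda>m. \<Sum>j\<le>N. expectation (\<lambda>\<omega>. min 1 ((J m (grid T N j) \<omega> - I (grid T N j) \<omega>)\<^sup>2) * indicator (space M) \<omega>)) \<longlonglongrightarrow> 0"
      by (intro tendsto_null_sum JI gT) auto
    ultimately have "(\<lambda>m. expectation (\<lambda>\<omega>. norm (u m \<omega>))) \<longlonglongrightarrow> 0" using unn by simp
    moreover have "integrable M (u m)" for m unfolding u_def by (rule Bochner_Integration.integrable_sum) (use ui in auto)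
    ultimately obtain r where r: "strict_mono r" "AE \<omega> in M. (\<lambda>i. u (r i) \<omega>) \<longlonglongrightarrow> 0"
      using tendsto_L1_AE_subseq[of M u] by blast
    have conv: "AE \<omega> in M. (\<lambda>i. Q' (r i) N \<omega>) \<longlonglongrightarrow> Q N \<omega>"
      using r(2) AE_space
    proof eventually_elim
      case (elim \<omega>)
      have JI': "(\<lambda>i. J (r i) (grid T N j) \<omega>) \<longlonglongrightarrow> I (grid T N j) \<omega>" if j: "j \<le> N" for j
      proof -
        let ?x = "\<lambda>i. J (r i) (grid T N j) \<omega> - I (grid T N j) \<omega>"
        have "(\<lambda>i. min 1 ((?x i)\<^sup>2)) \<longlonglongrightarrow> 0"
        proof (rule tendsto_sandwich[OF _ _ tendsto_const elim(1)])
          have "min 1 ((?x i)\<^sup>2) \<le> u (r i) \<omega>" for i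
            unfolding u_def using member_le_sum[of j "{..N}" "\<lambda>j. min 1 ((J (r i) (grid T N j) \<omega> - I (grid T N j) \<omega>)\<^sup>2) * indicator (space M) \<omega>"] j elim(2) by auto
          then show "eventually (\<lambda>i. min 1 ((?x i)\<^sup>2) \<le> u (r i) \<omega>) sequentially" by simp
        qed simp
        moreover from order_tendstoD(2)[OF this, of 1]
        have "eventually (\<lambda>i. min 1 ((?x i)\<^sup>2) = (?x i)\<^sup>2) sequentially" by (auto elim!: eventually_mono)
        ultimately have "(\<lambda>i. (?x i)\<^sup>2) \<longlonglongrightarrow> 0" by (rule Lim_transform_eventually)
        from tendsto_real_sqrt[OF this] have "?x \<longlonglongrightarrow> 0" by (simp add: tendsto_rabs_zero_iff)
        then show ?thesis by (simp add: LIM_zero_iff)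
      qed
      show ?case unfolding Q'_def Q_def R'_def R_def
        by (intro tendsto_sum tendsto_power tendsto_mult tendsto_diff tendsto_const JI') auto
    qed
    have "(\<lambda>i. expectation (\<lambda>\<omega>. \<bar>min 1 (Q' (r i) N \<omega>) - min 1 (Q N \<omega>)\<bar>)) \<longlonglongrightarrow> expectation (\<lambda>\<omega>. 0)"
    proof (rule integral_dominated_convergence[where w="\<lambda>_. 1"])
      show "AE \<omega> in M. (\<lambda>i. \<bar>min 1 (Q' (r i) N \<omega>) - min 1 (Q N \<omega>)\<bar>) \<longlonglongrightarrow> 0"
        using conv
      proof eventually_elim
        case (elim \<omega>)
        then have "(\<lambda>i. \<bar>min 1 (Q' (r i) N \<omega>) - min 1 (Q N \<omega>)\<bar>) \<longlonglongrightarrow> \<bar>min 1 (Q N \<omega>) - min 1 (Q N \<omega>)\<bar>"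
          by (intro tendsto_rabs tendsto_diff tendsto_min tendsto_const)
        then show ?case by simp
      qed
      have "\<bar>min 1 a - min 1 b\<bar> \<le> 1" if "0 \<le> a" "0 \<le> b" for a b :: real using that by (auto simp: min_def)
      then show "AE \<omega> in M. norm (\<bar>min 1 (Q' (r i) N \<omega>) - min 1 (Q N \<omega>)\<bar>) \<le> 1" for i using Qnn by simp
    qed (use QM in measurable)
    then have "(\<lambda>i. expectation (\<lambda>\<omega>. \<bar>min 1 (Q' (r i) N \<omega>) - min 1 (Q N \<omega>)\<bar>)) \<longlonglongrightarrow> 0" by simp
    then have "eventually (\<lambda>i. expectation (\<lambda>\<omega>. \<bar>min 1 (Q' (r i) N \<omega>) - min 1 (Q N \<omega>)\<bar>) < 1 / real (Suc N)) sequentially"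
      by (rule order_tendstoD(2)) simp
    then have "eventually (\<lambda>i. expectation (\<lambda>\<omega>. \<bar>min 1 (Q' (r i) N \<omega>) - min 1 (Q N \<omega>)\<bar>) < 1 / real (Suc N) \<and> i \<ge> N) sequentially"
      using eventually_ge_at_top[of N] by (rule eventually_conj)
    then obtain i where "i \<ge> N" "expectation (\<lambda>\<omega>. \<bar>min 1 (Q' (r i) N \<omega>) - min 1 (Q N \<omega>)\<bar>) < 1 / real (Suc N)"
      using eventually_happens'[OF sequentially_bot] by blast
    moreover have "r i \<ge> N" using \<open>i \<ge> N\<close> strict_mono_imp_increasing[OF r(1), of i] by simp
    ultimately show ?thesis by blast
  qed
  then obtain m where m: "\<And>N. m N \<ge> N"
    "\<And>N. expectation (\<lambda>\<omega>. \<bar>min 1 (Q' (m N) N \<omega>) - min 1 (Q N \<omega>)\<bar>) < 1 / real (Suc N)" by metis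
  define A where "A N = simple_times (S (m N)) \<union> grid T N ` {..N} \<union> {0}" for N
  define xs where "xs N = sorted_list_of_set (A N)" for N
  \<comment> \<open>Integrand of the weighted remainder: the left-endpoint term freezes the process
    at the start of each cell, so \<open>S - \<xi>\<close> is what remains to be integrated there.
    The adapted \<open>\<xi>\<close> is used because \<open>X\<close> agrees with it only almost
    surely on \<open>\<Omega>\<close>.\<close>
  define H where "H N u \<omega> = (if 0 < u \<and> u \<le> T then w (grid T N (cell T N u)) \<omega> *
      (simple_process (S (m N)) u \<omega> - \<xi> (grid T N (cell T N u)) \<omega>) else 0)" for N u \<omega>
  have A: "finite (A N)" "0 \<in> A N" for N by (auto simp: A_def)
  have Ann: "0 \<le> a" if "a \<in> A N" for a N
    using that simple_times_nonneg[OF S] by (auto simp: A_def grid_nonneg T0)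
  have P: "sorted_wrt (<) (xs N)" "set (xs N) = A N" "xs N \<noteq> []" "xs N ! 0 = 0"
    "p < length (xs N) - 1 \<Longrightarrow> 0 \<le> xs N ! p" "p < length (xs N) - 1 \<Longrightarrow> xs N ! p < xs N ! Suc p" for N p
    using sorted_list_of_set_points[of "A N"] A[of N] Ann unfolding xs_def by blast+
  have gapS: "simple_times (S (m N)) \<inter> {xs N ! p<..<xs N ! Suc p} = {}" if "p < length (xs N) - 1" for N p
    using sorted_gap[OF P(1) that] P(2)[of N] by (force simp: A_def)
  have gA: "grid T N j \<in> A N" if "j \<le> N" for N j using that by (auto simp: A_def)
  have ggap: "u \<le> grid T N j \<longleftrightarrow> xs N ! Suc p \<le> grid T N j"
    if "p < length (xs N) - 1" "xs N ! p < u" "u \<le> xs N ! Suc p" "j \<le> N" for N p u j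
    using sorted_gap[OF P(1) that(1), of "grid T N j"] P(2)[of N] gA[OF that(4)] that by force
  have cellc: "0 < u \<and> u \<le> T \<longleftrightarrow> 0 < xs N ! Suc p \<and> xs N ! Suc p \<le> T"
    "0 < u \<Longrightarrow> u \<le> T \<Longrightarrow> cell T N u = cell T N (xs N ! Suc p)"
    "0 < u \<Longrightarrow> u \<le> T \<Longrightarrow> grid T N (cell T N u) \<le> xs N ! p"
    if p: "p < length (xs N) - 1" and u: "xs N ! p < u" "u \<le> xs N ! Suc p" and N: "N > 0" for N p u
  proof -
    have u0: "0 < u" using P(5)[OF p] u by simp
    have eq: "u \<le> T \<longleftrightarrow> xs N ! Suc p \<le> T" using ggap[OF p u, of N] N by simp
    then show "0 < u \<and> u \<le> T \<longleftrightarrow> 0 < xs N ! Suc p \<and> xs N ! Suc p \<le> T" using u0 u by simp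
    assume uT: "u \<le> T"
    note c = cell[OF T N u0 uT]
    have l: "grid T N (cell T N u) \<le> xs N ! p"
      using sorted_gap[OF P(1) p, of "grid T N (cell T N u)"] P(2)[of N] gA[of "cell T N u" N] c u by force
    then show "grid T N (cell T N u) \<le> xs N ! p" .
    have "xs N ! Suc p \<le> grid T N (Suc (cell T N u))" using ggap[OF p u, of "Suc (cell T N u)"] c by simp
    then show "cell T N u = cell T N (xs N ! Suc p)"
      using cell_unique[OF T N, of "cell T N u" "xs N ! Suc p"] l u by simp
  qed
  have Hm: "H N (xs N ! Suc p) \<in> borel_measurable (F (xs N ! p))" if N: "N > 0" and p: "p < length (xs N) - 1" for N p
  proof (cases "0 < xs N ! Suc p \<and> xs N ! Suc p \<le> T")
    case True
    let ?g = "grid T N (cell T N (xs N ! Suc p))"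
    have g: "?g \<le> xs N ! p" "?g \<in> {0..T}"
      using cellc(3)[OF p P(6)[OF p] order_refl N] True gT[OF less_imp_le[OF cell(1)[OF T N]]] by blast+
    have "w ?g \<in> borel_measurable (F (xs N ! p))" "\<xi> ?g \<in> borel_measurable (F (xs N ! p))"
      using filtered_prob_spaceD(3)[OF fps _ g(1)] w[OF g(2)] \<xi>(1)[OF g(2)] g(2) by auto
    then show ?thesis using True simple_process_measurable[OF fps S gapS[OF p] P(5,6)[OF p]]
      unfolding H_def by measurable
  next
    case False
    then show ?thesis unfolding H_def by auto
  qed
  have Hc: "H N u \<omega> = H N (xs N ! Suc p) \<omega>"
    if N: "N > 0" and p: "p < length (xs N) - 1" and u: "xs N ! p < u" "u \<le> xs N ! Suc p" for N p u \<omega>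
    unfolding H_def using cellc(1,2)[OF p u N] simple_process_const[OF gapS[OF p] u] by auto
  define V where "V N \<omega> = (\<Sum>p<length (xs N) - 1. (H N (xs N ! Suc p) \<omega>)\<^sup>2 * (xs N ! Suc p - xs N ! p))" for N \<omega>
  have Vnn: "0 \<le> V N \<omega>" for N \<omega>
    unfolding V_def using P(6)[of _ N] by (intro sum_nonneg mult_nonneg_nonneg) (auto simp: less_imp_le)
  have VM: "V N \<in> borel_measurable M" if "N > 0" for N
    unfolding V_def
    by (intro borel_measurable_sum borel_measurable_times borel_measurable_power borel_measurable_const
        filtered_prob_spaceD(4)[OF fps P(5) Hm]) (use that in auto)
  have grid_AE: "AE \<omega> in M. \<omega> \<in> \<Omega> \<longrightarrow> (\<forall>N j. j \<le> N \<longrightarrow> X (grid T N j) \<omega> = \<xi> (grid T N j) \<omega>)"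
  proof -
    have "AE \<omega> in M. \<forall>N j. j \<le> N \<longrightarrow> \<omega> \<in> \<Omega> \<longrightarrow> X (grid T N j) \<omega> = \<xi> (grid T N j) \<omega>"
      unfolding AE_all_countable
    proof (intro allI)
      fix N j
      show "AE \<omega> in M. j \<le> N \<longrightarrow> \<omega> \<in> \<Omega> \<longrightarrow> X (grid T N j) \<omega> = \<xi> (grid T N j) \<omega>"
        using \<xi>(2)[OF gT, of j N] by (cases "j \<le> N") auto
    qed
    then show ?thesis by eventually_elim blast
  qed
  \<comment> \<open>The bracket is bounded by the \<open>L\<^sup>2\<close> error of
    \<open>S (m N)\<close>, which tends to 0, plus the squared oscillation of the continuous path of
    \<open>X\<close> over one cell times \<open>T\<close>; both carry the factor
    \<open>2 * K\<^sup>2\<close> from the weights.\<close>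
  have V0: "AE \<omega> in M. \<omega> \<in> \<Omega> \<longrightarrow> (\<lambda>N. V N \<omega>) \<longlonglongrightarrow> 0"
    using X Sa grid_AE cont
  proof (eventually_elim, intro impI)
    fix \<omega> assume X: "set_borel_measurable lborel {0..T} (\<lambda>s. X s \<omega>) \<and> set_integrable lborel {0..T} (\<lambda>s. (X s \<omega>)\<^sup>2)"
      and a: "(\<lambda>m. LINT s:{0..T}|lborel. (simple_process (S m) s \<omega> - X s \<omega>)\<^sup>2) \<longlonglongrightarrow> 0"
      and g0: "\<omega> \<in> \<Omega> \<longrightarrow> (\<forall>N j. j \<le> N \<longrightarrow> X (grid T N j) \<omega> = \<xi> (grid T N j) \<omega>)"
      and c0: "\<omega> \<in> \<Omega> \<longrightarrow> continuous_on {0..T} (\<lambda>s. X s \<omega>)" "\<omega> \<in> \<Omega> \<longrightarrow> continuous_on {0..T} (\<lambda>s. w s \<omega>)"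
      and \<omega>: "\<omega> \<in> \<Omega>"
    note g = g0[rule_format, OF \<omega>] and cX = c0(1)[rule_format, OF \<omega>] and cw = c0(2)[rule_format, OF \<omega>]
    obtain K where K: "K \<ge> 0" "\<And>s. s \<in> {0..T} \<Longrightarrow> \<bar>w s \<omega>\<bar> \<le> K" using continuous_on_Icc_bounded[OF cw] by metis
    define a' where "a' N = (LINT s:{0..T}|lborel. (simple_process (S (m N)) s \<omega> - X s \<omega>)\<^sup>2)" for N
    have "filterlim m at_top sequentially" by (rule filterlim_at_top_mono[OF filterlim_ident]) (use m in auto)
    from filterlim_compose[OF a this] have a': "a' \<longlonglongrightarrow> 0" by (simp add: a'_def[abs_def])
    have i1: "set_integrable lborel {0..T} (\<lambda>s. (simple_process (S m) s \<omega> - X s \<omega>)\<^sup>2)" for m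
      by (rule simple_process_diff_sq_integrable[OF conjunct1[OF X] conjunct2[OF X]])
    have bound: "V N \<omega> \<le> 2 * K\<^sup>2 * a' N + 2 * K\<^sup>2 * e\<^sup>2 * T"
      if N: "N > 0" and osc: "\<forall>j<N. \<forall>s\<in>{grid T N j..grid T N (Suc j)}. \<forall>s'\<in>{grid T N j..grid T N (Suc j)}. \<bar>X s \<omega> - X s' \<omega>\<bar> < e"
      for N e
    proof -
      have iS: "set_integrable lborel {0..T} (\<lambda>u. 2 * K\<^sup>2 * (simple_process (S (m N)) u \<omega> - X u \<omega>)\<^sup>2)"
        by (rule set_integrable_mult_right) (rule i1)
      have ie: "set_integrable lborel {0..T} (\<lambda>u. 2 * K\<^sup>2 * e\<^sup>2)"
        by (intro borel_integrable_atLeastAtMost' continuous_on_const)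
      have "V N \<omega> \<le> (LINT u:{0..T}|lborel. 2 * K\<^sup>2 * (simple_process (S (m N)) u \<omega> - X u \<omega>)\<^sup>2 + 2 * K\<^sup>2 * e\<^sup>2)"
        unfolding V_def
      proof (rule step_bracket_le[where h="\<lambda>u. H N u \<omega>" and xs="xs N", OF P(1) P(3) _ Hc[OF N]])
        show "0 \<le> xs N ! 0" by (simp add: P(4))
        show "\<And>u. u > T \<Longrightarrow> H N u \<omega> = 0" by (simp add: H_def)
        show "set_integrable lborel {0..T} (\<lambda>u. 2 * K\<^sup>2 * (simple_process (S (m N)) u \<omega> - X u \<omega>)\<^sup>2 + 2 * K\<^sup>2 * e\<^sup>2)"
          by (rule set_integral_add(1)[OF iS ie])
        fix u assume u: "u \<in> {0<..T}"
        then have u': "0 < u" "u \<le> T" by auto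
        note c = cell[OF T N u']
        let ?g = "grid T N (cell T N u)"
        have X': "\<xi> ?g \<omega> = X ?g \<omega>" using g[of "cell T N u" N] c by simp
        have "\<bar>X u \<omega> - X ?g \<omega>\<bar> < e"
          using osc[rule_format, OF c(1), of u ?g] c(2,3) by (simp add: grid_mono T0)
        then have "(X u \<omega> - X ?g \<omega>)\<^sup>2 \<le> e\<^sup>2" using abs_le_square_iff[of "X u \<omega> - X ?g \<omega>" e] by auto
        moreover have "(w ?g \<omega>)\<^sup>2 \<le> K\<^sup>2" using K(2)[OF gT[of "cell T N u" N]] c(1) K(1) abs_le_square_iff[of "w ?g \<omega>" K] by auto
        moreover have "(a - b)\<^sup>2 \<le> 2 * (a - x)\<^sup>2 + 2 * (x - b)\<^sup>2" for a b x :: real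
          using zero_le_power2[of "a - 2 * x + b"] by (simp add: power2_eq_square algebra_simps)
        then have "(simple_process (S (m N)) u \<omega> - X ?g \<omega>)\<^sup>2
          \<le> 2 * (simple_process (S (m N)) u \<omega> - X u \<omega>)\<^sup>2 + 2 * (X u \<omega> - X ?g \<omega>)\<^sup>2" .
        ultimately have le: "(w ?g \<omega>)\<^sup>2 * (simple_process (S (m N)) u \<omega> - X ?g \<omega>)\<^sup>2
          \<le> K\<^sup>2 * (2 * (simple_process (S (m N)) u \<omega> - X u \<omega>)\<^sup>2 + 2 * e\<^sup>2)"
          by (intro mult_mono) auto
        show "(H N u \<omega>)\<^sup>2 \<le> 2 * K\<^sup>2 * (simple_process (S (m N)) u \<omega> - X u \<omega>)\<^sup>2 + 2 * K\<^sup>2 * e\<^sup>2"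
        proof -
          have H: "H N u \<omega> = w ?g \<omega> * (simple_process (S (m N)) u \<omega> - X ?g \<omega>)" using u' by (simp add: H_def X')
          have "K\<^sup>2 * (2 * z + 2 * e\<^sup>2) = 2 * K\<^sup>2 * z + 2 * K\<^sup>2 * e\<^sup>2" for z :: real by (simp add: algebra_simps)
          then show ?thesis using le unfolding H power_mult_distrib by metis
        qed
      qed auto
      also have "\<dots> = 2 * K\<^sup>2 * a' N + 2 * K\<^sup>2 * e\<^sup>2 * T"
        using set_integral_add(2)[OF iS ie] T by (simp add: a'_def set_lebesgue_integral_def)
      finally show ?thesis .
    qed
    show "(\<lambda>N. V N \<omega>) \<longlonglongrightarrow> 0"
    proof (rule LIMSEQ_I)
      fix r :: real assume r: "r > 0"
      define e where "e = sqrt (r / (4 * (K\<^sup>2 * T + 1)))"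
      have KT: "K\<^sup>2 * T + 1 > 0" using T by (simp add: add_nonneg_pos)
      have e: "e > 0" using r KT by (simp add: e_def)
      have "e\<^sup>2 = r / (4 * (K\<^sup>2 * T + 1))" using r KT by (simp add: e_def)
      then have "e\<^sup>2 * (K\<^sup>2 * T + 1) = r / 4" using KT by (simp add: field_simps)
      moreover have "e\<^sup>2 * (K\<^sup>2 * T) \<le> e\<^sup>2 * (K\<^sup>2 * T + 1)" by (rule mult_left_mono) auto
      ultimately have e2: "2 * K\<^sup>2 * e\<^sup>2 * T \<le> r / 2" by (simp add: mult_ac)
      have "(\<lambda>N. 2 * K\<^sup>2 * a' N) \<longlonglongrightarrow> 0" by (rule tendsto_mult_right_zero[OF a'])
      then have "eventually (\<lambda>N. 2 * K\<^sup>2 * a' N < r / 2) sequentially" by (rule order_tendstoD(2)) (use r in simp)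
      then have "eventually (\<lambda>N. norm (V N \<omega> - 0) < r) sequentially"
        using grid_uniform_continuity[OF cX T0 e] eventually_gt_at_top[of 0]
      proof eventually_elim
        case (elim N)
        then show ?case using bound[of N e] e2 Vnn[of N \<omega>] by auto
      qed
      then show "\<exists>no. \<forall>N\<ge>no. norm (V N \<omega> - 0) < r" by (simp add: eventually_sequentially)
    qed
  qed
  \<comment> \<open>The properties of \<open>V\<close> are available for \<open>N > 0\<close>; the
    default value 0 covers the remaining cases.\<close>
  define V1 where "V1 b N \<omega> = (if N > 0 \<and> b > 0 then V N \<omega> / b else 0)" for b N \<omega>
  have "(\<lambda>N. expectation (\<lambda>\<omega>. min 1 (Q N \<omega>) * indicator \<Omega> \<omega>)) \<longlonglongrightarrow> 0"
  proof (rule tendsto_0_by_slack)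
    show "0 \<le> expectation (\<lambda>\<omega>. min 1 (Q N \<omega>) * indicator \<Omega> \<omega>)" for N
      using Qnn by (intro integral_nonneg_AE AE_I2) auto
    show "(\<lambda>N. expectation (\<lambda>\<omega>. min 1 (V1 b N \<omega>) * indicator \<Omega> \<omega>) + 1 / real (Suc N)) \<longlonglongrightarrow> 0" if b: "b > 0" for b
    proof (rule tendsto_add_zero)
      show "(\<lambda>N. expectation (\<lambda>\<omega>. min 1 (V1 b N \<omega>) * indicator \<Omega> \<omega>)) \<longlonglongrightarrow> 0"
      proof (rule expectation_min1_tendsto_0[OF _ _ \<Omega>])
        show "V1 b N \<in> borel_measurable M" for N
          using VM[of N] by (cases "N > 0 \<and> b > 0") (auto simp: V1_def[abs_def])
        show "0 \<le> V1 b N \<omega>" for N \<omega> using Vnn by (simp add: V1_def)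
        show "AE \<omega> in M. \<omega> \<in> \<Omega> \<longrightarrow> (\<lambda>N. V1 b N \<omega>) \<longlonglongrightarrow> 0"
          using V0
        proof (eventually_elim, intro impI)
          fix \<omega> assume "\<omega> \<in> \<Omega> \<longrightarrow> (\<lambda>N. V N \<omega>) \<longlonglongrightarrow> 0" "\<omega> \<in> \<Omega>"
          then have z: "(\<lambda>N. V N \<omega> / b) \<longlonglongrightarrow> 0" using tendsto_divide_zero by blast
          show "(\<lambda>N. V1 b N \<omega>) \<longlonglongrightarrow> 0"
            by (rule tendsto_sandwich[OF _ _ tendsto_const z]) (use Vnn b in \<open>auto simp: V1_def intro!: always_eventually\<close>)
        qed
      qed
      show "(\<lambda>N. 1 / real (Suc N)) \<longlonglongrightarrow> 0" by real_asymp
    qed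
    show "expectation (\<lambda>\<omega>. min 1 (Q N \<omega>) * indicator \<Omega> \<omega>)
      \<le> (expectation (\<lambda>\<omega>. min 1 (V1 b N \<omega>) * indicator \<Omega> \<omega>) + 1 / real (Suc N)) + b" if b: "b > 0" and N: "N > 0" for b N
    proof -
      interpret difference_array M "\<lambda>p. F (xs N ! p)" "\<lambda>p \<omega>. W (xs N ! Suc p) \<omega> - W (xs N ! p) \<omega>"
        "\<lambda>p. xs N ! Suc p - xs N ! p" "length (xs N) - 1"
        by (rule brownian_increment_array[OF fps bm]) (use P(4,6) in auto)
      \<comment> \<open>Each refined interval inherits the block of its cell. Intervals beyond
        \<open>T\<close> carry \<open>H = 0\<close>, so assigning them to cell 0 changes no sum and
        keeps the block inside \<open>C N\<close>.\<close>
      define \<kappa> where "\<kappa> p = c N (if 0 < xs N ! Suc p \<and> xs N ! Suc p \<le> T then cell T N (xs N ! Suc p) else 0)" for p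
      have \<kappa>C: "\<kappa> ` {..<length (xs N) - 1} \<subseteq> C N"
        using C(2)[of N] N cell(1)[OF T N] by (auto simp: \<kappa>_def)
      define n where "n = length (xs N) - 1"
      define dW where "dW p \<omega> = W (xs N ! Suc p) \<omega> - W (xs N ! p) \<omega>" for p \<omega>
      have term1: "w (grid T N j) \<omega> * R' (m N) N j \<omega> =
          (\<Sum>p<n. if 0 < xs N ! Suc p \<and> xs N ! Suc p \<le> T \<and> cell T N (xs N ! Suc p) = j then H N (xs N ! Suc p) \<omega> * dW p \<omega> else 0)"
        if j: "j < N" for j \<omega>
      proof -
        let ?a = "grid T N j" and ?b = "grid T N (Suc j)"
        have ab: "?a \<le> ?b" by (rule grid_mono[OF T0]) simp
        have inA: "?a \<in> set (xs N)" "?b \<in> set (xs N)" using gA[of j N] gA[of "Suc j" N] j P(2)[of N] by auto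
        have sub: "simple_times (S (m N)) \<subseteq> set (xs N)" using P(2)[of N] by (auto simp: A_def)
        have tel: "W ?b \<omega> - W ?a \<omega> = (\<Sum>p<n. if ?a < xs N ! Suc p \<and> xs N ! Suc p \<le> ?b then dW p \<omega> else 0)"
          unfolding n_def dW_def by (rule sorted_telescope[OF P(1) inA ab, of "\<lambda>s. W s \<omega>", symmetric])
        have Jd: "J (m N) ?b \<omega> - J (m N) ?a \<omega> = (\<Sum>p<n. if ?a < xs N ! Suc p \<and> xs N ! Suc p \<le> ?b
            then simple_process (S (m N)) (xs N ! Suc p) \<omega> * dW p \<omega> else 0)"
          unfolding J_def simple_integral_eq_sum[OF P(1) S sub inA(1)] simple_integral_eq_sum[OF P(1) S sub inA(2)]
            sum_subtractf[symmetric] n_def dW_def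
          by (rule sum.cong) (use ab in auto)
        have iff: "?a < u \<and> u \<le> ?b \<longleftrightarrow> 0 < u \<and> u \<le> T \<and> cell T N u = j" for u
        proof
          assume u: "?a < u \<and> u \<le> ?b"
          then show "0 < u \<and> u \<le> T \<and> cell T N u = j"
            using cell_unique[OF T N] gT[of j N] gT[of "Suc j" N] j by fastforce
        next
          assume "0 < u \<and> u \<le> T \<and> cell T N u = j"
          then show "?a < u \<and> u \<le> ?b" using cell[OF T N] by blast
        qed
        have "w ?a \<omega> * R' (m N) N j \<omega> = (\<Sum>p<n. w ?a \<omega> * ((if ?a < xs N ! Suc p \<and> xs N ! Suc p \<le> ?b
            then simple_process (S (m N)) (xs N ! Suc p) \<omega> * dW p \<omega> else 0)
            - \<xi> ?a \<omega> * (if ?a < xs N ! Suc p \<and> xs N ! Suc p \<le> ?b then dW p \<omega> else 0)))"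
          unfolding R'_def Jd tel by (simp only: sum_distrib_left sum_subtractf right_diff_distrib)
        also have "\<dots> = (\<Sum>p<n. if 0 < xs N ! Suc p \<and> xs N ! Suc p \<le> T \<and> cell T N (xs N ! Suc p) = j then H N (xs N ! Suc p) \<omega> * dW p \<omega> else 0)"
          unfolding iff by (rule sum.cong) (auto simp: H_def algebra_simps)
        finally show ?thesis .
      qed
      have block: "(\<Sum>j | j < N \<and> c N j = k. w (grid T N j) \<omega> * R' (m N) N j \<omega>)
        = (\<Sum>p | p < n \<and> \<kappa> p = k. H N (xs N ! Suc p) \<omega> * dW p \<omega>)" for k \<omega>
      proof -
        have "(\<Sum>j | j < N \<and> c N j = k. w (grid T N j) \<omega> * R' (m N) N j \<omega>) = (\<Sum>j | j < N \<and> c N j = k.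
          \<Sum>p<n. if 0 < xs N ! Suc p \<and> xs N ! Suc p \<le> T \<and> cell T N (xs N ! Suc p) = j then H N (xs N ! Suc p) \<omega> * dW p \<omega> else 0)"
          by (rule sum.cong) (use term1 in auto)
        also have "\<dots> = (\<Sum>p<n. \<Sum>j | j < N \<and> c N j = k.
          if 0 < xs N ! Suc p \<and> xs N ! Suc p \<le> T \<and> cell T N (xs N ! Suc p) = j then H N (xs N ! Suc p) \<omega> * dW p \<omega> else 0)"
          by (rule sum.swap)
        also have "\<dots> = (\<Sum>p<n. if \<kappa> p = k then H N (xs N ! Suc p) \<omega> * dW p \<omega> else 0)"
        proof (rule sum.cong[OF refl])
          fix p
          let ?u = "xs N ! Suc p" and ?h = "H N (xs N ! Suc p) \<omega> * dW p \<omega>"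
          show "(\<Sum>j | j < N \<and> c N j = k. if 0 < ?u \<and> ?u \<le> T \<and> cell T N ?u = j then ?h else 0) = (if \<kappa> p = k then ?h else 0)"
          proof (cases "0 < ?u \<and> ?u \<le> T")
            case True
            then have "(\<Sum>j | j < N \<and> c N j = k. if 0 < ?u \<and> ?u \<le> T \<and> cell T N ?u = j then ?h else 0)
              = (\<Sum>j\<in>{j. j < N \<and> c N j = k}. if cell T N ?u = j then ?h else 0)" by simp
            also have "\<dots> = (if cell T N ?u \<in> {j. j < N \<and> c N j = k} then ?h else 0)"
              by (rule sum.delta') simp
            finally show ?thesis using True cell(1)[OF T N, of ?u] by (simp add: \<kappa>_def)
          next
            case False
            then have "H N ?u \<omega> = 0" unfolding H_def by auto
            then have "?h = 0" by simp
            then show ?thesis by (intro trans[OF sum.neutral]) auto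
          qed
        qed
        also have "\<dots> = (\<Sum>p | p < n \<and> \<kappa> p = k. H N (xs N ! Suc p) \<omega> * dW p \<omega>)"
          by (subst sum.inter_filter[symmetric]) (auto intro!: sum.cong)
        finally show ?thesis .
      qed
      have "expectation (\<lambda>\<omega>. min 1 (Q' (m N) N \<omega>) * indicator \<Omega> \<omega>)
         \<le> expectation (\<lambda>\<omega>. min 1 (V1 b N \<omega>) * indicator \<Omega> \<omega>) + b"
        unfolding Q'_def block n_def dW_def
        using lenglart[OF Hm[OF N] b \<Omega> C(1) \<kappa>C] N b by (simp add: V1_def V_def)
      moreover have "expectation (\<lambda>\<omega>. min 1 (Q N \<omega>) * indicator \<Omega> \<omega>)
        \<le> expectation (\<lambda>\<omega>. min 1 (Q' (m N) N \<omega>) * indicator \<Omega> \<omega>) + expectation (\<lambda>\<omega>. \<bar>min 1 (Q' (m N) N \<omega>) - min 1 (Q N \<omega>)\<bar>)"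
      proof -
        have i: "integrable M (\<lambda>\<omega>. min 1 (Q N \<omega>) * indicator \<Omega> \<omega>)" "integrable M (\<lambda>\<omega>. min 1 (Q' (m N) N \<omega>) * indicator \<Omega> \<omega>)"
          using QM Qnn \<Omega> by (auto intro!: int1)
        have "\<bar>min 1 a - min 1 b\<bar> \<le> 1" if "0 \<le> a" "0 \<le> b" for a b :: real using that by (auto simp: min_def)
        then have i3: "integrable M (\<lambda>\<omega>. \<bar>min 1 (Q' (m N) N \<omega>) - min 1 (Q N \<omega>)\<bar>)"
          using QM Qnn by (intro integrable_const_bound[of _ 1]) auto
        have "expectation (\<lambda>\<omega>. min 1 (Q N \<omega>) * indicator \<Omega> \<omega>)
          \<le> expectation (\<lambda>\<omega>. min 1 (Q' (m N) N \<omega>) * indicator \<Omega> \<omega> + \<bar>min 1 (Q' (m N) N \<omega>) - min 1 (Q N \<omega>)\<bar>)"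
          by (rule integral_mono[OF i(1) Bochner_Integration.integrable_add[OF i(2) i3]]) (auto simp: indicator_def)
        then show ?thesis using i(2) i3 by simp
      qed
      ultimately show ?thesis using m(2)[of N] by linarith
    qed
  qed
  then show ?thesis by (simp add: Q_def)
qed

section \<open>The exponential of the noise\<close>

lemma (in prob_space) gaussian_rv_square_integrable:
  assumes "gaussian_rv M X"
  shows "X \<in> borel_measurable M" "integrable M (\<lambda>\<omega>. (X \<omega>)\<^sup>2)"
proof -
  show X: "X \<in> borel_measurable M" using assms unfolding gaussian_rv_def by blast
  obtain \<mu> where "(AE \<omega> in M. X \<omega> = \<mu>) \<or> (\<exists>\<sigma>>0. distributed M lborel X (\<lambda>x. ennreal (normal_density \<mu> \<sigma> x)))"
    using assms unfolding gaussian_rv_def by blast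
  then show "integrable M (\<lambda>\<omega>. (X \<omega>)\<^sup>2)"
  proof
    assume "AE \<omega> in M. X \<omega> = \<mu>"
    then have "AE \<omega> in M. norm ((X \<omega>)\<^sup>2) \<le> \<mu>\<^sup>2" by eventually_elim simp
    then show ?thesis using X by (intro integrable_const_bound[of _ "\<mu>\<^sup>2"]) auto
  next
    assume "\<exists>\<sigma>>0. distributed M lborel X (\<lambda>x. ennreal (normal_density \<mu> \<sigma> x))"
    then obtain \<sigma> where \<sigma>: "\<sigma> > 0" and D: "distributed M lborel X (\<lambda>x. ennreal (normal_density \<mu> \<sigma> x))" by blast
    have "integrable lborel (\<lambda>x. normal_density \<mu> \<sigma> x * (x - \<mu>) ^ 2 + 2 * \<mu> * (normal_density \<mu> \<sigma> x * (x - \<mu>) ^ 1)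
      + \<mu>\<^sup>2 * normal_density \<mu> \<sigma> x)"
      by (intro Bochner_Integration.integrable_add integrable_mult_right integrable_normal_moment integrable_normal_density \<sigma>)
    moreover have "normal_density \<mu> \<sigma> x * (x - \<mu>) ^ 2 + 2 * \<mu> * (normal_density \<mu> \<sigma> x * (x - \<mu>) ^ 1)
      + \<mu>\<^sup>2 * normal_density \<mu> \<sigma> x = normal_density \<mu> \<sigma> x * x\<^sup>2" for x
      by (simp add: power2_eq_square algebra_simps)
    ultimately have "integrable lborel (\<lambda>x. normal_density \<mu> \<sigma> x * x\<^sup>2)" by simp
    then show ?thesis using distributed_integrable[OF D, of "\<lambda>x. x\<^sup>2"] by simp
  qed
qed

text \<open>Integrability comes from the Gaussian marginal, which is the linear combination with the
  single time \<open>t\<close>; the covariance on the diagonal then gives the second moment.\<close>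

lemma (in prob_space) fbm_square_integrable:
  assumes "fractional_brownian_motion M H B" "0 \<le> t"
  shows "B t \<in> borel_measurable M" "integrable M (\<lambda>\<omega>. (B t \<omega>)\<^sup>2)"
    "expectation (\<lambda>\<omega>. (B t \<omega>)\<^sup>2) = t powr (2 * H)"
proof -
  have gp: "gaussian_process M B" using assms(1) unfolding fractional_brownian_motion_def by blast
  have "gaussian_rv M (B t)"
    using gp[unfolded gaussian_process_def, rule_format, of "{t}" "\<lambda>_. 1"] assms(2) by simp
  then show "B t \<in> borel_measurable M" "integrable M (\<lambda>\<omega>. (B t \<omega>)\<^sup>2)"
    using gaussian_rv_square_integrable by auto
  have "expectation (\<lambda>\<omega>. B t \<omega> * B t \<omega>) = (t powr (2 * H) + t powr (2 * H) - \<bar>t - t\<bar> powr (2 * H)) / 2"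
    using assms unfolding fractional_brownian_motion_def by blast
  then show "expectation (\<lambda>\<omega>. (B t \<omega>)\<^sup>2) = t powr (2 * H)" by (simp add: power2_eq_square)
qed

lemma (in prob_space) fbm_increment:
  assumes B: "fractional_brownian_motion M H B" and st: "0 \<le> s" "s \<le> t"
  shows "integrable M (\<lambda>\<omega>. (B t \<omega> - B s \<omega>)\<^sup>2)"
    "expectation (\<lambda>\<omega>. (B t \<omega> - B s \<omega>)\<^sup>2) = (t - s) powr (2 * H)"
proof -
  have t: "0 \<le> t" using st by simp
  note S = fbm_square_integrable[OF B st(1)] and T = fbm_square_integrable[OF B t]
  have P: "integrable M (\<lambda>\<omega>. B s \<omega> * B t \<omega>)"
  proof (rule Bochner_Integration.integrable_bound[OF Bochner_Integration.integrable_add[OF S(2) T(2)]])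
    have "\<bar>x * y\<bar> \<le> x\<^sup>2 + y\<^sup>2" for x y :: real
    proof -
      have "2 * (\<bar>x\<bar> * \<bar>y\<bar>) \<le> x\<^sup>2 + y\<^sup>2" using sum_squares_bound[of "\<bar>x\<bar>" "\<bar>y\<bar>"] by (simp add: mult.assoc)
      moreover have "0 \<le> \<bar>x\<bar> * \<bar>y\<bar>" by simp
      ultimately show ?thesis unfolding abs_mult by linarith
    qed
    then show "AE \<omega> in M. norm (B s \<omega> * B t \<omega>) \<le> norm ((B s \<omega>)\<^sup>2 + (B t \<omega>)\<^sup>2)" by simp
  qed (use S(1) T(1) in measurable)
  have eq: "(B t \<omega> - B s \<omega>)\<^sup>2 = (B t \<omega>)\<^sup>2 - 2 * (B s \<omega> * B t \<omega>) + (B s \<omega>)\<^sup>2" for \<omega>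
    by (simp add: power2_diff algebra_simps)
  show "integrable M (\<lambda>\<omega>. (B t \<omega> - B s \<omega>)\<^sup>2)" unfolding eq using S T P by simp
  have "expectation (\<lambda>\<omega>. B s \<omega> * B t \<omega>) = (s powr (2 * H) + t powr (2 * H) - \<bar>t - s\<bar> powr (2 * H)) / 2"
    using B st t unfolding fractional_brownian_motion_def by blast
  then show "expectation (\<lambda>\<omega>. (B t \<omega> - B s \<omega>)\<^sup>2) = (t - s) powr (2 * H)"
    unfolding eq using S T P st by simp
qed

text \<open>The sum has mean \<open>N * (T / N) powr (2 * H)\<close>, of order
  \<open>N powr (1 - 2 * H)\<close>. This is where \<open>H > 1 / 2\<close> enters; it also makes
  the covariation with \<open>W\<close> negligible.\<close>

lemma (in prob_space) fbm_quadratic_variation: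
  assumes B: "fractional_brownian_motion M H B" and H: "1 / 2 < H" and T: "0 < T"
  shows "integrable M (\<lambda>\<omega>. \<Sum>j<N. (B (grid T N (Suc j)) \<omega> - B (grid T N j) \<omega>)\<^sup>2)"
    and "(\<lambda>N. expectation (\<lambda>\<omega>. \<Sum>j<N. (B (grid T N (Suc j)) \<omega> - B (grid T N j) \<omega>)\<^sup>2)) \<longlonglongrightarrow> 0"
proof -
  have T0: "0 \<le> T" using T by simp
  note inc = fbm_increment[OF B grid_nonneg[OF T0] grid_mono[OF T0 le_SucI[OF order_refl]]]
  show i: "integrable M (\<lambda>\<omega>. \<Sum>j<N. (B (grid T N (Suc j)) \<omega> - B (grid T N j) \<omega>)\<^sup>2)" for N
    by (intro Bochner_Integration.integrable_sum inc)
  have eq: "expectation (\<lambda>\<omega>. \<Sum>j<N. (B (grid T N (Suc j)) \<omega> - B (grid T N j) \<omega>)\<^sup>2) = real N * (T / real N) powr (2 * H)" for N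
    by (subst Bochner_Integration.integral_sum) (simp_all add: inc grid_Suc_diff)
  have "(\<lambda>N. real N * (T / real N) powr (2 * H)) \<longlonglongrightarrow> 0" using H T by real_asymp
  then show "(\<lambda>N. expectation (\<lambda>\<omega>. \<Sum>j<N. (B (grid T N (Suc j)) \<omega> - B (grid T N j) \<omega>)\<^sup>2)) \<longlonglongrightarrow> 0"
    unfolding eq .
qed

lemma tendsto_of_min1:
  fixes f :: "nat \<Rightarrow> real"
  assumes "(\<lambda>l. min 1 (f l)) \<longlonglongrightarrow> 0"
  shows "f \<longlonglongrightarrow> 0"
proof -
  from order_tendstoD(2)[OF assms, of 1]
  have "eventually (\<lambda>i. min 1 (f i) = f i) sequentially" by (auto elim!: eventually_mono)
  with assms show ?thesis by (rule Lim_transform_eventually)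
qed

lemma tendsto_of_square:
  fixes f :: "nat \<Rightarrow> real"
  assumes "(\<lambda>l. (f l)\<^sup>2) \<longlonglongrightarrow> 0"
  shows "f \<longlonglongrightarrow> 0"
  using tendsto_real_sqrt[OF assms] by (simp add: tendsto_rabs_zero_iff)

text \<open>The probabilistic errors of the pathwise formula tend to 0 in truncated mean on
  \<open>\<Omega>\<close>, the squares of \<open>B\<close> in mean. Their sum \<open>Z\<close> tends
  to 0 in mean, so one subsequence of grids works almost surely for all of them. Here
  \<open>X\<close> is the cut-off integrand, \<open>y\<close> the path and \<open>\<xi>\<close> an
  adapted version; on \<open>\<Omega>\<close> they agree almost surely at the times
  concerned.\<close>

lemma ito_young_exponential:
  fixes W B :: "real \<Rightarrow> 'w \<Rightarrow> real"
  assumes fps: "filtered_prob_space M F" and bm: "brownian_motion M F W"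
    and fbm: "fractional_brownian_motion M H B" "adapted F B" "1 / 2 < H"
    and T: "T > 0" and \<kappa>: "\<kappa> > 0" and \<Omega>: "\<Omega> \<in> sets M"
    and I: "\<And>t. t \<in> {0..T} \<Longrightarrow> has_ito_integral M F W X t (I t)"
    and \<xi>: "\<And>t. t \<in> {0..T} \<Longrightarrow> \<xi> t \<in> borel_measurable (F t)"
      "\<And>t. t \<in> {0..T} \<Longrightarrow> AE \<omega> in M. \<omega> \<in> \<Omega> \<longrightarrow> X t \<omega> = \<xi> t \<omega>"
    and y: "AE \<omega> in M. \<omega> \<in> \<Omega> \<longrightarrow> continuous_on {0..T} (\<lambda>s. y s \<omega>) \<and> (\<forall>s\<in>{0..T}. X s \<omega> = y s \<omega>)"
    and a: "AE \<omega> in M. \<omega> \<in> \<Omega> \<longrightarrow> continuous_on {0..T} (\<lambda>s. a s \<omega>)"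
    and eq: "\<And>t. t \<in> {0..T} \<Longrightarrow> AE \<omega> in M. \<omega> \<in> \<Omega> \<longrightarrow>
      (\<exists>Y. has_young_integral (\<lambda>s. y s \<omega>) (\<lambda>s. B s \<omega>) 0 t Y \<and>
        y t \<omega> = y0 \<omega> + integral {0..t} (\<lambda>s. a s \<omega>) - \<kappa> * (I t \<omega> + Y))"
  defines "E \<equiv> \<lambda>s \<omega>. exp (\<kappa> * (W s \<omega> + B s \<omega>) + \<kappa>\<^sup>2 / 2 * s)"
  shows "AE \<omega> in M. \<omega> \<in> \<Omega> \<longrightarrow> y T \<omega> * E T \<omega> = y 0 \<omega> * E 0 \<omega> + integral {0..T} (\<lambda>s. E s \<omega> * a s \<omega>)"
proof -
  interpret prob_space M using filtered_prob_spaceD(1)[OF fps] .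
  have T0: "0 \<le> T" using T by simp
  have gT: "grid T N j \<in> {0..T}" if "j \<le> N" for N j using that by (auto simp: grid_nonneg grid_le T0)
  have WB: "AE \<omega> in M. continuous_on {0..T} (\<lambda>s. W s \<omega>) \<and> continuous_on {0..T} (\<lambda>s. B s \<omega>)"
  proof -
    have "AE \<omega> in M. continuous_on {0..} (\<lambda>s. B s \<omega>)" using fbm(1) unfolding fractional_brownian_motion_def by blast
    with brownian_motionD(2)[OF bm] show ?thesis
      by eventually_elim (auto intro: continuous_on_subset)
  qed
  have Em: "E t \<in> borel_measurable (F t)" if "t \<in> {0..T}" for t
  proof -
    have "W t \<in> borel_measurable (F t)" "B t \<in> borel_measurable (F t)"
      using brownian_motionD(1)[OF bm] fbm(2) that unfolding adapted_def by auto
    then show ?thesis unfolding E_def by measurable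
  qed
  have Ec: "AE \<omega> in M. \<omega> \<in> \<Omega> \<longrightarrow> continuous_on {0..T} (\<lambda>s. E s \<omega>)"
    using WB by eventually_elim (auto simp: E_def intro!: continuous_intros)
  have Xc: "AE \<omega> in M. \<omega> \<in> \<Omega> \<longrightarrow> continuous_on {0..T} (\<lambda>s. X s \<omega>)"
    using y
  proof (eventually_elim, intro impI)
    fix \<omega> assume "\<omega> \<in> \<Omega> \<longrightarrow> continuous_on {0..T} (\<lambda>s. y s \<omega>) \<and> (\<forall>s\<in>{0..T}. X s \<omega> = y s \<omega>)" "\<omega> \<in> \<Omega>"
    then show "continuous_on {0..T} (\<lambda>s. X s \<omega>)" by (subst continuous_on_cong[OF refl, of _ _ "\<lambda>s. y s \<omega>"]) auto
  qed
  define R where "R N j \<omega> = I (grid T N (Suc j)) \<omega> - I (grid T N j) \<omega>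
      - \<xi> (grid T N j) \<omega> * (W (grid T N (Suc j)) \<omega> - W (grid T N j) \<omega>)" for N j \<omega>
  define Q1 where "Q1 N \<omega> = (\<Sum>j<N. E (grid T N j) \<omega> * R N j \<omega>)\<^sup>2" for N \<omega>
  define Q2 where "Q2 N \<omega> = (\<Sum>j<N. (R N j \<omega>)\<^sup>2)" for N \<omega>
  define Q3 where "Q3 N \<omega> = (\<Sum>j<N. \<xi> (grid T N j) \<omega> * E (grid T N j) \<omega> *
      ((W (grid T N (Suc j)) \<omega> - W (grid T N j) \<omega>)\<^sup>2 - T / real N))\<^sup>2" for N \<omega>
  define Q4 where "Q4 N \<omega> = (\<Sum>j<N. 1 * ((W (grid T N (Suc j)) \<omega> - W (grid T N j) \<omega>)\<^sup>2 - T / real N))\<^sup>2" for N \<omega>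
  define Q5 where "Q5 N \<omega> = (\<Sum>j<N. (B (grid T N (Suc j)) \<omega> - B (grid T N j) \<omega>)\<^sup>2)" for N \<omega>
  have grid_AE: "AE \<omega> in M. \<omega> \<in> \<Omega> \<longrightarrow> (\<forall>N j. j \<le> N \<longrightarrow> \<xi> (grid T N j) \<omega> = y (grid T N j) \<omega>)"
  proof -
    have "AE \<omega> in M. \<forall>N j. j \<le> N \<longrightarrow> \<omega> \<in> \<Omega> \<longrightarrow> \<xi> (grid T N j) \<omega> = y (grid T N j) \<omega>"
      unfolding AE_all_countable
    proof (intro allI)
      fix N j
      show "AE \<omega> in M. j \<le> N \<longrightarrow> \<omega> \<in> \<Omega> \<longrightarrow> \<xi> (grid T N j) \<omega> = y (grid T N j) \<omega>"
      proof (cases "j \<le> N")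
        case True
        from \<xi>(2)[OF gT[OF True]] y show ?thesis by eventually_elim (use gT[OF True] in force)
      qed simp
    qed
    then show ?thesis by eventually_elim blast
  qed
  have L1: "(\<lambda>N. expectation (\<lambda>\<omega>. min 1 (Q1 N \<omega>) * indicator \<Omega> \<omega>)) \<longlonglongrightarrow> 0"
    using ito_remainder[OF fps bm T I \<xi> Em \<Omega> Xc Ec, of "\<lambda>_. {0}" "\<lambda>_ _. 0"]
    by (simp add: Q1_def R_def image_subset_iff lessThan_def)
  have L2: "(\<lambda>N. expectation (\<lambda>\<omega>. min 1 (Q2 N \<omega>) * indicator \<Omega> \<omega>)) \<longlonglongrightarrow> 0"
  proof -
    have "(\<Sum>k<N. (\<Sum>j | j < N \<and> j = k. 1 * R N j \<omega>)\<^sup>2) = Q2 N \<omega>" for N \<omega>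
      unfolding Q2_def
    proof (rule sum.cong[OF refl])
      fix k assume "k \<in> {..<N}"
      then have "{j. j < N \<and> j = k} = {k}" by auto
      then show "(\<Sum>j | j < N \<and> j = k. 1 * R N j \<omega>)\<^sup>2 = (R N k \<omega>)\<^sup>2" by simp
    qed
    then show ?thesis
      using ito_remainder[OF fps bm T I \<xi> _ \<Omega> Xc, of "\<lambda>_ _. 1" "\<lambda>N. {..<N}" "\<lambda>_ j. j", folded R_def]
      by simp
  qed
  have L3: "(\<lambda>N. expectation (\<lambda>\<omega>. min 1 (Q3 N \<omega>) * indicator \<Omega> \<omega>)) \<longlonglongrightarrow> 0"
    unfolding Q3_def
  proof (rule brownian_quadratic_variation[OF fps bm T _ \<Omega>])
    show "(\<lambda>\<omega>. \<xi> t \<omega> * E t \<omega>) \<in> borel_measurable (F t)" if "t \<in> {0..T}" for t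
      using \<xi>(1)[OF that] Em[OF that] by measurable
    show "AE \<omega> in M. \<omega> \<in> \<Omega> \<longrightarrow> (\<exists>C. \<forall>N j. j \<le> N \<longrightarrow> \<bar>\<xi> (grid T N j) \<omega> * E (grid T N j) \<omega>\<bar> \<le> C)"
      using grid_AE y Ec
    proof (eventually_elim, intro impI)
      fix \<omega> assume g: "\<omega> \<in> \<Omega> \<longrightarrow> (\<forall>N j. j \<le> N \<longrightarrow> \<xi> (grid T N j) \<omega> = y (grid T N j) \<omega>)"
        and y: "\<omega> \<in> \<Omega> \<longrightarrow> continuous_on {0..T} (\<lambda>s. y s \<omega>) \<and> (\<forall>s\<in>{0..T}. X s \<omega> = y s \<omega>)"
        and E: "\<omega> \<in> \<Omega> \<longrightarrow> continuous_on {0..T} (\<lambda>s. E s \<omega>)" and \<omega>: "\<omega> \<in> \<Omega>"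
      have "continuous_on {0..T} (\<lambda>s. y s \<omega> * E s \<omega>)" using y E \<omega> by (auto intro: continuous_intros)
      then obtain C where "C \<ge> 0" "\<And>s. s \<in> {0..T} \<Longrightarrow> \<bar>y s \<omega> * E s \<omega>\<bar> \<le> C"
        by (rule continuous_on_Icc_bounded) blast
      then show "\<exists>C. \<forall>N j. j \<le> N \<longrightarrow> \<bar>\<xi> (grid T N j) \<omega> * E (grid T N j) \<omega>\<bar> \<le> C"
        using g \<omega> gT by (intro exI[of _ C]) auto
    qed
  qed
  have L4: "(\<lambda>N. expectation (\<lambda>\<omega>. min 1 (Q4 N \<omega>) * indicator \<Omega> \<omega>)) \<longlonglongrightarrow> 0"
    unfolding Q4_def
    by (rule brownian_quadratic_variation[OF fps bm T _ \<Omega>, of "\<lambda>_ _. 1"]) auto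
  have L5: "(\<lambda>N. expectation (Q5 N)) \<longlonglongrightarrow> 0" "\<And>N. integrable M (Q5 N)"
    unfolding Q5_def[abs_def] using fbm_quadratic_variation[OF fbm(1,3) T] by auto
  have meas: "W t \<in> borel_measurable M" "E t \<in> borel_measurable M" "\<xi> t \<in> borel_measurable M" "I t \<in> borel_measurable M"
    if t: "t \<in> {0..T}" for t
  proof -
    have t0: "0 \<le> t" using t by simp
    show "W t \<in> borel_measurable M" by (rule filtered_prob_spaceD(4)[OF fps t0 brownian_motionD(1)[OF bm t0]])
    show "E t \<in> borel_measurable M" by (rule filtered_prob_spaceD(4)[OF fps t0 Em[OF t]])
    show "\<xi> t \<in> borel_measurable M" by (rule filtered_prob_spaceD(4)[OF fps t0 \<xi>(1)[OF t]])
    show "I t \<in> borel_measurable M" using I[OF t] unfolding has_ito_integral_def by blast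
  qed
  have QM: "Q1 N \<in> borel_measurable M" "Q2 N \<in> borel_measurable M" "Q3 N \<in> borel_measurable M" "Q4 N \<in> borel_measurable M" for N
    unfolding Q1_def Q2_def Q3_def Q4_def R_def
    by (intro borel_measurable_sum borel_measurable_power borel_measurable_times borel_measurable_diff
        borel_measurable_const meas gT; simp)+
  have Qnn: "0 \<le> Q1 N \<omega>" "0 \<le> Q2 N \<omega>" "0 \<le> Q3 N \<omega>" "0 \<le> Q4 N \<omega>" "0 \<le> Q5 N \<omega>" for N \<omega>
    by (auto simp: Q1_def Q2_def Q3_def Q4_def Q5_def intro!: sum_nonneg)
  define Z where "Z N \<omega> = min 1 (Q1 N \<omega>) * indicator \<Omega> \<omega> + min 1 (Q2 N \<omega>) * indicator \<Omega> \<omega>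
    + min 1 (Q3 N \<omega>) * indicator \<Omega> \<omega> + min 1 (Q4 N \<omega>) * indicator \<Omega> \<omega> + Q5 N \<omega>" for N \<omega>
  have int1: "integrable M (\<lambda>\<omega>. min 1 (f \<omega>) * indicator \<Omega> \<omega>)"
    if "f \<in> borel_measurable M" "\<And>\<omega>. 0 \<le> f \<omega>" for f :: "'w \<Rightarrow> real"
    using that \<Omega> by (intro integrable_const_bound[of _ 1]) (auto simp: indicator_def)
  note ints = int1[OF QM(1) Qnn(1)] int1[OF QM(2) Qnn(2)] int1[OF QM(3) Qnn(3)] int1[OF QM(4) Qnn(4)]
  have Znn: "0 \<le> Z N \<omega>" for N \<omega> using Qnn by (simp add: Z_def)
  have Zi: "integrable M (Z N)" for N
    unfolding Z_def by (intro Bochner_Integration.integrable_add ints L5)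
  have "expectation (Z N) = expectation (\<lambda>\<omega>. min 1 (Q1 N \<omega>) * indicator \<Omega> \<omega>) + expectation (\<lambda>\<omega>. min 1 (Q2 N \<omega>) * indicator \<Omega> \<omega>)
    + expectation (\<lambda>\<omega>. min 1 (Q3 N \<omega>) * indicator \<Omega> \<omega>) + expectation (\<lambda>\<omega>. min 1 (Q4 N \<omega>) * indicator \<Omega> \<omega>) + expectation (Q5 N)" for N
    unfolding Z_def
    by (subst Bochner_Integration.integral_add; (intro Bochner_Integration.integrable_add ints L5)?)+ simp
  then have "(\<lambda>N. expectation (Z N)) \<longlonglongrightarrow> 0"
    using tendsto_add_zero[OF tendsto_add_zero[OF tendsto_add_zero[OF tendsto_add_zero[OF L1 L2] L3] L4] L5(1)] by simp
  \<comment> \<open>The shift by one keeps the number of cells \<open>n l\<close> positive.\<close>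
  from LIMSEQ_Suc[OF this] have "(\<lambda>N. expectation (\<lambda>\<omega>. norm (Z (Suc N) \<omega>))) \<longlonglongrightarrow> 0" using Znn by simp
  then obtain r where r: "strict_mono r" "AE \<omega> in M. (\<lambda>l. Z (Suc (r l)) \<omega>) \<longlonglongrightarrow> 0"
    using tendsto_L1_AE_subseq[of M "\<lambda>N. Z (Suc N)"] Zi by blast
  define n where "n l = Suc (r l)" for l
  have n: "filterlim n at_top sequentially" "\<And>l. n l > 0"
    unfolding n_def using filterlim_compose[OF filterlim_Suc filterlim_subseq[OF r(1)]] by (auto simp: comp_def)
  have eq_AE: "AE \<omega> in M. \<omega> \<in> \<Omega> \<longrightarrow> (\<forall>N j. j \<le> N \<longrightarrow> (\<exists>Y. has_young_integral (\<lambda>s. y s \<omega>) (\<lambda>s. B s \<omega>) 0 (grid T N j) Y \<and>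
        y (grid T N j) \<omega> = y0 \<omega> + integral {0..grid T N j} (\<lambda>s. a s \<omega>) - \<kappa> * (I (grid T N j) \<omega> + Y)))"
  proof -
    have "AE \<omega> in M. \<forall>N j. j \<le> N \<longrightarrow> \<omega> \<in> \<Omega> \<longrightarrow> (\<exists>Y. has_young_integral (\<lambda>s. y s \<omega>) (\<lambda>s. B s \<omega>) 0 (grid T N j) Y \<and>
        y (grid T N j) \<omega> = y0 \<omega> + integral {0..grid T N j} (\<lambda>s. a s \<omega>) - \<kappa> * (I (grid T N j) \<omega> + Y))"
      unfolding AE_all_countable
    proof (intro allI)
      fix N j
      show "AE \<omega> in M. j \<le> N \<longrightarrow> \<omega> \<in> \<Omega> \<longrightarrow> (\<exists>Y. has_young_integral (\<lambda>s. y s \<omega>) (\<lambda>s. B s \<omega>) 0 (grid T N j) Y \<and>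
        y (grid T N j) \<omega> = y0 \<omega> + integral {0..grid T N j} (\<lambda>s. a s \<omega>) - \<kappa> * (I (grid T N j) \<omega> + Y))"
        using eq[OF gT, of j N] by (cases "j \<le> N") auto
    qed
    then show ?thesis by eventually_elim blast
  qed
  show ?thesis
    using WB y a grid_AE eq_AE r(2)
  proof (eventually_elim, intro impI)
    fix \<omega>
    assume WB: "continuous_on {0..T} (\<lambda>s. W s \<omega>) \<and> continuous_on {0..T} (\<lambda>s. B s \<omega>)"
      and y': "\<omega> \<in> \<Omega> \<longrightarrow> continuous_on {0..T} (\<lambda>s. y s \<omega>) \<and> (\<forall>s\<in>{0..T}. X s \<omega> = y s \<omega>)"
      and a': "\<omega> \<in> \<Omega> \<longrightarrow> continuous_on {0..T} (\<lambda>s. a s \<omega>)"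
      and g': "\<omega> \<in> \<Omega> \<longrightarrow> (\<forall>N j. j \<le> N \<longrightarrow> \<xi> (grid T N j) \<omega> = y (grid T N j) \<omega>)"
      and e': "\<omega> \<in> \<Omega> \<longrightarrow> (\<forall>N j. j \<le> N \<longrightarrow> (\<exists>Y. has_young_integral (\<lambda>s. y s \<omega>) (\<lambda>s. B s \<omega>) 0 (grid T N j) Y \<and>
        y (grid T N j) \<omega> = y0 \<omega> + integral {0..grid T N j} (\<lambda>s. a s \<omega>) - \<kappa> * (I (grid T N j) \<omega> + Y)))"
      and Z0: "(\<lambda>l. Z (Suc (r l)) \<omega>) \<longlonglongrightarrow> 0" and \<omega>: "\<omega> \<in> \<Omega>"
    have yc: "continuous_on {0..T} (\<lambda>s. y s \<omega>)" and ac: "continuous_on {0..T} (\<lambda>s. a s \<omega>)"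
      and g: "\<And>N j. j \<le> N \<Longrightarrow> \<xi> (grid T N j) \<omega> = y (grid T N j) \<omega>"
      using y' a' g' \<omega> by auto
    \<comment> \<open>Outside one null set a Young integral satisfying the equation exists at every
      grid time, and \<open>Y\<close> selects it; values at other times are never inspected.\<close>
    define Y where "Y s = (SOME Y. has_young_integral (\<lambda>s. y s \<omega>) (\<lambda>s. B s \<omega>) 0 s Y \<and>
        y s \<omega> = y0 \<omega> + integral {0..s} (\<lambda>s. a s \<omega>) - \<kappa> * (I s \<omega> + Y))" for s
    have Y: "has_young_integral (\<lambda>s. y s \<omega>) (\<lambda>s. B s \<omega>) 0 (grid T N j) (Y (grid T N j)) \<and>
        y (grid T N j) \<omega> = y0 \<omega> + integral {0..grid T N j} (\<lambda>s. a s \<omega>) - \<kappa> * (I (grid T N j) \<omega> + Y (grid T N j))"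
      if "j \<le> N" for N j
    proof -
      have "\<exists>Y. has_young_integral (\<lambda>s. y s \<omega>) (\<lambda>s. B s \<omega>) 0 (grid T N j) Y \<and>
        y (grid T N j) \<omega> = y0 \<omega> + integral {0..grid T N j} (\<lambda>s. a s \<omega>) - \<kappa> * (I (grid T N j) \<omega> + Y)"
        using e' \<omega> that by blast
      from someI_ex[OF this] show ?thesis unfolding Y_def .
    qed
    define RB where "RB N j = Y (grid T N (Suc j)) - Y (grid T N j)
      - y (grid T N j) \<omega> * (B (grid T N (Suc j)) \<omega> - B (grid T N j) \<omega>)" for N j
    have RB: "(\<lambda>N. \<Sum>j<N. \<bar>RB N j\<bar>) \<longlonglongrightarrow> 0"
      unfolding RB_def by (rule young_remainder[OF T0]) (use Y in blast)
    have Zn: "(\<lambda>l. Z (n l) \<omega>) \<longlonglongrightarrow> 0" using Z0 by (simp add: n_def)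
    have q: "(\<lambda>l. q (n l)) \<longlonglongrightarrow> 0" if q: "\<And>N. 0 \<le> q N" "\<And>N. min 1 (q N) \<le> Z N \<omega>" for q :: "nat \<Rightarrow> real"
    proof (rule tendsto_of_min1)
      show "(\<lambda>l. min 1 (q (n l))) \<longlonglongrightarrow> 0"
        by (rule tendsto_sandwich[OF _ _ tendsto_const Zn]) (use q in \<open>auto intro!: always_eventually\<close>)
    qed
    have bd: "min 1 (Q1 N \<omega>) \<le> Z N \<omega>" "min 1 (Q2 N \<omega>) \<le> Z N \<omega>" "min 1 (Q3 N \<omega>) \<le> Z N \<omega>"
      "min 1 (Q4 N \<omega>) \<le> Z N \<omega>" "min 1 (Q5 N \<omega>) \<le> Z N \<omega>" for N
      using Qnn[of N \<omega>] \<omega> by (auto simp: Z_def min_def)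
    show "y T \<omega> * E T \<omega> = y 0 \<omega> * E 0 \<omega> + integral {0..T} (\<lambda>s. E s \<omega> * a s \<omega>)"
    proof (rule exp_product_formula[where RW="\<lambda>l j. R (n l) j \<omega>" and RB="\<lambda>l j. RB (n l) j" and n=n and \<kappa>=\<kappa>
          and W="\<lambda>s. W s \<omega>" and B="\<lambda>s. B s \<omega>" and y="\<lambda>s. y s \<omega>" and a="\<lambda>s. a s \<omega>" and E="\<lambda>s. E s \<omega>", OF T \<kappa> yc _ _ ac n])
      show "continuous_on {0..T} (\<lambda>s. W s \<omega>)" "continuous_on {0..T} (\<lambda>s. B s \<omega>)" using WB by auto
      show "\<And>s. E s \<omega> = exp (\<kappa> * (W s \<omega> + B s \<omega>) + \<kappa>\<^sup>2 / 2 * s)" by (simp add: E_def)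
      show "y (grid T (n l) (Suc j)) \<omega> - y (grid T (n l) j) \<omega> =
         integral {grid T (n l) j..grid T (n l) (Suc j)} (\<lambda>s. a s \<omega>) -
         \<kappa> * (y (grid T (n l) j) \<omega> * (W (grid T (n l) (Suc j)) \<omega> - W (grid T (n l) j) \<omega>) +
              y (grid T (n l) j) \<omega> * (B (grid T (n l) (Suc j)) \<omega> - B (grid T (n l) j) \<omega>) + R (n l) j \<omega> + RB (n l) j)"
        if j: "j < n l" for l j
      proof -
        have split: "integral {0..grid T (n l) (Suc j)} (\<lambda>s. a s \<omega>) = integral {0..grid T (n l) j} (\<lambda>s. a s \<omega>)
          + integral {grid T (n l) j..grid T (n l) (Suc j)} (\<lambda>s. a s \<omega>)"
          using integral_grid_split[OF ac T0, of "Suc j" "n l"] integral_grid_split[OF ac T0, of j "n l"] j by simp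
        show ?thesis
        proof -
          have gj: "\<xi> (grid T (n l) j) \<omega> = y (grid T (n l) j) \<omega>" by (rule g) (use j in simp)
          \<comment> \<open>The equation at two consecutive grid times, subtracted: increments of
            both integrals are their left-endpoint terms plus the remainders, by the definitions of
            \<open>R\<close> and \<open>RB\<close>.\<close>
          have alg: "y1 - y0 = A - \<kappa> * (y0 * dW + y0 * dB + (I1 - I0 - y0 * dW) + (Y1 - Y0 - y0 * dB))"
            if "y0 = c + A0 - \<kappa> * (I0 + Y0)" "y1 = c + A1 - \<kappa> * (I1 + Y1)" "A1 = A0 + A"
            for y0 y1 A A0 A1 c dW dB I0 I1 Y0 Y1 :: real
            unfolding that(2,3) using that(1) by (simp add: algebra_simps)
          have Yj: "y (grid T (n l) j) \<omega> = y0 \<omega> + integral {0..grid T (n l) j} (\<lambda>s. a s \<omega>) - \<kappa> * (I (grid T (n l) j) \<omega> + Y (grid T (n l) j))"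
            "y (grid T (n l) (Suc j)) \<omega> = y0 \<omega> + integral {0..grid T (n l) (Suc j)} (\<lambda>s. a s \<omega>) - \<kappa> * (I (grid T (n l) (Suc j)) \<omega> + Y (grid T (n l) (Suc j)))"
            using Y[of j "n l"] Y[of "Suc j" "n l"] j by simp_all
          show ?thesis unfolding R_def RB_def gj by (rule alg[OF Yj]) (rule split)
        qed
      qed
      show "(\<lambda>l. \<Sum>j<n l. E (grid T (n l) j) \<omega> * R (n l) j \<omega>) \<longlonglongrightarrow> 0"
        by (rule tendsto_of_square, rule q[OF Qnn(1) bd(1), unfolded Q1_def])
      show "(\<lambda>l. \<Sum>j<n l. (R (n l) j \<omega>)\<^sup>2) \<longlonglongrightarrow> 0"
        by (rule q[OF Qnn(2) bd(2), unfolded Q2_def])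
      show "(\<lambda>l. \<Sum>j<n l. \<bar>RB (n l) j\<bar>) \<longlonglongrightarrow> 0" by (rule filterlim_compose[OF RB n(1)])
      have "(\<lambda>l. \<Sum>j<n l. \<xi> (grid T (n l) j) \<omega> * E (grid T (n l) j) \<omega> *
          ((W (grid T (n l) (Suc j)) \<omega> - W (grid T (n l) j) \<omega>)\<^sup>2 - T / real (n l))) \<longlonglongrightarrow> 0"
        by (rule tendsto_of_square, rule q[OF Qnn(3) bd(3), unfolded Q3_def])
      then show "(\<lambda>l. \<Sum>j<n l. y (grid T (n l) j) \<omega> * E (grid T (n l) j) \<omega> *
          ((W (grid T (n l) (Suc j)) \<omega> - W (grid T (n l) j) \<omega>)\<^sup>2 - T / real (n l))) \<longlonglongrightarrow> 0"
        using g by simp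
      have "(\<lambda>l. \<Sum>j<n l. 1 * ((W (grid T (n l) (Suc j)) \<omega> - W (grid T (n l) j) \<omega>)\<^sup>2 - T / real (n l))) \<longlonglongrightarrow> 0"
        by (rule tendsto_of_square, rule q[OF Qnn(4) bd(4), unfolded Q4_def])
      then show "(\<lambda>l. \<Sum>j<n l. (W (grid T (n l) (Suc j)) \<omega> - W (grid T (n l) j) \<omega>)\<^sup>2 - T / real (n l)) \<longlonglongrightarrow> 0"
        unfolding mult_1 .
      show "(\<lambda>l. \<Sum>j<n l. (B (grid T (n l) (Suc j)) \<omega> - B (grid T (n l) j) \<omega>)\<^sup>2) \<longlonglongrightarrow> 0"
        by (rule q[OF Qnn(5) bd(5), unfolded Q5_def])
    qed
  qed
qed

section \<open>Sublinear growth of the noise and divergence of the exponential integral\<close>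

lemma (in prob_space) expectation_abs_le:
  fixes X :: "'a \<Rightarrow> real"
  assumes X: "X \<in> borel_measurable M" "integrable M (\<lambda>\<omega>. (X \<omega>)\<^sup>2)" "expectation (\<lambda>\<omega>. (X \<omega>)\<^sup>2) \<le> c\<^sup>2" and c: "c > 0"
  shows "integrable M X" "expectation (\<lambda>\<omega>. \<bar>X \<omega>\<bar>) \<le> c"
proof -
  show i: "integrable M X" by (rule square_integrable_imp_integrable[OF X(1,2)])
  \<comment> \<open>The arithmetic-geometric mean inequality, weighted by \<open>c\<close> so that a
    second moment of at most \<open>c\<^sup>2\<close> gives exactly
    \<open>c / 2 + c / 2\<close>.\<close>
  have "\<bar>x\<bar> \<le> (1 / (2 * c)) * x\<^sup>2 + c / 2" for x :: real
  proof -
    have "2 * (\<bar>x\<bar> * c) \<le> x\<^sup>2 + c\<^sup>2" using sum_squares_bound[of "\<bar>x\<bar>" c] by (simp add: mult.assoc)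
    then have "\<bar>x\<bar> \<le> (x\<^sup>2 + c\<^sup>2) / (2 * c)" using c by (simp add: field_simps)
    also have "\<dots> = (1 / (2 * c)) * x\<^sup>2 + c / 2" using c by (simp add: field_simps power2_eq_square)
    finally show ?thesis .
  qed
  then have "expectation (\<lambda>\<omega>. \<bar>X \<omega>\<bar>) \<le> expectation (\<lambda>\<omega>. (1 / (2 * c)) * (X \<omega>)\<^sup>2 + c / 2)"
    using i X(2) by (intro integral_mono) auto
  also have "\<dots> = (1 / (2 * c)) * expectation (\<lambda>\<omega>. (X \<omega>)\<^sup>2) + c / 2" using X(2) by (simp add: prob_space)
  also have "\<dots> \<le> (1 / (2 * c)) * c\<^sup>2 + c / 2" using X(3) c by (intro add_right_mono mult_left_mono) auto
  also have "\<dots> = c" using c by (simp add: field_simps power2_eq_square)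
  finally show "expectation (\<lambda>\<omega>. \<bar>X \<omega>\<bar>) \<le> c" .
qed

text \<open>The second moments of \<open>W t\<close> and \<open>B t\<close> are \<open>t\<close> and
  \<open>t powr (2 * H)\<close>; monotonicity in \<open>t\<close> makes the bounds uniform on
  \<open>[0, T]\<close>, and for \<open>H < 1\<close> they are sublinear in
  \<open>T\<close>.\<close>

lemma noise_expectation_abs_le:
  fixes W B :: "real \<Rightarrow> 'w \<Rightarrow> real"
  assumes fps: "filtered_prob_space M F" and bm: "brownian_motion M F W"
    and fbm: "fractional_brownian_motion M H B" and H: "0 < H" and t: "0 \<le> t" "t \<le> T" "0 < T"
  shows "integrable M (\<lambda>\<omega>. W t \<omega> + B t \<omega>)" "(LINT \<omega>|M. \<bar>W t \<omega> + B t \<omega>\<bar>) \<le> sqrt T + T powr H"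
proof -
  interpret prob_space M using filtered_prob_spaceD(1)[OF fps] .
  have B2: "expectation (\<lambda>\<omega>. (B t \<omega>)\<^sup>2) \<le> (T powr H)\<^sup>2"
  proof -
    have "t powr (2 * H) \<le> T powr (2 * H)" using t H by (intro powr_mono2) auto
    also have "\<dots> = (T powr H)\<^sup>2" by (simp add: powr_add[symmetric] power2_eq_square)
    finally show ?thesis using fbm_square_integrable(3)[OF fbm t(1)] by simp
  qed
  have Bb: "integrable M (B t)" "expectation (\<lambda>\<omega>. \<bar>B t \<omega>\<bar>) \<le> T powr H"
    using expectation_abs_le[OF fbm_square_integrable(1,2)[OF fbm t(1)] B2] t by auto
  have Wm: "W t \<in> borel_measurable M"
    by (rule filtered_prob_spaceD(4)[OF fps t(1) brownian_motionD(1)[OF bm t(1)]])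
  have W0: "AE \<omega> in M. W 0 \<omega> = 0" by (rule brownian_motionD(3)[OF bm])
  have W2: "integrable M (\<lambda>\<omega>. (W t \<omega>)\<^sup>2) \<and> expectation (\<lambda>\<omega>. (W t \<omega>)\<^sup>2) \<le> (sqrt T)\<^sup>2"
  proof (cases "t = 0")
    case True
    then have z: "AE \<omega> in M. (W t \<omega>)\<^sup>2 = 0" using W0 by simp
    then have "expectation (\<lambda>\<omega>. (W t \<omega>)\<^sup>2) = 0" by (rule integral_eq_zero_AE)
    moreover have "integrable M (\<lambda>\<omega>. (W t \<omega>)\<^sup>2)"
      by (rule integrable_const_bound[of _ 0]) (use z Wm in auto)
    ultimately show ?thesis using t by simp
  next
    case False
    then have t0: "0 < t" using t by simp
    note N = normal_moments[OF brownian_motionD(4)[OF bm order_refl t0]]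
    have m: "W 0 \<in> borel_measurable M"
      by (rule filtered_prob_spaceD(4)[OF fps order_refl brownian_motionD(1)[OF bm order_refl]])
    have ae: "AE \<omega> in M. (W t \<omega> - W 0 \<omega>)\<^sup>2 = (W t \<omega>)\<^sup>2" using W0 by eventually_elim simp
    have "integrable M (\<lambda>\<omega>. (W t \<omega> - W 0 \<omega>)\<^sup>2) \<longleftrightarrow> integrable M (\<lambda>\<omega>. (W t \<omega>)\<^sup>2)"
      by (rule integrable_cong_AE) (use ae m Wm in auto)
    moreover have "expectation (\<lambda>\<omega>. (W t \<omega> - W 0 \<omega>)\<^sup>2) = expectation (\<lambda>\<omega>. (W t \<omega>)\<^sup>2)"
      by (rule integral_cong_AE) (use ae m Wm in auto)
    ultimately show ?thesis using N t t0 by simp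
  qed
  have Wb: "integrable M (W t)" "expectation (\<lambda>\<omega>. \<bar>W t \<omega>\<bar>) \<le> sqrt T"
    using expectation_abs_le[OF Wm conjunct1[OF W2] conjunct2[OF W2]] t by auto
  show "integrable M (\<lambda>\<omega>. W t \<omega> + B t \<omega>)" using Wb Bb by simp
  have "expectation (\<lambda>\<omega>. \<bar>W t \<omega> + B t \<omega>\<bar>) \<le> expectation (\<lambda>\<omega>. \<bar>W t \<omega>\<bar> + \<bar>B t \<omega>\<bar>)"
    using Wb Bb by (intro integral_mono) auto
  also have "\<dots> = expectation (\<lambda>\<omega>. \<bar>W t \<omega>\<bar>) + expectation (\<lambda>\<omega>. \<bar>B t \<omega>\<bar>)" using Wb Bb by simp
  finally show "expectation (\<lambda>\<omega>. \<bar>W t \<omega> + B t \<omega>\<bar>) \<le> sqrt T + T powr H" using Wb Bb by simp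
qed

text \<open>As the means of \<open>\<bar>W + B\<bar>\<close> grow sublinearly, the time average of \<open>W + B\<close> over \<open>[0, n]\<close> is
  negligible against the drift \<open>n\<close> along a subsequence; then \<open>exp x \<ge> 1 + x\<close> is enough.\<close>

lemma exp_integral_diverges:
  fixes W B :: "real \<Rightarrow> 'w \<Rightarrow> real"
  assumes fps: "filtered_prob_space M F" and bm: "brownian_motion M F W"
    and fbm: "fractional_brownian_motion M H B" and H: "0 < H" "H < 1" and \<kappa>: "\<kappa> > 0"
  shows "AE \<omega> in M. \<forall>K. \<exists>n::nat. n > 0 \<and>
    K \<le> integral {0..real n} (\<lambda>s. (exp (\<kappa> * (W s \<omega> + B s \<omega>) + \<kappa>\<^sup>2 / 2 * s)) ^ 3)"
proof -
  interpret prob_space M using filtered_prob_spaceD(1)[OF fps] .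
  define G where "G s \<omega> = W s \<omega> + B s \<omega>" for s \<omega>
  have Gc: "AE \<omega> in M. continuous_on {0..} (\<lambda>s. G s \<omega>)"
  proof -
    have "AE \<omega> in M. continuous_on {0..} (\<lambda>s. B s \<omega>)" using fbm unfolding fractional_brownian_motion_def by blast
    with brownian_motionD(2)[OF bm] show ?thesis
      by eventually_elim (auto simp: G_def intro!: continuous_intros)
  qed
  \<comment> \<open>The time integral of the noise is reached through Riemann sums because the
    processes are only known to be measurable at each fixed time: the limit \<open>Y\<close> is
    measurable, and Fatou's lemma carries the mean bound of the sums over to it.\<close>
  define \<rho> where "\<rho> T q \<omega> = (\<Sum>j<q. G (grid T q j) \<omega> * (T / real q))" for T q \<omega>
  define Y where "Y T \<omega> = lim (\<lambda>q. \<rho> T q \<omega>)" for T \<omega>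
  have lim: "AE \<omega> in M. \<forall>T\<ge>0. (\<lambda>q. \<rho> T q \<omega>) \<longlonglongrightarrow> integral {0..T} (\<lambda>s. G s \<omega>)"
    using Gc
  proof (eventually_elim, intro allI impI)
    fix \<omega> T assume c: "continuous_on {0..} (\<lambda>s. G s \<omega>)" and T: "0 \<le> (T::real)"
    have "(\<lambda>N. \<Sum>j<N. G (grid T N j) \<omega> * integral {grid T N j..grid T N (Suc j)} (\<lambda>_. 1))
       \<longlonglongrightarrow> integral {0..T} (\<lambda>s. G s \<omega> * 1)"
      by (rule riemann_sum_tendsto[OF continuous_on_subset[OF c] continuous_on_const T]) (auto intro: grid_mono T)
    moreover have "integral {grid T N j..grid T N (Suc j)} (\<lambda>_. 1::real) = T / real N" for N j
      using grid_mono[OF T, of j "Suc j" N] by (simp add: grid_Suc_diff)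
    ultimately show "(\<lambda>q. \<rho> T q \<omega>) \<longlonglongrightarrow> integral {0..T} (\<lambda>s. G s \<omega>)" by (simp add: \<rho>_def)
  qed
  have \<rho>: "integrable M (\<rho> T q)" "expectation (\<lambda>\<omega>. \<bar>\<rho> T q \<omega>\<bar>) \<le> T * (sqrt T + T powr H)" if T: "T > 0" for T q
  proof -
    have T0: "0 \<le> T" using T by simp
    have g: "integrable M (\<lambda>\<omega>. G (grid T q j) \<omega>)" "expectation (\<lambda>\<omega>. \<bar>G (grid T q j) \<omega>\<bar>) \<le> sqrt T + T powr H" if "j < q" for j
      unfolding G_def using noise_expectation_abs_le[OF fps bm fbm H(1) grid_nonneg[OF T0] grid_le[OF T0] T, of j q] that by auto
    show i: "integrable M (\<rho> T q)" unfolding \<rho>_def[abs_def]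
      by (intro Bochner_Integration.integrable_sum Bochner_Integration.integrable_mult_left g) auto
    have "expectation (\<lambda>\<omega>. \<bar>\<rho> T q \<omega>\<bar>) \<le> expectation (\<lambda>\<omega>. \<Sum>j<q. \<bar>G (grid T q j) \<omega>\<bar> * (T / real q))"
    proof (rule integral_mono)
      show "\<bar>\<rho> T q \<omega>\<bar> \<le> (\<Sum>j<q. \<bar>G (grid T q j) \<omega>\<bar> * (T / real q))" for \<omega>
        unfolding \<rho>_def by (rule order_trans[OF sum_abs]) (use T in \<open>simp add: abs_mult\<close>)
      show "integrable M (\<lambda>\<omega>. \<Sum>j<q. \<bar>G (grid T q j) \<omega>\<bar> * (T / real q))"
        by (intro Bochner_Integration.integrable_sum Bochner_Integration.integrable_mult_left integrable_abs g) auto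
    qed (use i in simp)
    also have "\<dots> = (\<Sum>j<q. expectation (\<lambda>\<omega>. \<bar>G (grid T q j) \<omega>\<bar>) * (T / real q))"
      using g by (subst Bochner_Integration.integral_sum) auto
    also have "\<dots> \<le> (\<Sum>j<q. (sqrt T + T powr H) * (T / real q))"
      using g T by (intro sum_mono mult_right_mono) auto
    also have "\<dots> \<le> T * (sqrt T + T powr H)" using T by (cases "q = 0") auto
    finally show "expectation (\<lambda>\<omega>. \<bar>\<rho> T q \<omega>\<bar>) \<le> T * (sqrt T + T powr H)" .
  qed
  have Ym: "Y T \<in> borel_measurable M" if T: "T > 0" for T
    unfolding Y_def[abs_def] using \<rho>(1)[OF T] by (intro borel_measurable_lim_metric) auto
  have Yb: "(\<integral>\<^sup>+\<omega>. ennreal \<bar>Y T \<omega>\<bar> \<partial>M) \<le> ennreal (T * (sqrt T + T powr H))" if T: "T > 0" for T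
  proof -
    have "(\<integral>\<^sup>+\<omega>. ennreal \<bar>Y T \<omega>\<bar> \<partial>M) = (\<integral>\<^sup>+\<omega>. liminf (\<lambda>q. ennreal \<bar>\<rho> T q \<omega>\<bar>) \<partial>M)"
    proof (rule nn_integral_cong_AE)
      show "AE \<omega> in M. ennreal \<bar>Y T \<omega>\<bar> = liminf (\<lambda>q. ennreal \<bar>\<rho> T q \<omega>\<bar>)"
        using lim
      proof eventually_elim
        case (elim \<omega>)
        then have "(\<lambda>q. \<rho> T q \<omega>) \<longlonglongrightarrow> integral {0..T} (\<lambda>s. G s \<omega>)" using T by simp
        then have l: "(\<lambda>q. \<rho> T q \<omega>) \<longlonglongrightarrow> Y T \<omega>" unfolding Y_def by (metis limI)
        have "(\<lambda>q. ennreal \<bar>\<rho> T q \<omega>\<bar>) \<longlonglongrightarrow> ennreal \<bar>Y T \<omega>\<bar>"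
          by (intro tendsto_ennrealI tendsto_rabs l)
        then show ?case by (rule lim_imp_Liminf[OF sequentially_bot, symmetric])
      qed
    qed
    also have "\<dots> \<le> liminf (\<lambda>q. \<integral>\<^sup>+\<omega>. ennreal \<bar>\<rho> T q \<omega>\<bar> \<partial>M)"
      using \<rho>(1)[OF T] by (intro nn_integral_liminf) auto
    also have "\<dots> \<le> liminf (\<lambda>q::nat. ennreal (T * (sqrt T + T powr H)))"
    proof (rule Liminf_mono, rule always_eventually, rule allI)
      fix q
      have "(\<integral>\<^sup>+\<omega>. ennreal \<bar>\<rho> T q \<omega>\<bar> \<partial>M) = ennreal (expectation (\<lambda>\<omega>. \<bar>\<rho> T q \<omega>\<bar>))"
        using \<rho>(1)[OF T] by (intro nn_integral_eq_integral) auto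
      also have "\<dots> \<le> ennreal (T * (sqrt T + T powr H))" by (intro ennreal_leI \<rho> T)
      finally show "(\<integral>\<^sup>+\<omega>. ennreal \<bar>\<rho> T q \<omega>\<bar> \<partial>M) \<le> ennreal (T * (sqrt T + T powr H))" .
    qed
    also have "\<dots> = ennreal (T * (sqrt T + T powr H))" by (simp add: Liminf_const)
    finally show ?thesis .
  qed
  \<comment> \<open>Dividing by the squared time compares the integral of \<open>G\<close> with that
    of the linear drift, which is quadratic; the mean of \<open>\<bar>Z\<bar>\<close> tends to 0
    because \<open>H < 1\<close>.\<close>
  define Z where "Z n \<omega> = Y (real (Suc n)) \<omega> / (real (Suc n))\<^sup>2" for n \<omega>
  have Yi: "integrable M (Y T)" "expectation (\<lambda>\<omega>. \<bar>Y T \<omega>\<bar>) \<le> T * (sqrt T + T powr H)" if T: "T > 0" for T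
  proof -
    show i: "integrable M (Y T)"
      using Ym[OF T] Yb[OF T] by (intro integrableI_bounded) (auto simp: top_unique intro: le_less_trans)
    have "ennreal (expectation (\<lambda>\<omega>. \<bar>Y T \<omega>\<bar>)) = (\<integral>\<^sup>+\<omega>. ennreal \<bar>Y T \<omega>\<bar> \<partial>M)"
      using i by (intro nn_integral_eq_integral[symmetric]) auto
    also note Yb[OF T]
    finally show "expectation (\<lambda>\<omega>. \<bar>Y T \<omega>\<bar>) \<le> T * (sqrt T + T powr H)"
      using T by (subst (asm) ennreal_le_iff) auto
  qed
  have "(\<lambda>n. expectation (\<lambda>\<omega>. norm (Z n \<omega>))) \<longlonglongrightarrow> 0"
  proof (rule tendsto_sandwich[OF _ _ tendsto_const])
    show "eventually (\<lambda>n. 0 \<le> expectation (\<lambda>\<omega>. norm (Z n \<omega>))) sequentially" by (intro always_eventually allI integral_nonneg_AE) auto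
    have "expectation (\<lambda>\<omega>. norm (Z n \<omega>)) \<le> real (Suc n) * (sqrt (real (Suc n)) + real (Suc n) powr H) / (real (Suc n))\<^sup>2" for n
    proof -
      have "expectation (\<lambda>\<omega>. norm (Z n \<omega>)) = expectation (\<lambda>\<omega>. \<bar>Y (real (Suc n)) \<omega>\<bar>) / (real (Suc n))\<^sup>2"
        unfolding Z_def by (simp add: abs_divide del: of_nat_Suc)
      then show ?thesis using Yi(2)[of "real (Suc n)"] by (simp add: divide_right_mono del: of_nat_Suc)
    qed
    then show "eventually (\<lambda>n. expectation (\<lambda>\<omega>. norm (Z n \<omega>)) \<le> real (Suc n) * (sqrt (real (Suc n)) + real (Suc n) powr H) / (real (Suc n))\<^sup>2) sequentially"
      by simp
    have "(\<lambda>n. sqrt (real (Suc n)) / real (Suc n)) \<longlonglongrightarrow> 0" by real_asymp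
    moreover have "(\<lambda>n. real (Suc n) powr H / real (Suc n)) \<longlonglongrightarrow> 0" using H by real_asymp
    ultimately have "(\<lambda>n. sqrt (real (Suc n)) / real (Suc n) + real (Suc n) powr H / real (Suc n)) \<longlonglongrightarrow> 0"
      by (rule tendsto_add_zero)
    then show "(\<lambda>n. real (Suc n) * (sqrt (real (Suc n)) + real (Suc n) powr H) / (real (Suc n))\<^sup>2) \<longlonglongrightarrow> 0"
      by (simp add: power2_eq_square add_divide_distrib del: of_nat_Suc)
  qed
  moreover have "integrable M (Z n)" for n unfolding Z_def[abs_def] using Yi(1)[of "real (Suc n)"] by simp
  ultimately obtain r where r: "strict_mono r" "AE \<omega> in M. (\<lambda>l. Z (r l) \<omega>) \<longlonglongrightarrow> 0"
    using tendsto_L1_AE_subseq[of M Z] by blast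
  show ?thesis
    using r(2) lim Gc
  proof (eventually_elim, intro allI)
    fix \<omega> and K :: real
    assume Z0: "(\<lambda>l. Z (r l) \<omega>) \<longlonglongrightarrow> 0"
      and l: "\<forall>T\<ge>0. (\<lambda>q. \<rho> T q \<omega>) \<longlonglongrightarrow> integral {0..T} (\<lambda>s. G s \<omega>)"
      and c: "continuous_on {0..} (\<lambda>s. G s \<omega>)"
    have "eventually (\<lambda>l. Z (r l) \<omega> > - (\<kappa> / 4)) sequentially" by (rule order_tendstoD(1)[OF Z0]) (use \<kappa> in simp)
    then have "eventually (\<lambda>l. Z (r l) \<omega> > - (\<kappa> / 4) \<and> l \<ge> nat \<lceil>K\<rceil>) sequentially"
      using eventually_ge_at_top by (rule eventually_conj)
    then obtain i where i: "Z (r i) \<omega> > - (\<kappa> / 4)" "i \<ge> nat \<lceil>K\<rceil>"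
      using eventually_happens'[OF sequentially_bot] by blast
    define n where "n = Suc (r i)"
    have n: "n > 0" "K \<le> real n"
    proof -
      have "i \<le> r i" by (rule strict_mono_imp_increasing[OF r(1)])
      then show "K \<le> real n" using i(2) by (simp add: n_def)
    qed (simp add: n_def)
    have "Y (real n) \<omega> = integral {0..real n} (\<lambda>s. G s \<omega>)" unfolding Y_def by (rule limI) (use l in simp)
    then have Zi: "integral {0..real n} (\<lambda>s. G s \<omega>) = (real n)\<^sup>2 * Z (r i) \<omega>"
      using n by (simp add: Z_def n_def del: of_nat_Suc)
    have cT: "continuous_on {0..real n} (\<lambda>s. G s \<omega>)" by (rule continuous_on_subset[OF c]) auto
    have id: "integral {0..real n} (\<lambda>s. s) = (real n)\<^sup>2 / 2"
      using ident_has_integral[of 0 "real n"] by (simp add: integral_unique)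
    have "integral {0..real n} (\<lambda>s. 1 + 3 * \<kappa> * G s \<omega> + 3 * \<kappa>\<^sup>2 / 2 * s)
        = integral {0..real n} (\<lambda>s. 1) + 3 * \<kappa> * integral {0..real n} (\<lambda>s. G s \<omega>) + 3 * \<kappa>\<^sup>2 / 2 * integral {0..real n} (\<lambda>s. s)"
    proof -
      have "integral {0..real n} (\<lambda>s. 1 + 3 * \<kappa> * G s \<omega> + 3 * \<kappa>\<^sup>2 / 2 * s)
        = integral {0..real n} (\<lambda>s. 1 + 3 * \<kappa> * G s \<omega>) + integral {0..real n} (\<lambda>s. 3 * \<kappa>\<^sup>2 / 2 * s)"
        by (rule Henstock_Kurzweil_Integration.integral_add; intro integrable_continuous_real continuous_intros cT)
      also have "integral {0..real n} (\<lambda>s. 1 + 3 * \<kappa> * G s \<omega>) = integral {0..real n} (\<lambda>s. 1) + integral {0..real n} (\<lambda>s. 3 * \<kappa> * G s \<omega>)"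
        by (rule Henstock_Kurzweil_Integration.integral_add; intro integrable_continuous_real continuous_intros cT)
      finally show ?thesis by simp
    qed
    \<comment> \<open>The drift contributes \<open>3 * \<kappa>\<^sup>2 / 4\<close> times the
      squared time, which explains the threshold \<open>- (\<kappa> / 4)\<close> for
      \<open>Z\<close>; the constant 1 leaves the lower bound \<open>real n\<close>.\<close>
    also have "\<dots> = real n + (real n)\<^sup>2 * (3 * \<kappa>) * (Z (r i) \<omega> + \<kappa> / 4)"
      unfolding Zi id by (simp add: power2_eq_square algebra_simps)
    also have "\<dots> \<ge> real n" using i(1) \<kappa> by simp
    finally have lower: "real n \<le> integral {0..real n} (\<lambda>s. 1 + 3 * \<kappa> * G s \<omega> + 3 * \<kappa>\<^sup>2 / 2 * s)" .
    have "integral {0..real n} (\<lambda>s. 1 + 3 * \<kappa> * G s \<omega> + 3 * \<kappa>\<^sup>2 / 2 * s)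
      \<le> integral {0..real n} (\<lambda>s. (exp (\<kappa> * (W s \<omega> + B s \<omega>) + \<kappa>\<^sup>2 / 2 * s)) ^ 3)"
    proof (rule integral_le)
      show "(\<lambda>s. 1 + 3 * \<kappa> * G s \<omega> + 3 * \<kappa>\<^sup>2 / 2 * s) integrable_on {0..real n}"
        by (intro integrable_continuous_real continuous_intros cT)
      show "(\<lambda>s. (exp (\<kappa> * (W s \<omega> + B s \<omega>) + \<kappa>\<^sup>2 / 2 * s)) ^ 3) integrable_on {0..real n}"
        using cT unfolding G_def[symmetric] by (intro integrable_continuous_real continuous_intros cT)
      show "1 + 3 * \<kappa> * G s \<omega> + 3 * \<kappa>\<^sup>2 / 2 * s \<le> (exp (\<kappa> * (W s \<omega> + B s \<omega>) + \<kappa>\<^sup>2 / 2 * s)) ^ 3" for s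
      proof -
        have "(exp (\<kappa> * G s \<omega> + \<kappa>\<^sup>2 / 2 * s)) ^ 3 = exp (3 * (\<kappa> * G s \<omega> + \<kappa>\<^sup>2 / 2 * s))"
          by (simp add: exp_of_nat_mult[of 3, symmetric])
        then show ?thesis using exp_ge_add_one_self[of "3 * (\<kappa> * G s \<omega> + \<kappa>\<^sup>2 / 2 * s)"]
          by (simp add: G_def algebra_simps)
      qed
    qed
    with lower n show "\<exists>n::nat. n > 0 \<and> K \<le> integral {0..real n} (\<lambda>s. (exp (\<kappa> * (W s \<omega> + B s \<omega>) + \<kappa>\<^sup>2 / 2 * s)) ^ 3)"
      by (intro exI[of _ n]) linarith
  qed
qed

section \<open>Comparison\<close>

lemma powi_minus_two: "(x::real) powi (-2) = 1 / x\<^sup>2"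
  by (simp add: power_int_minus divide_inverse)

lemma set_integrable_bounded_open:
  fixes f :: "'a::euclidean_space \<Rightarrow> real"
  assumes "bounded D" "open D" "continuous_on (closure D) f"
  shows "set_integrable lborel D f"
proof -
  have "compact (closure D)" using assms(1) by (simp add: compact_closure)
  from borel_integrable_compact[OF this assms(3)]
  have "set_integrable lborel (closure D) f" by (simp add: set_integrable_def indicator_def if_distrib cong: if_cong)
  then show ?thesis by (rule set_integrable_subset) (use assms(2) closure_subset in auto)
qed

text \<open>Dominated convergence with a constant bound, which exists because the integrand is
  continuous on a compact product and \<open>D\<close> has finite measure.\<close>

lemma continuous_on_LINT_param:
  fixes G :: "real \<Rightarrow> 'a::euclidean_space \<Rightarrow> real"
  assumes D: "bounded D" "open D" and G: "continuous_on ({0..T} \<times> closure D) (\<lambda>(s, x). G s x)"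
  shows "continuous_on {0..T} (\<lambda>s. LINT x:D|lborel. G s x)"
  unfolding continuous_on_sequentially comp_def
proof (intro allI ballI impI, elim conjE)
  fix S s assume s: "s \<in> {0..T}" and S: "\<forall>n. S n \<in> {0..T}" "S \<longlonglongrightarrow> (s::real)"
  have "compact ({0..T} \<times> closure D)" using D by (intro compact_Times) (auto simp: compact_closure)
  then have "bounded ((\<lambda>(s, x). G s x) ` ({0..T} \<times> closure D))"
    using G compact_continuous_image compact_imp_bounded by blast
  then obtain C where C: "\<And>p. p \<in> {0..T} \<times> closure D \<Longrightarrow> norm (case p of (s, x) \<Rightarrow> G s x) \<le> C"
    unfolding bounded_iff by blast
  have Gs: "continuous_on (closure D) (G r)" if "r \<in> {0..T}" for r
  proof -
    have "continuous_on (closure D) ((\<lambda>(s, x). G s x) \<circ> (\<lambda>x. (r, x)))"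
      by (rule continuous_on_compose) (use that in \<open>auto intro!: continuous_intros continuous_on_subset[OF G]\<close>)
    then show ?thesis by (simp add: comp_def)
  qed
  have Gm: "(\<lambda>x. indicat_real D x *\<^sub>R G r x) \<in> borel_measurable lborel" if "r \<in> {0..T}" for r
    using borel_measurable_continuous_on_indicator[of D "G r"] continuous_on_subset[OF Gs[OF that] closure_subset] D by simp
  show "(\<lambda>n. LINT x:D|lborel. G (S n) x) \<longlonglongrightarrow> (LINT x:D|lborel. G s x)"
    unfolding set_lebesgue_integral_def
  proof (rule integral_dominated_convergence[where w="\<lambda>x. indicat_real D x * C"])
    show "integrable lborel (\<lambda>x. indicat_real D x * C)"
      using set_integrable_bounded_open[OF D continuous_on_const, of C] by (simp add: set_integrable_def)
    show "AE x in lborel. (\<lambda>n. indicat_real D x *\<^sub>R G (S n) x) \<longlonglongrightarrow> indicat_real D x *\<^sub>R G s x"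
    proof (rule AE_I2)
      fix x
      show "(\<lambda>n. indicat_real D x *\<^sub>R G (S n) x) \<longlonglongrightarrow> indicat_real D x *\<^sub>R G s x"
      proof (cases "x \<in> D")
        case True
        then have x: "x \<in> closure D" using closure_subset by auto
        have "(\<lambda>n. (\<lambda>(s, x). G s x) (S n, x)) \<longlonglongrightarrow> (\<lambda>(s, x). G s x) (s, x)"
          by (rule continuous_on_tendsto_compose[OF G]) (use S s x in \<open>auto intro!: tendsto_Pair\<close>)
        then show ?thesis by (intro tendsto_scaleR tendsto_const) simp
      qed simp
    qed
    show "AE x in lborel. norm (indicat_real D x *\<^sub>R G (S n) x) \<le> indicat_real D x * C" for n
    proof (rule AE_I2)
      fix x
      show "norm (indicat_real D x *\<^sub>R G (S n) x) \<le> indicat_real D x * C"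
        using C[of "(S n, x)"] S(1) closure_subset[of D] by (auto simp: indicator_def)
    qed
  qed (use Gm S s in auto)
qed

text \<open>The integral formula is available almost surely at countably many times only;
  inequalities derived from it extend to all times by continuity from the right and density of the
  rationals.\<close>

lemma nonpos_from_rationals:
  fixes h :: "real \<Rightarrow> real"
  assumes c: "continuous_on {0..} h" and q: "\<And>q. q \<in> \<rat> \<Longrightarrow> 0 < q \<Longrightarrow> h q \<le> 0" and s: "0 \<le> s"
  shows "h s \<le> 0"
proof (rule ccontr)
  assume "\<not> h s \<le> 0"
  then have "0 < h s" by simp
  moreover have "(h \<longlongrightarrow> h s) (at_right s)"
    using c s by (auto simp: continuous_on_def intro: tendsto_within_subset)
  ultimately have "eventually (\<lambda>r. 0 < h r) (at_right s)" by (rule order_tendstoD(1)[rotated])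
  then obtain b where b: "s < b" "\<And>r. s < r \<Longrightarrow> r < b \<Longrightarrow> 0 < h r"
    by (auto simp: eventually_at_right_field)
  obtain r where "r \<in> \<rat>" "s < r" "r < b" using Rats_dense_in_real[OF b(1)] by blast
  then show False using b(2)[of r] q[of r] s by simp
qed

text \<open>The \<open>dt\<close> coefficient in the equation for the integral of
  \<open>z1 * \<phi>\<close>, with \<open>L\<close> in the role of the Laplacian of
  \<open>\<phi>\<close>. It refers to single paths, so that one comparison argument serves both
  systems.\<close>

definition drift ::
    "'a::euclidean_space set \<Rightarrow> real \<Rightarrow> real \<Rightarrow> ('a \<Rightarrow> real) \<Rightarrow> ('a \<Rightarrow> real) \<Rightarrow>
     (real \<Rightarrow> 'a \<Rightarrow> real) \<Rightarrow> (real \<Rightarrow> 'a \<Rightarrow> real) \<Rightarrow> real \<Rightarrow> real" where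
  "drift D l1 l2 \<phi> L z1 z2 s = (LINT x:D|lborel. z1 s x * L x)
     - l1 * (LINT x:D|lborel. z1 s x powi (-2) * \<phi> x) - l2 * (LINT x:D|lborel. z2 s x powi (-2) * \<phi> x)"

context
  fixes D :: "'a::euclidean_space set" and \<phi> L :: "'a \<Rightarrow> real"
  assumes D: "bounded D" "open D" and \<phi>: "continuous_on (closure D) \<phi>" and L: "continuous_on (closure D) L"
begin

lemma continuous_on_second: "continuous_on (closure D) f \<Longrightarrow> continuous_on (S \<times> closure D) (\<lambda>(s, x). f x :: real)"
  unfolding case_prod_beta by (rule continuous_on_compose2[where g=f]) (auto intro: continuous_intros)

lemma continuous_on_times_second:
  fixes z :: "real \<Rightarrow> 'a \<Rightarrow> real"
  assumes "continuous_on ({0..T} \<times> closure D) (\<lambda>(s, x). z s x)" "continuous_on (closure D) f"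
  shows "continuous_on {0..T} (\<lambda>s. LINT x:D|lborel. z s x * (f x :: real))"
  by (rule continuous_on_LINT_param[OF D])
    (use continuous_on_mult[OF assms(1) continuous_on_second[OF assms(2)]] in \<open>simp add: case_prod_beta\<close>)

lemma continuous_on_powi_second:
  fixes z :: "real \<Rightarrow> 'a \<Rightarrow> real"
  assumes "continuous_on ({0..T} \<times> closure D) (\<lambda>(s, x). z s x)" "\<And>s x. s \<in> {0..T} \<Longrightarrow> x \<in> closure D \<Longrightarrow> z s x \<noteq> 0"
  shows "continuous_on ({0..T} \<times> closure D) (\<lambda>(s, x). (z s x :: real) powi (-2))"
  using assms unfolding powi_minus_two case_prod_beta by (intro continuous_intros) auto

lemma continuous_on_drift:
  fixes z1 z2 :: "real \<Rightarrow> 'a \<Rightarrow> real"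
  assumes "continuous_on ({0..T} \<times> closure D) (\<lambda>(s, x). z1 s x)" "\<And>s x. s \<in> {0..T} \<Longrightarrow> x \<in> closure D \<Longrightarrow> z1 s x \<noteq> 0"
    and "continuous_on ({0..T} \<times> closure D) (\<lambda>(s, x). z2 s x)" "\<And>s x. s \<in> {0..T} \<Longrightarrow> x \<in> closure D \<Longrightarrow> z2 s x \<noteq> 0"
  shows "continuous_on {0..T} (drift D l1 l2 \<phi> L z1 z2)"
  unfolding drift_def[abs_def]
  by (intro continuous_intros continuous_on_times_second[OF assms(1) L]
      continuous_on_times_second[OF continuous_on_powi_second \<phi>] assms)

lemma LINT_drift:
  fixes z1 z2 :: "real \<Rightarrow> 'a \<Rightarrow> real"
  assumes z: "continuous_on ({0..T} \<times> closure D) (\<lambda>(s, x). z1 s x)" "\<And>s x. s \<in> {0..T} \<Longrightarrow> x \<in> closure D \<Longrightarrow> z1 s x \<noteq> 0"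
    "continuous_on ({0..T} \<times> closure D) (\<lambda>(s, x). z2 s x)" "\<And>s x. s \<in> {0..T} \<Longrightarrow> x \<in> closure D \<Longrightarrow> z2 s x \<noteq> 0"
  shows "(LINT s:{0..T}|lborel. LINT x:D|lborel. z1 s x * L x)
     - l1 * (LINT s:{0..T}|lborel. LINT x:D|lborel. z1 s x powi (-2) * \<phi> x)
     - l2 * (LINT s:{0..T}|lborel. LINT x:D|lborel. z2 s x powi (-2) * \<phi> x)
     = integral {0..T} (drift D l1 l2 \<phi> L z1 z2)"
proof -
  define f1 where "f1 s = (LINT x:D|lborel. z1 s x * L x)" for s
  define f2 where "f2 s = (LINT x:D|lborel. z1 s x powi (-2) * \<phi> x)" for s
  define f3 where "f3 s = (LINT x:D|lborel. z2 s x powi (-2) * \<phi> x)" for s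
  have c: "continuous_on {0..T} f1" "continuous_on {0..T} f2" "continuous_on {0..T} f3"
    unfolding f1_def[abs_def] f2_def[abs_def] f3_def[abs_def]
    by (intro continuous_on_times_second[OF z(1) L] continuous_on_times_second[OF continuous_on_powi_second \<phi>] z; simp)+
  have "integral {0..T} (drift D l1 l2 \<phi> L z1 z2) = integral {0..T} (\<lambda>s. (f1 s - l1 * f2 s) - l2 * f3 s)"
    unfolding drift_def[abs_def] f1_def f2_def f3_def ..
  also have "\<dots> = integral {0..T} (\<lambda>s. f1 s - l1 * f2 s) - integral {0..T} (\<lambda>s. l2 * f3 s)"
    by (rule Henstock_Kurzweil_Integration.integral_diff; intro integrable_continuous_real continuous_intros c)
  also have "integral {0..T} (\<lambda>s. f1 s - l1 * f2 s) = integral {0..T} f1 - integral {0..T} (\<lambda>s. l1 * f2 s)"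
    by (rule Henstock_Kurzweil_Integration.integral_diff; intro integrable_continuous_real continuous_intros c)
  finally show ?thesis
    using LINT_eq_integral[OF c(1)] LINT_eq_integral[OF c(2)] LINT_eq_integral[OF c(3)]
    by (simp add: f1_def[abs_def] f2_def[abs_def] f3_def[abs_def])
qed

text \<open>The tangent line of \<open>x \<mapsto> x\<^sup>-\<^sup>2\<close> at \<open>\<alpha>\<close> replaces Jensen's inequality.\<close>

lemma LINT_inverse_square_ge:
  assumes z: "continuous_on (closure D) z" "\<And>x. x \<in> closure D \<Longrightarrow> 0 < z x" and \<phi>0: "\<And>x. x \<in> closure D \<Longrightarrow> 0 \<le> \<phi> x"
    and \<alpha>: "\<alpha> > 0" and le: "(LINT x:D|lborel. z x * \<phi> x) \<le> \<alpha> * (LINT x:D|lborel. \<phi> x)"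
  shows "(LINT x:D|lborel. \<phi> x) / \<alpha>\<^sup>2 \<le> (LINT x:D|lborel. z x powi (-2) * \<phi> x)"
proof -
  let ?m = "LINT x:D|lborel. \<phi> x" and ?y = "LINT x:D|lborel. z x * \<phi> x"
  have tangent: "3 / \<alpha>\<^sup>2 - 2 / \<alpha> ^ 3 * x \<le> 1 / x\<^sup>2" if x: "x > 0" for x
  proof -
    \<comment> \<open>The difference between \<open>1 / x\<^sup>2\<close> and its tangent has a
      double zero at \<open>\<alpha>\<close>; multiplied by \<open>\<alpha> ^ 3 * x\<^sup>2\<close>
      it factors in this way.\<close>
    have "0 \<le> (x - \<alpha>)\<^sup>2 * (2 * x + \<alpha>)" using x \<alpha> by simp
    also have "\<dots> = \<alpha> ^ 3 - 3 * \<alpha> * x\<^sup>2 + 2 * x ^ 3" by (simp add: power2_eq_square power3_eq_cube algebra_simps)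
    finally have "0 \<le> \<alpha> ^ 3 - 3 * \<alpha> * x\<^sup>2 + 2 * x ^ 3" .
    then have "(3 * \<alpha> * x\<^sup>2 - 2 * x ^ 3) / (\<alpha> ^ 3 * x\<^sup>2) \<le> \<alpha> ^ 3 / (\<alpha> ^ 3 * x\<^sup>2)" using x \<alpha> by (intro divide_right_mono) auto
    also have "(3 * \<alpha> * x\<^sup>2 - 2 * x ^ 3) / (\<alpha> ^ 3 * x\<^sup>2) = 3 / \<alpha>\<^sup>2 - 2 / \<alpha> ^ 3 * x"
      using x \<alpha> by (simp add: field_simps power2_eq_square power3_eq_cube)
    also have "\<alpha> ^ 3 / (\<alpha> ^ 3 * x\<^sup>2) = 1 / x\<^sup>2" using \<alpha> by simp
    finally show ?thesis .
  qed
  have i: "set_integrable lborel D \<phi>" "set_integrable lborel D (\<lambda>x. z x * \<phi> x)" "set_integrable lborel D (\<lambda>x. z x powi (-2) * \<phi> x)"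
    using z \<phi> unfolding powi_minus_two by (intro set_integrable_bounded_open[OF D] continuous_intros; force)+
  have "?m / \<alpha>\<^sup>2 = 3 / \<alpha>\<^sup>2 * ?m - 2 / \<alpha> ^ 3 * (\<alpha> * ?m)" using \<alpha> by (simp add: field_simps power2_eq_square power3_eq_cube)
  \<comment> \<open>The tangent has negative slope, so an upper bound \<open>\<alpha>\<close> of the
    \<open>\<phi>\<close>-weighted mean of \<open>z\<close> can stand in for the mean
    itself.\<close>
  also have "\<dots> \<le> 3 / \<alpha>\<^sup>2 * ?m - 2 / \<alpha> ^ 3 * ?y" using le \<alpha> by (intro diff_left_mono mult_left_mono) auto
  also have "\<dots> = (LINT x:D|lborel. 3 / \<alpha>\<^sup>2 * \<phi> x - 2 / \<alpha> ^ 3 * (z x * \<phi> x))"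
    using i by (subst set_integral_diff) auto
  also have "\<dots> \<le> (LINT x:D|lborel. z x powi (-2) * \<phi> x)"
  proof (rule set_integral_mono)
    fix x assume "x \<in> D"
    then have x: "x \<in> closure D" using closure_subset by auto
    have "(3 / \<alpha>\<^sup>2 - 2 / \<alpha> ^ 3 * z x) * \<phi> x \<le> 1 / (z x)\<^sup>2 * \<phi> x"
      by (intro mult_right_mono tangent z \<phi>0 x)
    then show "3 / \<alpha>\<^sup>2 * \<phi> x - 2 / \<alpha> ^ 3 * (z x * \<phi> x) \<le> z x powi (-2) * \<phi> x"
      by (simp add: powi_minus_two algebra_simps)
  qed (use i in auto)
  finally show ?thesis .
qed

text \<open>The contradiction along one path. The formula is used twice: the sign of the drift first
  gives \<open>y * E \<le> u0\<close>, and this bound enters the tangent-line estimate, which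
  sharpens the drift to \<open>- c * E ^ 3\<close> and forces \<open>y * E \<le> 0\<close> at some
  integer time. The second component enters through a term of favourable sign that is
  dropped.\<close>

lemma no_global_positive_solution:
  assumes con: "connected D" "D \<noteq> {}" and \<phi>1: "\<And>x. x \<in> closure D \<Longrightarrow> 1 \<le> \<phi> x" and L0: "\<And>x. x \<in> closure D \<Longrightarrow> L x \<le> 0"
    and z1: "continuous_on ({0..} \<times> closure D) (\<lambda>(s, x). z1 s x)" "\<And>s x. 0 \<le> s \<Longrightarrow> x \<in> closure D \<Longrightarrow> z1 s x \<noteq> 0"
    and z2: "continuous_on ({0..} \<times> closure D) (\<lambda>(s, x). z2 s x)" "\<And>s x. 0 \<le> s \<Longrightarrow> x \<in> closure D \<Longrightarrow> z2 s x \<noteq> 0"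
    and init: "\<And>x. x \<in> D \<Longrightarrow> 0 < z1 0 x"
    and E: "continuous_on {0..} E" "\<And>s. 0 < E s" and l: "0 < l1" "0 < l2"
    and formula: "\<And>T. T \<in> \<rat> \<Longrightarrow> 0 < T \<Longrightarrow> (LINT x:D|lborel. z1 T x * \<phi> x) * E T =
       (LINT x:D|lborel. z1 0 x * \<phi> x) * E 0 + integral {0..T} (\<lambda>s. E s * drift D l1 l2 \<phi> L z1 z2 s)"
    and div: "\<And>K. \<exists>n::nat. n > 0 \<and> K \<le> integral {0..real n} (\<lambda>s. (E s) ^ 3)"
  shows False
proof -
  define y where "y s = (LINT x:D|lborel. z1 s x * \<phi> x)" for s
  define m where "m = (LINT x:D|lborel. \<phi> x)"
  have clD: "x \<in> D \<Longrightarrow> x \<in> closure D" for x using closure_subset by auto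
  obtain x0 where x0: "x0 \<in> D" using con by blast
  \<comment> \<open>The continuous image of the connected set
    \<open>{0..} \<times> closure D\<close> is an interval; it avoids 0 and contains a positive
    initial value.\<close>
  have pos: "0 < z1 s x" if "0 \<le> s" "x \<in> closure D" for s x
  proof (rule ccontr)
    assume "\<not> 0 < z1 s x"
    have conn: "connected ((\<lambda>(s, x). z1 s x) ` ({0..} \<times> closure D))"
      by (rule connected_continuous_image[OF z1(1)]) (intro connected_Times connected_imp_connected_closure con connected_Ici)
    have "(\<lambda>(s, x). z1 s x) (s, x) \<in> (\<lambda>(s, x). z1 s x) ` ({0..} \<times> closure D)"
      "(\<lambda>(s, x). z1 s x) (0, x0) \<in> (\<lambda>(s, x). z1 s x) ` ({0..} \<times> closure D)"
      using that clD[OF x0] by (intro imageI; simp)+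
    then have "z1 s x \<in> (\<lambda>(s, x). z1 s x) ` ({0..} \<times> closure D)" "z1 0 x0 \<in> (\<lambda>(s, x). z1 s x) ` ({0..} \<times> closure D)" by simp_all
    from connectedD_interval[OF conn this, of 0] init[OF x0] \<open>\<not> 0 < z1 s x\<close>
    obtain s' x' where "0 \<le> s'" "x' \<in> closure D" "z1 s' x' = 0" by auto
    then show False using z1(2) by blast
  qed
  have sub: "{0..T} \<times> closure D \<subseteq> {0..} \<times> closure D" for T :: real by auto
  note cz1 = continuous_on_subset[OF z1(1) sub] and cz2 = continuous_on_subset[OF z2(1) sub]
  have fix1: "continuous_on (closure D) (z1 s)" if "0 \<le> s" for s
  proof -
    have "continuous_on (closure D) ((\<lambda>(s, x). z1 s x) \<circ> (\<lambda>x. (s, x)))"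
      by (rule continuous_on_compose) (use that in \<open>auto intro!: continuous_intros continuous_on_subset[OF z1(1)]\<close>)
    then show ?thesis by (simp add: comp_def)
  qed
  have \<phi>0: "0 \<le> \<phi> x" if "x \<in> closure D" for x using \<phi>1[OF that] by linarith
  have pos_int: "0 < (LINT x:D|lborel. f x)" if f: "continuous_on (closure D) f" "\<And>x. x \<in> closure D \<Longrightarrow> 0 < f x" for f :: "'a \<Rightarrow> real"
  proof -
    have "compact (closure D)" "closure D \<noteq> {}" using D con by (auto simp: compact_closure)
    from continuous_attains_inf[OF this f(1)] obtain c where c: "c \<in> closure D" "\<And>x. x \<in> closure D \<Longrightarrow> f c \<le> f x" by blast
    have fin: "emeasure lborel D < \<infinity>" by (rule emeasure_bounded_finite[OF D(1)])
    have "emeasure lborel D \<noteq> 0"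
    proof
      assume "emeasure lborel D = 0"
      then have "D \<in> null_sets lebesgue" using D(2) by (intro null_sets_completionI) (auto simp: null_sets_def)
      then show False using open_not_negligible[OF D(2)] con by (simp add: negligible_iff_null_sets)
    qed
    then have mD: "0 < measure lborel D" using fin by (simp add: measure_def enn2real_positive_iff zero_less_iff_neq_zero)
    have "0 < f c * measure lborel D" using mD f(2)[OF c(1)] by simp
    also have "\<dots> = (LINT x:D|lborel. f c)" using D fin by (simp add: set_lebesgue_integral_def)
    also have "\<dots> \<le> (LINT x:D|lborel. f x)"
      by (rule set_integral_mono[OF set_integrable_bounded_open[OF D continuous_on_const] set_integrable_bounded_open[OF D f(1)]])
        (use c clD in auto)
    finally show ?thesis .
  qed
  have m: "0 < m" unfolding m_def by (rule pos_int[OF \<phi>]) (use \<phi>1 in force)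
  have ypos: "0 < y s" if "0 \<le> s" for s
    unfolding y_def by (rule pos_int) (use pos \<phi>1 that fix1 \<phi> in \<open>auto intro!: continuous_intros mult_pos_pos intro: less_le_trans[OF zero_less_one]\<close>)
  have drift_le: "drift D l1 l2 \<phi> L z1 z2 s \<le> - l1 * (LINT x:D|lborel. z1 s x powi (-2) * \<phi> x)" if s: "0 \<le> s" for s
  proof -
    have "(LINT x:D|lborel. z1 s x * L x) \<le> (LINT x:D|lborel. 0)"
      by (rule set_integral_mono[OF set_integrable_bounded_open[OF D] set_integrable_bounded_open[OF D]])
        (use fix1[OF s] L pos[OF s] L0 clD in \<open>auto intro!: continuous_intros mult_nonneg_nonpos simp: less_imp_le\<close>)
    then have 1: "(LINT x:D|lborel. z1 s x * L x) \<le> 0" by (simp add: set_lebesgue_integral_def)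
    have "0 \<le> (LINT x:D|lborel. z2 s x powi (-2) * \<phi> x)"
      unfolding set_lebesgue_integral_def powi_minus_two
      by (rule integral_nonneg_AE, rule AE_I2) (use \<phi>0 clD in \<open>auto simp: indicator_def\<close>)
    then have "0 \<le> l2 * (LINT x:D|lborel. z2 s x powi (-2) * \<phi> x)" using l by simp
    then show ?thesis using 1 unfolding drift_def by simp
  qed
  have drift_c: "continuous_on {0..T} (drift D l1 l2 \<phi> L z1 z2)" for T
    by (rule continuous_on_drift[OF cz1 _ cz2]) (use z1(2) z2(2) in auto)
  define u0 where "u0 = y 0 * E 0"
  have u0: "0 < u0" using ypos[of 0] E(2)[of 0] by (simp add: u0_def)
  have ET: "continuous_on {0..T} E" for T by (rule continuous_on_subset[OF E(1)]) auto
  have inv_nn: "0 \<le> (LINT x:D|lborel. z1 s x powi (-2) * \<phi> x)" for s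
    unfolding set_lebesgue_integral_def powi_minus_two
    by (rule integral_nonneg_AE, rule AE_I2) (use \<phi>0 clD in \<open>auto simp: indicator_def\<close>)
  have rat: "y T * E T - u0 \<le> 0" if T: "T \<in> \<rat>" "0 < T" for T
  proof -
    have "integral {0..T} (\<lambda>s. E s * drift D l1 l2 \<phi> L z1 z2 s) \<le> integral {0..T} (\<lambda>s. 0)"
    proof (rule integral_le)
      fix s assume "s \<in> {0..T}"
      then have "drift D l1 l2 \<phi> L z1 z2 s \<le> 0"
        using drift_le[of s] l mult_nonneg_nonneg[OF less_imp_le[OF l(1)] inv_nn[of s]] by simp
      then show "E s * drift D l1 l2 \<phi> L z1 z2 s \<le> 0" using E(2)[of s] by (simp add: mult_nonneg_nonpos)
    qed (auto intro!: integrable_continuous_real continuous_intros ET drift_c)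
    then show ?thesis using formula[OF T] by (simp add: y_def u0_def)
  qed
  have yc: "continuous_on {0..} y"
  proof -
    have "continuous_on {0..T} y" for T unfolding y_def by (rule continuous_on_times_second[OF cz1 \<phi>])
    then have "continuous (at s within {0..}) y" if "0 \<le> s" for s
    proof -
      have "at s within {0..} = at s within {0..s + 1}"
        by (rule at_within_nhd[of _ "{..<s + 1}"]) auto
      moreover have "continuous (at s within {0..s + 1}) y"
        using \<open>\<And>T. continuous_on {0..T} y\<close>[of "s + 1"] that by (simp add: continuous_on_eq_continuous_within)
      ultimately show ?thesis by simp
    qed
    then show ?thesis by (simp add: continuous_on_eq_continuous_within)
  qed
  have bound: "y s * E s \<le> u0" if "0 \<le> s" for s
  proof -
    have "continuous_on {0..} (\<lambda>s. y s * E s - u0)" by (intro continuous_intros yc E(1))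
    from nonpos_from_rationals[OF this rat that] show ?thesis by simp
  qed
  \<comment> \<open>With \<open>\<alpha> = u0 / (m * E s)\<close>, the bound
    \<open>m / \<alpha>\<^sup>2\<close> equals \<open>m * (m / u0)\<^sup>2 * (E s)\<^sup>2\<close>;
    the factor \<open>l1\<close> completes the constant.\<close>
  define c where "c = l1 * m * (m / u0)\<^sup>2"
  have c: "0 < c" using l m u0 by (simp add: c_def)
  have key: "E s * drift D l1 l2 \<phi> L z1 z2 s \<le> - c * (E s) ^ 3" if s: "0 \<le> s" for s
  proof -
    define \<alpha> where "\<alpha> = u0 / (m * E s)"
    have \<alpha>: "0 < \<alpha>" using u0 m E(2)[of s] by (simp add: \<alpha>_def)
    have "y s \<le> \<alpha> * m" using bound[OF s] E(2)[of s] m by (simp add: \<alpha>_def field_simps)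
    then have "m / \<alpha>\<^sup>2 \<le> (LINT x:D|lborel. z1 s x powi (-2) * \<phi> x)"
      unfolding y_def m_def by (intro LINT_inverse_square_ge fix1 pos s \<phi>0 \<alpha>)
    then have "l1 * (m / \<alpha>\<^sup>2) \<le> l1 * (LINT x:D|lborel. z1 s x powi (-2) * \<phi> x)" using l by (intro mult_left_mono) auto
    then have "drift D l1 l2 \<phi> L z1 z2 s \<le> - (l1 * (m / \<alpha>\<^sup>2))" using drift_le[OF s] by simp
    also have "l1 * (m / \<alpha>\<^sup>2) = c * (E s)\<^sup>2" using u0 m E(2)[of s] by (simp add: \<alpha>_def c_def field_simps power2_eq_square)
    finally have "E s * drift D l1 l2 \<phi> L z1 z2 s \<le> E s * (- (c * (E s)\<^sup>2))" using E(2)[of s] by (intro mult_left_mono) auto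
    then show ?thesis by (simp add: power2_eq_square power3_eq_cube algebra_simps)
  qed
  obtain n :: nat where n: "n > 0" "u0 / c \<le> integral {0..real n} (\<lambda>s. (E s) ^ 3)" using div by blast
  have "integral {0..real n} (\<lambda>s. E s * drift D l1 l2 \<phi> L z1 z2 s) \<le> integral {0..real n} (\<lambda>s. - c * (E s) ^ 3)"
    by (rule integral_le) (auto intro!: integrable_continuous_real continuous_intros ET drift_c key[simplified])
  also have "\<dots> = - c * integral {0..real n} (\<lambda>s. (E s) ^ 3)" by simp
  also have "\<dots> \<le> - c * (u0 / c)" using n(2) c by (simp add: pos_divide_le_eq mult.commute)
  also have "\<dots> = - u0" using c by simp
  finally have "y (real n) * E (real n) \<le> 0"
    using formula[of "real n"] n(1) by (simp add: y_def u0_def)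
  then show False using ypos[of "real n"] E(2)[of "real n"] by (simp add: mult_le_0_iff)
qed

end

section \<open>Measurability of spatial integrals and of stopping events\<close>

lemma dense_sequence_in_open:
  fixes D :: "'a::euclidean_space set"
  assumes "open D" "D \<noteq> {}"
  obtains d :: "nat \<Rightarrow> 'a" where "\<And>i. d i \<in> D" "\<And>x e. x \<in> D \<Longrightarrow> 0 < e \<Longrightarrow> \<exists>i. dist x (d i) < e"
proof -
  obtain S :: "'a set" where S: "countable S" "\<And>X. open X \<Longrightarrow> X \<noteq> {} \<Longrightarrow> \<exists>d\<in>S. d \<in> X"
    using countable_dense_exists by blast
  have ne: "S \<inter> D \<noteq> {}" using S(2)[OF assms] by blast
  have c: "countable (S \<inter> D)" using S(1) by blast
  show ?thesis
  proof (rule that[of "from_nat_into (S \<inter> D)"])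
    show "from_nat_into (S \<inter> D) i \<in> D" for i using from_nat_into[OF ne, of i] by blast
    fix x and e :: real assume "x \<in> D" "0 < e"
    then have "open (ball x e \<inter> D)" "x \<in> ball x e \<inter> D" using assms by auto
    then have "open (ball x e \<inter> D)" "ball x e \<inter> D \<noteq> {}" by blast+
    then obtain p where "p \<in> S" "p \<in> ball x e \<inter> D" using S(2) by blast
    moreover then obtain i where "from_nat_into (S \<inter> D) i = p" using from_nat_into_surj[OF c, of p] by blast
    ultimately show "\<exists>i. dist x (from_nat_into (S \<inter> D) i) < e" by (intro exI[of _ i]) auto
  qed
qed

text \<open>A field is only measurable at each point separately and continuous on some paths; the spatial
  integral over those paths is measurable because the field is the limit of its values at the
  nearby points of a dense sequence.\<close>

lemma spatial_integral_measurable: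
  fixes D :: "'a::euclidean_space set" and u :: "'a \<Rightarrow> 'w \<Rightarrow> real" and \<phi> :: "'a \<Rightarrow> real"
  assumes D: "open D" "D \<noteq> {}" and u: "\<And>x. x \<in> D \<Longrightarrow> u x \<in> borel_measurable G" and \<phi>: "continuous_on D \<phi>"
  obtains \<xi> where "\<xi> \<in> borel_measurable G"
    "\<And>\<omega>. continuous_on D (\<lambda>x. u x \<omega>) \<Longrightarrow> \<xi> \<omega> = (LINT x:D|lborel. u x \<omega> * \<phi> x)"
proof -
  obtain d :: "nat \<Rightarrow> 'a" where d: "\<And>i. d i \<in> D" "\<And>x e. x \<in> D \<Longrightarrow> 0 < e \<Longrightarrow> \<exists>i. dist x (d i) < e"
    using dense_sequence_in_open[OF D] by blast
  \<comment> \<open>Index of the first dense point within \<open>1 / (k + 1)\<close> of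
    \<open>x\<close>. It is measurable in \<open>x\<close> with countably many values, so
    \<open>\<zeta> k\<close> is jointly measurable although \<open>u\<close> is measurable only for
    each fixed point.\<close>
  define q where "q k x = (LEAST i. dist x (d i) < 1 / real (Suc k))" for k x
  define \<zeta> where "\<zeta> k p = u (d (q k (snd p))) (fst p)" for k p
  have \<zeta>: "\<zeta> k \<in> borel_measurable (G \<Otimes>\<^sub>M lborel)" for k
    unfolding \<zeta>_def[abs_def]
  proof (rule measurable_compose_countable[where f="\<lambda>i p. u (d i) (fst p)"])
    show "(\<lambda>p. u (d i) (fst p)) \<in> borel_measurable (G \<Otimes>\<^sub>M lborel)" for i
      using u[OF d(1)] by measurable
    show "(\<lambda>p. q k (snd p)) \<in> measurable (G \<Otimes>\<^sub>M lborel) (count_space UNIV)"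
      unfolding q_def by measurable
  qed
  define \<zeta>' where "\<zeta>' p = lim (\<lambda>k. \<zeta> k p)" for p
  have \<zeta>': "\<zeta>' \<in> borel_measurable (G \<Otimes>\<^sub>M lborel)"
    unfolding \<zeta>'_def[abs_def] by (rule borel_measurable_lim_metric[OF \<zeta>])
  have \<phi>m: "(\<lambda>x. indicat_real D x *\<^sub>R \<phi> x) \<in> borel_measurable lborel"
    using borel_measurable_continuous_on_indicator[OF _ \<phi>] D(1) by simp
  define \<xi> where "\<xi> \<omega> = (LINT x|lborel. (indicat_real D x *\<^sub>R \<phi> x) * \<zeta>' (\<omega>, x))" for \<omega>
  have "\<xi> \<in> borel_measurable G"
    unfolding \<xi>_def[abs_def]
  proof (rule lborel.borel_measurable_lebesgue_integral)
    show "case_prod (\<lambda>\<omega> x. (indicat_real D x *\<^sub>R \<phi> x) * \<zeta>' (\<omega>, x)) \<in> borel_measurable (G \<Otimes>\<^sub>M lborel)"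
      unfolding case_prod_beta prod.collapse
      by (intro borel_measurable_times measurable_compose[OF measurable_snd \<phi>m] \<zeta>')
  qed
  moreover have "\<xi> \<omega> = (LINT x:D|lborel. u x \<omega> * \<phi> x)" if c: "continuous_on D (\<lambda>x. u x \<omega>)" for \<omega>
  proof -
    have "\<zeta>' (\<omega>, x) = u x \<omega>" if x: "x \<in> D" for x
    proof -
      have "dist x (d (q k x)) < 1 / real (Suc k)" for k
        unfolding q_def by (rule LeastI_ex, rule d(2)[OF x]) simp
      then have "(\<lambda>k. dist (d (q k x)) x) \<longlonglongrightarrow> 0"
        by (intro tendsto_sandwich[OF _ _ tendsto_const LIMSEQ_inverse_real_of_nat])
          (auto simp: dist_commute inverse_eq_divide intro!: always_eventually less_imp_le)
      then have "(\<lambda>k. d (q k x)) \<longlonglongrightarrow> x" by (rule iffD2[OF tendsto_dist_iff])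
      then have "(\<lambda>k. u (d (q k x)) \<omega>) \<longlonglongrightarrow> u x \<omega>"
        by (rule continuous_on_tendsto_compose[OF c]) (use x d in auto)
      then show ?thesis unfolding \<zeta>'_def \<zeta>_def by (simp add: limI)
    qed
    then show ?thesis unfolding \<xi>_def set_lebesgue_integral_def
      by (intro Bochner_Integration.integral_cong) (auto simp: indicator_def)
  qed
  ultimately show ?thesis by (rule that)
qed

text \<open>The definition controls events of the form \<open>\<sigma> \<le> s\<close>. The
  complement \<open>\<sigma> < t\<close> is the countable union of the events
  \<open>\<sigma> \<le> t - 1 / (k + 1)\<close>, each in an earlier \<sigma>-algebra; a negative
  time contributes the empty set.\<close>

lemma ext_stopping_time_ge:
  assumes fps: "filtered_prob_space M F" and \<sigma>: "ext_stopping_time F \<sigma>" and t: "0 \<le> t"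
  shows "{\<omega> \<in> space M. ennreal t \<le> \<sigma> \<omega>} \<in> sets (F t)"
proof -
  have sp: "space (F s) = space M" if "0 \<le> s" for s
    using filtered_prob_spaceD(2)[OF fps that] by (simp add: subalgebra_def)
  define A where "A k = (if 0 \<le> t - 1 / real (Suc k) then {\<omega> \<in> space M. \<sigma> \<omega> \<le> ennreal (t - 1 / real (Suc k))} else {})" for k
  have A: "A k \<in> sets (F t)" for k
  proof (cases "0 \<le> t - 1 / real (Suc k)")
    case True
    have "{\<omega> \<in> space (F (t - 1 / real (Suc k))). \<sigma> \<omega> \<le> ennreal (t - 1 / real (Suc k))} \<in> sets (F (t - 1 / real (Suc k)))"
      using \<sigma> True unfolding ext_stopping_time_def pred_def by blast
    moreover have "sets (F (t - 1 / real (Suc k))) \<subseteq> sets (F t)"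
      using fps True unfolding filtered_prob_space_def by auto
    ultimately show ?thesis using True sp[OF True] by (auto simp: A_def)
  qed (simp add: A_def)
  have "{\<omega> \<in> space M. ennreal t \<le> \<sigma> \<omega>} = space (F t) - (\<Union>k. A k)"
  proof (intro set_eqI iffI)
    fix \<omega> assume \<omega>: "\<omega> \<in> {\<omega> \<in> space M. ennreal t \<le> \<sigma> \<omega>}"
    have "\<omega> \<notin> A k" for k
    proof
      assume "\<omega> \<in> A k"
      then have "0 \<le> t - 1 / real (Suc k)" "\<sigma> \<omega> \<le> ennreal (t - 1 / real (Suc k))" by (auto simp: A_def split: if_splits)
      then have "ennreal t \<le> ennreal (t - 1 / real (Suc k))" using \<omega> order_trans[of "ennreal t" "\<sigma> \<omega>"] by blast
      then show False using \<open>0 \<le> t - 1 / real (Suc k)\<close> by (simp add: ennreal_le_iff)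
    qed
    then show "\<omega> \<in> space (F t) - (\<Union>k. A k)" using \<omega> sp[OF t] by auto
  next
    fix \<omega> assume \<omega>: "\<omega> \<in> space (F t) - (\<Union>k. A k)"
    have "ennreal t \<le> \<sigma> \<omega>"
    proof (rule ccontr)
      assume "\<not> ennreal t \<le> \<sigma> \<omega>"
      then have lt: "\<sigma> \<omega> < ennreal t" by simp
      then have fin: "\<sigma> \<omega> < \<infinity>" by (metis ennreal_less_top infinity_ennreal_def less_trans)
      define s where "s = enn2real (\<sigma> \<omega>)"
      have s: "\<sigma> \<omega> = ennreal s" "0 \<le> s" using fin by (auto simp: s_def less_top)
      then have "s < t" using lt t by (simp add: ennreal_less_iff)
      then obtain k where "inverse (real (Suc k)) < t - s" using reals_Archimedean[of "t - s"] by auto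
      then have "s \<le> t - 1 / real (Suc k)" by (simp add: inverse_eq_divide)
      then have "\<omega> \<in> A k" using s \<omega> sp[OF t] by (auto simp: A_def intro!: ennreal_leI)
      then show False using \<omega> by blast
    qed
    then show "\<omega> \<in> {\<omega> \<in> space M. ennreal t \<le> \<sigma> \<omega>}" using \<omega> sp[OF t] by simp
  qed
  then show ?thesis using A by auto
qed

text \<open>Integrating factor for an equation with continuous right-hand side. With
  \<open>r = \<kappa>\<^sup>2 / 2\<close> it absorbs the zeroth-order term in the equation for
  \<open>v\<close>.\<close>

lemma exp_factor_integral:
  fixes b y :: "real \<Rightarrow> real"
  assumes b: "continuous_on {0..T} b" and y: "\<And>t. t \<in> {0..T} \<Longrightarrow> y t = c + integral {0..t} b" and T: "0 \<le> T"
  shows "exp (r * T) * y T = y 0 + integral {0..T} (\<lambda>s. exp (r * s) * (b s + r * y s))"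
proof -
  have dy: "(y has_vector_derivative b t) (at t within {0..T})" if t: "t \<in> {0..T}" for t
  proof (rule has_vector_derivative_transform[OF t y])
    show "((\<lambda>t. c + integral {0..t} b) has_vector_derivative b t) (at t within {0..T})"
      using has_vector_derivative_add[OF has_vector_derivative_const integral_has_vector_derivative[OF b t]] by simp
  qed
  have "((\<lambda>s. exp (r * s) * (b s + r * y s)) has_integral (exp (r * T) * y T - exp (r * 0) * y 0)) {0..T}"
  proof (rule fundamental_theorem_of_calculus[OF T])
    fix t assume t: "t \<in> {0..T}"
    have "((\<lambda>t. exp (r * t)) has_vector_derivative r * exp (r * t)) (at t within {0..T})"
      unfolding has_real_derivative_iff_has_vector_derivative[symmetric] by (auto intro!: derivative_eq_intros)
    from has_vector_derivative_mult[OF this dy[OF t]]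
    show "((\<lambda>t. exp (r * t) * y t) has_vector_derivative exp (r * t) * (b t + r * y t)) (at t within {0..T})"
      by (simp add: algebra_simps)
  qed
  then show ?thesis by (simp add: integral_unique)
qed

lemma exp_scaled_powi:
  fixes v :: "'a::euclidean_space \<Rightarrow> real"
  shows "(LINT x:D|lborel. (exp (- a) * v x) * f x) = exp (- a) * (LINT x:D|lborel. v x * f x)"
    and "(LINT x:D|lborel. (exp (- a) * v x) powi (-2) * f x) = exp (2 * a) * (LINT x:D|lborel. v x powi (-2) * f x)"
proof -
  show "(LINT x:D|lborel. (exp (- a) * v x) * f x) = exp (- a) * (LINT x:D|lborel. v x * f x)"
    by (simp add: mult.assoc)
  have eq: "(exp (- a) * v x) powi (-2) * f x = exp (2 * a) * (v x powi (-2) * f x)" for x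
    unfolding exp_double powi_minus_two
    by (simp add: power_mult_distrib exp_minus inverse_eq_divide power_one_over power_divide)
  show "(LINT x:D|lborel. (exp (- a) * v x) powi (-2) * f x) = exp (2 * a) * (LINT x:D|lborel. v x powi (-2) * f x)"
    unfolding eq by simp
qed

text \<open>The drift of \<open>exp (- N) * v\<close> times \<open>exp (N + \<kappa>\<^sup>2 s / 2)\<close> is the derivative of \<open>exp (\<kappa>\<^sup>2 s / 2)\<close> times the
  integral of \<open>v\<close>, so both systems lead to the same integral equation.\<close>

lemma weak_V_path_formula:
  fixes D :: "'a::euclidean_space set" and v1 v2 :: "real \<Rightarrow> 'a \<Rightarrow> real"
  assumes D: "bounded D" "open D" and \<phi>: "continuous_on (closure D) \<phi>" and L: "continuous_on (closure D) L"
    and v1: "continuous_on ({0..} \<times> closure D) (\<lambda>(s, x). v1 s x)" "\<And>s x. 0 \<le> s \<Longrightarrow> x \<in> closure D \<Longrightarrow> v1 s x \<noteq> 0"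
    and v2: "continuous_on ({0..} \<times> closure D) (\<lambda>(s, x). v2 s x)" "\<And>s x. 0 \<le> s \<Longrightarrow> x \<in> closure D \<Longrightarrow> v2 s x \<noteq> 0"
    and N: "continuous_on {0..} N" and T: "0 \<le> T"
    and eq: "\<And>t. 0 \<le> t \<Longrightarrow> (LINT x:D|lborel. v1 t x * \<phi> x) = c
        + (LINT s:{0..t}|lborel. LINT x:D|lborel. v1 s x * (L x - \<kappa>\<^sup>2 / 2 * \<phi> x))
        - l1 * (LINT s:{0..t}|lborel. exp (3 * N s) * (LINT x:D|lborel. v1 s x powi (-2) * \<phi> x))
        - l2 * (LINT s:{0..t}|lborel. exp (N s + 2 * N s) * (LINT x:D|lborel. v2 s x powi (-2) * \<phi> x))"
  shows "(LINT x:D|lborel. (exp (- N T) * v1 T x) * \<phi> x) * exp (N T + \<kappa>\<^sup>2 / 2 * T) =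
    (LINT x:D|lborel. (exp (- N 0) * v1 0 x) * \<phi> x) * exp (N 0 + \<kappa>\<^sup>2 / 2 * 0) +
    integral {0..T} (\<lambda>s. exp (N s + \<kappa>\<^sup>2 / 2 * s) * drift D l1 l2 \<phi> L (\<lambda>s x. exp (- N s) * v1 s x) (\<lambda>s x. exp (- N s) * v2 s x) s)"
proof -
  define y where "y t = (LINT x:D|lborel. v1 t x * \<phi> x)" for t
  define f1 where "f1 s = (LINT x:D|lborel. v1 s x * (L x - \<kappa>\<^sup>2 / 2 * \<phi> x))" for s
  define f2 where "f2 s = exp (3 * N s) * (LINT x:D|lborel. v1 s x powi (-2) * \<phi> x)" for s
  define f3 where "f3 s = exp (N s + 2 * N s) * (LINT x:D|lborel. v2 s x powi (-2) * \<phi> x)" for s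
  define b where "b s = f1 s - l1 * f2 s - l2 * f3 s" for s
  have sub: "{0..t} \<times> closure D \<subseteq> {0..} \<times> closure D" "{0..t} \<subseteq> {0..}" for t :: real by auto
  note cv1 = continuous_on_subset[OF v1(1) sub(1)] and cv2 = continuous_on_subset[OF v2(1) sub(1)] and cN = continuous_on_subset[OF N sub(2)]
  have c1: "continuous_on {0..t} f1" for t
    unfolding f1_def[abs_def]
    by (rule continuous_on_times_second[OF D \<phi> L cv1]) (intro continuous_intros \<phi> L)
  have c2: "continuous_on {0..t} f2" for t
    unfolding f2_def[abs_def]
    by (intro continuous_intros cN continuous_on_times_second[OF D \<phi> L continuous_on_powi_second[OF D \<phi> L cv1] \<phi>]) (use v1 in auto)
  have c3: "continuous_on {0..t} f3" for t
    unfolding f3_def[abs_def]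
    by (intro continuous_intros cN continuous_on_times_second[OF D \<phi> L continuous_on_powi_second[OF D \<phi> L cv2] \<phi>]) (use v2 in auto)
  have bc: "continuous_on {0..t} b" for t unfolding b_def[abs_def] by (intro continuous_intros c1 c2 c3)
  have yb: "y t = c + integral {0..t} b" if "0 \<le> t" for t
  proof -
    have "integral {0..t} b = integral {0..t} (\<lambda>s. f1 s - l1 * f2 s) - integral {0..t} (\<lambda>s. l2 * f3 s)"
      unfolding b_def[abs_def]
      by (rule Henstock_Kurzweil_Integration.integral_diff; intro integrable_continuous_real continuous_intros c1 c2 c3)
    also have "integral {0..t} (\<lambda>s. f1 s - l1 * f2 s) = integral {0..t} f1 - integral {0..t} (\<lambda>s. l1 * f2 s)"
      by (rule Henstock_Kurzweil_Integration.integral_diff; intro integrable_continuous_real continuous_intros c1 c2 c3)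
    finally show ?thesis
      using eq[OF that] LINT_eq_integral[OF c1, of t] LINT_eq_integral[OF c2, of t] LINT_eq_integral[OF c3, of t]
      by (simp add: y_def f1_def[abs_def] f2_def[abs_def] f3_def[abs_def])
  qed
  have A: "exp (\<kappa>\<^sup>2 / 2 * T) * y T = y 0 + integral {0..T} (\<lambda>s. exp (\<kappa>\<^sup>2 / 2 * s) * (b s + \<kappa>\<^sup>2 / 2 * y s))"
    by (rule exp_factor_integral[OF bc yb T]) simp
  \<comment> \<open>The factors \<open>exp (- N s)\<close> and \<open>exp (N s)\<close> cancel,
    which leaves the integral of \<open>v1 * \<phi>\<close> times the integrating factor.\<close>
  have E: "(LINT x:D|lborel. (exp (- N s) * v1 s x) * \<phi> x) * exp (N s + r) = exp r * y s" for s r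
    unfolding exp_scaled_powi y_def by (simp add: exp_add exp_minus)
  have "integral {0..T} (\<lambda>s. exp (\<kappa>\<^sup>2 / 2 * s) * (b s + \<kappa>\<^sup>2 / 2 * y s)) =
    integral {0..T} (\<lambda>s. exp (N s + \<kappa>\<^sup>2 / 2 * s) * drift D l1 l2 \<phi> L (\<lambda>s x. exp (- N s) * v1 s x) (\<lambda>s x. exp (- N s) * v2 s x) s)"
  proof (rule Henstock_Kurzweil_Integration.integral_cong)
    fix s assume s: "s \<in> {0..T}"
    have vs: "continuous_on (closure D) (v1 s)"
    proof -
      have "continuous_on (closure D) ((\<lambda>(s, x). v1 s x) \<circ> (\<lambda>x. (s, x)))"
        by (rule continuous_on_compose) (use s in \<open>auto intro!: continuous_intros continuous_on_subset[OF v1(1)]\<close>)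
      then show ?thesis by (simp add: comp_def)
    qed
    have "f1 s = (LINT x:D|lborel. v1 s x * L x - \<kappa>\<^sup>2 / 2 * (v1 s x * \<phi> x))"
      unfolding f1_def by (simp add: algebra_simps)
    also have "\<dots> = (LINT x:D|lborel. v1 s x * L x) - (LINT x:D|lborel. \<kappa>\<^sup>2 / 2 * (v1 s x * \<phi> x))"
      by (rule set_integral_diff; intro set_integrable_bounded_open[OF D] continuous_intros vs \<phi> L)
    finally have f1: "f1 s = (LINT x:D|lborel. v1 s x * L x) - \<kappa>\<^sup>2 / 2 * y s" by (simp add: y_def)
    have e3: "exp (3 * N s) = exp (N s) * exp (2 * N s)" "exp (N s + 2 * N s) = exp (N s) * exp (2 * N s)"
      by (simp_all add: exp_add[symmetric])
    show "exp (\<kappa>\<^sup>2 / 2 * s) * (b s + \<kappa>\<^sup>2 / 2 * y s) = exp (N s + \<kappa>\<^sup>2 / 2 * s) * drift D l1 l2 \<phi> L (\<lambda>s x. exp (- N s) * v1 s x) (\<lambda>s x. exp (- N s) * v2 s x) s"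
    proof -
      \<comment> \<open>The zeroth-order term of the equation for \<open>v\<close> cancels the one
        produced by the integrating factor; the weight \<open>exp (3 * N s)\<close> splits into
        \<open>exp (N s)\<close> and the \<open>exp (2 * N s)\<close> that arises from the inverse
        square of \<open>exp (- N s) * v\<close>.\<close>
      have alg: "er * (P1 - r * y' - l1 * (e1 * e2 * P2) - l2 * (e1 * e2 * P3) + r * y')
        = (e1 * er) * (inverse e1 * P1 - l1 * (e2 * P2) - l2 * (e2 * P3))" if "e1 \<noteq> 0" for er e1 e2 P1 P2 P3 r y' :: real
        using that by (simp add: algebra_simps)
      show ?thesis
        unfolding drift_def exp_scaled_powi b_def f1 f2_def f3_def e3 exp_add[of "N s" "\<kappa>\<^sup>2 / 2 * s"]
        unfolding exp_minus by (rule alg) simp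
    qed
  qed
  then show ?thesis using A E[of T "\<kappa>\<^sup>2 / 2 * T"] E[of 0 "\<kappa>\<^sup>2 / 2 * 0"] by simp
qed

section \<open>The two systems\<close>

lemma local_random_fieldD:
  assumes "local_random_field M F D g u \<tau>" "i \<in> {1, 2}"
  shows "\<And>x. x \<in> closure D \<Longrightarrow> adapted F (\<lambda>t \<omega>. if t \<in> lifetime \<tau> \<omega> then u i t x \<omega> else 0)"
    and "AE \<omega> in M. continuous_on (lifetime \<tau> \<omega> \<times> closure D) (\<lambda>(t, x). u i t x \<omega>)"
    and "AE \<omega> in M. \<forall>t\<in>lifetime \<tau> \<omega>. \<forall>x\<in>closure D. u i t x \<omega> \<noteq> 0"
    and "AE \<omega> in M. \<forall>x\<in>D. u i 0 x \<omega> = g i x"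
  using assms unfolding local_random_field_def by blast+

text \<open>The setting after the reductions: all noise coefficients equal the single
  \<open>\<kappa>\<close>, so both noises coincide, and a superharmonic test function is
  fixed.\<close>

locale robin_system =
  fixes M :: "'w measure" and F :: "real \<Rightarrow> 'w measure" and W B :: "real \<Rightarrow> 'w \<Rightarrow> real"
    and D :: "'a::euclidean_space set" and \<nu> :: "'a \<Rightarrow> 'a" and \<beta> H \<kappa> :: real
    and lam k :: "nat \<Rightarrow> nat \<Rightarrow> real" and g :: "nat \<Rightarrow> 'a \<Rightarrow> real" and \<phi> :: "'a \<Rightarrow> real"
  assumes D: "smooth_bounded_domain D"
    and fps: "filtered_prob_space M F" and bm: "brownian_motion M F W"
    and fbm: "fractional_brownian_motion M H B" "adapted F B" and H: "1 / 2 < H" "H < 1"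
    and \<kappa>: "0 < \<kappa>" "\<And>i l. i \<in> {1, 2} \<Longrightarrow> l \<in> {1, 2} \<Longrightarrow> k i l = \<kappa>"
    and lam: "0 < lam 1 1" "0 < lam 1 2"
    and g: "\<And>x. x \<in> D \<Longrightarrow> 0 < g 1 x"
    and \<phi>: "robin_test_function D \<nu> \<beta> \<phi>" "\<And>x. x \<in> closure D \<Longrightarrow> 1 \<le> \<phi> x"
      "\<And>x. x \<in> closure D \<Longrightarrow> laplacian_on (closure D) \<phi> x \<le> 0"
begin

abbreviation "L \<equiv> laplacian_on (closure D) \<phi>"
definition "E s \<omega> = exp (\<kappa> * (W s \<omega> + B s \<omega>) + \<kappa>\<^sup>2 / 2 * s)"

lemma domain: "bounded D" "open D" "connected D" "D \<noteq> {}"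
  using D unfolding smooth_bounded_domain_def by blast+

lemma \<phi>_cont: "continuous_on (closure D) \<phi>"
  using \<phi>(1) Ck_on_imp_continuous_on unfolding robin_test_function_def by blast

lemma L_cont: "continuous_on (closure D) L"
proof -
  have "Ck_on (Suc (Suc 0)) (closure D) \<phi>" using \<phi>(1) unfolding robin_test_function_def by (simp only: numeral_2_eq_2)
  then show ?thesis unfolding laplacian_on_def by (intro continuous_on_sum) auto
qed

lemma noise_eq: "i \<in> {1, 2} \<Longrightarrow> noise k W B i s \<omega> = \<kappa> * (W s \<omega> + B s \<omega>)"
  using \<kappa>(2)[of i 1] \<kappa>(2)[of i 2] by (simp add: noise_def algebra_simps)

lemma WB_cont: "AE \<omega> in M. continuous_on {0..} (\<lambda>s. W s \<omega>) \<and> continuous_on {0..} (\<lambda>s. B s \<omega>)"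
proof -
  have "AE \<omega> in M. continuous_on {0..} (\<lambda>s. B s \<omega>)" using fbm(1) unfolding fractional_brownian_motion_def by blast
  with brownian_motionD(2)[OF bm] show ?thesis by eventually_elim simp
qed

lemma E_diverges: "AE \<omega> in M. \<forall>K. \<exists>n::nat. n > 0 \<and> K \<le> integral {0..real n} (\<lambda>s. (E s \<omega>) ^ 3)"
  unfolding E_def using exp_integral_diverges[OF fps bm fbm(1) _ H(2) \<kappa>(1)] H(1) by simp

lemma lifetime_infinite: "\<tau> \<omega> = \<infinity> \<Longrightarrow> lifetime \<tau> \<omega> = {0..}"
  by (auto simp: lifetime_def)

text \<open>If \<open>\<tau> \<omega> = \<infinity>\<close>, the fields \<open>exp (- N) * v\<close>
  fulfil the comparison argument on that path: the weak equation tested with the single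
  \<open>\<phi>\<close> holds for all times outside one null set, and the product rule turns it into
  the required formula.\<close>

theorem V_quenches:
  assumes sol: "weak_solution_V M F W B D \<nu> \<beta> lam k g v \<tau>"
  shows "AE \<omega> in M. \<tau> \<omega> < \<infinity>"
proof -
  have field: "local_random_field M F D g v \<tau>" using sol unfolding weak_solution_V_def by blast
  note f1 = local_random_fieldD[OF field, of 1, OF insertI1] and f2 = local_random_fieldD[OF field, of 2, OF insertI2[OF singletonI]]
  have eqs: "AE \<omega> in M. \<forall>t\<in>lifetime \<tau> \<omega>.
           (LINT x:D|lborel. v 1 t x \<omega> * \<phi> x) =
             (LINT x:D|lborel. g 1 x * \<phi> x)
             + (LINT s:{0..t}|lborel. LINT x:D|lborel. v 1 s x \<omega> * (L x - (k 1 1)\<^sup>2 / 2 * \<phi> x))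
             - lam 1 1 * (LINT s:{0..t}|lborel. exp (3 * noise k W B 1 s \<omega>) *
                  (LINT x:D|lborel. v 1 s x \<omega> powi (-2) * \<phi> x))
             - lam 1 2 * (LINT s:{0..t}|lborel. exp (noise k W B 1 s \<omega> + 2 * noise k W B (3 - 1) s \<omega>) *
                  (LINT x:D|lborel. v (3 - 1) s x \<omega> powi (-2) * \<phi> x))"
    using sol \<phi>(1) unfolding weak_solution_V_def by blast
  show ?thesis
    using f1(2,3,4) f2(2,3) eqs E_diverges WB_cont
  proof eventually_elim
    case (elim \<omega>)
    note c1 = elim(1) and n1 = elim(2) and i1 = elim(3) and c2 = elim(4) and n2 = elim(5)
      and eq = elim(6) and div = elim(7) and WB = elim(8)
    show "\<tau> \<omega> < \<infinity>"
    proof (rule ccontr)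
      assume "\<not> \<tau> \<omega> < \<infinity>"
      then have life: "lifetime \<tau> \<omega> = {0..}" by (intro lifetime_infinite) (simp add: less_top[symmetric])
      define N where "N s = \<kappa> * (W s \<omega> + B s \<omega>)" for s
      have N: "continuous_on {0..} N" unfolding N_def[abs_def] using WB by (auto intro!: continuous_intros)
      note c1' = c1[unfolded life] and c2' = c2[unfolded life]
      have n1': "v 1 s x \<omega> \<noteq> 0" and n2': "v 2 s x \<omega> \<noteq> 0" if "0 \<le> s" "x \<in> closure D" for s x
        using n1 n2 life that by auto
      have k11: "k 1 1 = \<kappa>" and nz: "noise k W B 1 s \<omega> = N s" "noise k W B (3 - 1) s \<omega> = N s" for s
        using \<kappa>(2)[of 1 1] noise_eq[of 1] noise_eq[of 2] by (auto simp: N_def)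
      have j: "(3 - 1 :: nat) = 2" by simp
      have eq': "(LINT x:D|lborel. v 1 t x \<omega> * \<phi> x) = (LINT x:D|lborel. g 1 x * \<phi> x)
        + (LINT s:{0..t}|lborel. LINT x:D|lborel. v 1 s x \<omega> * (L x - \<kappa>\<^sup>2 / 2 * \<phi> x))
        - lam 1 1 * (LINT s:{0..t}|lborel. exp (3 * N s) * (LINT x:D|lborel. v 1 s x \<omega> powi (-2) * \<phi> x))
        - lam 1 2 * (LINT s:{0..t}|lborel. exp (N s + 2 * N s) * (LINT x:D|lborel. v 2 s x \<omega> powi (-2) * \<phi> x))"
        if "0 \<le> t" for t
        using eq[unfolded life nz k11, unfolded j] that by simp
      have E: "E s \<omega> = exp (N s + \<kappa>\<^sup>2 / 2 * s)" for s by (simp add: E_def N_def)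
      have ce: "continuous_on ({0..} \<times> closure D) (\<lambda>(s, x). exp (- N s) * w s x)"
        if "continuous_on ({0..} \<times> closure D) (\<lambda>(s, x). w s x)" for w :: "real \<Rightarrow> 'a \<Rightarrow> real"
      proof -
        have "continuous_on ({0..} \<times> closure D) (\<lambda>p. N (fst p))"
          by (rule continuous_on_compose2[OF N]) (auto intro!: continuous_intros)
        then show ?thesis using that unfolding case_prod_beta by (intro continuous_intros)
      qed
      show False
      proof (rule no_global_positive_solution[OF domain(1,2) \<phi>_cont L_cont domain(3,4) \<phi>(2,3),
            of "\<lambda>s x. exp (- N s) * v 1 s x \<omega>" "\<lambda>s x. exp (- N s) * v 2 s x \<omega>" "\<lambda>s. E s \<omega>" "lam 1 1" "lam 1 2"])
        show "continuous_on {0..} (\<lambda>s. E s \<omega>)" unfolding E by (intro continuous_intros N)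
        show "0 < exp (- N 0) * v 1 0 x \<omega>" if "x \<in> D" for x using i1 g that by simp
        show "(LINT x:D|lborel. (exp (- N T) * v 1 T x \<omega>) * \<phi> x) * E T \<omega> =
          (LINT x:D|lborel. (exp (- N 0) * v 1 0 x \<omega>) * \<phi> x) * E 0 \<omega> + integral {0..T} (\<lambda>s. E s \<omega> *
            drift D (lam 1 1) (lam 1 2) \<phi> L (\<lambda>s x. exp (- N s) * v 1 s x \<omega>) (\<lambda>s x. exp (- N s) * v 2 s x \<omega>) s)"
          if "0 < T" for T
          unfolding E
          by (rule weak_V_path_formula[where N=N, OF domain(1,2) \<phi>_cont L_cont c1' n1' c2' n2' N less_imp_le[OF that] eq'])
        show "\<And>K. \<exists>n::nat. n > 0 \<and> K \<le> integral {0..real n} (\<lambda>s. (E s \<omega>) ^ 3)" using div by blast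
      qed (use n1' n2' ce[OF c1'] ce[OF c2'] lam in \<open>auto simp: E\<close>)
    qed
  qed
qed

text \<open>On the event \<open>T \<le> \<sigma>\<close> every \<open>t \<le> T\<close> satisfies
  \<open>t \<le> \<sigma> < \<tau>\<close> almost surely: the cut-off of the Ito integrand is
  inactive, the paths are regular on \<open>[0, T]\<close>, and the weak equation holds at each
  fixed \<open>t\<close>. The exponential Ito formula then applies with the tested solution as
  \<open>y\<close>.\<close>

lemma Z_path_formula:
  assumes field: "local_random_field M F D g z \<tau>" and \<sigma>: "ext_stopping_time F \<sigma>" "AE \<omega> in M. \<sigma> \<omega> < \<tau> \<omega>"
    and eq: "\<And>t. 0 \<le> t \<Longrightarrow> \<exists>I.
             has_ito_integral M F W
               (\<lambda>s \<omega>. if ennreal s \<le> \<sigma> \<omega> then LINT x:D|lborel. z 1 s x \<omega> * \<phi> x else 0) t I \<and>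
             (AE \<omega> in M. ennreal t \<le> \<sigma> \<omega> \<longrightarrow>
                (\<exists>Y. has_young_integral
                       (\<lambda>s. LINT x:D|lborel. z 1 s x \<omega> * \<phi> x) (\<lambda>s. B s \<omega>) 0 t Y \<and>
                   (LINT x:D|lborel. z 1 t x \<omega> * \<phi> x) =
                     (LINT x:D|lborel. g 1 x * \<phi> x)
                     + (LINT s:{0..t}|lborel. LINT x:D|lborel. z 1 s x \<omega> * L x)
                     - lam 1 1 * (LINT s:{0..t}|lborel. LINT x:D|lborel. z 1 s x \<omega> powi (-2) * \<phi> x)
                     - lam 1 2 * (LINT s:{0..t}|lborel. LINT x:D|lborel. z 2 s x \<omega> powi (-2) * \<phi> x)
                     - (\<kappa> * I \<omega> + \<kappa> * Y)))"
    and T: "0 < T"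
  shows "AE \<omega> in M. ennreal T \<le> \<sigma> \<omega> \<longrightarrow> (LINT x:D|lborel. z 1 T x \<omega> * \<phi> x) * E T \<omega> =
    (LINT x:D|lborel. z 1 0 x \<omega> * \<phi> x) * E 0 \<omega> + integral {0..T} (\<lambda>s. E s \<omega> *
      drift D (lam 1 1) (lam 1 2) \<phi> L (\<lambda>s x. z 1 s x \<omega>) (\<lambda>s x. z 2 s x \<omega>) s)"
proof -
  define y where "y s \<omega> = (LINT x:D|lborel. z 1 s x \<omega> * \<phi> x)" for s \<omega>
  define X where "X s \<omega> = (if ennreal s \<le> \<sigma> \<omega> then y s \<omega> else 0)" for s \<omega>
  define a where "a s \<omega> = drift D (lam 1 1) (lam 1 2) \<phi> L (\<lambda>s x. z 1 s x \<omega>) (\<lambda>s x. z 2 s x \<omega>) s" for s \<omega>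
  define \<Omega> where "\<Omega> = {\<omega> \<in> space M. ennreal T \<le> \<sigma> \<omega>}"
  have T0: "0 \<le> T" using T by simp
  have \<Omega>: "\<Omega> \<in> sets M"
    using ext_stopping_time_ge[OF fps \<sigma>(1) T0] filtered_prob_spaceD(2)[OF fps T0] by (auto simp: \<Omega>_def subalgebra_def)
  note f1 = local_random_fieldD[OF field, of 1, OF insertI1] and f2 = local_random_fieldD[OF field, of 2, OF insertI2[OF singletonI]]
  define reg where "reg \<omega> \<longleftrightarrow> {0..T} \<subseteq> lifetime \<tau> \<omega> \<and>
      continuous_on ({0..T} \<times> closure D) (\<lambda>(s, x). z 1 s x \<omega>) \<and> (\<forall>s\<in>{0..T}. \<forall>x\<in>closure D. z 1 s x \<omega> \<noteq> 0) \<and>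
      continuous_on ({0..T} \<times> closure D) (\<lambda>(s, x). z 2 s x \<omega>) \<and> (\<forall>s\<in>{0..T}. \<forall>x\<in>closure D. z 2 s x \<omega> \<noteq> 0)" for \<omega>
  have paths: "AE \<omega> in M. \<omega> \<in> \<Omega> \<longrightarrow> reg \<omega>"
    using f1(2,3) f2(2,3) \<sigma>(2)
  proof eventually_elim
    case (elim \<omega>)
    show ?case
    proof
      assume \<omega>: "\<omega> \<in> \<Omega>"
      have life: "{0..T} \<subseteq> lifetime \<tau> \<omega>"
      proof
        fix t assume "t \<in> {0..T}"
        then have "ennreal t \<le> \<sigma> \<omega>" using \<omega> by (auto simp: \<Omega>_def intro: order_trans[OF ennreal_leI])
        then show "t \<in> lifetime \<tau> \<omega>" using elim(5) \<open>t \<in> {0..T}\<close> by (auto simp: lifetime_def)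
      qed
      then have "{0..T} \<times> closure D \<subseteq> lifetime \<tau> \<omega> \<times> closure D" by auto
      with life elim(1-4) continuous_on_subset show "reg \<omega>" unfolding reg_def by blast
    qed
  qed
  define weak where "weak t I' \<omega> \<longleftrightarrow> (\<exists>Y. has_young_integral (\<lambda>s. y s \<omega>) (\<lambda>s. B s \<omega>) 0 t Y \<and>
        y t \<omega> = (LINT x:D|lborel. g 1 x * \<phi> x)
                     + (LINT s:{0..t}|lborel. LINT x:D|lborel. z 1 s x \<omega> * L x)
                     - lam 1 1 * (LINT s:{0..t}|lborel. LINT x:D|lborel. z 1 s x \<omega> powi (-2) * \<phi> x)
                     - lam 1 2 * (LINT s:{0..t}|lborel. LINT x:D|lborel. z 2 s x \<omega> powi (-2) * \<phi> x)
                     - (\<kappa> * I' + \<kappa> * Y))" for t I' \<omega>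
  have "\<forall>t\<in>{0..T}. \<exists>I. has_ito_integral M F W X t I \<and> (AE \<omega> in M. ennreal t \<le> \<sigma> \<omega> \<longrightarrow> weak t (I \<omega>) \<omega>)"
    unfolding X_def y_def weak_def using eq by simp
  \<comment> \<open>The random variables \<open>I t\<close> are chosen time by time, each with its
    own null set; only countably many of them are combined later, along the grids.\<close>
  from bchoice[OF this] obtain I where I: "\<And>t. t \<in> {0..T} \<Longrightarrow> has_ito_integral M F W X t (I t)"
    "\<And>t. t \<in> {0..T} \<Longrightarrow> AE \<omega> in M. ennreal t \<le> \<sigma> \<omega> \<longrightarrow> weak t (I t \<omega>) \<omega>"
    by blast
  have leT: "ennreal t \<le> \<sigma> \<omega>" if "t \<in> {0..T}" "\<omega> \<in> \<Omega>" for t \<omega>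
    using that by (auto simp: \<Omega>_def intro: order_trans[OF ennreal_leI])
  have "\<forall>t\<in>{0..T}. \<exists>\<xi>. \<xi> \<in> borel_measurable (F t) \<and> (AE \<omega> in M. \<omega> \<in> \<Omega> \<longrightarrow> X t \<omega> = \<xi> \<omega>)"
  proof
    fix t assume t: "t \<in> {0..T}"
    \<comment> \<open>Extension by 0 outside the lifetime is the form in which adaptedness is given;
      on \<open>\<Omega>\<close> it agrees with the field itself.\<close>
    define u where "u x \<omega> = (if t \<in> lifetime \<tau> \<omega> then z 1 t x \<omega> else 0)" for x \<omega>
    have u: "u x \<in> borel_measurable (F t)" if "x \<in> D" for x
    proof -
      have "x \<in> closure D" using that closure_subset by auto
      from f1(1)[OF this] t show ?thesis unfolding adapted_def u_def[abs_def] by auto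
    qed
    obtain \<xi> where \<xi>: "\<xi> \<in> borel_measurable (F t)"
      "\<And>\<omega>. continuous_on D (\<lambda>x. u x \<omega>) \<Longrightarrow> \<xi> \<omega> = (LINT x:D|lborel. u x \<omega> * \<phi> x)"
      using spatial_integral_measurable[where u=u, OF domain(2,4) u continuous_on_subset[OF \<phi>_cont closure_subset]] by blast
    have "AE \<omega> in M. \<omega> \<in> \<Omega> \<longrightarrow> X t \<omega> = \<xi> \<omega>"
      using paths
    proof (eventually_elim, intro impI)
      fix \<omega> assume p0: "\<omega> \<in> \<Omega> \<longrightarrow> reg \<omega>"
        and \<omega>: "\<omega> \<in> \<Omega>"
      note p = p0[rule_format, OF \<omega>, unfolded reg_def]
      have ux: "u x \<omega> = z 1 t x \<omega>" for x using t p by (auto simp: u_def)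
      have "continuous_on D ((\<lambda>(s, x). z 1 s x \<omega>) \<circ> (\<lambda>x. (t, x)))"
      proof (rule continuous_on_compose)
        have "(\<lambda>x. (t, x)) ` D \<subseteq> {0..T} \<times> closure D" using t closure_subset[of D] by auto
        then show "continuous_on ((\<lambda>x. (t, x)) ` D) (\<lambda>(s, x). z 1 s x \<omega>)" using p \<omega> continuous_on_subset by blast
      qed (intro continuous_intros)
      then have "continuous_on D (\<lambda>x. u x \<omega>)" by (simp add: comp_def ux)
      from \<xi>(2)[OF this] show "X t \<omega> = \<xi> \<omega>" using leT[OF t \<omega>] by (simp add: X_def y_def ux)
    qed
    with \<xi>(1) show "\<exists>\<xi>. \<xi> \<in> borel_measurable (F t) \<and> (AE \<omega> in M. \<omega> \<in> \<Omega> \<longrightarrow> X t \<omega> = \<xi> \<omega>)" by blast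
  qed
  from bchoice[OF this] obtain \<xi> where \<xi>: "\<And>t. t \<in> {0..T} \<Longrightarrow> \<xi> t \<in> borel_measurable (F t)"
    "\<And>t. t \<in> {0..T} \<Longrightarrow> AE \<omega> in M. \<omega> \<in> \<Omega> \<longrightarrow> X t \<omega> = \<xi> t \<omega>" by blast
  have "AE \<omega> in M. \<omega> \<in> \<Omega> \<longrightarrow> y T \<omega> * exp (\<kappa> * (W T \<omega> + B T \<omega>) + \<kappa>\<^sup>2 / 2 * T) =
    y 0 \<omega> * exp (\<kappa> * (W 0 \<omega> + B 0 \<omega>) + \<kappa>\<^sup>2 / 2 * 0) +
    integral {0..T} (\<lambda>s. exp (\<kappa> * (W s \<omega> + B s \<omega>) + \<kappa>\<^sup>2 / 2 * s) * a s \<omega>)"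
  proof (rule ito_young_exponential[OF fps bm fbm H(1) T \<kappa>(1) \<Omega> I(1) \<xi>, where ?y0.0="\<lambda>_. LINT x:D|lborel. g 1 x * \<phi> x"])
    show "AE \<omega> in M. \<omega> \<in> \<Omega> \<longrightarrow> continuous_on {0..T} (\<lambda>s. y s \<omega>) \<and> (\<forall>s\<in>{0..T}. X s \<omega> = y s \<omega>)"
      using paths
    proof (eventually_elim, intro impI conjI ballI)
      fix \<omega> assume p0: "\<omega> \<in> \<Omega> \<longrightarrow> reg \<omega>"
        and \<omega>: "\<omega> \<in> \<Omega>"
      note p = p0[rule_format, OF \<omega>, unfolded reg_def]
      have "continuous_on ({0..T} \<times> closure D) (\<lambda>(s, x). z 1 s x \<omega>)" using p by blast
      from continuous_on_times_second[OF domain(1,2) \<phi>_cont L_cont this \<phi>_cont]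
      show "continuous_on {0..T} (\<lambda>s. y s \<omega>)" by (simp add: y_def)
      show "X s \<omega> = y s \<omega>" if "s \<in> {0..T}" for s using leT[OF that \<omega>] by (simp add: X_def)
    qed
    show "AE \<omega> in M. \<omega> \<in> \<Omega> \<longrightarrow> continuous_on {0..T} (\<lambda>s. a s \<omega>)"
      using paths
    proof (eventually_elim, intro impI)
      fix \<omega> assume p0: "\<omega> \<in> \<Omega> \<longrightarrow> reg \<omega>"
        and \<omega>: "\<omega> \<in> \<Omega>"
      note p = p0[rule_format, OF \<omega>, unfolded reg_def]
      show "continuous_on {0..T} (\<lambda>s. a s \<omega>)" unfolding a_def
        by (rule continuous_on_drift[OF domain(1,2) \<phi>_cont L_cont]) (use p \<omega> in blast)+
    qed
    fix t assume t: "t \<in> {0..T}"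
    show "AE \<omega> in M. \<omega> \<in> \<Omega> \<longrightarrow> (\<exists>Y. has_young_integral (\<lambda>s. y s \<omega>) (\<lambda>s. B s \<omega>) 0 t Y \<and>
        y t \<omega> = (LINT x:D|lborel. g 1 x * \<phi> x) + integral {0..t} (\<lambda>s. a s \<omega>) - \<kappa> * (I t \<omega> + Y))"
      using paths I(2)[OF t]
    proof (eventually_elim, intro impI)
      fix \<omega> assume p0: "\<omega> \<in> \<Omega> \<longrightarrow> reg \<omega>"
        and w: "ennreal t \<le> \<sigma> \<omega> \<longrightarrow> weak t (I t \<omega>) \<omega>"
        and \<omega>: "\<omega> \<in> \<Omega>"
      note p = p0[rule_format, OF \<omega>, unfolded reg_def]
      obtain Y where Y: "has_young_integral (\<lambda>s. y s \<omega>) (\<lambda>s. B s \<omega>) 0 t Y"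
        "y t \<omega> = (LINT x:D|lborel. g 1 x * \<phi> x)
                     + (LINT s:{0..t}|lborel. LINT x:D|lborel. z 1 s x \<omega> * L x)
                     - lam 1 1 * (LINT s:{0..t}|lborel. LINT x:D|lborel. z 1 s x \<omega> powi (-2) * \<phi> x)
                     - lam 1 2 * (LINT s:{0..t}|lborel. LINT x:D|lborel. z 2 s x \<omega> powi (-2) * \<phi> x)
                     - (\<kappa> * I t \<omega> + \<kappa> * Y)"
        using w leT[OF t \<omega>] unfolding weak_def by blast
      have sub: "{0..t} \<times> closure D \<subseteq> {0..T} \<times> closure D" using t by auto
      have "(LINT s:{0..t}|lborel. LINT x:D|lborel. z 1 s x \<omega> * L x)
         - lam 1 1 * (LINT s:{0..t}|lborel. LINT x:D|lborel. z 1 s x \<omega> powi (-2) * \<phi> x)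
         - lam 1 2 * (LINT s:{0..t}|lborel. LINT x:D|lborel. z 2 s x \<omega> powi (-2) * \<phi> x)
         = integral {0..t} (drift D (lam 1 1) (lam 1 2) \<phi> L (\<lambda>s x. z 1 s x \<omega>) (\<lambda>s x. z 2 s x \<omega>))"
        by (rule LINT_drift[OF domain(1,2) \<phi>_cont L_cont]) (use p \<omega> sub t in \<open>auto intro: continuous_on_subset\<close>)
      then show "\<exists>Y. has_young_integral (\<lambda>s. y s \<omega>) (\<lambda>s. B s \<omega>) 0 t Y \<and>
        y t \<omega> = (LINT x:D|lborel. g 1 x * \<phi> x) + integral {0..t} (\<lambda>s. a s \<omega>) - \<kappa> * (I t \<omega> + Y)"
        using Y by (intro exI[of _ Y]) (simp add: a_def distrib_left)
    qed
  qed
  then show ?thesis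
    using AE_space by eventually_elim (auto simp: \<Omega>_def y_def a_def E_def)
qed

text \<open>The formula at time \<open>T\<close> is available on the event
  \<open>T \<le> \<sigma> n\<close>. Rational \<open>T\<close> and all \<open>n\<close> together
  produce one null set; if \<open>\<tau> \<omega> = \<infinity>\<close>, then
  \<open>\<sigma> n \<omega>\<close> tends to \<infinity>, so every positive rational
  \<open>T\<close> is reached by some \<open>n\<close>.\<close>

theorem Z_quenches:
  assumes sol: "weak_solution_Z M F W B D \<nu> \<beta> lam k g z \<tau>"
  shows "AE \<omega> in M. \<tau> \<omega> < \<infinity>"
proof -
  have field: "local_random_field M F D g z \<tau>" using sol unfolding weak_solution_Z_def by blast
  note f1 = local_random_fieldD[OF field, of 1, OF insertI1] and f2 = local_random_fieldD[OF field, of 2, OF insertI2[OF singletonI]]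
  obtain \<sigma> :: "nat \<Rightarrow> 'w \<Rightarrow> ennreal" where \<sigma>: "\<And>n. ext_stopping_time F (\<sigma> n)"
    "AE \<omega> in M. incseq (\<lambda>n. \<sigma> n \<omega>) \<and> (\<forall>n. \<sigma> n \<omega> < \<tau> \<omega>) \<and> (\<lambda>n. \<sigma> n \<omega>) \<longlonglongrightarrow> \<tau> \<omega>"
    and w: "\<forall>i\<in>{1, 2}. \<forall>\<phi>. robin_test_function D \<nu> \<beta> \<phi> \<longrightarrow>
          (\<forall>n. \<forall>t\<ge>0. \<exists>I.
             has_ito_integral M F W
               (\<lambda>s \<omega>. if ennreal s \<le> \<sigma> n \<omega> then LINT x:D|lborel. z i s x \<omega> * \<phi> x else 0) t I \<and>
             (AE \<omega> in M. ennreal t \<le> \<sigma> n \<omega> \<longrightarrow>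
                (\<exists>Y. has_young_integral
                       (\<lambda>s. LINT x:D|lborel. z i s x \<omega> * \<phi> x) (\<lambda>s. B s \<omega>) 0 t Y \<and>
                   (LINT x:D|lborel. z i t x \<omega> * \<phi> x) =
                     (LINT x:D|lborel. g i x * \<phi> x)
                     + (LINT s:{0..t}|lborel. LINT x:D|lborel.
                          z i s x \<omega> * laplacian_on (closure D) \<phi> x)
                     - lam i 1 * (LINT s:{0..t}|lborel. LINT x:D|lborel.
                          z i s x \<omega> powi (-2) * \<phi> x)
                     - lam i (2::nat) * (LINT s:{0..t}|lborel. LINT x:D|lborel.
                          z (3 - i) s x \<omega> powi (-2) * \<phi> x)
                     - (k i 1 * I \<omega> + k i (2::nat) * Y))))"
    using sol unfolding weak_solution_Z_def by blast
  have k1: "k 1 1 = \<kappa>" "k 1 2 = \<kappa>" using \<kappa>(2) by auto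
  have j: "(3 - 1 :: nat) = 2" by simp
  note w1 = w[rule_format, of 1, OF insertI1 \<phi>(1), unfolded k1 j]
  have form: "AE \<omega> in M. ennreal T \<le> \<sigma> n \<omega> \<longrightarrow> (LINT x:D|lborel. z 1 T x \<omega> * \<phi> x) * E T \<omega> =
    (LINT x:D|lborel. z 1 0 x \<omega> * \<phi> x) * E 0 \<omega> + integral {0..T} (\<lambda>s. E s \<omega> *
      drift D (lam 1 1) (lam 1 2) \<phi> L (\<lambda>s x. z 1 s x \<omega>) (\<lambda>s x. z 2 s x \<omega>) s)" if "0 < T" for n T
  proof (rule Z_path_formula[OF field \<sigma>(1) _ _ that])
    show "AE \<omega> in M. \<sigma> n \<omega> < \<tau> \<omega>" using \<sigma>(2) by eventually_elim blast
  qed (rule w1)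
  have "countable {T \<in> \<rat>. 0 < (T::real)}" by (rule countable_subset[OF _ countable_rat]) auto
  then have form_all: "AE \<omega> in M. \<forall>n. \<forall>T\<in>{T \<in> \<rat>. 0 < (T::real)}. ennreal T \<le> \<sigma> n \<omega> \<longrightarrow>
    (LINT x:D|lborel. z 1 T x \<omega> * \<phi> x) * E T \<omega> =
    (LINT x:D|lborel. z 1 0 x \<omega> * \<phi> x) * E 0 \<omega> + integral {0..T} (\<lambda>s. E s \<omega> *
      drift D (lam 1 1) (lam 1 2) \<phi> L (\<lambda>s x. z 1 s x \<omega>) (\<lambda>s x. z 2 s x \<omega>) s)"
    unfolding AE_all_countable by (intro allI AE_ball_countable[THEN iffD2]) (use form in blast)+
  show ?thesis
    using f1(2,3,4) f2(2,3) form_all E_diverges WB_cont \<sigma>(2)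
  proof eventually_elim
    case (elim \<omega>)
    note c1 = elim(1) and n1 = elim(2) and i1 = elim(3) and c2 = elim(4) and n2 = elim(5)
      and fo = elim(6) and div = elim(7) and WB = elim(8) and s = elim(9)
    show "\<tau> \<omega> < \<infinity>"
    proof (rule ccontr)
      assume "\<not> \<tau> \<omega> < \<infinity>"
      then have inf: "\<tau> \<omega> = \<infinity>" by (simp add: less_top[symmetric])
      then have life: "lifetime \<tau> \<omega> = {0..}" by (rule lifetime_infinite)
      show False
      proof (rule no_global_positive_solution[OF domain(1,2) \<phi>_cont L_cont domain(3,4) \<phi>(2,3),
            of "\<lambda>s x. z 1 s x \<omega>" "\<lambda>s x. z 2 s x \<omega>" "\<lambda>s. E s \<omega>" "lam 1 1" "lam 1 2"])
        show "continuous_on {0..} (\<lambda>s. E s \<omega>)" unfolding E_def using WB by (auto intro!: continuous_intros)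
        show "0 < z 1 0 x \<omega>" if "x \<in> D" for x using i1 g that by simp
        show "(LINT x:D|lborel. z 1 T x \<omega> * \<phi> x) * E T \<omega> =
          (LINT x:D|lborel. z 1 0 x \<omega> * \<phi> x) * E 0 \<omega> + integral {0..T} (\<lambda>s. E s \<omega> *
            drift D (lam 1 1) (lam 1 2) \<phi> L (\<lambda>s x. z 1 s x \<omega>) (\<lambda>s x. z 2 s x \<omega>) s)"
          if T: "T \<in> \<rat>" "0 < T" for T
        proof -
          have "eventually (\<lambda>n. ennreal T < \<sigma> n \<omega>) sequentially"
            using s inf by (intro order_tendstoD(1)[of _ "\<tau> \<omega>"]) auto
          then obtain n where "ennreal T < \<sigma> n \<omega>" using eventually_happens'[OF sequentially_bot] by blast
          then have "ennreal T \<le> \<sigma> n \<omega>" by simp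
          with fo T show ?thesis by blast
        qed
        show "\<And>K. \<exists>n::nat. n > 0 \<and> K \<le> integral {0..real n} (\<lambda>s. (E s \<omega>) ^ 3)" using div by blast
        show "\<And>s. 0 < E s \<omega>" by (simp add: E_def)
      qed (use n1 n2 c1 c2 lam life in auto)
    qed
  qed
qed

end

theorem theorem5p6:
  fixes M :: "'w measure" and F :: "real \<Rightarrow> 'w measure" and W B :: "real \<Rightarrow> 'w \<Rightarrow> real"
    and D :: "'a::euclidean_space set" and \<nu> :: "'a \<Rightarrow> 'a"
    and \<beta> H \<rho>1 \<rho>2 \<rho> :: real and lam k :: "nat \<Rightarrow> nat \<Rightarrow> real"
    and f g :: "nat \<Rightarrow> 'a \<Rightarrow> real"
  assumes "smooth_bounded_domain D" and "outward_unit_normal D \<nu>"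
    and "\<beta> > 0" and "\<And>i l. i \<in> {1, 2} \<Longrightarrow> l \<in> {1, 2} \<Longrightarrow> lam i l > 0 \<and> k i l > 0"
    and "filtered_prob_space M F"
    and "brownian_motion M F W"
    and "fractional_brownian_motion M H B" and "adapted F B"
    and "\<And>i. i \<in> {1, 2} \<Longrightarrow> Ck_on 2 (closure D) (f i)"
    and "\<And>i x. i \<in> {1, 2} \<Longrightarrow> x \<in> D \<Longrightarrow> 0 \<le> f i x \<and> f i x < 1"
    and "\<And>i. i \<in> {1, 2} \<Longrightarrow> \<exists>x\<in>D. f i x \<noteq> 0"
    and "\<And>i x. g i x = 1 - f i x"
    and "parameter_condition k \<rho>1 \<rho>2"
    and "3 / 4 < H" and "H < 1"
    and "independent_processes M W B"
    and "\<rho>1 = \<rho>" and "\<rho>2 = \<rho>"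
  shows "(\<forall>v \<tau>. weak_solution_V M F W B D \<nu> \<beta> lam k g v \<tau> \<longrightarrow> quenching_time M F D v \<tau> \<longrightarrow>
            (AE \<omega> in M. \<tau> \<omega> < \<infinity>)) \<and>
         (\<forall>z \<tau>. weak_solution_Z M F W B D \<nu> \<beta> lam k g z \<tau> \<longrightarrow> quenching_time M F D z \<tau> \<longrightarrow>
            (AE \<omega> in M. \<tau> \<omega> < \<infinity>))"
proof -
  \<comment> \<open>The equations \<open>k 2 l + 2 * k 1 l = 3 * k 1 l\<close> identify the two
    components, and \<open>3 * k 1 1 = \<rho> = 3 * k 1 2\<close> identifies the two noises.\<close>
  have "k 2 1 = k 1 1" "k 2 2 = k 1 2" "k 1 2 = k 1 1"
    using assms(13,17,18) unfolding parameter_condition_def by auto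
  then have k: "k i l = k 1 1" if "i \<in> {1, 2}" "l \<in> {1, 2}" for i l using that by auto
  obtain \<phi> where \<phi>: "robin_test_function D \<nu> \<beta> \<phi>" "\<And>x. x \<in> closure D \<Longrightarrow> 1 \<le> \<phi> x"
    "\<And>x. x \<in> closure D \<Longrightarrow> laplacian_on (closure D) \<phi> x \<le> 0"
    using superharmonic_robin_test_function[OF assms(1-3)] by blast
  interpret robin_system M F W B D \<nu> \<beta> H "k 1 1" lam k g \<phi>
  proof
    show "0 < g 1 x" if "x \<in> D" for x using assms(10)[of 1 x] assms(12)[of 1 x] that by simp
    show "0 < k 1 1" "0 < lam 1 1" "0 < lam 1 2" using assms(4)[of 1 1] assms(4)[of 1 2] by auto
    show "k i l = k 1 1" if "i \<in> {1, 2}" "l \<in> {1, 2}" for i l by (rule k[OF that])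
  qed (use assms \<phi> in auto)
  show ?thesis using V_quenches Z_quenches by blast
qed

end
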